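(* Let $G$ be a Lie groupoid over $M$ with Lie algebroid $AG$. Let $B_G$ be a multiplicative closed $2$-form on $G$ with induced morphic $2$-form $B_{AG}$ on $AG$. Then the map $\mathrm{Lie}:\mathrm{Dir}_{mult}(G)\to \mathrm{Dir}_{IM}(AG)$ conjugates the $B$-field transformations $\tau_{B_G}$ and $\tau_{B_{AG}}$; that is, for every multiplicative Dirac structure $L_G$ on $G$, $$\mathrm{Lie}(\tau_{B_G}(L_G))=\tau_{B_{AG}}(\mathrm{Lie}(L_G)).$$
   Context: Dirac structures. For a manifold $P$ put $\mathbb{T}P=TP\oplus T^*P$, with pairing $\langle (X,\alpha),(Y,\beta)\rangle=\alpha(Y)+\beta(X)$ and Courant bracket $[\![(X,\alpha),(Y,\beta)]\!]=([X,Y],\mathcal{L}_X\beta-i_Y d\alpha)$. A Dirac structure on $P$ is a subbundle $L\subseteq\mathbb{T}P$ with $L^\perp=L$ and $[\![\Gamma(L),\Gamma(L)]\!]\subseteq\Gamma(L)$. For a $2$-form $B$ on $P$, $B^\sharp:TP\to T^*P$ is $B^\sharp(X)=B(X,\cdot)$ and $\tau_B:\mathbb{T}P\to\mathbb{T}P$ is $\tau_B(X,\alpha)=(X,\alpha+B^\sharp(X))$; if $B$ is closed, $\tau_B$ maps Dirac structures to Dirac structures. Groupoids. $G$ has source and target $\mathsf{s},\mathsf{t}:G\to M$, composable pairs $G_{(2)}=\{(g,h):\mathsf{t}(h)=\mathsf{s}(g)\}$ and multiplication $m_G$. Its Lie algebroid is $AG=\ker(T\mathsf{s})|_M$ with anchor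 $T\mathsf{t}|_{AG}$ and bracket from right-invariant vector fields; for a groupoid morphism $\Phi$, $A(\Phi)$ is the induced Lie algebroid morphism (restriction of $T\Phi$). A $2$-form $\omega$ on $G$ is multiplicative if $m_G^*\omega=\mathrm{pr}_1^*\omega+\mathrm{pr}_2^*\omega$ on $G_{(2)}$. The tangent groupoid $TG$ over $TM$ is obtained by applying the tangent functor to all structure maps; write $X_g\bullet Y_h=Tm_G(X_g,Y_h)$. The cotangent groupoid $T^*G$ over $A^*G$ has source $\tilde{\mathsf{s}}(\xi_g)(a)=\xi_g(Tl_g(a-T\mathsf{t}(a)))$ for $a\in A_{\mathsf{s}(g)}G$, target $\tilde{\mathsf{t}}(\xi_g)(b)=\xi_g(Tr_g(b))$ for $b\in A_{\mathsf{t}(g)}G$, and multiplication $(\xi_g\circ\eta_h)(X_g\bullet Y_h)=\xi_g(X_g)+\eta_h(Y_h)$. $\mathbb{T}G$ is a Lie groupoid over $TM\oplus A^*G$ with the direct sum structure. A Dirac structure $L_G$ on $G$ is multiplicative if it is a Lie subgroupoid of $\mathbb{T}G$; $\mathrm{Dir}_{mult}(G)$ is the set of these. ($\omega$ is multiplicative iff $\omega^\sharp:TG\to T^*G$ is a groupoid morphism.) Algebroids. For a Lie algebroid $A\to M$, $TA\to TM$ is the tangent Lie algebroid and $T^*A\to A^*$ the cotangent Lie algebroid. The former is determined as follows: for $a\in\Gamma(A)$ let $Ta\in\Gamma_{TM}(TA)$ be its tangent map and let $\hat a(X)=T0_A(X)+_{p_A}\frac{d}{dt}\big|_{t=0}\,t\,a(p_M(X))$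 be its core section (where $0_A$ is the zero section of $A$, $p_M:TM\to M$ and $p_A:TA\to A$ are the tangent bundle projections and $+_{p_A}$ is addition in the fibres of $p_A$); then $[Ta,Tb]=T[a,b]$, $[Ta,\hat b]=\widehat{[a,b]}$, $[\hat a,\hat b]=0$, and the anchor is $J_M\circ T\rho_A$ with $J_M$ the canonical involution of $TTM$. The latter is obtained from the Lie algebroid $T^*A^*\to A^*$ of the linear Poisson structure on $A^*$ dual to $A$ by transport through the isomorphism $R_A:T^*A^*\to T^*A$, $(x^i,\xi_r,p_i,a^r)\mapsto(x^i,a^r,-p_i,\xi_r)$. $\mathbb{T}A=TA\oplus T^*A$ is then a Lie algebroid over $TM\oplus A^*$ with the direct sum structure. An IM-Dirac structure on $A$ is a Dirac structure on the manifold $A$ that is a Lie subalgebroid of $\mathbb{T}A$; $\mathrm{Dir}_{IM}(A)$ is the set of these. A $2$-form $\omega_A$ on $A$ is morphic if $\omega_A^\sharp:TA\to T^*A$ is a Lie algebroid morphism. Identifications. $j_G:T(AG)\to A(TG)$ is the Lie algebroid isomorphism given by restriction of the canonical involution $J_G:TTG\to TTG$. Applying the Lie functor to the canonical pairing $T^*G\times_G TG\to\mathbb{R}$ (a groupoid morphism to the additive group) gives a nondegenerate pairing $A(T^*G)\times_{AG}A(TG)\to\mathbb{R}$, hence an isomorphism of $A(T^*G)\to AG$ with the dual of $A(TG)\to AG$; composing it with the dual $j_G^*$ of $j_G$ gives the Lie algebroid isomorphism $\theta_G:A(T^*G)\to T^*(AG)$. For a multiplicative $2$-form $B_G$, the induced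 morphic $2$-form $B_{AG}$ on $AG$ is defined by $B_{AG}^\sharp=\theta_G\circ A(B_G^\sharp)\circ j_G$. The map $\mathrm{Lie}$ is $\mathrm{Lie}(L_G)=(j_G^{-1}\oplus\theta_G)(A(L_G))$, where $A(L_G)\subseteq A(\mathbb{T}G)=A(TG)\oplus A(T^*G)$ is the Lie algebroid of the Lie groupoid $L_G$; it is known that it takes values in $\mathrm{Dir}_{IM}(AG)$. *)

theory Defs
  imports "HOL-Analysis.Analysis"
begin

section \<open>Smooth maps between subsets of Euclidean spaces\<close>

primrec Ck_on :: "nat \<Rightarrow> 'a::euclidean_space set \<Rightarrow> ('a \<Rightarrow> 'b::euclidean_space) \<Rightarrow> bool" where
  "Ck_on 0 U f \<longleftrightarrow> continuous_on U f"
| "Ck_on (Suc k) U f \<longleftrightarrow>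
     (\<forall>x\<in>U. f differentiable (at x)) \<and> (\<forall>v. Ck_on k U (\<lambda>x. frechet_derivative f (at x) v))"

text \<open>Smoothness on an arbitrary subset means local extendability to a smooth function on an open
  set. It is needed because charts take values in linear subspaces (below), and for the
  multiplication of a groupoid, which lives on the submanifold of composable pairs.\<close>

definition smooth_on :: "'a::euclidean_space set \<Rightarrow> ('a \<Rightarrow> 'b::euclidean_space) \<Rightarrow> bool" where
  "smooth_on S f \<longleftrightarrow>
     (\<forall>x\<in>S. \<exists>U g. open U \<and> x \<in> U \<and> (\<forall>k. Ck_on k U g) \<and> (\<forall>y\<in>S \<inter> U. g y = f y))"


section \<open>Manifolds\<close>

type_synonym ('a, 'e) atlas = "('a set \<times> ('a \<Rightarrow> 'e)) set"

definition pts :: "('a, 'e) atlas \<Rightarrow> 'a set" where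
  "pts A = \<Union> (fst ` A)"

definition mopen :: "('a, 'e::euclidean_space) atlas \<Rightarrow> 'a set \<Rightarrow> bool" where
  "mopen A W \<longleftrightarrow> W \<subseteq> pts A \<and> (\<forall>(U, \<phi>)\<in>A. \<exists>V. open V \<and> U \<inter> W = U \<inter> \<phi> -` V)"

definition mtop :: "('a, 'e::euclidean_space) atlas \<Rightarrow> 'a topology" where
  "mtop A = topology (mopen A)"

lemma istopology_mopen: "istopology (mopen A)"
proof -
  have 1: "mopen A (S \<inter> T)" if S: "mopen A S" and T: "mopen A T" for S T
  proof -
    have "\<exists>V. open V \<and> U \<inter> (S \<inter> T) = U \<inter> \<phi> -` V" if c: "(U, \<phi>) \<in> A" for U \<phi>
    proof -
      obtain V where V: "open V" "U \<inter> S = U \<inter> \<phi> -` V"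
        using S c unfolding mopen_def by fast
      obtain V' where V': "open V'" "U \<inter> T = U \<inter> \<phi> -` V'"
        using T c unfolding mopen_def by fast
      have "U \<inter> (S \<inter> T) = U \<inter> \<phi> -` (V \<inter> V')" using V V' by auto
      then show ?thesis using V V' open_Int by metis
    qed
    then show ?thesis using S unfolding mopen_def by auto
  qed
  have 2: "mopen A (\<Union> K)" if K: "\<forall>S\<in>K. mopen A S" for K
  proof -
    have "\<exists>V. open V \<and> U \<inter> \<Union> K = U \<inter> \<phi> -` V" if c: "(U, \<phi>) \<in> A" for U \<phi>
    proof -
      have "\<forall>S\<in>K. \<exists>V. open V \<and> U \<inter> S = U \<inter> \<phi> -` V"
        using K c unfolding mopen_def by fast
      then obtain V where V: "\<forall>S\<in>K. open (V S) \<and> U \<inter> S = U \<inter> \<phi> -` V S"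
        by metis
      have "U \<inter> \<Union> K = (\<Union>S\<in>K. U \<inter> S)" by auto
      also have "\<dots> = (\<Union>S\<in>K. U \<inter> \<phi> -` V S)" using V by simp
      also have "\<dots> = U \<inter> \<phi> -` (\<Union>S\<in>K. V S)" by auto
      finally show ?thesis using V open_UN by metis
    qed
    moreover have "\<Union> K \<subseteq> pts A" using K unfolding mopen_def by auto
    ultimately show ?thesis unfolding mopen_def by auto
  qed
  show ?thesis unfolding istopology_def using 1 2 by simp
qed

lemma openin_mtop [simp]: "openin (mtop A) = mopen A"
  unfolding mtop_def by (simp add: istopology_mopen topology_inverse')

text \<open>The charts of an n-manifold have images that are relatively open in n-dimensional linear
  subspaces of the type \<open>'e\<close>; as every \<open>euclidean_space\<close> type has positive
  dimension, this is what admits manifolds of dimension 0 (for instance the base of a Lie group).\<close>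

definition manifold :: "nat \<Rightarrow> ('a, 'e::euclidean_space) atlas \<Rightarrow> bool" where
  "manifold n A \<longleftrightarrow>
     (\<forall>(U, \<phi>)\<in>A. inj_on \<phi> U \<and>
        (\<exists>K. subspace K \<and> dim K = n \<and> openin (top_of_set K) (\<phi> ` U))) \<and>
     (\<forall>(U, \<phi>)\<in>A. \<forall>(V, \<psi>)\<in>A. openin (top_of_set (\<phi> ` U)) (\<phi> ` (U \<inter> V)) \<and>
        smooth_on (\<phi> ` (U \<inter> V)) (\<psi> \<circ> inv_into U \<phi>)) \<and>
     Hausdorff_space (mtop A) \<and> second_countable (mtop A)"

definition smooth_map ::
  "('a, 'e::euclidean_space) atlas \<Rightarrow> 'a set \<Rightarrow> ('b, 'f::euclidean_space) atlas \<Rightarrow> ('a \<Rightarrow> 'b) \<Rightarrow> bool"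
  where
  "smooth_map A S B f \<longleftrightarrow> S \<subseteq> pts A \<and> f ` S \<subseteq> pts B \<and>
     (\<forall>p\<in>S. \<exists>(U, \<phi>)\<in>A. \<exists>(V, \<psi>)\<in>B. \<exists>W. mopen A W \<and> p \<in> W \<and> W \<subseteq> U \<and> f ` (S \<inter> W) \<subseteq> V \<and>
        smooth_on (\<phi> ` (S \<inter> W)) (\<psi> \<circ> f \<circ> inv_into U \<phi>))"

definition euc :: "('e, 'e) atlas" where
  "euc = {(UNIV, id)}"

definition prod_atlas :: "('a, 'e) atlas \<Rightarrow> ('b, 'f) atlas \<Rightarrow> ('a \<times> 'b, 'e \<times> 'f) atlas" where
  "prod_atlas A B = {(U \<times> V, map_prod \<phi> \<psi>) |U \<phi> V \<psi>. (U, \<phi>) \<in> A \<and> (V, \<psi>) \<in> B}"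

text \<open>The structure that an injection \<open>\<iota> : S \<rightarrow> pts A\<close> induces on \<open>S\<close>. It is only used for
  embedded submanifolds. Its charts are restrictions of charts of the ambient manifold, so their
  images need not be open in a subspace; curves, tangent vectors and smooth maps
  (in the sense of \<open>smooth_on\<close>) agree with those of the submanifold.\<close>

definition induced :: "('a, 'e) atlas \<Rightarrow> 'b set \<Rightarrow> ('b \<Rightarrow> 'a) \<Rightarrow> ('b, 'e) atlas" where
  "induced A S \<iota> = {({x\<in>S. \<iota> x \<in> U}, \<phi> \<circ> \<iota>) |U \<phi>. (U, \<phi>) \<in> A}"

abbreviation restr :: "('a, 'e) atlas \<Rightarrow> 'a set \<Rightarrow> ('a, 'e) atlas" where
  "restr A S \<equiv> induced A S id"

text \<open>Charts of the maximal atlas.\<close>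

definition compatible_chart :: "('a, 'e::euclidean_space) atlas \<Rightarrow> 'a set \<Rightarrow> ('a \<Rightarrow> 'e) \<Rightarrow> bool" where
  "compatible_chart A U \<phi> \<longleftrightarrow> mopen A U \<and> inj_on \<phi> U \<and>
     (\<exists>K. subspace K \<and> openin (top_of_set K) (\<phi> ` U)) \<and>
     smooth_map A U euc \<phi> \<and> smooth_map euc (\<phi> ` U) A (inv_into U \<phi>)"

definition submanifold :: "('a, 'e::euclidean_space) atlas \<Rightarrow> 'a set \<Rightarrow> bool" where
  "submanifold A S \<longleftrightarrow> S \<subseteq> pts A \<and>
     (\<exists>k. \<forall>p\<in>S. \<exists>U \<phi> K. p \<in> U \<and> compatible_chart A U \<phi> \<and> subspace K \<and> dim K = k \<and>
        \<phi> ` (U \<inter> S) = \<phi> ` U \<inter> K)"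


section \<open>Tangent and cotangent bundles\<close>

text \<open>A tangent vector is an equivalence class of curves that are smooth near 0; their values away
  from 0 are irrelevant.\<close>

type_synonym 'a tan = "(real \<Rightarrow> 'a) set"

definition curve :: "('a, 'e::euclidean_space) atlas \<Rightarrow> (real \<Rightarrow> 'a) \<Rightarrow> bool" where
  "curve A \<gamma> \<longleftrightarrow> (\<exists>e>0. smooth_map euc {-e<..<e} A \<gamma>)"

definition velocity :: "('a, 'e::euclidean_space) atlas \<Rightarrow> (real \<Rightarrow> 'a) \<Rightarrow> 'a tan" where
  "velocity A \<gamma> = {\<delta>. curve A \<delta> \<and> \<delta> 0 = \<gamma> 0 \<and>
     (\<forall>(U, \<phi>)\<in>A. \<gamma> 0 \<in> U \<longrightarrow>
        vector_derivative (\<phi> \<circ> \<delta>) (at 0) = vector_derivative (\<phi> \<circ> \<gamma>) (at 0))}"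

definition TB :: "('a, 'e::euclidean_space) atlas \<Rightarrow> 'a tan set" where
  "TB A = {velocity A \<gamma> |\<gamma>. curve A \<gamma>}"

definition pt :: "'a tan \<Rightarrow> 'a" where
  "pt v = (SOME \<gamma>. \<gamma> \<in> v) 0"

definition TS :: "('a, 'e::euclidean_space) atlas \<Rightarrow> 'a \<Rightarrow> 'a tan set" where
  "TS A p = {v\<in>TB A. pt v = p}"

text \<open>Derivative of a vector-valued function along a tangent vector; applied to a chart, it gives
  the coordinates of the tangent vector.\<close>

definition dir_deriv :: "'a tan \<Rightarrow> ('a \<Rightarrow> 'e::real_normed_vector) \<Rightarrow> 'e" where
  "dir_deriv v f = vector_derivative (f \<circ> (SOME \<gamma>. \<gamma> \<in> v)) (at 0)"

abbreviation dcoord :: "('a \<Rightarrow> 'e::real_normed_vector) \<Rightarrow> 'a tan \<Rightarrow> 'e" where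
  "dcoord \<phi> v \<equiv> dir_deriv v \<phi>"

definition tzero :: "('a, 'e::euclidean_space) atlas \<Rightarrow> 'a \<Rightarrow> 'a tan" where
  "tzero A p = velocity A (\<lambda>_. p)"

text \<open>The linear combination \<open>a u + b v\<close> of two tangent vectors at the same point.\<close>

definition tlin :: "('a, 'e::euclidean_space) atlas \<Rightarrow> real \<Rightarrow> 'a tan \<Rightarrow> real \<Rightarrow> 'a tan \<Rightarrow> 'a tan" where
  "tlin A a u b v = (THE w. w \<in> TS A (pt u) \<and>
     (\<forall>(U, \<phi>)\<in>A. pt u \<in> U \<longrightarrow> dcoord \<phi> w = a *\<^sub>R dcoord \<phi> u + b *\<^sub>R dcoord \<phi> v))"

text \<open>The tangent map of \<open>f\<close>, which need only be defined on a submanifold \<open>S\<close> that the vector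
  is tangent to.\<close>

definition tmap_on :: "'a set \<Rightarrow> ('b, 'f::euclidean_space) atlas \<Rightarrow> ('a \<Rightarrow> 'b) \<Rightarrow> 'a tan \<Rightarrow> 'b tan" where
  "tmap_on S B f v = velocity B (f \<circ> (SOME \<gamma>. \<gamma> \<in> v \<and> (\<forall>\<^sub>F t in nhds 0. \<gamma> t \<in> S)))"

abbreviation tmap :: "('b, 'f::euclidean_space) atlas \<Rightarrow> ('a \<Rightarrow> 'b) \<Rightarrow> 'a tan \<Rightarrow> 'b tan" where
  "tmap \<equiv> tmap_on UNIV"

abbreviation tchart :: "('a \<Rightarrow> 'e::real_normed_vector) \<Rightarrow> 'a tan \<Rightarrow> 'e \<times> 'e" where
  "tchart \<phi> \<equiv> \<lambda>v. (\<phi> (pt v), dcoord \<phi> v)"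

definition tan_atlas :: "('a, 'e::euclidean_space) atlas \<Rightarrow> ('a tan, 'e \<times> 'e) atlas" where
  "tan_atlas A = {({v\<in>TB A. pt v \<in> U}, tchart \<phi>) |U \<phi>. (U, \<phi>) \<in> A}"

text \<open>A covector is a point together with a linear functional on the tangent space there, extended
  by 0 to all other arguments.\<close>

type_synonym 'a cot = "'a \<times> ('a tan \<Rightarrow> real)"

definition CB :: "('a, 'e::euclidean_space) atlas \<Rightarrow> 'a cot set" where
  "CB A = {(p, \<xi>). p \<in> pts A \<and>
     (\<forall>u\<in>TS A p. \<forall>v\<in>TS A p. \<forall>a b. \<xi> (tlin A a u b v) = a * \<xi> u + b * \<xi> v) \<and>
     (\<forall>v. v \<notin> TS A p \<longrightarrow> \<xi> v = 0)}"

text \<open>Fibre coordinates of a covector: the dual of the chart's model subspace is identified with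
  the subspace by the inner product.\<close>

definition ccoord :: "('a, 'e::euclidean_space) atlas \<Rightarrow> ('a \<Rightarrow> 'e) \<Rightarrow> 'a cot \<Rightarrow> 'e" where
  "ccoord A \<phi> \<alpha> = (THE y. y \<in> dcoord \<phi> ` TS A (fst \<alpha>) \<and>
     (\<forall>v\<in>TS A (fst \<alpha>). snd \<alpha> v = inner y (dcoord \<phi> v)))"

definition cot_atlas :: "('a, 'e::euclidean_space) atlas \<Rightarrow> ('a cot, 'e \<times> 'e) atlas" where
  "cot_atlas A =
     {({\<alpha>\<in>CB A. fst \<alpha> \<in> U}, \<lambda>\<alpha>. (\<phi> (fst \<alpha>), ccoord A \<phi> \<alpha>)) |U \<phi>. (U, \<phi>) \<in> A}"

definition PB :: "('a, 'e::euclidean_space) atlas \<Rightarrow> ('a tan \<times> 'a cot) set" where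
  "PB A = {(X, \<alpha>). X \<in> TB A \<and> \<alpha> \<in> CB A \<and> pt X = fst \<alpha>}"

abbreviation pcoord ::
  "('a, 'e::euclidean_space) atlas \<Rightarrow> ('a \<Rightarrow> 'e) \<Rightarrow> 'a tan \<times> 'a cot \<Rightarrow> 'e \<times> 'e" where
  "pcoord A \<phi> \<equiv> \<lambda>(X, \<alpha>). (dcoord \<phi> X, ccoord A \<phi> \<alpha>)"

definition pont_atlas :: "('a, 'e::euclidean_space) atlas \<Rightarrow> ('a tan \<times> 'a cot, 'e \<times> 'e \<times> 'e) atlas" where
  "pont_atlas A =
     {({l\<in>PB A. pt (fst l) \<in> U}, \<lambda>l. (\<phi> (pt (fst l)), pcoord A \<phi> l)) |U \<phi>. (U, \<phi>) \<in> A}"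


section \<open>Two-forms\<close>

text \<open>The extension of the tangent vector \<open>u\<close> to a vector field with constant coordinates in the
  chart \<open>\<phi>\<close>. Such fields commute, so no bracket terms occur in the exterior derivatives below.\<close>

definition const_field :: "('a, 'e::euclidean_space) atlas \<Rightarrow> ('a \<Rightarrow> 'e) \<Rightarrow> 'a tan \<Rightarrow> 'a \<Rightarrow> 'a tan" where
  "const_field A \<phi> u q = (THE w. w \<in> TS A q \<and> dcoord \<phi> w = dcoord \<phi> u)"

definition two_form :: "('a, 'e::euclidean_space) atlas \<Rightarrow> ('a tan \<Rightarrow> 'a tan \<Rightarrow> real) \<Rightarrow> bool" where
  "two_form A \<omega> \<longleftrightarrow>
     (\<forall>p\<in>pts A. \<forall>u\<in>TS A p. \<forall>v\<in>TS A p. \<omega> u v = - \<omega> v u \<and>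
        (\<forall>w\<in>TS A p. \<forall>a b. \<omega> (tlin A a u b v) w = a * \<omega> u w + b * \<omega> v w)) \<and>
     (\<forall>(U, \<phi>)\<in>A. \<forall>p\<in>U. \<forall>u\<in>TS A p. \<forall>v\<in>TS A p.
        smooth_map A U euc (\<lambda>q. \<omega> (const_field A \<phi> u q) (const_field A \<phi> v q)))"

definition closed_form :: "('a, 'e::euclidean_space) atlas \<Rightarrow> ('a tan \<Rightarrow> 'a tan \<Rightarrow> real) \<Rightarrow> bool" where
  "closed_form A \<omega> \<longleftrightarrow>
     (\<forall>(U, \<phi>)\<in>A. \<forall>p\<in>U. \<forall>u\<in>TS A p. \<forall>v\<in>TS A p. \<forall>w\<in>TS A p.
        dir_deriv u (\<lambda>q. \<omega> (const_field A \<phi> v q) (const_field A \<phi> w q)) +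
        dir_deriv v (\<lambda>q. \<omega> (const_field A \<phi> w q) (const_field A \<phi> u q)) +
        dir_deriv w (\<lambda>q. \<omega> (const_field A \<phi> u q) (const_field A \<phi> v q)) = 0)"

definition sharp ::
  "('a, 'e::euclidean_space) atlas \<Rightarrow> ('a tan \<Rightarrow> 'a tan \<Rightarrow> real) \<Rightarrow> 'a tan \<Rightarrow> 'a cot" where
  "sharp A \<omega> X = (pt X, \<lambda>Y. if Y \<in> TS A (pt X) then \<omega> X Y else 0)"

definition tau ::
  "('a, 'e::euclidean_space) atlas \<Rightarrow> ('a tan \<Rightarrow> 'a tan \<Rightarrow> real) \<Rightarrow> 'a tan \<times> 'a cot \<Rightarrow> 'a tan \<times> 'a cot"
  where
  "tau A \<omega> = (\<lambda>(X, \<alpha>). (X, (fst \<alpha>, \<lambda>Y. snd \<alpha> Y + snd (sharp A \<omega> X) Y)))"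


section \<open>Dirac structures\<close>

definition pont_section ::
  "('a, 'e::euclidean_space) atlas \<Rightarrow> 'a set \<Rightarrow> ('a \<Rightarrow> 'a tan \<times> 'a cot) \<Rightarrow> bool" where
  "pont_section A W \<sigma> \<longleftrightarrow>
     smooth_map A W (pont_atlas A) \<sigma> \<and> (\<forall>p\<in>W. pt (fst (\<sigma> p)) = p)"

definition pont_subbundle :: "('a, 'e::euclidean_space) atlas \<Rightarrow> ('a tan \<times> 'a cot) set \<Rightarrow> bool" where
  "pont_subbundle A L \<longleftrightarrow> L \<subseteq> PB A \<and>
     (\<exists>k. \<forall>p\<in>pts A. \<exists>(U, \<phi>)\<in>A. \<exists>W \<sigma>. mopen A W \<and> p \<in> W \<and> W \<subseteq> U \<and>
        (\<forall>i<k::nat. pont_section A W (\<sigma> i)) \<and>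
        (\<forall>q\<in>W. inj_on (\<lambda>i. pcoord A \<phi> (\<sigma> i q)) {..<k} \<and>
           independent ((\<lambda>i. pcoord A \<phi> (\<sigma> i q)) ` {..<k}) \<and>
           pcoord A \<phi> ` {l\<in>L. pt (fst l) = q} = span ((\<lambda>i. pcoord A \<phi> (\<sigma> i q)) ` {..<k})))"

definition pont_orth ::
  "('a, 'e::euclidean_space) atlas \<Rightarrow> ('a tan \<times> 'a cot) set \<Rightarrow> ('a tan \<times> 'a cot) set" where
  "pont_orth A L =
     {(Y, \<beta>)\<in>PB A. \<forall>(X, \<alpha>)\<in>L. pt X = pt Y \<longrightarrow> snd \<alpha> Y + snd \<beta> X = 0}"

definition lie_bracket ::
  "('a, 'e::euclidean_space) atlas \<Rightarrow> ('a \<Rightarrow> 'a tan) \<Rightarrow> ('a \<Rightarrow> 'a tan) \<Rightarrow> 'a \<Rightarrow> 'a tan" where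
  "lie_bracket A X Y p = (THE v. v \<in> TS A p \<and> (\<forall>(U, \<phi>)\<in>A. p \<in> U \<longrightarrow>
     dcoord \<phi> v = dir_deriv (X p) (\<lambda>q. dcoord \<phi> (Y q)) - dir_deriv (Y p) (\<lambda>q. dcoord \<phi> (X q))))"

text \<open>The exterior derivative of a one-form, evaluated on two tangent vectors at \<open>p\<close>.\<close>

definition ext_deriv ::
  "('a, 'e::euclidean_space) atlas \<Rightarrow> ('a \<Rightarrow> 'a cot) \<Rightarrow> 'a \<Rightarrow> 'a tan \<Rightarrow> 'a tan \<Rightarrow> real" where
  "ext_deriv A \<alpha> p u v = (THE r. \<forall>(U, \<phi>)\<in>A. p \<in> U \<longrightarrow>
     r = dir_deriv u (\<lambda>q. snd (\<alpha> q) (const_field A \<phi> v q)) -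
         dir_deriv v (\<lambda>q. snd (\<alpha> q) (const_field A \<phi> u q)))"

definition lie_deriv ::
  "('a, 'e::euclidean_space) atlas \<Rightarrow> ('a \<Rightarrow> 'a tan) \<Rightarrow> ('a \<Rightarrow> 'a cot) \<Rightarrow> 'a \<Rightarrow> 'a tan \<Rightarrow> real" where
  \<comment> \<open>Cartan's formula\<close>
  "lie_deriv A X \<beta> p Z = dir_deriv Z (\<lambda>q. snd (\<beta> q) (X q)) + ext_deriv A \<beta> p (X p) Z"

definition courant ::
  "('a, 'e::euclidean_space) atlas \<Rightarrow> ('a \<Rightarrow> 'a tan \<times> 'a cot) \<Rightarrow> ('a \<Rightarrow> 'a tan \<times> 'a cot) \<Rightarrow>
     'a \<Rightarrow> 'a tan \<times> 'a cot" where
  "courant A \<sigma> \<tau> p =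
     (let X = fst \<circ> \<sigma>; \<alpha> = snd \<circ> \<sigma>; Y = fst \<circ> \<tau>; \<beta> = snd \<circ> \<tau>
      in (lie_bracket A X Y p,
          (p, \<lambda>Z. if Z \<in> TS A p then lie_deriv A X \<beta> p Z - ext_deriv A \<alpha> p (Y p) Z else 0)))"

definition dirac :: "('a, 'e::euclidean_space) atlas \<Rightarrow> ('a tan \<times> 'a cot) set \<Rightarrow> bool" where
  "dirac A L \<longleftrightarrow> pont_subbundle A L \<and> pont_orth A L = L \<and>
     (\<forall>\<sigma> \<tau>. pont_section A (pts A) \<sigma> \<and> pont_section A (pts A) \<tau> \<and>
        (\<forall>p\<in>pts A. \<sigma> p \<in> L \<and> \<tau> p \<in> L) \<longrightarrow> (\<forall>p\<in>pts A. courant A \<sigma> \<tau> p \<in> L))"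


section \<open>Lie groupoids\<close>

record ('g, 'e, 'm, 'f) gpd =
  arr :: "('g, 'e) atlas"
  obj :: "('m, 'f) atlas"
  src :: "'g \<Rightarrow> 'm"
  tgt :: "'g \<Rightarrow> 'm"
  one :: "'m \<Rightarrow> 'g"
  ginv :: "'g \<Rightarrow> 'g"
  mul :: "'g \<Rightarrow> 'g \<Rightarrow> 'g"

text \<open>The product \<open>g h\<close> is defined when \<open>t(h) = s(g)\<close>.\<close>

definition groupoid :: "('g, 'e, 'm, 'f) gpd \<Rightarrow> bool" where
  "groupoid G \<longleftrightarrow>
     (\<forall>g\<in>pts (arr G). src G g \<in> pts (obj G) \<and> tgt G g \<in> pts (obj G)) \<and>
     (\<forall>x\<in>pts (obj G). one G x \<in> pts (arr G) \<and> src G (one G x) = x \<and> tgt G (one G x) = x) \<and>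
     (\<forall>g\<in>pts (arr G). \<forall>h\<in>pts (arr G). src G g = tgt G h \<longrightarrow>
        mul G g h \<in> pts (arr G) \<and> src G (mul G g h) = src G h \<and> tgt G (mul G g h) = tgt G g) \<and>
     (\<forall>g\<in>pts (arr G). \<forall>h\<in>pts (arr G). \<forall>k\<in>pts (arr G). src G g = tgt G h \<and> src G h = tgt G k \<longrightarrow>
        mul G (mul G g h) k = mul G g (mul G h k)) \<and>
     (\<forall>g\<in>pts (arr G). mul G g (one G (src G g)) = g \<and> mul G (one G (tgt G g)) g = g) \<and>
     (\<forall>g\<in>pts (arr G). ginv G g \<in> pts (arr G) \<and>
        src G (ginv G g) = tgt G g \<and> tgt G (ginv G g) = src G g \<and>
        mul G g (ginv G g) = one G (tgt G g) \<and> mul G (ginv G g) g = one G (src G g))"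

definition comp_pairs :: "('g, 'e, 'm, 'f) gpd \<Rightarrow> ('g \<times> 'g, 'e \<times> 'e) atlas" where
  "comp_pairs G = restr (prod_atlas (arr G) (arr G))
     {(g, h). g \<in> pts (arr G) \<and> h \<in> pts (arr G) \<and> tgt G h = src G g}"

definition submersion ::
  "('a, 'e::euclidean_space) atlas \<Rightarrow> ('b, 'f::euclidean_space) atlas \<Rightarrow> ('a \<Rightarrow> 'b) \<Rightarrow> bool" where
  "submersion A B f \<longleftrightarrow> smooth_map A (pts A) B f \<and> (\<forall>p\<in>pts A. tmap B f ` TS A p = TS B (f p))"

definition smooth_groupoid :: "('g, 'e::euclidean_space, 'm, 'f::euclidean_space) gpd \<Rightarrow> bool" where
  "smooth_groupoid G \<longleftrightarrow> groupoid G \<and>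
     submersion (arr G) (obj G) (src G) \<and> submersion (arr G) (obj G) (tgt G) \<and>
     smooth_map (obj G) (pts (obj G)) (arr G) (one G) \<and>
     smooth_map (arr G) (pts (arr G)) (arr G) (ginv G) \<and>
     smooth_map (comp_pairs G) (pts (comp_pairs G)) (arr G) (\<lambda>(g, h). mul G g h)"

definition lie_groupoid :: "('g, 'e::euclidean_space, 'm, 'f::euclidean_space) gpd \<Rightarrow> bool" where
  "lie_groupoid G \<longleftrightarrow> (\<exists>k. manifold k (arr G)) \<and> (\<exists>n. manifold n (obj G)) \<and> smooth_groupoid G"

text \<open>The restriction of \<open>G\<close> to a set \<open>H\<close> of arrows and the objects that occur as their sources.\<close>

definition gpd_restr :: "('g, 'e, 'm, 'f) gpd \<Rightarrow> 'g set \<Rightarrow> ('g, 'e, 'm, 'f) gpd" where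
  "gpd_restr G H = G\<lparr>arr := restr (arr G) H, obj := restr (obj G) (src G ` H)\<rparr>"

definition lie_subgroupoid ::
  "('g, 'e::euclidean_space, 'm, 'f::euclidean_space) gpd \<Rightarrow> 'g set \<Rightarrow> bool" where
  "lie_subgroupoid G H \<longleftrightarrow> submanifold (arr G) H \<and> submanifold (obj G) (src G ` H) \<and>
     smooth_groupoid (gpd_restr G H)"

definition mult_form ::
  "('g, 'e::euclidean_space, 'm, 'f) gpd \<Rightarrow> ('g tan \<Rightarrow> 'g tan \<Rightarrow> real) \<Rightarrow> bool" where
  "mult_form G \<omega> \<longleftrightarrow> (\<forall>V\<in>TB (comp_pairs G). \<forall>W\<in>TB (comp_pairs G). pt V = pt W \<longrightarrow>
     \<omega> (tmap (arr G) (\<lambda>(g, h). mul G g h) V) (tmap (arr G) (\<lambda>(g, h). mul G g h) W) =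
     \<omega> (tmap (arr G) fst V) (tmap (arr G) fst W) + \<omega> (tmap (arr G) snd V) (tmap (arr G) snd W))"

text \<open>The total space of the Lie algebroid, as a subset of the tangent bundle, and its fibres.\<close>

definition lie_alg :: "('g, 'e::euclidean_space, 'm, 'f::euclidean_space) gpd \<Rightarrow> 'g tan set" where
  "lie_alg G = {v\<in>TB (arr G).
     \<exists>x\<in>pts (obj G). pt v = one G x \<and> tmap (obj G) (src G) v = tzero (obj G) x}"

definition lie_alg_fib ::
  "('g, 'e::euclidean_space, 'm, 'f::euclidean_space) gpd \<Rightarrow> 'm \<Rightarrow> 'g tan set" where
  "lie_alg_fib G x = {a\<in>lie_alg G. pt a = one G x}"

definition alg_mfd ::
  "('g, 'e::euclidean_space, 'm, 'f::euclidean_space) gpd \<Rightarrow> ('g tan, 'e \<times> 'e) atlas" where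
  "alg_mfd G = restr (tan_atlas (arr G)) (lie_alg G)"


section \<open>The tangent and cotangent groupoids\<close>

definition tmul ::
  "('g, 'e::euclidean_space, 'm, 'f) gpd \<Rightarrow> 'g tan \<Rightarrow> 'g tan \<Rightarrow> 'g tan" where
  "tmul G X Y = tmap (arr G) (\<lambda>(g, h). mul G g h)
     (THE V. V \<in> TB (comp_pairs G) \<and> tmap (arr G) fst V = X \<and> tmap (arr G) snd V = Y)"

definition tan_gpd ::
  "('g, 'e::euclidean_space, 'm, 'f::euclidean_space) gpd \<Rightarrow>
     ('g tan, 'e \<times> 'e, 'm tan, 'f \<times> 'f) gpd" where
  "tan_gpd G = \<lparr>arr = tan_atlas (arr G), obj = tan_atlas (obj G),
     src = tmap (obj G) (src G), tgt = tmap (obj G) (tgt G), one = tmap (arr G) (one G),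
     ginv = tmap (arr G) (ginv G), mul = tmul G\<rparr>"

type_synonym ('g, 'm) acot = "'m \<times> ('g tan \<Rightarrow> real)"

definition dual_alg ::
  "('g, 'e::euclidean_space, 'm, 'f::euclidean_space) gpd \<Rightarrow> ('g, 'm) acot set" where
  "dual_alg G = {(x, \<alpha>). x \<in> pts (obj G) \<and>
     (\<forall>a\<in>lie_alg_fib G x. \<forall>b\<in>lie_alg_fib G x. \<forall>c d.
        \<alpha> (tlin (arr G) c a d b) = c * \<alpha> a + d * \<alpha> b) \<and>
     (\<forall>a. a \<notin> lie_alg_fib G x \<longrightarrow> \<alpha> a = 0)}"

text \<open>Translations \<open>l\<^sub>g\<close> and \<open>r\<^sub>g\<close> are defined on target and source fibres, respectively.\<close>

definition tleft ::
  "('g, 'e::euclidean_space, 'm, 'f) gpd \<Rightarrow> 'g \<Rightarrow> 'g tan \<Rightarrow> 'g tan" where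
  "tleft G g = tmap_on {h\<in>pts (arr G). tgt G h = src G g} (arr G) (\<lambda>h. mul G g h)"

definition tright ::
  "('g, 'e::euclidean_space, 'm, 'f) gpd \<Rightarrow> 'g \<Rightarrow> 'g tan \<Rightarrow> 'g tan" where
  "tright G g = tmap_on {h\<in>pts (arr G). src G h = tgt G g} (arr G) (\<lambda>h. mul G h g)"

text \<open>In \<open>a - Tt(a)\<close>, the base is regarded as embedded in \<open>G\<close> by the units.\<close>

definition cot_src ::
  "('g, 'e::euclidean_space, 'm, 'f::euclidean_space) gpd \<Rightarrow> 'g cot \<Rightarrow> ('g, 'm) acot" where
  "cot_src G = (\<lambda>(g, \<xi>). (src G g, \<lambda>a. if a \<in> lie_alg_fib G (src G g)
     then \<xi> (tleft G g (tlin (arr G) 1 a (-1) (tmap (arr G) (one G) (tmap (obj G) (tgt G) a))))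
     else 0))"

definition cot_tgt ::
  "('g, 'e::euclidean_space, 'm, 'f::euclidean_space) gpd \<Rightarrow> 'g cot \<Rightarrow> ('g, 'm) acot" where
  "cot_tgt G = (\<lambda>(g, \<xi>). (tgt G g, \<lambda>b. if b \<in> lie_alg_fib G (tgt G g)
     then \<xi> (tright G g b) else 0))"

text \<open>The unit at \<open>\<alpha>\<close> vanishes on vectors tangent to the units and restricts to \<open>\<alpha>\<close> on the
  Lie algebroid.\<close>

definition cot_one ::
  "('g, 'e::euclidean_space, 'm, 'f::euclidean_space) gpd \<Rightarrow> ('g, 'm) acot \<Rightarrow> 'g cot" where
  "cot_one G = (\<lambda>(x, \<alpha>). (one G x, \<lambda>v. if v \<in> TS (arr G) (one G x)
     then \<alpha> (tlin (arr G) 1 v (-1) (tmap (arr G) (one G) (tmap (obj G) (src G) v))) else 0))"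

definition cot_inv :: "('g, 'e::euclidean_space, 'm, 'f) gpd \<Rightarrow> 'g cot \<Rightarrow> 'g cot" where
  "cot_inv G = (\<lambda>(g, \<xi>). (ginv G g, \<lambda>v. if v \<in> TS (arr G) (ginv G g)
     then - \<xi> (tmap (arr G) (ginv G) v) else 0))"

definition cot_mul ::
  "('g, 'e::euclidean_space, 'm, 'f::euclidean_space) gpd \<Rightarrow> 'g cot \<Rightarrow> 'g cot \<Rightarrow> 'g cot" where
  "cot_mul G = (\<lambda>(g, \<xi>) (h, \<eta>). (mul G g h, \<lambda>Z. if Z \<in> TS (arr G) (mul G g h)
     then (THE r. \<forall>X\<in>TS (arr G) g. \<forall>Y\<in>TS (arr G) h.
             tmap (obj G) (src G) X = tmap (obj G) (tgt G) Y \<and> tmul G X Y = Z \<longrightarrow> r = \<xi> X + \<eta> Y)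
     else 0))"

text \<open>The dual bundle of the Lie algebroid carries the manifold structure that makes its unit map
  an embedding into the cotangent bundle (as the annihilator of the tangent bundle of the units).\<close>

definition cot_gpd ::
  "('g, 'e::euclidean_space, 'm, 'f::euclidean_space) gpd \<Rightarrow>
     ('g cot, 'e \<times> 'e, ('g, 'm) acot, 'e \<times> 'e) gpd" where
  "cot_gpd G = \<lparr>arr = cot_atlas (arr G),
     obj = induced (cot_atlas (arr G)) (dual_alg G) (cot_one G),
     src = cot_src G, tgt = cot_tgt G, one = cot_one G, ginv = cot_inv G, mul = cot_mul G\<rparr>"

definition pont_gpd ::
  "('g, 'e::euclidean_space, 'm, 'f::euclidean_space) gpd \<Rightarrow>
     ('g tan \<times> 'g cot, 'e \<times> 'e \<times> 'e, 'm tan \<times> ('g, 'm) acot, ('f \<times> 'f) \<times> ('e \<times> 'e)) gpd" where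
  "pont_gpd G = \<lparr>arr = pont_atlas (arr G),
     obj = restr (prod_atlas (obj (tan_gpd G)) (obj (cot_gpd G)))
             {(x, \<alpha>). x \<in> TB (obj G) \<and> \<alpha> \<in> dual_alg G \<and> pt x = fst \<alpha>},
     src = map_prod (src (tan_gpd G)) (src (cot_gpd G)),
     tgt = map_prod (tgt (tan_gpd G)) (tgt (cot_gpd G)),
     one = map_prod (one (tan_gpd G)) (one (cot_gpd G)),
     ginv = map_prod (ginv (tan_gpd G)) (ginv (cot_gpd G)),
     mul = (\<lambda>(X, \<xi>) (Y, \<eta>). (mul (tan_gpd G) X Y, mul (cot_gpd G) \<xi> \<eta>))\<rparr>"

definition Dir_mult ::
  "('g, 'e::euclidean_space, 'm, 'f::euclidean_space) gpd \<Rightarrow> ('g tan \<times> 'g cot) set set" where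
  "Dir_mult G = {L. dirac (arr G) L \<and> lie_subgroupoid (pont_gpd G) L}"


section \<open>The Lie functor on multiplicative Dirac structures\<close>

text \<open>The canonical involution of the double tangent bundle, in induced coordinates
  \<open>(x, x', dx, dx') \<mapsto> (x, dx, x', dx')\<close>.\<close>

definition tan_flip :: "('a, 'e::euclidean_space) atlas \<Rightarrow> 'a tan tan \<Rightarrow> 'a tan tan" where
  "tan_flip A V = (THE W. W \<in> TB (tan_atlas A) \<and> pt (pt W) = pt (pt V) \<and>
     (\<forall>(U, \<phi>)\<in>A. pt (pt V) \<in> U \<longrightarrow>
        dcoord \<phi> (pt W) = fst (dcoord (tchart \<phi>) V) \<and>
        dcoord (tchart \<phi>) W = (dcoord \<phi> (pt V), snd (dcoord (tchart \<phi>) V))))"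

text \<open>\<open>T(AG)\<close> is included in \<open>TTG\<close> by the tangent map of the inclusion of \<open>AG\<close> in \<open>TG\<close>.\<close>

definition jG ::
  "('g, 'e::euclidean_space, 'm, 'f::euclidean_space) gpd \<Rightarrow> 'g tan tan \<Rightarrow> 'g tan tan" where
  "jG G Y = tan_flip (arr G) (tmap (tan_atlas (arr G)) id Y)"

text \<open>The tangent map of the canonical pairing of covectors with vectors over the same point.\<close>

definition tan_pairing :: "'a cot tan \<Rightarrow> 'a tan tan \<Rightarrow> real" where
  "tan_pairing W V =
     (let (\<xi>, X) = (SOME (\<xi>, X). \<xi> \<in> W \<and> X \<in> V \<and> (\<forall>\<^sub>F t in nhds 0. fst (\<xi> t) = pt (X t)))
      in vector_derivative (\<lambda>t. snd (\<xi> t) (X t)) (at 0))"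

definition thetaG ::
  "('g, 'e::euclidean_space, 'm, 'f::euclidean_space) gpd \<Rightarrow> 'g cot tan \<Rightarrow> 'g tan cot" where
  "thetaG G W = (let a = tmap (arr G) fst W in
     (a, \<lambda>Y. if Y \<in> TS (alg_mfd G) a then tan_pairing W (jG G Y) else 0))"

text \<open>The two-form \<open>B\<close> on \<open>AG\<close> with \<open>B\<^sup>\<sharp> = \<theta>\<^sub>G \<circ> A(B\<^sub>G\<^sup>\<sharp>) \<circ> j\<^sub>G\<close>.\<close>

definition induced_form ::
  "('g, 'e::euclidean_space, 'm, 'f::euclidean_space) gpd \<Rightarrow> ('g tan \<Rightarrow> 'g tan \<Rightarrow> real) \<Rightarrow>
     'g tan tan \<Rightarrow> 'g tan tan \<Rightarrow> real" where
  "induced_form G \<omega> Y Z =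
     snd (thetaG G (tmap (cot_atlas (arr G)) (sharp (arr G) \<omega>) (jG G Y))) Z"

text \<open>The image of \<open>A(L)\<close> under \<open>j\<^sub>G\<inverse> \<oplus> \<theta>\<^sub>G\<close>, where \<open>A(L)\<close> is the Lie algebroid of the groupoid
  \<open>L\<close> and its elements are split into their \<open>A(TG)\<close> and \<open>A(T\<^sup>*G)\<close> components by the tangent
  maps of the two projections. The pairs \<open>(j\<^sub>G\<inverse>(V), \<theta>\<^sub>G(W))\<close> are written as
  \<open>(Y, \<theta>\<^sub>G(W))\<close> with \<open>j\<^sub>G(Y) = V\<close>.\<close>

definition Lie ::
  "('g, 'e::euclidean_space, 'm, 'f::euclidean_space) gpd \<Rightarrow> ('g tan \<times> 'g cot) set \<Rightarrow>
     ('g tan tan \<times> 'g tan cot) set" where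
  "Lie G L = {(Y, thetaG G (tmap (cot_atlas (arr G)) snd U)) |Y U.
     U \<in> lie_alg (gpd_restr (pont_gpd G) L) \<and> Y \<in> TB (alg_mfd G) \<and>
     jG G Y = tmap (tan_atlas (arr G)) fst U}"

end

theory Submission
  imports Defs
begin

text \<open>An element of the Lie algebroid of \<open>L\<close> is the velocity of a curve \<open>(X, \<alpha>)\<close> in \<open>L\<close> through a unit
  whose source has velocity zero. The B-field transformation sends it to \<open>(X, \<alpha> + B\<^sup>\<sharp>(X))\<close>. As the
  pairing of covectors with vectors is bilinear in the fibres, differentiating it shows that
  \<open>\<theta>\<^sub>G\<close> turns this sum of curves into the sum of the velocity of \<open>\<alpha>\<close> and of the velocity of
  \<open>B\<^sup>\<sharp>(X)\<close>, and the latter gives the induced form by definition.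

  What remains is that the transformed curve again starts at a unit and has a source with velocity
  zero. Both follow from \<open>1(s(B\<^sup>\<sharp>(X))) = B\<^sup>\<sharp>(T1(Ts(X)))\<close>, one half of the statement that
  \<open>B\<^sup>\<sharp>\<close> is a groupoid morphism. It is obtained by applying multiplicativity to the products
  \<open>X = X \<bullet> T1(Ts(X))\<close> and \<open>Tl\<^sub>g(b) = 0\<^sub>g \<bullet> b\<close>. To make sense of \<open>Tl\<^sub>g(b)\<close> one needs a
  curve in a target fibre with velocity \<open>b\<close>, which the inverse function theorem provides. The inverse
  B-field transformation gives the converse inclusion.\<close>

section \<open>Calculus of smooth maps\<close>

text \<open>Tangent vectors are sets of curves, and \<open>tmap\<close>, \<open>tlin\<close>,
  \<open>tan_flip\<close> and \<open>tan_pairing\<close> are built from \<open>SOME\<close> and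
  \<open>THE\<close>. Each of them is therefore first tied to coordinates: tangent maps to
  derivatives of local representatives, the involution to symmetric second derivatives, the pairing
  to a product rule. The obstacle is that a Dirac structure L is a submanifold whose
  \<open>restr\<close> charts have images that need not be open in a subspace. Hence most facts are
  stated for atlases with \<open>satlas\<close> and for maps with extendable local representatives,
  \<open>smap\<close>. The manifold structure on the dual of AG is pulled back from the cotangent
  bundle through \<open>cot_one\<close>. Smoothness and vanishing velocity of a source curve thus
  become conditions on the unit at the source, a curve in the cotangent bundle, and this is why the
  compatibility of the form with the groupoid is wanted for the composite of source and unit. For
  the transformed structure only the behaviour of the source along curves
  (\<open>smooth_src\<close>) is established, which avoids reconstructing a Lie subgroupoid.\<close>

definition Cinf :: "'a::euclidean_space set \<Rightarrow> ('a \<Rightarrow> 'b::euclidean_space) \<Rightarrow> bool" where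
  "Cinf U f \<longleftrightarrow> (\<forall>k. Ck_on k U f)"

text \<open>\<open>Ck_on\<close> controls derivatives only in a direction that does not move with
  the point. Expanding a moving direction over \<open>Basis\<close> reduces it to finitely many
  fixed ones with variable coefficients.\<close>

lemma frechet_derivative_expand:
  fixes f :: "'a::euclidean_space \<Rightarrow> 'b::real_normed_vector"
  assumes "f differentiable (at x)"
  shows "frechet_derivative f (at x) v = (\<Sum>b\<in>Basis. (v \<bullet> b) *\<^sub>R frechet_derivative f (at x) b)"
proof -
  have "linear (frechet_derivative f (at x))"
    using assms by (rule linear_frechet_derivative)
  then have "frechet_derivative f (at x) (\<Sum>b\<in>Basis. (v \<bullet> b) *\<^sub>R b) =
      (\<Sum>b\<in>Basis. (v \<bullet> b) *\<^sub>R frechet_derivative f (at x) b)"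
    by (simp add: linear_sum linear_cmul)
  then show ?thesis
    by (simp add: euclidean_representation)
qed

lemma Ck_on_subset: "Ck_on k U f \<Longrightarrow> V \<subseteq> U \<Longrightarrow> Ck_on k V f"
  by (induction k arbitrary: f) (auto intro: continuous_on_subset)

lemma Ck_on_cong:
  assumes "open U" "\<And>x. x \<in> U \<Longrightarrow> f x = g x" "Ck_on k U f"
  shows "Ck_on k U g"
  using assms
proof (induction k arbitrary: f g)
  case 0
  then show ?case by (simp cong: continuous_on_cong)
next
  case (Suc k)
  have d: "f differentiable (at x)" if "x \<in> U" for x
    using Suc.prems(3) that by simp
  have hd: "(g has_derivative frechet_derivative f (at x)) (at x)" if "x \<in> U" for x
    by (rule has_derivative_transform_within_open
        [OF d[OF that, unfolded frechet_derivative_works] \<open>open U\<close> that Suc.prems(2)])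
  then have fd: "frechet_derivative f (at x) = frechet_derivative g (at x)" if "x \<in> U" for x
    using frechet_derivative_at that by metis
  have "Ck_on k U (\<lambda>x. frechet_derivative g (at x) v)" for v
    by (rule Suc.IH[of "\<lambda>x. frechet_derivative f (at x) v"]) (use Suc.prems fd in auto)
  then show ?case
    using hd by (auto simp: differentiable_def)
qed

lemma Ck_on_SucD: "Ck_on (Suc k) U f \<Longrightarrow> Ck_on k U f"
proof (induction k arbitrary: f)
  case 0
  then show ?case
    by (auto intro!: continuous_at_imp_continuous_on differentiable_imp_continuous_within)
next
  case (Suc k)
  then show ?case by (metis Ck_on.simps(2))
qed

text \<open>Uniqueness of the derivative on an open set replaces \<open>frechet_derivative\<close>
  by whatever derivative the differentiation rules produce.\<close>

lemma Ck_on_SucI: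
  assumes "open U" "\<And>x. x \<in> U \<Longrightarrow> (f has_derivative f' x) (at x)" "\<And>v. Ck_on k U (\<lambda>x. f' x v)"
  shows "Ck_on (Suc k) U f"
proof -
  have "frechet_derivative f (at x) = f' x" if "x \<in> U" for x
    using assms(2)[OF that] frechet_derivative_at by metis
  then have "Ck_on k U (\<lambda>x. frechet_derivative f (at x) v)" for v
    by (intro Ck_on_cong[OF assms(1) _ assms(3)]) auto
  then show ?thesis
    using assms(2) by (auto simp: differentiable_def)
qed

lemma Ck_on_has_derivative:
  "Ck_on (Suc k) U f \<Longrightarrow> x \<in> U \<Longrightarrow> (f has_derivative frechet_derivative f (at x)) (at x)"
  by (simp add: frechet_derivative_works)

lemma Ck_on_const: "open U \<Longrightarrow> Ck_on k U (\<lambda>_. c)"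
proof (induction k arbitrary: c)
  case (Suc k)
  show ?case
    by (rule Ck_on_SucI[OF Suc.prems, of _ "\<lambda>_ _. 0"]) (auto intro: Suc)
qed simp

lemma Ck_on_add:
  "open U \<Longrightarrow> Ck_on k U f \<Longrightarrow> Ck_on k U g \<Longrightarrow> Ck_on k U (\<lambda>x. f x + g x)"
proof (induction k arbitrary: f g)
  case 0
  then show ?case by (auto intro: continuous_on_add)
next
  case (Suc k)
  show ?case
    by (rule Ck_on_SucI[OF \<open>open U\<close> has_derivative_add])
      (use Suc in \<open>auto intro: Ck_on_has_derivative\<close>)
qed

lemma Ck_on_linear:
  assumes "bounded_linear L" "open U" "Ck_on k U f"
  shows "Ck_on k U (\<lambda>x. L (f x))"
  using assms(3)
proof (induction k arbitrary: f)
  case 0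
  then show ?case using assms by (auto intro: linear_continuous_on_compose bounded_linear.linear)
next
  case (Suc k)
  show ?case
    by (rule Ck_on_SucI[OF \<open>open U\<close> bounded_linear.has_derivative[OF assms(1)]])
      (use Suc in \<open>auto intro: Ck_on_has_derivative\<close>)
qed

lemma Ck_on_bilinear:
  assumes "bounded_bilinear P" "open U" "Ck_on k U f" "Ck_on k U g"
  shows "Ck_on k U (\<lambda>x. P (f x) (g x))"
  using assms(3,4)
proof (induction k arbitrary: f g)
  case 0
  then show ?case using assms by (auto intro: bounded_bilinear.continuous_on)
next
  case (Suc k)
  have "Ck_on k U f" "Ck_on k U g"
    using Suc.prems Ck_on_SucD by blast+
  then show ?case
    by (intro Ck_on_SucI[OF \<open>open U\<close> bounded_bilinear.FDERIV[OF assms(1)]])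
      (use Suc in \<open>auto intro: Ck_on_has_derivative Ck_on_add[OF assms(2)]\<close>)
qed

lemma Ck_on_sum:
  assumes "open U" "\<And>i. i \<in> I \<Longrightarrow> Ck_on k U (f i)"
  shows "Ck_on k U (\<lambda>x. \<Sum>i\<in>I. f i x)"
  using assms(2)
proof (induction I rule: infinite_finite_induct)
  case (insert i I)
  then show ?case using assms(1) by (simp add: Ck_on_add)
qed (auto simp: Ck_on_const assms)

lemma Ck_on_id: "open U \<Longrightarrow> Ck_on k U (\<lambda>x. x)"
proof (cases k)
  case (Suc n)
  assume "open U"
  then show ?thesis
    unfolding Suc by (intro Ck_on_SucI[of _ _ "\<lambda>_ v. v"]) (auto intro: Ck_on_const)
qed auto

text \<open>In the chain rule the direction fed to the derivative of \<open>f\<close> varies with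
  \<open>x\<close>, so the induction hypothesis does not apply to it directly. After the expansion
  over \<open>Basis\<close> it applies to each fixed direction \<open>b\<close>, and sums and
  products do the rest.\<close>

lemma Ck_on_compose:
  assumes "open U" "open V"
  shows "Ck_on k V f \<Longrightarrow> Ck_on k U g \<Longrightarrow> g ` U \<subseteq> V \<Longrightarrow> Ck_on k U (\<lambda>x. f (g x))"
proof (induction k arbitrary: f)
  case 0
  then show ?case by (auto intro: continuous_on_compose2)
next
  case (Suc k)
  let ?D = "\<lambda>h x. frechet_derivative h (at x)"
  have f: "f differentiable (at (g x))" if "x \<in> U" for x
    using Suc.prems that by auto
  have "Ck_on k U (\<lambda>x. ?D f (g x) (?D g x v))" for v
  proof (rule Ck_on_cong[OF assms(1)])
    show "(\<Sum>b\<in>Basis. (?D g x v \<bullet> b) *\<^sub>R ?D f (g x) b) = ?D f (g x) (?D g x v)" if "x \<in> U" for x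
      using frechet_derivative_expand[OF f[OF that]] by metis
    show "Ck_on k U (\<lambda>x. \<Sum>b\<in>Basis. (?D g x v \<bullet> b) *\<^sub>R ?D f (g x) b)"
    proof (intro Ck_on_sum Ck_on_bilinear[OF bounded_bilinear_scaleR] assms)
      fix b :: 'b
      show "Ck_on k U (\<lambda>x. ?D g x v \<bullet> b)"
        using Suc.prems by (intro Ck_on_linear[OF bounded_linear_inner_left] assms) auto
      show "Ck_on k U (\<lambda>x. ?D f (g x) b)"
        using Suc.prems by (intro Suc.IH Ck_on_SucD[OF Suc.prems(2)]) auto
    qed
  qed
  then show ?case
    by (intro Ck_on_SucI[OF assms(1), where f' = "\<lambda>x v. ?D f (g x) (?D g x v)"]
        has_derivative_compose[of g _ _ _ f])
      (use Suc.prems in \<open>auto intro!: Ck_on_has_derivative\<close>)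
qed

lemma Cinf_subset: "Cinf U f \<Longrightarrow> V \<subseteq> U \<Longrightarrow> Cinf V f"
  unfolding Cinf_def using Ck_on_subset by blast

lemma Cinf_cong: "Cinf U f \<Longrightarrow> open U \<Longrightarrow> (\<And>x. x \<in> U \<Longrightarrow> f x = g x) \<Longrightarrow> Cinf U g"
  unfolding Cinf_def using Ck_on_cong by blast

lemma Cinf_const: "open U \<Longrightarrow> Cinf U (\<lambda>_. c)"
  unfolding Cinf_def using Ck_on_const by blast

lemma Cinf_id: "open U \<Longrightarrow> Cinf U (\<lambda>x. x)"
  unfolding Cinf_def using Ck_on_id by blast

lemma Cinf_add: "open U \<Longrightarrow> Cinf U f \<Longrightarrow> Cinf U g \<Longrightarrow> Cinf U (\<lambda>x. f x + g x)"
  unfolding Cinf_def using Ck_on_add by blast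

lemma Cinf_linear: "bounded_linear L \<Longrightarrow> open U \<Longrightarrow> Cinf U f \<Longrightarrow> Cinf U (\<lambda>x. L (f x))"
  unfolding Cinf_def using Ck_on_linear by blast

lemma Cinf_diff: "open U \<Longrightarrow> Cinf U f \<Longrightarrow> Cinf U g \<Longrightarrow> Cinf U (\<lambda>x. f x - g x)"
  using Cinf_add[of U f "\<lambda>x. - g x"] Cinf_linear[OF bounded_linear_minus[OF bounded_linear_ident], of U g]
  by simp

lemma Cinf_bilinear:
  "bounded_bilinear P \<Longrightarrow> open U \<Longrightarrow> Cinf U f \<Longrightarrow> Cinf U g \<Longrightarrow> Cinf U (\<lambda>x. P (f x) (g x))"
  unfolding Cinf_def using Ck_on_bilinear by blast

lemmas Cinf_scaleR = Cinf_bilinear[OF bounded_bilinear_scaleR]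
lemmas Cinf_inner = Cinf_bilinear[OF bounded_bilinear_inner]
lemmas Cinf_fst = Cinf_linear[OF bounded_linear_fst]
lemmas Cinf_snd = Cinf_linear[OF bounded_linear_snd]

lemma Cinf_sum: "open U \<Longrightarrow> (\<And>i. i \<in> I \<Longrightarrow> Cinf U (f i)) \<Longrightarrow> Cinf U (\<lambda>x. \<Sum>i\<in>I. f i x)"
  unfolding Cinf_def by (auto intro: Ck_on_sum)

lemma Cinf_compose:
  "Cinf V f \<Longrightarrow> Cinf U g \<Longrightarrow> open U \<Longrightarrow> open V \<Longrightarrow> g ` U \<subseteq> V \<Longrightarrow> Cinf U (\<lambda>x. f (g x))"
  unfolding Cinf_def by (rule allI, rule Ck_on_compose[of U V]) auto

lemma Cinf_Pair:
  assumes "open U" "Cinf U f" "Cinf U g"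
  shows "Cinf U (\<lambda>x. (f x, g x))"
proof -
  have "bounded_linear (\<lambda>a. (a, 0))" "bounded_linear (\<lambda>b. (0, b))"
    by (auto intro!: bounded_linear_Pair bounded_linear_ident bounded_linear_zero)
  then have "Cinf U (\<lambda>x. (f x, 0) + (0, g x))"
    using assms by (intro Cinf_add Cinf_linear[of "\<lambda>a. (a, 0)"] Cinf_linear[of "\<lambda>b. (0, b)"])
  then show ?thesis by simp
qed

lemma Cinf_has_derivative:
  "Cinf U f \<Longrightarrow> x \<in> U \<Longrightarrow> (f has_derivative frechet_derivative f (at x)) (at x)"
  unfolding Cinf_def using Ck_on_has_derivative by blast

lemma Cinf_continuous_on: "Cinf U f \<Longrightarrow> continuous_on U f"
  unfolding Cinf_def by (metis Ck_on.simps(1))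

lemma Cinf_frechet: "Cinf U f \<Longrightarrow> Cinf U (\<lambda>x. frechet_derivative f (at x) v)"
  unfolding Cinf_def by (metis Ck_on.simps(2))

lemma Cinf_open_vimage: "Cinf U f \<Longrightarrow> open U \<Longrightarrow> open V \<Longrightarrow> open (U \<inter> f -` V)"
  using Cinf_continuous_on continuous_open_preimage by blast

text \<open>Coordinate expressions of tangent maps evaluate the derivative at a moving point on a
  moving direction; linearity in the direction reduces this to the fixed directions in
  \<open>Basis\<close>.\<close>

lemma Cinf_frechet_joint:
  assumes "Cinf U f" "open U" "Cinf W g" "Cinf W h" "open W" "g ` W \<subseteq> U"
  shows "Cinf W (\<lambda>x. frechet_derivative f (at (g x)) (h x))"
proof (rule Cinf_cong)
  show "(\<Sum>b\<in>Basis. (h x \<bullet> b) *\<^sub>R frechet_derivative f (at (g x)) b) =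
      frechet_derivative f (at (g x)) (h x)" if "x \<in> W" for x
  proof -
    have "f differentiable (at (g x))"
      using Cinf_has_derivative[OF assms(1), of "g x"] that assms(6) differentiableI by blast
    then show ?thesis by (rule frechet_derivative_expand[symmetric])
  qed
  show "Cinf W (\<lambda>x. \<Sum>b\<in>Basis. (h x \<bullet> b) *\<^sub>R frechet_derivative f (at (g x)) b)"
    using assms by (intro Cinf_sum Cinf_scaleR Cinf_inner Cinf_const
        Cinf_compose[OF Cinf_frechet[OF assms(1)]]) auto
qed (use assms in auto)


subsection \<open>Symmetry of second derivatives\<close>

text \<open>Two applications of the mean value theorem to the mixed second difference: along
  \<open>v\<close> to the difference of \<open>F\<close> over two parallel segments, then along
  \<open>w\<close> to the derivative so obtained.\<close>

lemma second_difference_mvt: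
  fixes F :: "'a::euclidean_space \<Rightarrow> real"
  assumes "Cinf U F" "open U" "ball x r \<subseteq> U" "h > 0" "h * (norm v + norm w) < r"
  obtains y where "dist x y \<le> h * (norm v + norm w)"
    "F (x + h *\<^sub>R v + h *\<^sub>R w) - F (x + h *\<^sub>R v) - F (x + h *\<^sub>R w) + F x =
      h * h * frechet_derivative (\<lambda>z. frechet_derivative F (at z) v) (at y) w"
proof -
  let ?G = "\<lambda>z. frechet_derivative F (at z) v"
  let ?H = "\<lambda>z. frechet_derivative ?G (at z) w"
  have dist: "dist x (x + s *\<^sub>R v + t *\<^sub>R w) \<le> h * (norm v + norm w)"
    if "0 \<le> s" "s \<le> h" "0 \<le> t" "t \<le> h" for s t
  proof -
    have "norm (s *\<^sub>R v + t *\<^sub>R w) \<le> s * norm v + t * norm w"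
      using that by (intro norm_triangle_le) auto
    also have "\<dots> \<le> h * norm v + h * norm w"
      using that by (intro add_mono mult_right_mono) auto
    finally show ?thesis
      by (simp add: dist_norm algebra_simps norm_minus_commute)
  qed
  have inU: "x + s *\<^sub>R v + t *\<^sub>R w \<in> U" if "0 \<le> s" "s \<le> h" "0 \<le> t" "t \<le> h" for s t
    using dist[OF that] assms(3,5) by (auto simp: subset_iff)
  have dv: "((\<lambda>s. F (x + s *\<^sub>R v + t *\<^sub>R w)) has_real_derivative ?G (x + s *\<^sub>R v + t *\<^sub>R w)) (at s)"
    if "0 \<le> s" "s \<le> h" "0 \<le> t" "t \<le> h" for s t
  proof -
    have F: "(F has_derivative frechet_derivative F (at (x + s *\<^sub>R v + t *\<^sub>R w))) (at (x + s *\<^sub>R v + t *\<^sub>R w))"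
      using Cinf_has_derivative[OF assms(1) inU[OF that]] .
    have "((\<lambda>s. F (x + s *\<^sub>R v + t *\<^sub>R w)) has_derivative
        (\<lambda>a. frechet_derivative F (at (x + s *\<^sub>R v + t *\<^sub>R w)) (a *\<^sub>R v))) (at s)"
      by (rule has_derivative_compose[where f = "\<lambda>s. x + s *\<^sub>R v + t *\<^sub>R w", OF _ F]) (auto intro!: derivative_eq_intros)
    then show ?thesis
      using linear_cmul[OF has_derivative_linear[OF F]]
      by (simp add: has_field_derivative_def mult_commute_abs)
  qed
  have dw: "((\<lambda>t. ?G (x + s *\<^sub>R v + t *\<^sub>R w)) has_real_derivative ?H (x + s *\<^sub>R v + t *\<^sub>R w)) (at t)"
    if "0 \<le> s" "s \<le> h" "0 \<le> t" "t \<le> h" for s t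
  proof -
    have F: "(?G has_derivative frechet_derivative ?G (at (x + s *\<^sub>R v + t *\<^sub>R w))) (at (x + s *\<^sub>R v + t *\<^sub>R w))"
      using Cinf_has_derivative[OF Cinf_frechet[OF assms(1)] inU[OF that]] .
    have "((\<lambda>t. ?G (x + s *\<^sub>R v + t *\<^sub>R w)) has_derivative
        (\<lambda>a. frechet_derivative ?G (at (x + s *\<^sub>R v + t *\<^sub>R w)) (a *\<^sub>R w))) (at t)"
      by (rule has_derivative_compose[where f = "\<lambda>t. x + s *\<^sub>R v + t *\<^sub>R w", OF _ F]) (auto intro!: derivative_eq_intros)
    then show ?thesis
      using linear_cmul[OF has_derivative_linear[OF F]]
      by (simp add: has_field_derivative_def mult_commute_abs)
  qed
  \<comment> \<open>The increment of \<open>?u\<close> from 0 to \<open>h\<close> is the mixed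
    second difference. The summand with factor 0 keeps both terms in the shape for which
    \<open>dv\<close> is stated.\<close>
  let ?u = "\<lambda>s. F (x + s *\<^sub>R v + h *\<^sub>R w) - F (x + s *\<^sub>R v + 0 *\<^sub>R w)"
  have "\<exists>s. 0 < s \<and> s < h \<and>
      ?u h - ?u 0 = (h - 0) * (?G (x + s *\<^sub>R v + h *\<^sub>R w) - ?G (x + s *\<^sub>R v + 0 *\<^sub>R w))"
    using assms(4) by (intro MVT2 DERIV_diff dv) auto
  then obtain s where s: "0 < s" "s < h"
      "?u h - ?u 0 = h * (?G (x + s *\<^sub>R v + h *\<^sub>R w) - ?G (x + s *\<^sub>R v + 0 *\<^sub>R w))"
    by auto
  have "\<exists>t. 0 < t \<and> t < h \<and>
      ?G (x + s *\<^sub>R v + h *\<^sub>R w) - ?G (x + s *\<^sub>R v + 0 *\<^sub>R w) = (h - 0) * ?H (x + s *\<^sub>R v + t *\<^sub>R w)"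
    using assms(4) s by (intro MVT2 dw) auto
  then obtain t where t: "0 < t" "t < h"
      "?G (x + s *\<^sub>R v + h *\<^sub>R w) - ?G (x + s *\<^sub>R v + 0 *\<^sub>R w) = h * ?H (x + s *\<^sub>R v + t *\<^sub>R w)"
    by auto
  show thesis
  proof (rule that)
    show "dist x (x + s *\<^sub>R v + t *\<^sub>R w) \<le> h * (norm v + norm w)"
      using s t by (intro dist) auto
    show "F (x + h *\<^sub>R v + h *\<^sub>R w) - F (x + h *\<^sub>R v) - F (x + h *\<^sub>R w) + F x =
        h * h * ?H (x + s *\<^sub>R v + t *\<^sub>R w)"
      using s(3) t(3) by (simp add: algebra_simps)
  qed
qed

text \<open>The mixed second difference is symmetric in \<open>v\<close> and \<open>w\<close>, so
  for every step size the two iterated derivatives agree at points close to \<open>x\<close>;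
  continuity carries the equality to the limit.\<close>

lemma frechet_derivative_commute_real:
  fixes F :: "'a::euclidean_space \<Rightarrow> real"
  assumes "Cinf U F" "open U" "x \<in> U"
  shows "frechet_derivative (\<lambda>z. frechet_derivative F (at z) v) (at x) w =
    frechet_derivative (\<lambda>z. frechet_derivative F (at z) w) (at x) v"
proof -
  let ?H = "\<lambda>v w y. frechet_derivative (\<lambda>z. frechet_derivative F (at z) v) (at y) w"
  obtain r where r: "r > 0" "ball x r \<subseteq> U"
    using assms(2,3) open_contains_ball by blast
  \<comment> \<open>The summand 1 keeps \<open>c\<close> positive when both vectors vanish and makes
    the bound by \<open>r\<close> below strict.\<close>
  define c where "c = norm v + norm w + 1"
  have c: "c > 0" "norm v + norm w < c" "norm w + norm v < c"
    by (auto simp: c_def add_nonneg_pos)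
  define h where "h n = r / c / (Suc n)" for n
  have h: "h n > 0" "h n * (norm v + norm w) < r" "h n * (norm w + norm v) < r" for n
  proof -
    show "h n > 0" using r c by (simp add: h_def)
    have "h n * (norm v + norm w) < h n * c"
      using c \<open>h n > 0\<close> by simp
    also have "\<dots> \<le> r"
    proof -
      have "h n * c = r / Suc n" using c by (simp add: h_def)
      also have "\<dots> \<le> r / 1" using r by (intro divide_left_mono) auto
      finally show ?thesis by simp
    qed
    finally show "h n * (norm v + norm w) < r" "h n * (norm w + norm v) < r"
      by (simp_all add: add.commute)
  qed
  let ?D = "\<lambda>n v w. F (x + h n *\<^sub>R v + h n *\<^sub>R w) - F (x + h n *\<^sub>R v) - F (x + h n *\<^sub>R w) + F x"
  have "\<exists>y. dist x y \<le> h n * (norm v + norm w) \<and> ?D n v w = h n * h n * ?H v w y"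
      "\<exists>y. dist x y \<le> h n * (norm w + norm v) \<and> ?D n w v = h n * h n * ?H w v y" for n
    using second_difference_mvt[OF assms(1,2) r(2) h(1,2)]
      second_difference_mvt[OF assms(1,2) r(2) h(1,3)] by metis+
  then obtain y z where
    y: "\<And>n. dist x (y n) \<le> h n * (norm v + norm w)" "\<And>n. ?D n v w = h n * h n * ?H v w (y n)" and
    z: "\<And>n. dist x (z n) \<le> h n * (norm w + norm v)" "\<And>n. ?D n w v = h n * h n * ?H w v (z n)"
    by metis
  have eq: "?H v w (y n) = ?H w v (z n)" for n
  proof -
    have "?D n v w = ?D n w v" by (simp add: algebra_simps)
    then show ?thesis using y(2)[of n] z(2)[of n] h(1)[of n] by simp
  qed
  have h0: "h \<longlonglongrightarrow> 0"
    using tendsto_mult_right[OF LIMSEQ_inverse_real_of_nat, of "r / c"]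
    by (simp add: h_def[abs_def] field_simps)
  have lim: "u \<longlonglongrightarrow> x" if "\<And>n. dist x (u n) \<le> h n * b" for u b
  proof (rule metric_tendsto_imp_tendsto)
    show "(\<lambda>n. h n * b) \<longlonglongrightarrow> 0" using tendsto_mult_right[OF h0, of b] by simp
    show "\<forall>\<^sub>F n in sequentially. dist (u n) x \<le> dist (h n * b) 0"
      using that by (auto intro!: always_eventually order_trans[OF _ abs_ge_self] simp: dist_commute)
  qed
  have cont: "(\<lambda>n. ?H a b (u n)) \<longlonglongrightarrow> ?H a b x" if "u \<longlonglongrightarrow> x" for a b u
  proof -
    have "continuous (at x) (?H a b)"
      using Cinf_continuous_on[OF Cinf_frechet[OF Cinf_frechet[OF assms(1)]]] assms(2,3)
      by (metis continuous_on_eq_continuous_at)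
    then show ?thesis using that continuous_at_sequentially[of x "?H a b"] by (simp add: o_def)
  qed
  show ?thesis
    using cont[OF lim[OF y(1)], of v w] cont[OF lim[OF z(1)], of w v] LIMSEQ_unique
    unfolding eq by blast
qed

text \<open>Inner products with basis vectors are linear, so they pass through both derivatives and
  leave a claim about real-valued functions.\<close>

lemma frechet_derivative_commute:
  assumes "Cinf U f" "open U" "x \<in> U"
  shows "frechet_derivative (\<lambda>z. frechet_derivative f (at z) v) (at x) w =
    frechet_derivative (\<lambda>z. frechet_derivative f (at z) w) (at x) v"
proof (rule euclidean_eqI)
  fix b :: 'b
  let ?F = "\<lambda>z. f z \<bullet> b"
  have inner: "frechet_derivative (\<lambda>z. g z \<bullet> b) (at y) a = frechet_derivative g (at y) a \<bullet> b"
    if "Cinf U g" "y \<in> U" for g a y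
    using frechet_derivative_at[OF bounded_linear.has_derivative
        [OF bounded_linear_inner_left Cinf_has_derivative[OF that]]]
    by metis
  have second: "frechet_derivative (\<lambda>z. frechet_derivative f (at z) a) (at x) c \<bullet> b =
      frechet_derivative (\<lambda>z. frechet_derivative ?F (at z) a) (at x) c" for a c
  proof -
    let ?g = "\<lambda>z. frechet_derivative f (at z) a"
    have "frechet_derivative (\<lambda>z. ?g z \<bullet> b) (at x) =
        frechet_derivative (\<lambda>z. frechet_derivative ?F (at z) a) (at x)"
    proof (rule frechet_derivative_transform_within_open[OF _ assms(2,3)])
      show "(\<lambda>z. ?g z \<bullet> b) differentiable (at x)"
        using bounded_linear.has_derivative
            [OF bounded_linear_inner_left Cinf_has_derivative[OF Cinf_frechet[OF assms(1)] assms(3)]]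
          differentiableI by blast
    qed (simp add: inner[OF assms(1)])
    then show ?thesis
      using inner[OF Cinf_frechet[OF assms(1)] assms(3)] by metis
  qed
  have "Cinf U ?F"
    using assms by (intro Cinf_linear[OF bounded_linear_inner_left])
  then show "frechet_derivative (\<lambda>z. frechet_derivative f (at z) v) (at x) w \<bullet> b =
      frechet_derivative (\<lambda>z. frechet_derivative f (at z) w) (at x) v \<bullet> b"
    unfolding second by (rule frechet_derivative_commute_real[OF _ assms(2,3)])
qed

subsection \<open>The inverse function theorem for smooth maps\<close>

text \<open>Injectivity gives a lower bound \<open>m\<close> at \<open>y0\<close>. A linear map is
  determined by its values on \<open>Basis\<close>, so pointwise continuity makes the perturbation
  at most \<open>m / 2\<close> times the norm of \<open>u\<close> near \<open>y0\<close>, and half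
  of the bound survives.\<close>

lemma linear_family_bounded_below:
  fixes A :: "'a::euclidean_space \<Rightarrow> 'b::euclidean_space \<Rightarrow> 'b"
  assumes lin: "\<And>y. y \<in> Y \<Longrightarrow> linear (A y)" and inj: "inj (A y0)" and "open Y" "y0 \<in> Y"
    and cont: "\<And>u. continuous_on Y (\<lambda>y. A y u)"
  obtains m where "m > 0" "\<forall>\<^sub>F y in nhds y0. \<forall>u. m * norm u \<le> norm (A y u)"
proof -
  obtain m where m: "m > 0" "\<And>u. m * norm u \<le> norm (A y0 u)"
    using linear_inj_bounded_below_pos[OF lin[OF \<open>y0 \<in> Y\<close>] inj] by (metis mult.commute)
  let ?e = "\<lambda>y. \<Sum>b\<in>Basis. norm (A y b - A y0 b)"
  have "isCont (\<lambda>y. A y b) y0" for b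
    using cont \<open>open Y\<close> \<open>y0 \<in> Y\<close> continuous_on_eq_continuous_at by blast
  then have "isCont ?e y0"
    by (intro continuous_intros) auto
  then have "(?e \<longlongrightarrow> ?e y0) (nhds y0)"
    unfolding isCont_def by (rule iffD1[OF tendsto_at_iff_tendsto_nhds[of ?e y0]])
  then have ev: "\<forall>\<^sub>F y in nhds y0. ?e y < m / 2"
    using order_tendstoD(2)[of ?e "?e y0" _ "m / 2"] m(1) by simp
  have "\<forall>\<^sub>F y in nhds y0. \<forall>u. m / 2 * norm u \<le> norm (A y u)"
    using ev eventually_nhds_in_open[OF \<open>open Y\<close> \<open>y0 \<in> Y\<close>]
  proof eventually_elim
    case (elim y)
    show ?case
    proof
      fix u :: 'b
      have "A y u - A y0 u = (\<Sum>b\<in>Basis. (u \<bullet> b) *\<^sub>R (A y b - A y0 b))"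
      proof -
        have "A z u = (\<Sum>b\<in>Basis. (u \<bullet> b) *\<^sub>R A z b)" if "z \<in> Y" for z
          using linear_sum[OF lin[OF that], of "\<lambda>b. (u \<bullet> b) *\<^sub>R b" Basis] linear_cmul[OF lin[OF that]]
          by (simp add: euclidean_representation)
        then show ?thesis
          using elim \<open>y0 \<in> Y\<close> by (simp add: sum_subtractf scaleR_diff_right)
      qed
      also have "norm \<dots> \<le> (\<Sum>b\<in>Basis. norm u * norm (A y b - A y0 b))"
        by (rule order_trans[OF norm_sum]) (auto intro!: sum_mono mult_right_mono Basis_le_norm)
      also have "\<dots> = norm u * ?e y"
        by (simp add: sum_distrib_left)
      also have "\<dots> \<le> norm u * (m / 2)"
        using elim by (intro mult_left_mono) auto
      finally have "norm (A y u - A y0 u) \<le> norm u * (m / 2)" .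
      then show "m / 2 * norm u \<le> norm (A y u)"
        using m(2)[of u] norm_triangle_ineq3[of "A y u" "A y0 u"] by (simp add: mult.commute)
    qed
  qed
  then show thesis
    using that[of "m / 2"] m(1) by simp
qed

text \<open>The residual \<open>r\<close> of the solution frozen at \<open>y0\<close> satisfies
  \<open>A y (z y - z y0) = r y\<close> and tends to 0; the uniform lower bound on
  \<open>A y\<close> turns this into convergence of \<open>z\<close>.\<close>

lemma solve_continuous_on:
  fixes A :: "'a::euclidean_space \<Rightarrow> 'b::euclidean_space \<Rightarrow> 'b"
  assumes lin: "\<And>y. y \<in> Y \<Longrightarrow> linear (A y)" and inj: "\<And>y. y \<in> Y \<Longrightarrow> inj (A y)" and "open Y"
    and cont: "\<And>u. continuous_on Y (\<lambda>y. A y u)" "continuous_on Y w"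
    and eq: "\<And>y. y \<in> Y \<Longrightarrow> A y (z y) = w y"
  shows "continuous_on Y z"
  unfolding continuous_on_eq_continuous_at[OF \<open>open Y\<close>]
proof
  fix y0 assume y0: "y0 \<in> Y"
  obtain m where m: "m > 0" "\<forall>\<^sub>F y in nhds y0. \<forall>u. m * norm u \<le> norm (A y u)"
    using linear_family_bounded_below[of Y A, OF lin inj[OF y0] \<open>open Y\<close> y0 cont(1)] by blast
  define r where "r y = w y - A y (z y0)" for y
  have "isCont r y0"
    unfolding r_def using cont y0 \<open>open Y\<close>
    by (intro continuous_intros) (auto simp: continuous_on_eq_continuous_at)
  then have r0: "(r \<longlongrightarrow> 0) (at y0)"
    using eq[OF y0] by (simp add: isCont_def r_def)
  show "isCont z y0"
    unfolding isCont_def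
  proof (rule metric_tendsto_imp_tendsto)
    show "((\<lambda>y. norm (r y) / m) \<longlongrightarrow> 0) (at y0)"
      using tendsto_divide[OF tendsto_norm[OF r0] tendsto_const, of m] m(1) by simp
    have "\<forall>\<^sub>F y in nhds y0. dist (z y) (z y0) \<le> dist (norm (r y) / m) 0"
      using m(2) eventually_nhds_in_open[OF \<open>open Y\<close> y0]
    proof eventually_elim
      case (elim y)
      have "r y = A y (z y - z y0)"
        using eq elim linear_diff[OF lin] by (simp add: r_def)
      then have "m * norm (z y - z y0) \<le> norm (r y)" using elim by simp
      then show ?case using m(1) by (simp add: dist_norm field_simps)
    qed
    then show "\<forall>\<^sub>F y in at y0. dist (z y) (z y0) \<le> dist (norm (r y) / m) 0"
      by (simp add: eventually_nhds_conv_at)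
  qed
qed

text \<open>The derivative is guessed by freezing both the matrix and the solution at
  \<open>y0\<close>: \<open>J\<close> inverts \<open>A y0\<close> from the right and
  \<open>r'\<close> is the derivative of the residual \<open>w y - A y (z y0)\<close>. The lower
  bound on \<open>A y\<close> then controls the error.\<close>

lemma solve_differentiable:
  fixes A :: "'a::euclidean_space \<Rightarrow> 'b::euclidean_space \<Rightarrow> 'b"
  assumes lin: "\<And>y. y \<in> Y \<Longrightarrow> linear (A y)" and inj: "inj (A y0)" and "open Y" "y0 \<in> Y"
    and cont: "\<And>u. continuous_on Y (\<lambda>y. A y u)"
    and diff: "\<And>u. (\<lambda>y. A y u) differentiable (at y0)" "w differentiable (at y0)"
    and eq: "\<And>y. y \<in> Y \<Longrightarrow> A y (z y) = w y"
  shows "z differentiable (at y0)"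
proof -
  obtain m where m: "m > 0" "\<forall>\<^sub>F y in nhds y0. \<forall>u. m * norm u \<le> norm (A y u)"
    using linear_family_bounded_below[of Y A, OF lin inj \<open>open Y\<close> \<open>y0 \<in> Y\<close> cont] by blast
  have linA: "linear (A y0)" using lin \<open>y0 \<in> Y\<close> .
  obtain J where J: "linear J" "\<And>u. A y0 (J u) = u"
    using linear_injective_imp_surjective[OF linA inj] linear_surjective_right_inverse[OF linA]
    by (metis comp_apply id_apply)
  define r where "r y = w y - A y (z y0)" for y
  have r0: "r y0 = 0" using eq[OF \<open>y0 \<in> Y\<close>] by (simp add: r_def)
  have "r differentiable (at y0)"
    unfolding r_def using diff by (intro differentiable_diff)
  then obtain r' where r': "(r has_derivative r') (at y0)"
    unfolding differentiable_def by blast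
  then have linr': "linear r'" by (rule has_derivative_linear)
  let ?D = "\<lambda>h. J (r' h)"
  have linD: "linear ?D"
    using linear_compose[OF linr' J(1)] by (simp add: o_def)
  then have blD: "bounded_linear ?D"
    by (simp add: linear_conv_bounded_linear)
  then obtain K where K: "K > 0" "\<And>h. norm (?D h) \<le> norm h * K"
    using bounded_linear.pos_bounded by blast
  let ?e = "\<lambda>y. \<Sum>b\<in>Basis. norm (A y b - A y0 b)"
  have "isCont (\<lambda>y. A y b) y0" for b
    using cont \<open>open Y\<close> \<open>y0 \<in> Y\<close> continuous_on_eq_continuous_at by blast
  then have "isCont ?e y0"
    by (intro continuous_intros) auto
  then have elim: "(?e \<longlongrightarrow> ?e y0) (nhds y0)"
    unfolding isCont_def by (rule iffD1[OF tendsto_at_iff_tendsto_nhds[of ?e y0]])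
  have "(z has_derivative ?D) (at y0)"
    unfolding has_derivative_at_alt
  proof (intro conjI allI impI blD)
    fix e :: real assume "e > 0"
    \<comment> \<open>Each of the two error terms below may cost half of \<open>e * m\<close>;
      \<open>K\<close> bounds the candidate derivative, to which the change of the matrix is
      applied.\<close>
    define e1 where "e1 = e * m / 2"
    define e2 where "e2 = e * m / (2 * K)"
    have "e1 > 0" "e2 > 0" using \<open>e > 0\<close> m(1) K(1) by (auto simp: e1_def e2_def)
    have "\<forall>\<^sub>F y in nhds y0. norm (r y - r y0 - r' (y - y0)) \<le> e1 * norm (y - y0)"
      using r'[unfolded has_derivative_at_alt] \<open>e1 > 0\<close> unfolding eventually_nhds_metric dist_norm
      by blast
    moreover have "\<forall>\<^sub>F y in nhds y0. ?e y < e2"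
      using order_tendstoD(2)[OF elim] \<open>e2 > 0\<close> by auto
    ultimately have "\<forall>\<^sub>F y in nhds y0. norm (z y - z y0 - ?D (y - y0)) \<le> e * norm (y - y0)"
      using m(2) eventually_nhds_in_open[OF \<open>open Y\<close> \<open>y0 \<in> Y\<close>]
    proof eventually_elim
      case (elim y)
      let ?d = "?D (y - y0)"
      have linAy: "linear (A y)" using lin elim by blast
      \<comment> \<open>As \<open>A y0 ?d = r' (y - y0)\<close>, the error splits into the
        differentiability error of the residual and the change of the matrix on
        \<open>?d\<close>.\<close>
      have "A y (z y - z y0 - ?d) = r y - A y ?d"
        using eq elim by (simp add: r_def linear_diff[OF linAy])
      also have "\<dots> = (r y - r y0 - r' (y - y0)) - (A y ?d - A y0 ?d)"
        by (simp add: J r0)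
      finally have 1: "A y (z y - z y0 - ?d) = (r y - r y0 - r' (y - y0)) - (A y ?d - A y0 ?d)" .
      have "A x u = (\<Sum>b\<in>Basis. (u \<bullet> b) *\<^sub>R A x b)" if "x \<in> Y" for x u
        using linear_sum[OF lin[OF that], of "\<lambda>b. (u \<bullet> b) *\<^sub>R b" Basis] linear_cmul[OF lin[OF that]]
        by (simp add: euclidean_representation)
      then have "A y ?d - A y0 ?d = (\<Sum>b\<in>Basis. (?d \<bullet> b) *\<^sub>R (A y b - A y0 b))"
        using elim \<open>y0 \<in> Y\<close> by (simp add: sum_subtractf scaleR_diff_right)
      also have "norm \<dots> \<le> (\<Sum>b\<in>Basis. norm ?d * norm (A y b - A y0 b))"
        by (rule order_trans[OF norm_sum]) (auto intro!: sum_mono mult_right_mono Basis_le_norm)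
      also have "\<dots> = norm ?d * ?e y"
        by (simp add: sum_distrib_left)
      also have "\<dots> \<le> (norm (y - y0) * K) * e2"
        using elim K by (intro mult_mono) (auto intro: sum_nonneg)
      also have "\<dots> = e * m / 2 * norm (y - y0)"
        using K(1) by (simp add: e2_def)
      finally have 2: "norm (A y ?d - A y0 ?d) \<le> e * m / 2 * norm (y - y0)" .
      have "m * norm (z y - z y0 - ?d) \<le> norm (A y (z y - z y0 - ?d))"
        using elim by blast
      also have "\<dots> \<le> e1 * norm (y - y0) + e * m / 2 * norm (y - y0)"
        unfolding 1 by (rule order_trans[OF norm_triangle_ineq4 add_mono]) (use elim 2 in auto)
      also have "\<dots> = m * (e * norm (y - y0))"
        by (simp add: e1_def)
      finally show ?case using m(1) by simp
    qed
    then show "\<exists>d>0. \<forall>y. norm (y - y0) < d \<longrightarrow> norm (z y - z y0 - ?D (y - y0)) \<le> e * norm (y - y0)"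
      unfolding eventually_nhds_metric dist_norm by blast
  qed
  then show ?thesis unfolding differentiable_def by blast
qed

text \<open>Differentiating \<open>A z = w\<close> gives \<open>A z' = w' - A' z\<close>, an equation of the same kind for
  \<open>z'\<close>.\<close>

lemma Ck_on_solve:
  fixes A :: "'a::euclidean_space \<Rightarrow> 'b::euclidean_space \<Rightarrow> 'b"
  assumes lin: "\<And>y. y \<in> Y \<Longrightarrow> linear (A y)" and inj: "\<And>y. y \<in> Y \<Longrightarrow> inj (A y)" and "open Y"
  shows "(\<And>u. Ck_on k Y (\<lambda>y. A y u)) \<Longrightarrow> Ck_on k Y w \<Longrightarrow> (\<And>y. y \<in> Y \<Longrightarrow> A y (z y) = w y) \<Longrightarrow>
    Ck_on k Y z"
proof (induction k arbitrary: w z)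
  case 0
  then show ?case
    using solve_continuous_on[of Y A w z, OF lin inj \<open>open Y\<close>] by simp
next
  case (Suc k)
  have Ak: "Ck_on k Y (\<lambda>y. A y u)" for u
    using Suc.prems(1) by (rule Ck_on_SucD)
  have zk: "Ck_on k Y z"
    using Suc.IH[OF Ak Ck_on_SucD[OF Suc.prems(2)] Suc.prems(3)] .
  have contA: "continuous_on Y (\<lambda>y. A y u)" for u
    using Suc.prems(1)[of u]
    by (auto intro!: continuous_at_imp_continuous_on differentiable_imp_continuous_within)
  have dz: "z differentiable (at y)" if "y \<in> Y" for y
    using Suc.prems that inj by (intro solve_differentiable[of Y A y w z, OF lin _ \<open>open Y\<close> _ contA]) auto
  have expand: "A y u = (\<Sum>b\<in>Basis. (u \<bullet> b) *\<^sub>R A y b)" if "y \<in> Y" for y u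
    using linear_sum[OF lin[OF that], of "\<lambda>b. (u \<bullet> b) *\<^sub>R b" Basis] linear_cmul[OF lin[OF that]]
    by (simp add: euclidean_representation)
  let ?w = "\<lambda>v y. frechet_derivative w (at y) v -
      (\<Sum>b\<in>Basis. (z y \<bullet> b) *\<^sub>R frechet_derivative (\<lambda>y. A y b) (at y) v)"
  have "A y (frechet_derivative z (at y) v) = ?w v y" if "y \<in> Y" for y v
  proof -
    have z': "(z has_derivative frechet_derivative z (at y)) (at y)"
      using dz[OF that] by (simp add: frechet_derivative_works)
    have A': "((\<lambda>y. A y b) has_derivative frechet_derivative (\<lambda>y. A y b) (at y)) (at y)" for b
      using Ck_on_has_derivative[OF Suc.prems(1) that] .
    have "((\<lambda>y. \<Sum>b\<in>Basis. (z y \<bullet> b) *\<^sub>R A y b) has_derivative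
        (\<lambda>v. \<Sum>b\<in>Basis. (z y \<bullet> b) *\<^sub>R frechet_derivative (\<lambda>y. A y b) (at y) v +
          (frechet_derivative z (at y) v \<bullet> b) *\<^sub>R A y b)) (at y)"
      by (intro has_derivative_sum has_derivative_scaleR has_derivative_inner_left z' A')
    then have "(w has_derivative
        (\<lambda>v. \<Sum>b\<in>Basis. (z y \<bullet> b) *\<^sub>R frechet_derivative (\<lambda>y. A y b) (at y) v +
          (frechet_derivative z (at y) v \<bullet> b) *\<^sub>R A y b)) (at y)"
      by (rule has_derivative_transform_within_open[OF _ \<open>open Y\<close> that])
        (use Suc.prems(3) expand in metis)
    from frechet_derivative_at[OF this, symmetric]
    show ?thesis using expand[OF that, of "frechet_derivative z (at y) v"]
      by (simp add: sum.distrib)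
  qed
  moreover have "Ck_on k Y (?w v)" for v
  proof -
    have "Ck_on k Y (\<lambda>y. \<Sum>b\<in>Basis. (z y \<bullet> b) *\<^sub>R frechet_derivative (\<lambda>y. A y b) (at y) v)"
      using Suc.prems(1) \<open>open Y\<close>
      by (intro Ck_on_sum Ck_on_bilinear[OF bounded_bilinear_scaleR] zk
          Ck_on_linear[OF bounded_linear_inner_left]) auto
    moreover have "Ck_on k Y (\<lambda>y. frechet_derivative w (at y) v)"
      using Suc.prems(2) by simp
    ultimately show ?thesis
      using Ck_on_add[OF \<open>open Y\<close> _ Ck_on_linear[OF bounded_linear_minus[OF bounded_linear_ident] \<open>open Y\<close>]]
      by fastforce
  qed
  ultimately have "Ck_on k Y (\<lambda>y. frechet_derivative z (at y) v)" for v
    using Suc.IH[OF Ak, of "?w v" "\<lambda>y. frechet_derivative z (at y) v"] by blast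
  then show ?case using dz by simp
qed

text \<open>Continuity of the derivative as a bounded linear map, the form in which the inverse
  function theorem of the library takes it; in finite dimension the directions in
  \<open>Basis\<close> decide.\<close>

lemma Cinf_blinfun_derivative:
  fixes f :: "'a::euclidean_space \<Rightarrow> 'b::euclidean_space"
  assumes "Cinf U f" "open U"
  shows "continuous_on U (\<lambda>x. Blinfun (frechet_derivative f (at x)))"
proof (rule continuous_on_blinfun_componentwise)
  fix i :: 'a
  have "continuous_on U (\<lambda>x. frechet_derivative f (at x) i)"
    using Cinf_continuous_on[OF Cinf_frechet[OF assms(1)]] .
  moreover have "blinfun_apply (Blinfun (frechet_derivative f (at x))) i = frechet_derivative f (at x) i"
    if "x \<in> U" for x
    using Cinf_has_derivative[OF assms(1) that] has_derivative_bounded_linear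
    by (metis bounded_linear_Blinfun_apply)
  ultimately show "continuous_on U (\<lambda>x. blinfun_apply (Blinfun (frechet_derivative f (at x))) i)"
    by (simp cong: continuous_on_cong)
qed

text \<open>The library theorem yields a differentiable inverse, and smoothness is bootstrapped:
  \<open>g' y v\<close> solves a linear system whose matrix is as smooth as \<open>g\<close>, so by
  \<open>Ck_on_solve\<close> the derivative is as smooth as \<open>g\<close>, and \<open>g\<close>
  gains one order.\<close>

theorem Cinf_inverse_function:
  fixes f :: "'a::euclidean_space \<Rightarrow> 'a"
  assumes f: "Cinf U f" "open U" "x0 \<in> U" and d: "frechet_derivative f (at x0) = id"
  obtains V g where "open V" "f x0 \<in> V" "Cinf V g" "g ` V \<subseteq> U" "g (f x0) = x0"
    "\<And>y. y \<in> V \<Longrightarrow> f (g y) = y"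
proof -
  let ?f' = "\<lambda>x. Blinfun (frechet_derivative f (at x))"
  have app: "blinfun_apply (?f' x) = frechet_derivative f (at x)" if "x \<in> U" for x
    using Cinf_has_derivative[OF f(1) that] has_derivative_bounded_linear
    by (metis bounded_linear_Blinfun_apply)
  have der: "(f has_derivative blinfun_apply (?f' x)) (at x)" if "x \<in> U" for x
    using Cinf_has_derivative[OF f(1) that] app[OF that] by simp
  \<comment> \<open>With the derivative normalised to the identity, the left inverse that the
    theorem asks for is the identity as well.\<close>
  have "?f' x0 = id_blinfun"
    using app[OF f(3)] d by (intro blinfun_eqI) simp
  then have "id_blinfun o\<^sub>L ?f' x0 = id_blinfun"
    by (intro blinfun_eqI) simp
  from inverse_function_theorem[OF f(2) der Cinf_blinfun_derivative[OF f(1,2)] f(3) this]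
  obtain U' V g g' where g: "open U'" "U' \<subseteq> U" "x0 \<in> U'" "open V" "f x0 \<in> V" "homeomorphism U' V f g"
    and g': "\<And>y. y \<in> V \<Longrightarrow> (g has_derivative (g' y)) (at y)"
      "\<And>y. y \<in> V \<Longrightarrow> g' y = inv (blinfun_apply (?f' (g y)))"
      "\<And>y. y \<in> V \<Longrightarrow> bij (blinfun_apply (?f' (g y)))"
    by metis
  have gU: "g y \<in> U'" "f (g y) = y" if "y \<in> V" for y
    using g(6) that by (auto simp: homeomorphism_def)
  have gV: "g ` V \<subseteq> U" using gU(1) g(2) by auto
  have "Ck_on k V g" for k
  proof (induction k)
    case 0
    show ?case using g(6) by (simp add: homeomorphism_def)
  next
    case (Suc k)
    have "Ck_on k V (\<lambda>y. g' y v)" for v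
    proof (rule Ck_on_solve[of V "\<lambda>y. frechet_derivative f (at (g y))" k "\<lambda>_. v"])
      fix y assume y: "y \<in> V"
      show "linear (frechet_derivative f (at (g y)))"
        using has_derivative_linear[OF Cinf_has_derivative[OF f(1)]] gU(1) g(2) y by blast
      show "inj (frechet_derivative f (at (g y)))"
        using bij_is_inj[OF g'(3)[OF y]] app[of "g y"] gU(1)[OF y] g(2) by (metis subsetD)
      show "frechet_derivative f (at (g y)) (g' y v) = v"
        using g'(2)[OF y] surj_f_inv_f[OF bij_is_surj[OF g'(3)[OF y]]] app[of "g y"] gU(1)[OF y] g(2)
        by (metis subsetD)
    next
      fix u
      show "Ck_on k V (\<lambda>y. frechet_derivative f (at (g y)) u)"
        using Cinf_frechet[OF f(1)] Suc.IH gV f(2) g(4)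
        by (intro Ck_on_compose[of V U k "\<lambda>x. frechet_derivative f (at x) u" g]) (auto simp: Cinf_def)
    qed (use g Ck_on_const in auto)
    with Ck_on_SucI[where f = g and f' = g', OF g(4) g'(1)] show ?case by blast
  qed
  then have "Cinf V g" by (simp add: Cinf_def)
  moreover have "g (f x0) = x0"
    using g(3,6) by (simp add: homeomorphism_def)
  ultimately show thesis
    using that g(4,5) gV gU(2) by blast
qed

section \<open>Smooth maps and curves in charts\<close>

text \<open>\<open>g\<close> lives on an open set of the model space although the chart may map onto
  a set without interior; agreement is demanded only at coordinates of points of \<open>S\<close>.
  Neighbourhoods are open sets of coordinates, so no topology on the atlas enters.\<close>

definition loc_rep ::
  "'a set \<Rightarrow> 'a set \<Rightarrow> ('a \<Rightarrow> 'e::euclidean_space) \<Rightarrow> 'b set \<Rightarrow> ('b \<Rightarrow> 'f::euclidean_space) \<Rightarrow>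
     ('a \<Rightarrow> 'b) \<Rightarrow> 'e set \<Rightarrow> ('e \<Rightarrow> 'f) \<Rightarrow> bool" where
  "loc_rep S U \<phi> V \<psi> f O' g \<longleftrightarrow>
     open O' \<and> Cinf O' g \<and> (\<forall>q\<in>S \<inter> U. \<phi> q \<in> O' \<longrightarrow> f q \<in> V \<and> \<psi> (f q) = g (\<phi> q))"

text \<open>A variant of \<open>smooth_map\<close> that quantifies over all charts and does not mention inverses of
  charts.\<close>

definition smap ::
  "('a, 'e::euclidean_space) atlas \<Rightarrow> 'a set \<Rightarrow> ('b, 'f::euclidean_space) atlas \<Rightarrow> ('a \<Rightarrow> 'b) \<Rightarrow> bool"
  where
  "smap A S B f \<longleftrightarrow> S \<subseteq> pts A \<and> f ` S \<subseteq> pts B \<and>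
     (\<forall>p\<in>S. \<forall>(U, \<phi>)\<in>A. \<forall>(V, \<psi>)\<in>B. p \<in> U \<longrightarrow> f p \<in> V \<longrightarrow>
        (\<exists>O' g. \<phi> p \<in> O' \<and> loc_rep S U \<phi> V \<psi> f O' g))"

text \<open>Smooth compatibility of the charts. Unlike \<open>manifold\<close> it survives
  restriction to a subset and pullback along a map, which is what \<open>restr\<close> and
  \<open>induced\<close> call for.\<close>

definition satlas :: "('a, 'e::euclidean_space) atlas \<Rightarrow> bool" where
  "satlas A \<longleftrightarrow> smap A (pts A) A (\<lambda>p. p)"

definition inj_charts :: "('a, 'e) atlas \<Rightarrow> bool" where
  "inj_charts A \<longleftrightarrow> (\<forall>(U, \<phi>)\<in>A. inj_on \<phi> U)"

lemma pts_chart: "p \<in> pts A \<Longrightarrow> (\<And>U \<phi>. (U, \<phi>) \<in> A \<Longrightarrow> p \<in> U \<Longrightarrow> thesis) \<Longrightarrow> thesis"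
  unfolding pts_def by force

lemma chart_pts: "(U, \<phi>) \<in> A \<Longrightarrow> p \<in> U \<Longrightarrow> p \<in> pts A"
  unfolding pts_def by force

lemma smapD:
  assumes "smap A S B f" "p \<in> S" "(U, \<phi>) \<in> A" "p \<in> U" "(V, \<psi>) \<in> B" "f p \<in> V"
  obtains O' g where "\<phi> p \<in> O'" "loc_rep S U \<phi> V \<psi> f O' g"
  using assms unfolding smap_def by fast

lemma smap_pts: "smap A S B f \<Longrightarrow> p \<in> S \<Longrightarrow> p \<in> pts A" "smap A S B f \<Longrightarrow> p \<in> S \<Longrightarrow> f p \<in> pts B"
  unfolding smap_def by blast+

lemma loc_rep_compose:
  assumes "loc_rep S U \<phi> V \<psi> f P g" "loc_rep T V \<psi> W \<rho> h Q k" "f ` S \<subseteq> T"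
  shows "loc_rep S U \<phi> W \<rho> (\<lambda>p. h (f p)) (P \<inter> g -` Q) (\<lambda>x. k (g x))"
proof -
  have o: "open (P \<inter> g -` Q)"
    using assms Cinf_open_vimage[of P g Q] unfolding loc_rep_def by blast
  moreover have "Cinf (P \<inter> g -` Q) (\<lambda>x. k (g x))"
    using assms o by (intro Cinf_compose[of Q k _ g]) (auto simp: loc_rep_def intro: Cinf_subset)
  ultimately show ?thesis
    using assms unfolding loc_rep_def by (auto simp: image_subset_iff)
qed

lemma loc_rep_subset: "loc_rep S U \<phi> V \<psi> f P g \<Longrightarrow> T \<subseteq> S \<Longrightarrow> loc_rep T U \<phi> V \<psi> f P g"
  unfolding loc_rep_def by blast

lemma smap_allI:
  assumes "S \<subseteq> pts A" "\<And>p. p \<in> S \<Longrightarrow> f p \<in> pts B"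
    and "\<And>p U \<phi> V \<psi>. p \<in> S \<Longrightarrow> (U, \<phi>) \<in> A \<Longrightarrow> (V, \<psi>) \<in> B \<Longrightarrow> p \<in> U \<Longrightarrow> f p \<in> V \<Longrightarrow>
      \<exists>O' g. \<phi> p \<in> O' \<and> loc_rep S U \<phi> V \<psi> f O' g"
  shows "smap A S B f"
  unfolding smap_def
proof (intro conjI)
  show "\<forall>p\<in>S. \<forall>(U, \<phi>)\<in>A. \<forall>(V, \<psi>)\<in>B. p \<in> U \<longrightarrow> f p \<in> V \<longrightarrow>
      (\<exists>O' g. \<phi> p \<in> O' \<and> loc_rep S U \<phi> V \<psi> f O' g)"
    by (clarify, rule assms(3))
qed (use assms(1,2) in auto)

lemma smap_subset:
  assumes "smap A S B f" "T \<subseteq> S"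
  shows "smap A T B f"
proof (rule smap_allI)
  fix p U \<phi> V \<psi> assume p: "p \<in> T" "(U, \<phi>) \<in> A" "(V, \<psi>) \<in> B" "p \<in> U" "f p \<in> V"
  obtain P g where P: "\<phi> p \<in> P" "loc_rep S U \<phi> V \<psi> f P g"
    using smapD[OF assms(1) subsetD[OF assms(2) p(1)] p(2,4,3,5)] .
  show "\<exists>O' g. \<phi> p \<in> O' \<and> loc_rep T U \<phi> V \<psi> f O' g"
    by (intro exI conjI, rule P(1), rule loc_rep_subset[OF P(2) assms(2)])
qed (use assms(2) smap_pts[OF assms(1)] in auto)

lemma smap_cong:
  assumes "smap A S B f" "\<And>p. p \<in> S \<Longrightarrow> f p = g p"
  shows "smap A S B g"
proof -
  have eq: "loc_rep S U \<phi> V \<psi> g P h" if "loc_rep S U \<phi> V \<psi> f P h" for U \<phi> V \<psi> P h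
    using that assms(2) unfolding loc_rep_def by auto
  show ?thesis
  proof (rule smap_allI)
    fix p U \<phi> V \<psi> assume "p \<in> S" "(U, \<phi>) \<in> A" "(V, \<psi>) \<in> B" "p \<in> U" "g p \<in> V"
    then show "\<exists>O' h. \<phi> p \<in> O' \<and> loc_rep S U \<phi> V \<psi> g O' h"
      using smapD[OF assms(1)] assms(2) eq by metis
  qed (use assms smap_pts in \<open>auto simp flip: assms(2)\<close>)
qed

lemma smap_id: "satlas A \<Longrightarrow> S \<subseteq> pts A \<Longrightarrow> smap A S A (\<lambda>p. p)"
  unfolding satlas_def using smap_subset by blast

text \<open>Smooth changes of charts on both sides carry one representative to any other pair of
  charts, so one convenient pair at each point is enough.\<close>

lemma smapI:
  assumes "satlas A" "satlas B" "S \<subseteq> pts A"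
    and ex: "\<And>p. p \<in> S \<Longrightarrow> \<exists>U \<phi> V \<psi> P g. (U, \<phi>) \<in> A \<and> (V, \<psi>) \<in> B \<and> p \<in> U \<and>
      \<phi> p \<in> P \<and> loc_rep S U \<phi> V \<psi> f P g"
  shows "smap A S B f"
proof -
  have fB: "f p \<in> pts B" if p: "p \<in> S" for p
  proof -
    obtain U \<phi> V \<psi> P g where "(U, \<phi>) \<in> A" "(V, \<psi>) \<in> B" "p \<in> U" "\<phi> p \<in> P"
        "loc_rep S U \<phi> V \<psi> f P g"
      using ex[OF p] by (elim exE conjE) (rule that; assumption)
    then show ?thesis using p chart_pts unfolding loc_rep_def by fast
  qed
  show ?thesis
  proof (rule smap_allI[OF assms(3) fB])
    fix p U' \<phi>' V' \<psi>'
    assume p: "p \<in> S" and 2: "(U', \<phi>') \<in> A" "(V', \<psi>') \<in> B" "p \<in> U'" "f p \<in> V'"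
    have "p \<in> pts A" using p assms(3) by blast
    obtain U \<phi> V \<psi> P g where 1: "(U, \<phi>) \<in> A" "(V, \<psi>) \<in> B" "p \<in> U" "\<phi> p \<in> P"
        "loc_rep S U \<phi> V \<psi> f P g"
      using ex[OF p] by (elim exE conjE) (rule that; assumption)
    have fp: "f p \<in> V" "\<psi> (f p) = g (\<phi> p)" using 1 p unfolding loc_rep_def by blast+
    obtain P1 T1 where T1: "\<phi>' p \<in> P1" "loc_rep (pts A) U' \<phi>' U \<phi> (\<lambda>p. p) P1 T1"
      using smapD[OF assms(1)[unfolded satlas_def] \<open>p \<in> pts A\<close> 2(1,3) 1(1,3)] by metis
    obtain P2 T2 where T2: "\<psi> (f p) \<in> P2" "loc_rep (pts B) V \<psi> V' \<psi>' (\<lambda>p. p) P2 T2"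
      using smapD[OF assms(2)[unfolded satlas_def] fB[OF p] 1(2) fp(1) 2(2,4)] by metis
    have T1S: "loc_rep S U' \<phi>' U \<phi> (\<lambda>p. p) P1 T1"
      using T1(2) assms(3) by (rule loc_rep_subset)
    have a: "loc_rep S U' \<phi>' V \<psi> f (P1 \<inter> T1 -` P) (\<lambda>x. g (T1 x))"
      using loc_rep_compose[OF T1S 1(5)] by simp
    have "f ` (S \<inter> U' \<inter> \<phi>' -` (P1 \<inter> T1 -` P)) \<subseteq> pts B"
      using a 1(2) chart_pts unfolding loc_rep_def by fast
    then have rep: "loc_rep S U' \<phi>' V' \<psi>' f ((P1 \<inter> T1 -` P) \<inter> (\<lambda>x. g (T1 x)) -` P2) (\<lambda>x. T2 (g (T1 x)))"
      using loc_rep_compose[of "S \<inter> U' \<inter> \<phi>' -` (P1 \<inter> T1 -` P)", OF loc_rep_subset[OF a] T2(2)]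
      unfolding loc_rep_def by auto
    have in_dom: "\<phi>' p \<in> (P1 \<inter> T1 -` P) \<inter> (\<lambda>x. g (T1 x)) -` P2"
      using T1 T2 1 fp p 2(3) \<open>p \<in> pts A\<close> unfolding loc_rep_def by auto
    show "\<exists>O' g. \<phi>' p \<in> O' \<and> loc_rep S U' \<phi>' V' \<psi>' f O' g"
      by (intro exI conjI, rule in_dom, rule rep)
  qed
qed

text \<open>The open set \<open>W\<close> around \<open>p\<close> is cut out of the chart by an open
  set \<open>V'\<close> of coordinates, to which the extension from \<open>smooth_on\<close> is
  restricted. Injectivity of the chart cancels \<open>inv_into\<close>.\<close>

lemma smooth_map_imp_smap:
  assumes "satlas A" "satlas B" "inj_charts A" "smooth_map A S B f"
  shows "smap A S B f"
proof (rule smapI[OF assms(1,2)])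
  show "S \<subseteq> pts A" using assms(4) unfolding smooth_map_def by blast
  fix p assume p: "p \<in> S"
  obtain U \<phi> V \<psi> W where 1: "(U, \<phi>) \<in> A" "(V, \<psi>) \<in> B" "mopen A W" "p \<in> W" "W \<subseteq> U"
      "f ` (S \<inter> W) \<subseteq> V" "smooth_on (\<phi> ` (S \<inter> W)) (\<psi> \<circ> f \<circ> inv_into U \<phi>)"
    using assms(4) p unfolding smooth_map_def by fast
  have inj: "inj_on \<phi> U" using assms(3) 1(1) unfolding inj_charts_def by blast
  obtain V' where V': "open V'" "U \<inter> W = U \<inter> \<phi> -` V'"
    using 1(1,3) unfolding mopen_def by fast
  obtain P g where P: "open P" "\<phi> p \<in> P" "\<And>k. Ck_on k P g"
      "\<And>y. y \<in> \<phi> ` (S \<inter> W) \<inter> P \<Longrightarrow> g y = (\<psi> \<circ> f \<circ> inv_into U \<phi>) y"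
    using 1(7) p 1(4) unfolding smooth_on_def by (metis IntI imageI)
  have "loc_rep S U \<phi> V \<psi> f (P \<inter> V') g"
    unfolding loc_rep_def
  proof (intro conjI ballI impI)
    show "open (P \<inter> V')" using P V' by blast
    show "Cinf (P \<inter> V') g" using P(3) Cinf_subset[of P g] unfolding Cinf_def by blast
    fix q assume q: "q \<in> S \<inter> U" "\<phi> q \<in> P \<inter> V'"
    then have "q \<in> S \<inter> W" using V' by blast
    then show "f q \<in> V" using 1(6) by blast
    show "\<psi> (f q) = g (\<phi> q)"
      using P(4)[of "\<phi> q"] \<open>q \<in> S \<inter> W\<close> q inv_into_f_f[OF inj] by auto
  qed
  moreover have "\<phi> p \<in> P \<inter> V'" using P(2) V' 1(4,5) by blast
  moreover have "p \<in> U" using 1(4,5) by blast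
  ultimately show "\<exists>U \<phi> V \<psi> P g. (U, \<phi>) \<in> A \<and> (V, \<psi>) \<in> B \<and> p \<in> U \<and>
      \<phi> p \<in> P \<and> loc_rep S U \<phi> V \<psi> f P g"
    using 1(1,2) by (intro exI conjI)
qed

section \<open>Curves and their coordinate expressions\<close>

lemma pts_euc [simp]: "pts euc = UNIV"
  by (simp add: euc_def pts_def)

lemma satlas_euc: "satlas (euc :: ('e, 'e::euclidean_space) atlas)"
  unfolding satlas_def smap_def euc_def pts_def loc_rep_def
  by (auto intro!: exI[of _ "UNIV :: 'e set"] exI[of _ "\<lambda>x::'e. x"] Cinf_id)

lemma inj_charts_euc: "inj_charts euc"
  by (simp add: inj_charts_def euc_def)

lemma smap_eucD:
  assumes "smap A S euc f" "p \<in> S" "(U, \<phi>) \<in> A" "p \<in> U"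
  obtains P g where "\<phi> p \<in> P" "open P" "Cinf P g" "\<And>q. q \<in> S \<inter> U \<Longrightarrow> \<phi> q \<in> P \<Longrightarrow> f q = g (\<phi> q)"
proof -
  obtain P g where "\<phi> p \<in> P" "loc_rep S U \<phi> UNIV id f P g"
    using smapD[OF assms, of UNIV id] by (auto simp: euc_def)
  then show thesis using that unfolding loc_rep_def by auto
qed

text \<open>The way back from coordinates to \<open>curve\<close>: an eventual coordinate expression
  already holds on an interval around 0, where one chart serves for all times.\<close>

lemma curveI:
  assumes A: "satlas A" "(U, \<phi>) \<in> A" and c: "open P" "0 \<in> P" "Cinf P c"
    and ev: "\<forall>\<^sub>F t in nhds 0. \<gamma> t \<in> U \<and> \<phi> (\<gamma> t) = c t"
  shows "curve A \<gamma>"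
proof -
  have "\<forall>\<^sub>F t in nhds 0. t \<in> P \<and> \<gamma> t \<in> U \<and> \<phi> (\<gamma> t) = c t"
    using ev eventually_nhds_in_open[OF c(1,2)] by eventually_elim blast
  then obtain e where e: "e > 0" "\<And>t. \<bar>t\<bar> < e \<Longrightarrow> t \<in> P \<and> \<gamma> t \<in> U \<and> \<phi> (\<gamma> t) = c t"
    unfolding eventually_nhds_metric by (auto simp: dist_real_def)
  let ?I = "{-e<..<e}"
  have sub: "t \<in> P \<and> \<gamma> t \<in> U \<and> \<phi> (\<gamma> t) = c t" if "t \<in> ?I" for t
    using e(2)[of t] that by auto
  have "smooth_on (id ` (?I \<inter> ?I)) (\<phi> \<circ> \<gamma> \<circ> inv_into UNIV id)"
    unfolding smooth_on_def
  proof
    fix x assume "x \<in> id ` (?I \<inter> ?I)"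
    moreover have "\<forall>k. Ck_on k ?I c"
      using c(3) Cinf_subset[of P c ?I] sub unfolding Cinf_def by blast
    ultimately show "\<exists>V g. open V \<and> x \<in> V \<and> (\<forall>k. Ck_on k V g) \<and>
        (\<forall>y\<in>id ` (?I \<inter> ?I) \<inter> V. g y = (\<phi> \<circ> \<gamma> \<circ> inv_into UNIV id) y)"
      using sub by (intro exI[of _ ?I] exI[of _ c]) (simp add: inv_f_f[of id, simplified])
  qed
  then have s: "smooth_on (id ` (?I \<inter> ?I)) (\<phi> \<circ> \<gamma> \<circ> inv_into UNIV id)" .
  have mo: "mopen euc ?I"
    unfolding mopen_def euc_def pts_def by (auto intro!: exI[of _ ?I])
  have "smooth_map euc ?I A \<gamma>"
    unfolding smooth_map_def
  proof (intro conjI ballI)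
    show "\<gamma> ` ?I \<subseteq> pts A" using sub A(2) chart_pts by fast
    fix t assume t: "t \<in> ?I"
    have ex: "\<exists>W. mopen euc W \<and> t \<in> W \<and> W \<subseteq> UNIV \<and>
        \<gamma> ` (?I \<inter> W) \<subseteq> U \<and> smooth_on (id ` (?I \<inter> W)) (\<phi> \<circ> \<gamma> \<circ> inv_into UNIV id)"
      by (rule exI[of _ ?I]) (use s mo sub t in auto)
    show "\<exists>(U, \<phi>)\<in>euc. \<exists>(V, \<psi>)\<in>A. \<exists>W. mopen euc W \<and> t \<in> W \<and> W \<subseteq> U \<and>
        \<gamma> ` (?I \<inter> W) \<subseteq> V \<and> smooth_on (\<phi> ` (?I \<inter> W)) (\<psi> \<circ> \<gamma> \<circ> inv_into U \<phi>)"
      by (rule bexI[of _ "(UNIV, id)"], unfold prod.case, rule bexI[of _ "(U, \<phi>)"],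
          unfold prod.case, rule ex, rule A(2), simp add: euc_def)
  qed simp
  then show ?thesis
    unfolding curve_def using e(1) by blast
qed

lemma curveD:
  assumes A: "satlas A" and "curve A \<gamma>" "(U, \<phi>) \<in> A" "\<gamma> 0 \<in> U"
  obtains P c where "open P" "0 \<in> P" "Cinf P c" "\<And>t. t \<in> P \<Longrightarrow> \<gamma> t \<in> U \<and> \<phi> (\<gamma> t) = c t"
proof -
  obtain e where e: "e > 0" "smooth_map euc {-e<..<e} A \<gamma>"
    using assms(2) unfolding curve_def by blast
  have "smap euc {-e<..<e} A \<gamma>"
    using smooth_map_imp_smap[OF satlas_euc A inj_charts_euc e(2)] .
  then obtain P g where P: "0 \<in> P" "loc_rep {-e<..<e} UNIV id U \<phi> \<gamma> P g"
    using smapD[of euc "{-e<..<e}" A \<gamma> 0 UNIV id U \<phi>] assms e(1) by (auto simp: euc_def)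
  then show thesis
    using that[of "P \<inter> {-e<..<e}" g] e(1) unfolding loc_rep_def
    by (auto simp: open_Int intro: Cinf_subset)
qed

lemma curve_pts: "curve A \<gamma> \<Longrightarrow> \<gamma> 0 \<in> pts A"
  unfolding curve_def smooth_map_def by (auto simp: image_subset_iff)

lemma curve_ev_chart:
  assumes "satlas A" "curve A \<gamma>" "(U, \<phi>) \<in> A" "\<gamma> 0 \<in> U"
  shows "\<forall>\<^sub>F t in nhds 0. \<gamma> t \<in> U"
proof -
  obtain P c where "open P" "0 \<in> P" "Cinf P c" "\<And>t. t \<in> P \<Longrightarrow> \<gamma> t \<in> U \<and> \<phi> (\<gamma> t) = c t"
    by (rule curveD[OF assms]) blast
  then show ?thesis unfolding eventually_nhds by blast
qed

lemma curve_ev_pts: "satlas A \<Longrightarrow> curve A \<gamma> \<Longrightarrow> \<forall>\<^sub>F t in nhds 0. \<gamma> t \<in> pts A"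
  using curve_ev_chart curve_pts chart_pts pts_chart
  by (smt (verit, ccfv_threshold) eventually_mono)

lemma curve_const:
  assumes "satlas A" "p \<in> pts A"
  shows "curve A (\<lambda>_. p)"
proof -
  obtain U \<phi> where "(U, \<phi>) \<in> A" "p \<in> U" using assms(2) pts_chart by metis
  then show ?thesis
    by (intro curveI[OF assms(1), of U \<phi> UNIV "\<lambda>_. \<phi> p"]) (auto intro: Cinf_const)
qed

lemma curve_has_vd:
  assumes "satlas A" "curve A \<gamma>" "(U, \<phi>) \<in> A" "\<gamma> 0 \<in> U"
  shows "((\<phi> \<circ> \<gamma>) has_vector_derivative vector_derivative (\<phi> \<circ> \<gamma>) (at 0)) (at 0)"
proof -
  obtain P c where P: "open P" "0 \<in> P" "Cinf P c" "\<And>t. t \<in> P \<Longrightarrow> \<gamma> t \<in> U \<and> \<phi> (\<gamma> t) = c t"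
    using curveD[OF assms] by metis
  have "((\<phi> \<circ> \<gamma>) has_derivative frechet_derivative c (at 0)) (at 0)"
    by (rule has_derivative_transform_within_open[OF Cinf_has_derivative[OF P(3,2)] P(1,2)])
      (use P(4) in auto)
  then show ?thesis
    using vector_derivative_works differentiableI by blast
qed

text \<open>Chain rule along a curve that stays in \<open>S\<close> only near 0. The extension
  \<open>g\<close> is differentiated in the ambient model space, but its value on this velocity does
  not depend on the extension, being the derivative of the image curve.\<close>

lemma loc_rep_vd:
  assumes "satlas A" "curve A \<gamma>" "(U, \<phi>) \<in> A" "\<gamma> 0 \<in> U" "\<forall>\<^sub>F t in nhds 0. \<gamma> t \<in> S"
    and "loc_rep S U \<phi> V \<psi> f P g" "\<phi> (\<gamma> 0) \<in> P"
  shows "((\<lambda>t. \<psi> (f (\<gamma> t))) has_vector_derivative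
    frechet_derivative g (at (\<phi> (\<gamma> 0))) (vector_derivative (\<phi> \<circ> \<gamma>) (at 0))) (at 0)"
proof -
  let ?d = "vector_derivative (\<phi> \<circ> \<gamma>) (at 0)"
  have g: "(g has_derivative frechet_derivative g (at (\<phi> (\<gamma> 0)))) (at (\<phi> (\<gamma> 0)))"
    using assms(6,7) Cinf_has_derivative unfolding loc_rep_def by blast
  have vd: "((\<phi> \<circ> \<gamma>) has_derivative (\<lambda>s. s *\<^sub>R ?d)) (at 0)"
    using curve_has_vd[OF assms(1-4)] by (simp add: has_vector_derivative_def)
  have 1: "((\<lambda>t. g (\<phi> (\<gamma> t))) has_derivative (\<lambda>s. s *\<^sub>R frechet_derivative g (at (\<phi> (\<gamma> 0))) ?d)) (at 0)"
    using diff_chain_at[OF vd, of g] g linear_cmul[OF has_derivative_linear[OF g]]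
    by (fastforce simp: o_def)
  have "isCont (\<phi> \<circ> \<gamma>) 0"
    using vd has_derivative_continuous by blast
  then have "\<forall>\<^sub>F t in nhds 0. (\<phi> \<circ> \<gamma>) t \<in> P"
    using assms(6,7) unfolding loc_rep_def isCont_def tendsto_at_iff_tendsto_nhds
    using topological_tendstoD[of "\<phi> \<circ> \<gamma>" "(\<phi> \<circ> \<gamma>) 0" "nhds 0" P] by auto
  then have ev: "\<forall>\<^sub>F t in nhds 0. g (\<phi> (\<gamma> t)) = \<psi> (f (\<gamma> t))"
    using assms(5) curve_ev_chart[OF assms(1-4)]
    by eventually_elim (use assms(6) in \<open>auto simp: loc_rep_def\<close>)
  then obtain Q where Q: "open Q" "0 \<in> Q" "\<And>t. t \<in> Q \<Longrightarrow> g (\<phi> (\<gamma> t)) = \<psi> (f (\<gamma> t))"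
    unfolding eventually_nhds by blast
  show ?thesis
    unfolding has_vector_derivative_def
    by (rule has_derivative_transform_within_open[OF 1 Q])
qed

lemma curve_compose:
  assumes "satlas A" "satlas B" "curve A \<gamma>" "\<forall>\<^sub>F t in nhds 0. \<gamma> t \<in> S" "smap A S B f"
  shows "curve B (\<lambda>t. f (\<gamma> t))"
proof -
  have S: "\<gamma> 0 \<in> S" using assms(4) eventually_nhds_x_imp_x by blast
  obtain U \<phi> where U: "(U, \<phi>) \<in> A" "\<gamma> 0 \<in> U" using curve_pts[OF assms(3)] pts_chart by metis
  obtain V \<psi> where V: "(V, \<psi>) \<in> B" "f (\<gamma> 0) \<in> V" using smap_pts(2)[OF assms(5) S] pts_chart by metis
  obtain P g where P: "\<phi> (\<gamma> 0) \<in> P" "loc_rep S U \<phi> V \<psi> f P g"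
    using smapD[OF assms(5) S U V] by metis
  obtain Q c where Q: "open Q" "0 \<in> Q" "Cinf Q c" "\<And>t. t \<in> Q \<Longrightarrow> \<gamma> t \<in> U \<and> \<phi> (\<gamma> t) = c t"
    using curveD[OF assms(1,3) U] by metis
  have o: "open (Q \<inter> c -` P)" using Q P Cinf_open_vimage unfolding loc_rep_def by blast
  have 0: "0 \<in> Q \<inter> c -` P" using Q(2,4) P(1) by force
  show ?thesis
  proof (rule curveI[OF assms(2) V(1) o 0])
    show "Cinf (Q \<inter> c -` P) (\<lambda>t. g (c t))"
      using Q P o by (intro Cinf_compose[of P g _ c]) (auto simp: loc_rep_def intro: Cinf_subset)
    show "\<forall>\<^sub>F t in nhds 0. f (\<gamma> t) \<in> V \<and> \<psi> (f (\<gamma> t)) = g (c t)"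
      using assms(4) eventually_nhds_in_open[OF o 0]
      by eventually_elim (use Q(4) P(2) in \<open>force simp: loc_rep_def\<close>)
  qed
qed

subsection \<open>Tangent vectors\<close>

lemma velocity_self: "curve A \<gamma> \<Longrightarrow> \<gamma> \<in> velocity A \<gamma>"
  by (simp add: velocity_def)

lemma velocityD:
  assumes "\<delta> \<in> velocity A \<gamma>"
  shows "curve A \<delta>" "\<delta> 0 = \<gamma> 0" "(U, \<phi>) \<in> A \<Longrightarrow> \<gamma> 0 \<in> U \<Longrightarrow>
    vector_derivative (\<phi> \<circ> \<delta>) (at 0) = vector_derivative (\<phi> \<circ> \<gamma>) (at 0)"
  using assms unfolding velocity_def by auto

lemma velocity_eqD: "\<delta> \<in> velocity A \<gamma> \<Longrightarrow> velocity A \<delta> = velocity A \<gamma>"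
  unfolding velocity_def by fastforce

text \<open>The derivative of a change of charts carries equality of derivatives from one chart to
  every other.\<close>

lemma velocity_eqI:
  assumes "satlas A" "curve A \<gamma>" "curve A \<delta>" "\<gamma> 0 = \<delta> 0" "(U, \<phi>) \<in> A" "\<gamma> 0 \<in> U"
    and eq: "vector_derivative (\<phi> \<circ> \<gamma>) (at 0) = vector_derivative (\<phi> \<circ> \<delta>) (at 0)"
  shows "velocity A \<gamma> = velocity A \<delta>"
proof -
  have "vector_derivative (\<psi> \<circ> \<gamma>) (at 0) = vector_derivative (\<psi> \<circ> \<delta>) (at 0)"
    if V: "(V, \<psi>) \<in> A" "\<gamma> 0 \<in> V" for V \<psi>
  proof -
    obtain P g where P: "\<phi> (\<gamma> 0) \<in> P" "loc_rep (pts A) U \<phi> V \<psi> (\<lambda>p. p) P g"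
      using smapD[OF assms(1)[unfolded satlas_def] curve_pts[OF assms(2)] assms(5,6) V] by metis
    have "\<phi> (\<delta> 0) \<in> P" "\<delta> 0 \<in> U" using P(1) assms(4,6) by simp_all
    from loc_rep_vd[OF assms(1,2,5,6) curve_ev_pts[OF assms(1,2)] P(2,1)]
      loc_rep_vd[OF assms(1,3,5) this(2) curve_ev_pts[OF assms(1,3)] P(2) this(1)]
    show ?thesis
      using eq assms(4) by (simp add: o_def vector_derivative_at)
  qed
  then show ?thesis
    unfolding velocity_def using assms(4) by auto
qed

lemma some_velocity:
  assumes "curve A \<gamma>"
  shows "(SOME \<delta>. \<delta> \<in> velocity A \<gamma>) \<in> velocity A \<gamma>"
  using someI[of "\<lambda>\<delta>. \<delta> \<in> velocity A \<gamma>", OF velocity_self[OF assms]] .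

lemma pt_velocity [simp]: "curve A \<gamma> \<Longrightarrow> pt (velocity A \<gamma>) = \<gamma> 0"
  unfolding pt_def using velocityD(2)[OF some_velocity] .

lemma dcoord_velocity:
  assumes "curve A \<gamma>" "(U, \<phi>) \<in> A" "\<gamma> 0 \<in> U"
  shows "dcoord \<phi> (velocity A \<gamma>) = vector_derivative (\<phi> \<circ> \<gamma>) (at 0)"
  unfolding dir_deriv_def using velocityD(3)[OF some_velocity] assms by blast

lemma velocity_TB: "curve A \<gamma> \<Longrightarrow> velocity A \<gamma> \<in> TB A"
  unfolding TB_def by blast

lemma TB_velocity:
  assumes "v \<in> TB A"
  obtains \<gamma> where "curve A \<gamma>" "v = velocity A \<gamma>" "\<gamma> 0 = pt v"
  using assms unfolding TB_def by force

lemma TB_memD: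
  assumes "v \<in> TB A" "\<gamma> \<in> v"
  shows "curve A \<gamma>" "v = velocity A \<gamma>" "\<gamma> 0 = pt v"
proof -
  obtain \<delta> where \<delta>: "curve A \<delta>" "v = velocity A \<delta>" "\<delta> 0 = pt v"
    using TB_velocity[OF assms(1)] .
  then show "curve A \<gamma>" "v = velocity A \<gamma>" "\<gamma> 0 = pt v"
    using assms(2) velocityD(1,2)[of \<gamma> A \<delta>] velocity_eqD[of \<gamma> A \<delta>] by simp_all
qed

lemma TB_some: "v \<in> TB A \<Longrightarrow> (SOME \<gamma>. \<gamma> \<in> v) \<in> v"
  by (metis TB_velocity some_velocity)

lemma TB_pt: "v \<in> TB A \<Longrightarrow> pt v \<in> pts A"
  by (metis TB_velocity curve_pts)

lemma TS_iff [simp]: "v \<in> TS A p \<longleftrightarrow> v \<in> TB A \<and> pt v = p"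
  by (auto simp: TS_def)

lemma TB_eqI:
  assumes "satlas A" "u \<in> TB A" "v \<in> TB A" "pt u = pt v" "(U, \<phi>) \<in> A" "pt u \<in> U"
    "dcoord \<phi> u = dcoord \<phi> v"
  shows "u = v"
proof -
  obtain \<gamma> where \<gamma>: "curve A \<gamma>" "u = velocity A \<gamma>" "\<gamma> 0 = pt u"
    using TB_velocity[OF assms(2)] by metis
  obtain \<delta> where \<delta>: "curve A \<delta>" "v = velocity A \<delta>" "\<delta> 0 = pt v"
    using TB_velocity[OF assms(3)] by metis
  show ?thesis
    unfolding \<gamma>(2) \<delta>(2)
    by (rule velocity_eqI[OF assms(1) \<gamma>(1) \<delta>(1) _ assms(5)])
      (use assms \<gamma> \<delta> dcoord_velocity in \<open>metis+\<close>)
qed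

lemma dcoord_has_vd:
  assumes "satlas A" "curve A \<gamma>" "(U, \<phi>) \<in> A" "\<gamma> 0 \<in> U"
  shows "((\<lambda>t. \<phi> (\<gamma> t)) has_vector_derivative dcoord \<phi> (velocity A \<gamma>)) (at 0)"
  using curve_has_vd[OF assms] dcoord_velocity[OF assms(2-)] by (simp add: o_def)

lemma dcoord_velocityI:
  assumes "curve A \<gamma>" "(U, \<phi>) \<in> A" "\<gamma> 0 \<in> U" "((\<lambda>t. \<phi> (\<gamma> t)) has_vector_derivative d) (at 0)"
  shows "dcoord \<phi> (velocity A \<gamma>) = d"
  using dcoord_velocity[OF assms(1-3)] vector_derivative_at[OF assms(4)] by (simp add: o_def)

text \<open>\<open>tmap_on\<close> follows a representative chosen by \<open>SOME\<close>. By the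
  chain rule in charts, every representative that remains in \<open>T\<close>, and therefore in
  \<open>S\<close>, near 0 gives the same velocity.\<close>

lemma tmap_on_velocity:
  assumes AB: "satlas A" "satlas B" and f: "smap A S B f"
    and \<gamma>: "curve A \<gamma>" "\<forall>\<^sub>F t in nhds 0. \<gamma> t \<in> S"
    and T: "\<forall>\<^sub>F t in nhds 0. \<gamma> t \<in> T" "\<And>\<delta>. \<delta> \<in> velocity A \<gamma> \<Longrightarrow> \<forall>\<^sub>F t in nhds 0. \<delta> t \<in> T \<Longrightarrow>
      \<forall>\<^sub>F t in nhds 0. \<delta> t \<in> S"
  shows "tmap_on T B f (velocity A \<gamma>) = velocity B (\<lambda>t. f (\<gamma> t))"
proof -
  let ?\<delta> = "SOME \<delta>. \<delta> \<in> velocity A \<gamma> \<and> (\<forall>\<^sub>F t in nhds 0. \<delta> t \<in> T)"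
  have \<delta>: "?\<delta> \<in> velocity A \<gamma> \<and> (\<forall>\<^sub>F t in nhds 0. ?\<delta> t \<in> T)"
    by (rule someI[of _ \<gamma>]) (use velocity_self[OF \<gamma>(1)] T(1) in blast)
  then have c: "curve A ?\<delta>" "?\<delta> 0 = \<gamma> 0" "\<forall>\<^sub>F t in nhds 0. ?\<delta> t \<in> S"
    using velocityD(1,2)[OF conjunct1[OF \<delta>]] T(2) by simp_all
  have S: "\<gamma> 0 \<in> S" using \<gamma>(2) eventually_nhds_x_imp_x by blast
  obtain U \<phi> where U: "(U, \<phi>) \<in> A" "\<gamma> 0 \<in> U" using curve_pts[OF \<gamma>(1)] pts_chart by metis
  obtain V \<psi> where V: "(V, \<psi>) \<in> B" "f (\<gamma> 0) \<in> V" using smap_pts(2)[OF f S] pts_chart by metis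
  obtain P g where P: "\<phi> (\<gamma> 0) \<in> P" "loc_rep S U \<phi> V \<psi> f P g"
    using smapD[OF f S U V] by metis
  have P': "\<phi> (?\<delta> 0) \<in> P" "?\<delta> 0 \<in> U" using P(1) U(2) c(2) by simp_all
  have "velocity B (\<lambda>t. f (?\<delta> t)) = velocity B (\<lambda>t. f (\<gamma> t))"
  proof (rule velocity_eqI[OF AB(2) _ _ _ V(1)])
    show "curve B (\<lambda>t. f (?\<delta> t))" "curve B (\<lambda>t. f (\<gamma> t))"
      using curve_compose[OF AB c(1,3) f] curve_compose[OF AB \<gamma> f] .
    show "vector_derivative (\<psi> \<circ> (\<lambda>t. f (?\<delta> t))) (at 0) = vector_derivative (\<psi> \<circ> (\<lambda>t. f (\<gamma> t))) (at 0)"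
      using loc_rep_vd[OF AB(1) \<gamma>(1) U \<gamma>(2) P(2,1)]
        loc_rep_vd[OF AB(1) c(1) U(1) P'(2) c(3) P(2) P'(1)]
        velocityD(3)[OF conjunct1[OF \<delta>] U] c(2)
      by (simp add: o_def vector_derivative_at)
  qed (use c(2) V in simp_all)
  then show ?thesis
    unfolding tmap_on_def by (simp add: o_def)
qed

lemma tmap_velocity:
  assumes "satlas A" "satlas B" "smap A (pts A) B f" "curve A \<gamma>"
  shows "tmap B f (velocity A \<gamma>) = velocity B (\<lambda>t. f (\<gamma> t))"
  by (rule tmap_on_velocity[OF assms(1-4)])
    (use assms curve_ev_pts[OF assms(1)] velocityD(1) in auto)

lemma tmap_TB:
  assumes "satlas A" "satlas B" "smap A (pts A) B f" "v \<in> TB A"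
  shows "tmap B f v \<in> TB B" "pt (tmap B f v) = f (pt v)"
proof -
  obtain \<gamma> where \<gamma>: "curve A \<gamma>" "v = velocity A \<gamma>" "\<gamma> 0 = pt v" using TB_velocity[OF assms(4)] by metis
  have "curve B (\<lambda>t. f (\<gamma> t))"
    using curve_compose[OF assms(1,2) \<gamma>(1) curve_ev_pts[OF assms(1) \<gamma>(1)] assms(3)] .
  then show "tmap B f v \<in> TB B" "pt (tmap B f v) = f (pt v)"
    using tmap_velocity[OF assms(1-3) \<gamma>(1)] \<gamma> velocity_TB by simp_all
qed

lemma dcoord_tmap:
  assumes "satlas A" "satlas B" "smap A (pts A) B f" "v \<in> TB A"
    and "(U, \<phi>) \<in> A" "pt v \<in> U" "(V, \<psi>) \<in> B" "loc_rep (pts A) U \<phi> V \<psi> f P g" "\<phi> (pt v) \<in> P"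
  shows "dcoord \<psi> (tmap B f v) = frechet_derivative g (at (\<phi> (pt v))) (dcoord \<phi> v)"
proof -
  obtain \<gamma> where \<gamma>: "curve A \<gamma>" "v = velocity A \<gamma>" "\<gamma> 0 = pt v" using TB_velocity[OF assms(4)] by metis
  have c: "curve B (\<lambda>t. f (\<gamma> t))"
    using curve_compose[OF assms(1,2) \<gamma>(1) curve_ev_pts[OF assms(1) \<gamma>(1)] assms(3)] .
  have "f (pt v) \<in> V" using assms(5,6,8,9) chart_pts[OF assms(5,6)] unfolding loc_rep_def by blast
  then show ?thesis
    using loc_rep_vd[OF assms(1) \<gamma>(1) assms(5) _ curve_ev_pts[OF assms(1) \<gamma>(1)] assms(8)] assms(6,9)
      tmap_velocity[OF assms(1-3) \<gamma>(1)] dcoord_velocityI[OF c assms(7)] \<gamma> dcoord_velocity[OF \<gamma>(1) assms(5)]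
    by metis
qed

section \<open>Manifolds\<close>

lemma manifold_inj_charts: "manifold n A \<Longrightarrow> inj_charts A"
  unfolding manifold_def inj_charts_def by fast

text \<open>Relative openness of the overlap supplies an open set of coordinates that forces a point
  of \<open>U\<close> into \<open>V\<close>; on it the extension of the transition map represents
  the identity.\<close>

lemma manifold_satlas:
  assumes "manifold n A"
  shows "satlas A"
  unfolding satlas_def
proof (rule smap_allI)
  fix p U \<phi> V \<psi> assume p: "p \<in> pts A" "(U, \<phi>) \<in> A" "(V, \<psi>) \<in> A" "p \<in> U" "p \<in> V"
  have inj: "inj_on \<phi> U" using manifold_inj_charts[OF assms] p(2) unfolding inj_charts_def by fast
  have "\<forall>(U, \<phi>)\<in>A. \<forall>(V, \<psi>)\<in>A. openin (top_of_set (\<phi> ` U)) (\<phi> ` (U \<inter> V)) \<and>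
        smooth_on (\<phi> ` (U \<inter> V)) (\<psi> \<circ> inv_into U \<phi>)"
    using assms unfolding manifold_def by argo
  from bspec[OF this p(2), unfolded prod.case, THEN bspec, OF p(3), unfolded prod.case]
  have o: "openin (top_of_set (\<phi> ` U)) (\<phi> ` (U \<inter> V))"
    and s: "smooth_on (\<phi> ` (U \<inter> V)) (\<psi> \<circ> inv_into U \<phi>)"
    by blast+
  obtain P1 where P1: "open P1" "\<phi> ` (U \<inter> V) = \<phi> ` U \<inter> P1"
    using o unfolding openin_open by blast
  obtain P2 g where P2: "open P2" "\<phi> p \<in> P2" "\<forall>k. Ck_on k P2 g"
      "\<forall>y\<in>\<phi> ` (U \<inter> V) \<inter> P2. g y = (\<psi> \<circ> inv_into U \<phi>) y"
    using s p(4,5) unfolding smooth_on_def by (metis IntI imageI)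
  have "loc_rep (pts A) U \<phi> V \<psi> (\<lambda>p. p) (P1 \<inter> P2) g"
    unfolding loc_rep_def
  proof (intro conjI ballI impI)
    show "Cinf (P1 \<inter> P2) g"
      by (rule Cinf_subset[of P2]) (use P2(3) in \<open>auto simp: Cinf_def\<close>)
    fix q assume q: "q \<in> pts A \<inter> U" "\<phi> q \<in> P1 \<inter> P2"
    then have "\<phi> q \<in> \<phi> ` (U \<inter> V)" using P1(2) by blast
    then show "q \<in> V" using inj q(1) by (auto dest: inj_onD)
    then show "\<psi> q = g (\<phi> q)"
      using P2(4) q inv_into_f_f[OF inj] by auto
  qed (use P1 P2 in blast)
  moreover have "\<phi> p \<in> P1 \<inter> P2" using P1(2) P2(2) p(4,5) by blast
  ultimately show "\<exists>O' g. \<phi> p \<in> O' \<and> loc_rep (pts A) U \<phi> V \<psi> (\<lambda>p. p) O' g"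
    by (intro exI conjI)
qed auto

text \<open>Difference quotients stay in the subspace, and subspaces of a Euclidean space are
  closed.\<close>

lemma has_vector_derivative_in_subspace:
  fixes f :: "real \<Rightarrow> 'e::euclidean_space"
  assumes "(f has_vector_derivative d) (at 0)" "subspace K" "\<forall>\<^sub>F t in nhds 0. f t \<in> K"
  shows "d \<in> K"
proof -
  have "((\<lambda>t. norm (f (0 + t) - f 0 - t *\<^sub>R d) / norm t) \<longlongrightarrow> 0) (at 0)"
    using assms(1) unfolding has_vector_derivative_def has_derivative_at by blast
  moreover have "\<forall>\<^sub>F t in at 0. norm (f (0 + t) - f 0 - t *\<^sub>R d) / norm t =
      norm ((f t - f 0) /\<^sub>R t - d)"
  proof -
    have "norm (f (0 + t) - f 0 - t *\<^sub>R d) / norm t = norm ((f t - f 0) /\<^sub>R t - d)" if "t \<noteq> 0" for t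
    proof -
      have "(f t - f 0) /\<^sub>R t - d = (f t - f 0 - t *\<^sub>R d) /\<^sub>R t"
        using that by (simp add: scaleR_diff_right)
      then show ?thesis by (simp add: divide_inverse)
    qed
    then show ?thesis by (auto simp: eventually_at_filter)
  qed
  ultimately have "((\<lambda>t. norm ((f t - f 0) /\<^sub>R t - d)) \<longlongrightarrow> 0) (at 0)"
    by (rule Lim_transform_eventually)
  then have lim: "((\<lambda>t. (f t - f 0) /\<^sub>R t) \<longlongrightarrow> d) (at 0)"
    by (rule LIM_zero_cancel[OF tendsto_norm_zero_cancel])
  have "\<forall>\<^sub>F t in at 0. (f t - f 0) /\<^sub>R t \<in> K"
  proof -
    have f0: "f 0 \<in> K" using assms(3) eventually_nhds_x_imp_x by blast
    have "\<forall>\<^sub>F t in nhds 0. (f t - f 0) /\<^sub>R t \<in> K"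
      using assms(3) by eventually_elim (use assms(2) f0 in \<open>auto intro: subspace_scale subspace_diff\<close>)
    then show ?thesis by (simp add: eventually_nhds_conv_at)
  qed
  then show ?thesis
    by (rule Lim_in_closed_set[OF closed_subspace[OF assms(2)] _ trivial_limit_at lim])
qed

lemma manifold_chartE:
  assumes "manifold n A" "(U, \<phi>) \<in> A"
  obtains K where "inj_on \<phi> U" "subspace K" "openin (top_of_set K) (\<phi> ` U)"
proof -
  have "inj_on \<phi> U \<and> (\<exists>K. subspace K \<and> dim K = n \<and> openin (top_of_set K) (\<phi> ` U))"
    using assms unfolding manifold_def by fast
  then show thesis using that by blast
qed

text \<open>Chart images are relatively open in \<open>K\<close>, so a curve in \<open>K\<close>
  through \<open>\<phi> p\<close> remains in the image for small times and lifts to the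
  manifold.\<close>

lemma model_curve:
  assumes "satlas A" "(U, \<phi>) \<in> A" "inj_on \<phi> U" "openin (top_of_set K) (\<phi> ` U)"
    and "open P" "0 \<in> P" "Cinf P c" "\<And>t. t \<in> P \<Longrightarrow> c t \<in> K" "p \<in> U" "c 0 = \<phi> p"
  shows "curve A (\<lambda>t. inv_into U \<phi> (c t))" "inv_into U \<phi> (c 0) = p"
    "\<forall>\<^sub>F t in nhds 0. inv_into U \<phi> (c t) \<in> U \<and> \<phi> (inv_into U \<phi> (c t)) = c t"
proof -
  obtain Q where Q: "open Q" "\<phi> ` U = K \<inter> Q"
    using assms(4) unfolding openin_open by blast
  have "open (P \<inter> c -` Q)" "0 \<in> P \<inter> c -` Q"
    using Cinf_open_vimage[OF assms(7,5) Q(1)] Q(2) assms(6,9,10) by auto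
  from eventually_nhds_in_open[OF this]
  show ev: "\<forall>\<^sub>F t in nhds 0. inv_into U \<phi> (c t) \<in> U \<and> \<phi> (inv_into U \<phi> (c t)) = c t"
  proof eventually_elim
    case (elim t)
    then have "c t \<in> \<phi> ` U" using Q(2) assms(8) by auto
    then show ?case by (simp add: inv_into_into f_inv_into_f)
  qed
  show "curve A (\<lambda>t. inv_into U \<phi> (c t))"
    by (rule curveI[OF assms(1,2,5,6,7) ev])
  show "inv_into U \<phi> (c 0) = p"
    using assms(3,9,10) by simp
qed

lemma Cinf_line: "Cinf UNIV (\<lambda>t. x + t *\<^sub>R v)"
  by (intro Cinf_add Cinf_const Cinf_scaleR Cinf_id) auto

lemma has_vector_derivative_line: "((\<lambda>t. x + t *\<^sub>R v) has_vector_derivative v) (at 0)"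
  by (auto intro!: derivative_eq_intros simp: has_vector_derivative_def)

lemma model_vector:
  assumes "satlas A" "(U, \<phi>) \<in> A" "inj_on \<phi> U" "subspace K" "openin (top_of_set K) (\<phi> ` U)"
    and "p \<in> U" "k \<in> K"
  shows "\<exists>v\<in>TS A p. dcoord \<phi> v = k"
proof -
  have pK: "\<phi> p \<in> K" using assms(5,6) openin_imp_subset by blast
  let ?c = "\<lambda>t. \<phi> p + t *\<^sub>R k"
  have cK: "?c t \<in> K" for t using pK assms(4,7) by (simp add: subspace_add subspace_scale)
  let ?\<gamma> = "\<lambda>t. inv_into U \<phi> (?c t)"
  have \<gamma>: "curve A ?\<gamma>" "?\<gamma> 0 = p" "\<forall>\<^sub>F t in nhds 0. ?\<gamma> t \<in> U \<and> \<phi> (?\<gamma> t) = ?c t"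
    using model_curve[OF assms(1-3,5) open_UNIV UNIV_I Cinf_line cK assms(6)] by simp_all
  obtain Q where Q: "open Q" "0 \<in> Q" "\<And>t. t \<in> Q \<Longrightarrow> ?c t = \<phi> (?\<gamma> t)"
    using \<gamma>(3) unfolding eventually_nhds by metis
  have "((\<lambda>t. \<phi> (?\<gamma> t)) has_vector_derivative k) (at 0)"
    using has_vector_derivative_transform_within_open[OF has_vector_derivative_line Q] .
  then have "dcoord \<phi> (velocity A ?\<gamma>) = k"
    using dcoord_velocityI[OF \<gamma>(1) assms(2)] \<gamma>(2) assms(6) by simp
  then show ?thesis
    using velocity_TB[OF \<gamma>(1)] pt_velocity[OF \<gamma>(1)] \<gamma>(2) by auto
qed

lemma model_dcoord:
  assumes "satlas A" "(U, \<phi>) \<in> A" "subspace K" "openin (top_of_set K) (\<phi> ` U)"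
    and "v \<in> TB A" "pt v \<in> U"
  shows "dcoord \<phi> v \<in> K"
proof -
  obtain \<gamma> where \<gamma>: "curve A \<gamma>" "v = velocity A \<gamma>" "\<gamma> 0 = pt v" using TB_velocity[OF assms(5)] .
  have U: "\<gamma> 0 \<in> U" using \<gamma>(3) assms(6) by simp
  have "\<forall>\<^sub>F t in nhds 0. \<phi> (\<gamma> t) \<in> K"
    using curve_ev_chart[OF assms(1) \<gamma>(1) assms(2) U]
    by eventually_elim (use openin_imp_subset[OF assms(4)] in blast)
  then show ?thesis
    using has_vector_derivative_in_subspace[OF dcoord_has_vd[OF assms(1) \<gamma>(1) assms(2) U] assms(3)]
      \<gamma>(2) by simp
qed

text \<open>Lines in \<open>K\<close> realise every vector of \<open>K\<close>, and velocities
  cannot leave \<open>K\<close>. That one subspace serves all points of the chart is the reason why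
  fields with constant coordinates exist.\<close>

lemma manifold_spaceE:
  assumes "manifold n A" "(U, \<phi>) \<in> A"
  obtains K where "inj_on \<phi> U" "subspace K" "openin (top_of_set K) (\<phi> ` U)"
    "\<And>p. p \<in> U \<Longrightarrow> dcoord \<phi> ` TS A p = K"
proof -
  obtain K where K: "inj_on \<phi> U" "subspace K" "openin (top_of_set K) (\<phi> ` U)"
    using manifold_chartE[OF assms] .
  have "dcoord \<phi> ` TS A p = K" if "p \<in> U" for p
  proof (intro equalityI subsetI)
    show "k \<in> K" if "k \<in> dcoord \<phi> ` TS A p" for k
      using model_dcoord[OF manifold_satlas[OF assms(1)] assms(2) K(2,3)] that \<open>p \<in> U\<close> by auto
    show "k \<in> dcoord \<phi> ` TS A p" if "k \<in> K" for k
      using model_vector[OF manifold_satlas[OF assms(1)] assms(2) K \<open>p \<in> U\<close> that] by blast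
  qed
  then show thesis by (rule that[OF K])
qed

lemma tmap_id:
  assumes "satlas A" "v \<in> TB A"
  shows "tmap A (\<lambda>p. p) v = v"
  using TB_velocity[OF assms(2)] tmap_velocity[OF assms(1,1) assms(1)[unfolded satlas_def]] by metis

lemma dcoord_change:
  assumes "satlas A" "v \<in> TB A" "(U, \<phi>) \<in> A" "pt v \<in> U" "(V, \<psi>) \<in> A"
    "loc_rep (pts A) U \<phi> V \<psi> (\<lambda>p. p) P g" "\<phi> (pt v) \<in> P"
  shows "dcoord \<psi> v = frechet_derivative g (at (\<phi> (pt v))) (dcoord \<phi> v)"
  using dcoord_tmap[OF assms(1,1) assms(1)[unfolded satlas_def] assms(2-)] tmap_id[OF assms(1,2)]
  by simp

lemma loc_rep_linear:
  "loc_rep S U \<phi> V \<psi> f P g \<Longrightarrow> x \<in> P \<Longrightarrow> linear (frechet_derivative g (at x))"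
  unfolding loc_rep_def using has_derivative_linear Cinf_has_derivative by blast

text \<open>Well-definedness of the description: \<open>w\<close> is found in one chart, where
  tangent vectors fill a subspace, and linearity of the transition derivatives gives the equation in
  all other charts.\<close>

lemma tlin:
  assumes "manifold n A" "u \<in> TS A p" "v \<in> TS A p"
  shows "tlin A a u b v \<in> TS A p"
    "(U, \<phi>) \<in> A \<Longrightarrow> p \<in> U \<Longrightarrow> dcoord \<phi> (tlin A a u b v) = a *\<^sub>R dcoord \<phi> u + b *\<^sub>R dcoord \<phi> v"
proof -
  have sA: "satlas A" using manifold_satlas[OF assms(1)] .
  have "\<exists>!w. w \<in> TS A (pt u) \<and>
     (\<forall>(U, \<phi>)\<in>A. pt u \<in> U \<longrightarrow> dcoord \<phi> w = a *\<^sub>R dcoord \<phi> u + b *\<^sub>R dcoord \<phi> v)"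
  proof -
    have uv: "u \<in> TB A" "v \<in> TB A" "pt u = p" "pt v = p" using assms by auto
    obtain U \<phi> where U: "(U, \<phi>) \<in> A" "p \<in> U" using TB_pt[OF uv(1)] uv(3) pts_chart by metis
    obtain K where K: "subspace K" "\<And>q. q \<in> U \<Longrightarrow> dcoord \<phi> ` TS A q = K"
      using manifold_spaceE[OF assms(1) U(1)] by metis
    have "dcoord \<phi> u \<in> K" "dcoord \<phi> v \<in> K"
      using K(2)[OF U(2)] assms(2,3) by blast+
    then have "a *\<^sub>R dcoord \<phi> u + b *\<^sub>R dcoord \<phi> v \<in> dcoord \<phi> ` TS A p"
      using K U(2) by (simp add: subspace_add subspace_scale)
    then obtain w where w: "w \<in> TS A p" "dcoord \<phi> w = a *\<^sub>R dcoord \<phi> u + b *\<^sub>R dcoord \<phi> v"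
      by auto
    have "dcoord \<psi> w = a *\<^sub>R dcoord \<psi> u + b *\<^sub>R dcoord \<psi> v" if V: "(V, \<psi>) \<in> A" "p \<in> V" for V \<psi>
    proof -
      obtain P g where P: "\<phi> p \<in> P" "loc_rep (pts A) U \<phi> V \<psi> (\<lambda>p. p) P g"
        using smapD[OF sA[unfolded satlas_def] _ U V] U chart_pts by metis
      have "dcoord \<psi> z = frechet_derivative g (at (\<phi> p)) (dcoord \<phi> z)" if "z \<in> TS A p" for z
        using dcoord_change[OF sA _ U(1) _ V(1) P(2)] that P(1) U(2) by auto
      then show ?thesis
        using w assms(2,3) linear_add[OF loc_rep_linear[OF P(2,1)]] linear_cmul[OF loc_rep_linear[OF P(2,1)]]
        by metis
    qed
    moreover have "w = w'" if "w' \<in> TS A p" "dcoord \<phi> w' = a *\<^sub>R dcoord \<phi> u + b *\<^sub>R dcoord \<phi> v" for w'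
      using TB_eqI[OF sA, of w w' U \<phi>] w that U by simp
    ultimately show ?thesis
      using w U uv(3) by (intro ex1I[of _ w]) fast+
  qed
  from theI'[OF this] show "tlin A a u b v \<in> TS A p"
    "(U, \<phi>) \<in> A \<Longrightarrow> p \<in> U \<Longrightarrow> dcoord \<phi> (tlin A a u b v) = a *\<^sub>R dcoord \<phi> u + b *\<^sub>R dcoord \<phi> v"
    using assms unfolding tlin_def by auto
qed

lemma tlin_eqI:
  assumes "manifold n A" "u \<in> TS A p" "v \<in> TS A p" "w \<in> TS A p" "(U, \<phi>) \<in> A" "p \<in> U"
    "dcoord \<phi> w = a *\<^sub>R dcoord \<phi> u + b *\<^sub>R dcoord \<phi> v"
  shows "tlin A a u b v = w"
  by (rule TB_eqI[OF manifold_satlas[OF assms(1)] _ _ _ assms(5)])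
    (use tlin[OF assms(1-3)] assms(4-) in auto)

lemma tmap_tlin:
  assumes "manifold n A" "manifold m B" "smap A (pts A) B f" "u \<in> TS A p" "v \<in> TS A p"
  shows "tmap B f (tlin A a u b v) = tlin B a (tmap B f u) b (tmap B f v)"
proof -
  have sA: "satlas A" and sB: "satlas B" using manifold_satlas assms(1,2) by blast+
  have T: "tmap B f z \<in> TS B (f p)" if "z \<in> TS A p" for z
    using tmap_TB[OF sA sB assms(3), of z] that by auto
  have p: "p \<in> pts A" using assms(4) TB_pt by auto
  obtain U \<phi> where U: "(U, \<phi>) \<in> A" "p \<in> U" using p pts_chart by metis
  obtain V \<psi> where V: "(V, \<psi>) \<in> B" "f p \<in> V" using smap_pts(2)[OF assms(3) p] pts_chart by metis
  obtain P g where P: "\<phi> p \<in> P" "loc_rep (pts A) U \<phi> V \<psi> f P g"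
    using smapD[OF assms(3) p U V] .
  have D: "dcoord \<psi> (tmap B f z) = frechet_derivative g (at (\<phi> p)) (dcoord \<phi> z)" if "z \<in> TS A p" for z
    using dcoord_tmap[OF sA sB assms(3) _ U(1) _ V(1) P(2)] that P(1) U(2) by auto
  show ?thesis
    by (rule tlin_eqI[OF assms(2) T[OF assms(4)] T[OF assms(5)] T[OF tlin(1)[OF assms(1,4,5)]] V, symmetric])
      (simp only: D[OF tlin(1)[OF assms(1,4,5)]] D[OF assms(4)] D[OF assms(5)] tlin(2)[OF assms(1,4,5) U]
        linear_add[OF loc_rep_linear[OF P(2,1)]] linear_cmul[OF loc_rep_linear[OF P(2,1)]])
qed

lemma const_field:
  assumes "manifold n A" "(U, \<phi>) \<in> A" "u \<in> TB A" "pt u \<in> U" "q \<in> U"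
  shows "const_field A \<phi> u q \<in> TS A q" "dcoord \<phi> (const_field A \<phi> u q) = dcoord \<phi> u"
proof -
  have sA: "satlas A" using manifold_satlas assms(1) .
  obtain K where K: "subspace K" "\<And>q. q \<in> U \<Longrightarrow> dcoord \<phi> ` TS A q = K"
    using manifold_spaceE[OF assms(1,2)] by metis
  have "dcoord \<phi> u \<in> dcoord \<phi> ` TS A q"
    using K(2)[OF assms(4)] K(2)[OF assms(5)] assms(3) by auto
  then obtain w where "w \<in> TS A q" "dcoord \<phi> w = dcoord \<phi> u" by auto
  then have "\<exists>!w. w \<in> TS A q \<and> dcoord \<phi> w = dcoord \<phi> u"
    using TB_eqI[OF sA, of _ w U \<phi>] assms(2,5) by (intro ex1I[of _ w]) auto
  from theI'[OF this] show "const_field A \<phi> u q \<in> TS A q" "dcoord \<phi> (const_field A \<phi> u q) = dcoord \<phi> u"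
    unfolding const_field_def by blast+
qed

lemma tzero:
  assumes "satlas A" "p \<in> pts A"
  shows "tzero A p \<in> TS A p" "(U, \<phi>) \<in> A \<Longrightarrow> p \<in> U \<Longrightarrow> dcoord \<phi> (tzero A p) = 0"
  using curve_const[OF assms] velocity_TB pt_velocity
    dcoord_velocityI[OF curve_const[OF assms], of U \<phi> 0]
  by (auto simp: tzero_def)

section \<open>Induced and product atlases\<close>

lemma pts_induced: "pts (induced A S \<iota>) = {x \<in> S. \<iota> x \<in> pts A}"
  unfolding pts_def induced_def by force

lemma induced_chartE:
  assumes "(V, \<psi>) \<in> induced A S \<iota>"
  obtains U \<phi> where "(U, \<phi>) \<in> A" "V = {x \<in> S. \<iota> x \<in> U}" "\<psi> = \<phi> \<circ> \<iota>"
  using assms unfolding induced_def by blast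

lemma satlas_induced:
  assumes "satlas A"
  shows "satlas (induced A S \<iota>)"
  unfolding satlas_def
proof (rule smap_allI)
  fix p U' \<phi>' V' \<psi>'
  assume p: "p \<in> pts (induced A S \<iota>)" "(U', \<phi>') \<in> induced A S \<iota>" "(V', \<psi>') \<in> induced A S \<iota>"
    "p \<in> U'" "p \<in> V'"
  obtain U \<phi> where U: "(U, \<phi>) \<in> A" "U' = {x \<in> S. \<iota> x \<in> U}" "\<phi>' = \<phi> \<circ> \<iota>"
    using induced_chartE[OF p(2)] .
  obtain V \<psi> where V: "(V, \<psi>) \<in> A" "V' = {x \<in> S. \<iota> x \<in> V}" "\<psi>' = \<psi> \<circ> \<iota>"
    using induced_chartE[OF p(3)] .
  obtain P g where P: "\<phi> (\<iota> p) \<in> P" "loc_rep (pts A) U \<phi> V \<psi> (\<lambda>p. p) P g"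
    using smapD[OF assms[unfolded satlas_def] _ U(1) _ V(1), of "\<iota> p"] p U V
    by (auto simp: pts_induced)
  have "loc_rep (pts (induced A S \<iota>)) U' \<phi>' V' \<psi>' (\<lambda>p. p) P g"
    using P(2) U V unfolding loc_rep_def by (auto simp: pts_induced)
  then show "\<exists>O' g. \<phi>' p \<in> O' \<and> loc_rep (pts (induced A S \<iota>)) U' \<phi>' V' \<psi>' (\<lambda>p. p) O' g"
    using P(1) U(3) by (intro exI conjI) auto
qed auto

text \<open>Charts of the induced atlas are ambient charts composed with \<iota>, so only membership
  in \<open>S\<close> has to be added; it is eventual because values away from 0 are
  arbitrary.\<close>

lemma curve_induced:
  assumes "satlas A"
  shows "curve (induced A S \<iota>) \<gamma> \<longleftrightarrow> curve A (\<lambda>t. \<iota> (\<gamma> t)) \<and> (\<forall>\<^sub>F t in nhds 0. \<gamma> t \<in> S)"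
proof (intro iffI conjI)
  assume c: "curve (induced A S \<iota>) \<gamma>"
  have sI: "satlas (induced A S \<iota>)" using satlas_induced[OF assms] .
  obtain U' \<phi>' where U': "(U', \<phi>') \<in> induced A S \<iota>" "\<gamma> 0 \<in> U'"
    using curve_pts[OF c] pts_chart by metis
  obtain U \<phi> where U: "(U, \<phi>) \<in> A" "U' = {x \<in> S. \<iota> x \<in> U}" "\<phi>' = \<phi> \<circ> \<iota>"
    using induced_chartE[OF U'(1)] .
  obtain P h where P: "open P" "0 \<in> P" "Cinf P h" "\<And>t. t \<in> P \<Longrightarrow> \<gamma> t \<in> U' \<and> \<phi>' (\<gamma> t) = h t"
    by (rule curveD[OF sI c U']) blast
  show "\<forall>\<^sub>F t in nhds 0. \<gamma> t \<in> S"
    using eventually_nhds_in_open[OF P(1,2)] by eventually_elim (use P(4) U(2) in auto)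
  show "curve A (\<lambda>t. \<iota> (\<gamma> t))"
    by (rule curveI[OF assms U(1) P(1-3)], use eventually_nhds_in_open[OF P(1,2)] in eventually_elim)
      (use P(4) U(2,3) in auto)
next
  assume c: "curve A (\<lambda>t. \<iota> (\<gamma> t)) \<and> (\<forall>\<^sub>F t in nhds 0. \<gamma> t \<in> S)"
  then obtain U \<phi> where U: "(U, \<phi>) \<in> A" "\<iota> (\<gamma> 0) \<in> U"
    using curve_pts pts_chart by metis
  obtain P h where P: "open P" "0 \<in> P" "Cinf P h" "\<And>t. t \<in> P \<Longrightarrow> \<iota> (\<gamma> t) \<in> U \<and> \<phi> (\<iota> (\<gamma> t)) = h t"
    by (rule curveD[where \<gamma> = "\<lambda>t. \<iota> (\<gamma> t)", OF assms _ U]) (use c in auto)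
  have ev: "\<forall>\<^sub>F t in nhds 0. \<gamma> t \<in> S" using c by blast
  have "({x \<in> S. \<iota> x \<in> U}, \<phi> \<circ> \<iota>) \<in> induced A S \<iota>" using U unfolding induced_def by blast
  then show "curve (induced A S \<iota>) \<gamma>"
    by (rule curveI[OF satlas_induced[OF assms] _ P(1-3)],
        use ev eventually_nhds_in_open[OF P(1,2)] in eventually_elim) (use P(4) in auto)
qed

lemma curve_restr:
  "satlas A \<Longrightarrow> curve (restr A S) \<gamma> \<longleftrightarrow> curve A \<gamma> \<and> (\<forall>\<^sub>F t in nhds 0. \<gamma> t \<in> S)"
  using curve_induced[of A S id \<gamma>] by simp

lemma inj_charts_restr: "inj_charts A \<Longrightarrow> inj_charts (restr A S)"
  unfolding inj_charts_def induced_def by (fastforce simp: inj_on_def)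

lemma smap_restr:
  assumes "smap A S B f" "S \<subseteq> T"
  shows "smap (restr A T) S B f"
proof (rule smap_allI)
  show "S \<subseteq> pts (restr A T)" using smap_pts(1)[OF assms(1)] assms(2) by (auto simp: pts_induced)
  show "f p \<in> pts B" if "p \<in> S" for p using smap_pts(2)[OF assms(1) that] .
  fix p U' \<phi>' V \<psi> assume p: "p \<in> S" "(U', \<phi>') \<in> restr A T" "(V, \<psi>) \<in> B" "p \<in> U'" "f p \<in> V"
  obtain U \<phi> where U: "(U, \<phi>) \<in> A" "U' = {x \<in> T. id x \<in> U}" "\<phi>' = \<phi> \<circ> id"
    using induced_chartE[OF p(2)] .
  obtain P g where P: "\<phi> p \<in> P" "loc_rep S U \<phi> V \<psi> f P g"
    using smapD[OF assms(1) p(1) U(1) _ p(3,5)] p(4) U(2) by auto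
  have "loc_rep S U' \<phi>' V \<psi> f P g" using P(2) U unfolding loc_rep_def by auto
  then show "\<exists>O' g. \<phi>' p \<in> O' \<and> loc_rep S U' \<phi>' V \<psi> f O' g"
    using P(1) U(3) by (intro exI conjI) auto
qed

lemma pts_prod: "pts (prod_atlas A B) = pts A \<times> pts B"
  unfolding pts_def prod_atlas_def by force

lemma prod_chartE:
  assumes "(W, \<rho>) \<in> prod_atlas A B"
  obtains U \<phi> V \<psi> where "(U, \<phi>) \<in> A" "(V, \<psi>) \<in> B" "W = U \<times> V" "\<rho> = map_prod \<phi> \<psi>"
  using assms unfolding prod_atlas_def by blast

lemma prod_chartI: "(U, \<phi>) \<in> A \<Longrightarrow> (V, \<psi>) \<in> B \<Longrightarrow> (U \<times> V, map_prod \<phi> \<psi>) \<in> prod_atlas A B"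
  unfolding prod_atlas_def by blast

lemma Cinf_fst_on: "Cinf P g \<Longrightarrow> open P \<Longrightarrow> open Q \<Longrightarrow> Cinf (P \<times> Q) (\<lambda>x. g (fst x))"
  by (rule Cinf_compose[of P]) (auto intro!: Cinf_fst Cinf_id open_Times)

lemma Cinf_snd_on: "Cinf Q g \<Longrightarrow> open P \<Longrightarrow> open Q \<Longrightarrow> Cinf (P \<times> Q) (\<lambda>x. g (snd x))"
  by (rule Cinf_compose[of Q]) (auto intro!: Cinf_snd Cinf_id open_Times)

lemma satlas_prod:
  assumes "satlas A" "satlas B"
  shows "satlas (prod_atlas A B)"
  unfolding satlas_def
proof (rule smap_allI)
  fix p W \<rho> W' \<rho>'
  assume p: "p \<in> pts (prod_atlas A B)" "(W, \<rho>) \<in> prod_atlas A B" "(W', \<rho>') \<in> prod_atlas A B"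
    "p \<in> W" "p \<in> W'"
  obtain U \<phi> V \<psi> where W: "(U, \<phi>) \<in> A" "(V, \<psi>) \<in> B" "W = U \<times> V" "\<rho> = map_prod \<phi> \<psi>"
    using prod_chartE[OF p(2)] .
  obtain U' \<phi>' V' \<psi>' where W': "(U', \<phi>') \<in> A" "(V', \<psi>') \<in> B" "W' = U' \<times> V'" "\<rho>' = map_prod \<phi>' \<psi>'"
    using prod_chartE[OF p(3)] .
  obtain a b where ab: "p = (a, b)" by fastforce
  have mem: "a \<in> pts A" "b \<in> pts B" "a \<in> U" "a \<in> U'" "b \<in> V" "b \<in> V'"
    using p ab W W' by (auto simp: pts_prod)
  obtain P g where P: "\<phi> a \<in> P" "loc_rep (pts A) U \<phi> U' \<phi>' (\<lambda>p. p) P g"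
    using smapD[OF assms(1)[unfolded satlas_def] mem(1) W(1) mem(3) W'(1) mem(4)] .
  obtain Q h where Q: "\<psi> b \<in> Q" "loc_rep (pts B) V \<psi> V' \<psi>' (\<lambda>p. p) Q h"
    using smapD[OF assms(2)[unfolded satlas_def] mem(2) W(2) mem(5) W'(2) mem(6)] .
  have "loc_rep (pts (prod_atlas A B)) W \<rho> W' \<rho>' (\<lambda>p. p) (P \<times> Q) (\<lambda>x. (g (fst x), h (snd x)))"
    unfolding loc_rep_def
  proof (intro conjI)
    show "Cinf (P \<times> Q) (\<lambda>x. (g (fst x), h (snd x)))"
      using P Q by (intro Cinf_Pair Cinf_fst_on Cinf_snd_on open_Times) (auto simp: loc_rep_def)
  qed (use P Q W W' in \<open>auto simp: loc_rep_def pts_prod intro: open_Times\<close>)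
  then show "\<exists>O' g. \<rho> p \<in> O' \<and> loc_rep (pts (prod_atlas A B)) W \<rho> W' \<rho>' (\<lambda>p. p) O' g"
    using P(1) Q(1) W ab by (intro exI conjI) auto
qed auto

lemma inj_charts_prod: "inj_charts A \<Longrightarrow> inj_charts B \<Longrightarrow> inj_charts (prod_atlas A B)"
  unfolding inj_charts_def prod_atlas_def by (fastforce simp: inj_on_def)

lemma smap_proj:
  assumes "satlas A" "satlas B"
  shows "smap (prod_atlas A B) (pts (prod_atlas A B)) A fst"
    "smap (prod_atlas A B) (pts (prod_atlas A B)) B snd"
proof -
  have "\<exists>U \<phi> V \<psi> P g. (U, \<phi>) \<in> prod_atlas A B \<and> (V, \<psi>) \<in> A \<and> p \<in> U \<and>
      \<phi> p \<in> P \<and> loc_rep (pts (prod_atlas A B)) U \<phi> V \<psi> fst P g"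
    "\<exists>U \<phi> V \<psi> P g. (U, \<phi>) \<in> prod_atlas A B \<and> (V, \<psi>) \<in> B \<and> p \<in> U \<and>
      \<phi> p \<in> P \<and> loc_rep (pts (prod_atlas A B)) U \<phi> V \<psi> snd P g"
    if p: "p \<in> pts (prod_atlas A B)" for p
  proof -
    obtain W \<rho> where W: "(W, \<rho>) \<in> prod_atlas A B" "p \<in> W" using p pts_chart by metis
    obtain U \<phi> V \<psi> where c: "(U, \<phi>) \<in> A" "(V, \<psi>) \<in> B" "W = U \<times> V" "\<rho> = map_prod \<phi> \<psi>"
      using prod_chartE[OF W(1)] .
    have "loc_rep (pts (prod_atlas A B)) W \<rho> U \<phi> fst UNIV fst"
      "loc_rep (pts (prod_atlas A B)) W \<rho> V \<psi> snd UNIV snd"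
      using c unfolding loc_rep_def by (auto intro: Cinf_fst[OF open_UNIV] Cinf_snd[OF open_UNIV]
          Cinf_id[OF open_UNIV])
    then show "\<exists>U \<phi> V \<psi> P g. (U, \<phi>) \<in> prod_atlas A B \<and> (V, \<psi>) \<in> A \<and> p \<in> U \<and>
      \<phi> p \<in> P \<and> loc_rep (pts (prod_atlas A B)) U \<phi> V \<psi> fst P g"
    "\<exists>U \<phi> V \<psi> P g. (U, \<phi>) \<in> prod_atlas A B \<and> (V, \<psi>) \<in> B \<and> p \<in> U \<and>
      \<phi> p \<in> P \<and> loc_rep (pts (prod_atlas A B)) U \<phi> V \<psi> snd P g"
      using W c(1,2) by (metis UNIV_I)+
  qed
  then show "smap (prod_atlas A B) (pts (prod_atlas A B)) A fst"
    "smap (prod_atlas A B) (pts (prod_atlas A B)) B snd"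
    by (auto intro!: smapI[OF satlas_prod[OF assms]] assms)
qed

lemma curve_prodI:
  assumes "satlas A" "satlas B" "curve A (\<lambda>t. fst (\<gamma> t))" "curve B (\<lambda>t. snd (\<gamma> t))"
  shows "curve (prod_atlas A B) \<gamma>"
proof -
  obtain U \<phi> where U: "(U, \<phi>) \<in> A" "fst (\<gamma> 0) \<in> U" using curve_pts[OF assms(3)] pts_chart by metis
  obtain V \<psi> where V: "(V, \<psi>) \<in> B" "snd (\<gamma> 0) \<in> V" using curve_pts[OF assms(4)] pts_chart by metis
  obtain P c where P: "open P" "0 \<in> P" "Cinf P c" "\<And>t. t \<in> P \<Longrightarrow> fst (\<gamma> t) \<in> U \<and> \<phi> (fst (\<gamma> t)) = c t"
    by (rule curveD[OF assms(1,3) U]) blast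
  obtain Q d where Q: "open Q" "0 \<in> Q" "Cinf Q d" "\<And>t. t \<in> Q \<Longrightarrow> snd (\<gamma> t) \<in> V \<and> \<psi> (snd (\<gamma> t)) = d t"
    by (rule curveD[OF assms(2,4) V]) blast
  have o: "open (P \<inter> Q)" "0 \<in> P \<inter> Q" using P Q by auto
  show ?thesis
  proof (rule curveI[OF satlas_prod[OF assms(1,2)] prod_chartI[OF U(1) V(1)] o])
    show "Cinf (P \<inter> Q) (\<lambda>t. (c t, d t))"
      using P Q o by (intro Cinf_Pair) (auto intro: Cinf_subset)
    show "\<forall>\<^sub>F t in nhds 0. \<gamma> t \<in> U \<times> V \<and> map_prod \<phi> \<psi> (\<gamma> t) = (c t, d t)"
      using eventually_nhds_in_open[OF o]
      by eventually_elim (use P(4) Q(4) in \<open>auto simp: mem_Times_iff map_prod_def split_beta\<close>)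
  qed
qed

section \<open>The tangent bundle\<close>

lemma tan_chartE:
  assumes "(V, \<psi>) \<in> tan_atlas A"
  obtains U \<phi> where "(U, \<phi>) \<in> A" "V = {v \<in> TB A. pt v \<in> U}" "\<psi> = tchart \<phi>"
  using assms unfolding tan_atlas_def by blast

lemma tan_chartI: "(U, \<phi>) \<in> A \<Longrightarrow> ({v \<in> TB A. pt v \<in> U}, tchart \<phi>) \<in> tan_atlas A"
  unfolding tan_atlas_def by blast

lemma pts_tan: "pts (tan_atlas A) = TB A"
proof (intro equalityI subsetI)
  fix v assume "v \<in> pts (tan_atlas A)"
  then obtain V \<psi> where V: "(V, \<psi>) \<in> tan_atlas A" "v \<in> V" by (rule pts_chart)
  show "v \<in> TB A" by (rule tan_chartE[OF V(1)]) (use V(2) in simp)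
next
  fix v assume v: "v \<in> TB A"
  obtain U \<phi> where U: "(U, \<phi>) \<in> A" "pt v \<in> U" using TB_pt[OF v] by (rule pts_chart)
  show "v \<in> pts (tan_atlas A)"
    by (rule chart_pts[OF tan_chartI[OF U(1)]]) (use v U(2) in simp)
qed

text \<open>The tangent map of \<open>g\<close> in induced coordinates of the tangent
  bundles.\<close>

definition trep :: "('e::euclidean_space \<Rightarrow> 'f::euclidean_space) \<Rightarrow> 'e \<times> 'e \<Rightarrow> 'f \<times> 'f" where
  "trep g = (\<lambda>x. (g (fst x), frechet_derivative g (at (fst x)) (snd x)))"

lemma Cinf_trep: "Cinf P g \<Longrightarrow> open P \<Longrightarrow> Cinf (P \<times> UNIV) (trep g)"
  unfolding trep_def
  by (intro Cinf_Pair open_Times Cinf_fst_on Cinf_frechet_joint[of P g] Cinf_fst Cinf_snd Cinf_id) auto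

lemma loc_rep_tmap:
  assumes "satlas A" "satlas B" "smap A (pts A) B f" "(U, \<phi>) \<in> A" "(V, \<psi>) \<in> B"
    and "loc_rep (pts A) U \<phi> V \<psi> f P g"
  shows "loc_rep (TB A) {v \<in> TB A. pt v \<in> U} (tchart \<phi>) {v \<in> TB B. pt v \<in> V} (tchart \<psi>) (tmap B f)
    (P \<times> UNIV) (trep g)"
  unfolding loc_rep_def
proof (intro conjI ballI impI)
  show "open (P \<times> (UNIV :: 'b set))" "Cinf (P \<times> UNIV) (trep g)"
    using assms(6) by (auto simp: loc_rep_def intro: open_Times Cinf_trep)
  fix v assume v: "v \<in> TB A \<inter> {v \<in> TB A. pt v \<in> U}" "tchart \<phi> v \<in> P \<times> UNIV"
  have T: "tmap B f v \<in> TB B" "pt (tmap B f v) = f (pt v)"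
    using tmap_TB[OF assms(1-3)] v(1) by auto
  have "f (pt v) \<in> V" "\<psi> (f (pt v)) = g (\<phi> (pt v))"
    using assms(6) v chart_pts[OF assms(4)] unfolding loc_rep_def by auto
  then show "tmap B f v \<in> {v \<in> TB B. pt v \<in> V}" "tchart \<psi> (tmap B f v) = trep g (tchart \<phi> v)"
    using T dcoord_tmap[OF assms(1-3) _ assms(4) _ assms(5,6), of v] v by (auto simp: trep_def)
qed

lemma smap_tmap:
  assumes "satlas A" "satlas B" "smap A (pts A) B f"
  shows "smap (tan_atlas A) (TB A) (tan_atlas B) (tmap B f)"
proof (rule smap_allI)
  show "tmap B f v \<in> pts (tan_atlas B)" if "v \<in> TB A" for v
    using tmap_TB[OF assms that] by (simp add: pts_tan)
  fix v U' \<phi>' V' \<psi>'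
  assume v: "v \<in> TB A" "(U', \<phi>') \<in> tan_atlas A" "(V', \<psi>') \<in> tan_atlas B" "v \<in> U'" "tmap B f v \<in> V'"
  obtain U \<phi> where U: "(U, \<phi>) \<in> A" "U' = {v \<in> TB A. pt v \<in> U}" "\<phi>' = tchart \<phi>"
    using tan_chartE[OF v(2)] .
  obtain V \<psi> where V: "(V, \<psi>) \<in> B" "V' = {v \<in> TB B. pt v \<in> V}" "\<psi>' = tchart \<psi>"
    using tan_chartE[OF v(3)] .
  have "pt v \<in> U" "f (pt v) \<in> V"
    using v U V tmap_TB[OF assms v(1)] by auto
  then obtain P g where P: "\<phi> (pt v) \<in> P" "loc_rep (pts A) U \<phi> V \<psi> f P g"
    using smapD[OF assms(3) TB_pt[OF v(1)] U(1) _ V(1)] by blast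
  show "\<exists>O' g. \<phi>' v \<in> O' \<and> loc_rep (TB A) U' \<phi>' V' \<psi>' (tmap B f) O' g"
    unfolding U V
    using loc_rep_tmap[OF assms U(1) V(1) P(2)] P(1) by (intro exI conjI) auto
qed (simp add: pts_tan)

text \<open>Smoothness of tangent maps, applied to the identity of \<open>A\<close>, whose tangent
  map is the identity of \<open>TB A\<close>.\<close>

lemma satlas_tan: "satlas A \<Longrightarrow> satlas (tan_atlas A)"
  unfolding satlas_def[of "tan_atlas A"] pts_tan
  by (rule smap_cong[OF smap_tmap[of A A "\<lambda>p. p"]]) (auto simp: satlas_def tmap_id)

lemma smap_pt:
  assumes "satlas A"
  shows "smap (tan_atlas A) (TB A) A pt"
proof (rule smapI[OF satlas_tan[OF assms] assms])
  fix v assume v: "v \<in> TB A"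
  obtain U \<phi> where U: "(U, \<phi>) \<in> A" "pt v \<in> U" using TB_pt[OF v] pts_chart by metis
  have "loc_rep (TB A) {v \<in> TB A. pt v \<in> U} (tchart \<phi>) U \<phi> pt UNIV fst"
    unfolding loc_rep_def using Cinf_linear[OF bounded_linear_fst open_UNIV Cinf_id[OF open_UNIV]] by auto
  then show "\<exists>U \<phi> V \<psi> P g. (U, \<phi>) \<in> tan_atlas A \<and> (V, \<psi>) \<in> A \<and> v \<in> U \<and> \<phi> v \<in> P \<and>
      loc_rep (TB A) U \<phi> V \<psi> pt P g"
    using tan_chartI[OF U(1)] U v by (intro exI conjI) auto
qed (simp add: pts_tan)

section \<open>Vectors with prescribed coordinates\<close>

text \<open>A variant of \<open>const_field\<close> that takes the coordinates themselves, so that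
  they may vary along a curve.\<close>

definition vec_at :: "('a, 'e::euclidean_space) atlas \<Rightarrow> ('a \<Rightarrow> 'e) \<Rightarrow> 'a \<Rightarrow> 'e \<Rightarrow> 'a tan" where
  "vec_at A \<phi> q k = (THE w. w \<in> TS A q \<and> dcoord \<phi> w = k)"

lemma const_field_vec_at: "const_field A \<phi> u q = vec_at A \<phi> q (dcoord \<phi> u)"
  unfolding const_field_def vec_at_def ..

lemma vec_at_dcoord:
  assumes "satlas A" "(U, \<phi>) \<in> A" "v \<in> TB A" "pt v \<in> U"
  shows "vec_at A \<phi> (pt v) (dcoord \<phi> v) = v"
  unfolding vec_at_def
  by (rule the_equality) (use assms(3,4) TB_eqI[OF assms(1) _ assms(3) _ assms(2)] in auto)

lemma vec_at:
  assumes "satlas A" "(U, \<phi>) \<in> A" "q \<in> U" "k \<in> dcoord \<phi> ` TS A q"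
  shows "vec_at A \<phi> q k \<in> TB A" "pt (vec_at A \<phi> q k) = q" "dcoord \<phi> (vec_at A \<phi> q k) = k"
  using assms vec_at_dcoord[OF assms(1,2)] by force+

text \<open>The condition on \<open>k\<close> refers to the model space at \<open>q 0\<close> alone,
  because it is the same subspace at all points of the chart.\<close>

lemma vec_at_curve:
  assumes "manifold n A" "(U, \<phi>) \<in> A" "curve A q" "q 0 \<in> U"
    and "open P" "0 \<in> P" "Cinf P k" "\<And>t. t \<in> P \<Longrightarrow> k t \<in> dcoord \<phi> ` TS A (q 0)"
  shows "curve (tan_atlas A) (\<lambda>t. vec_at A \<phi> (q t) (k t))"
    "\<forall>\<^sub>F t in nhds 0. vec_at A \<phi> (q t) (k t) \<in> TB A \<and> pt (vec_at A \<phi> (q t) (k t)) = q t \<and>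
      dcoord \<phi> (vec_at A \<phi> (q t) (k t)) = k t"
proof -
  have sA: "satlas A" using manifold_satlas assms(1) .
  obtain K where K: "\<And>p. p \<in> U \<Longrightarrow> dcoord \<phi> ` TS A p = K"
    using manifold_spaceE[OF assms(1,2)] by metis
  obtain Q c where Q: "open Q" "0 \<in> Q" "Cinf Q c" "\<And>t. t \<in> Q \<Longrightarrow> q t \<in> U \<and> \<phi> (q t) = c t"
    by (rule curveD[OF sA assms(3,2,4)]) blast
  have o: "open (P \<inter> Q)" "0 \<in> P \<inter> Q" using assms(5,6) Q by auto
  have v: "vec_at A \<phi> (q t) (k t) \<in> TB A" "pt (vec_at A \<phi> (q t) (k t)) = q t"
      "dcoord \<phi> (vec_at A \<phi> (q t) (k t)) = k t" if "t \<in> P \<inter> Q" for t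
    using vec_at[OF sA assms(2), of "q t" "k t"] that Q(4)[of t] assms(8)[of t] K[of "q t"] K[OF assms(4)]
    by auto
  show "\<forall>\<^sub>F t in nhds 0. vec_at A \<phi> (q t) (k t) \<in> TB A \<and> pt (vec_at A \<phi> (q t) (k t)) = q t \<and>
      dcoord \<phi> (vec_at A \<phi> (q t) (k t)) = k t"
    using eventually_nhds_in_open[OF o] by eventually_elim (use v in blast)
  show "curve (tan_atlas A) (\<lambda>t. vec_at A \<phi> (q t) (k t))"
  proof (rule curveI[OF satlas_tan[OF sA] tan_chartI[OF assms(2)] o])
    show "Cinf (P \<inter> Q) (\<lambda>t. (c t, k t))"
      using o assms(7) Q(3) by (intro Cinf_Pair) (auto intro: Cinf_subset)
    show "\<forall>\<^sub>F t in nhds 0. vec_at A \<phi> (q t) (k t) \<in> {v \<in> TB A. pt v \<in> U} \<and>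
        tchart \<phi> (vec_at A \<phi> (q t) (k t)) = (c t, k t)"
      using eventually_nhds_in_open[OF o] by eventually_elim (use v Q(4) in auto)
  qed
qed

lemma tan_curveD:
  assumes "satlas A" "curve (tan_atlas A) X" "(U, \<phi>) \<in> A" "pt (X 0) \<in> U"
  obtains P c k where "open P" "0 \<in> P" "Cinf P c" "Cinf P k"
    "\<And>t. t \<in> P \<Longrightarrow> X t \<in> TB A \<and> pt (X t) \<in> U \<and> \<phi> (pt (X t)) = c t \<and> dcoord \<phi> (X t) = k t"
proof -
  have "X 0 \<in> {v \<in> TB A. pt v \<in> U}" using curve_pts[OF assms(2)] assms(4) by (simp add: pts_tan)
  then obtain P h where P: "open P" "0 \<in> P" "Cinf P h"
      "\<And>t. t \<in> P \<Longrightarrow> X t \<in> {v \<in> TB A. pt v \<in> U} \<and> tchart \<phi> (X t) = h t"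
    by (rule curveD[OF satlas_tan[OF assms(1)] assms(2) tan_chartI[OF assms(3)]]) blast
  have "X t \<in> TB A \<and> pt (X t) \<in> U \<and> \<phi> (pt (X t)) = fst (h t) \<and> dcoord \<phi> (X t) = snd (h t)"
    if "t \<in> P" for t
    using P(4)[OF that] by (auto simp: prod_eq_iff)
  then show thesis
    by (rule that[OF P(1,2) Cinf_fst[OF P(1,3)] Cinf_snd[OF P(1,3)]])
qed

lemma smap_pt': "satlas A \<Longrightarrow> smap (tan_atlas A) (pts (tan_atlas A)) A pt"
  using smap_pt by (simp add: pts_tan)

lemma dcoord_tmap_pt:
  assumes "satlas A" "V \<in> TB (tan_atlas A)" "(U, \<phi>) \<in> A" "pt (pt V) \<in> U"
  shows "dcoord \<phi> (tmap A pt V) = fst (dcoord (tchart \<phi>) V)"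
proof -
  obtain X where X: "curve (tan_atlas A) X" "V = velocity (tan_atlas A) X" "X 0 = pt V"
    using TB_velocity[OF assms(2)] .
  have X0: "X 0 \<in> {v \<in> TB A. pt v \<in> U}" using curve_pts[OF X(1)] assms(4) X(3) by (simp add: pts_tan)
  have c: "curve A (\<lambda>t. pt (X t))"
    using curve_compose[OF satlas_tan[OF assms(1)] assms(1) X(1) curve_ev_pts[OF satlas_tan[OF assms(1)] X(1)]
        smap_pt'[OF assms(1)]] .
  have "((\<lambda>t. fst (tchart \<phi> (X t))) has_vector_derivative fst (dcoord (tchart \<phi>) V)) (at 0)"
    unfolding X(2)
    by (rule bounded_linear.has_vector_derivative[OF bounded_linear_fst
          dcoord_has_vd[OF satlas_tan[OF assms(1)] X(1) tan_chartI[OF assms(3)] X0]])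
  then show ?thesis
    using dcoord_velocityI[OF c assms(3)] assms(4) X(3)
    unfolding X(2) tmap_velocity[OF satlas_tan[OF assms(1)] assms(1) smap_pt'[OF assms(1)] X(1)]
    by simp
qed

section \<open>The canonical involution\<close>

text \<open>The change of induced coordinates on the double tangent bundle. \<open>v\<close> and
  \<open>dx\<close> mix only through the second derivative of \<open>g\<close>, whose symmetry
  allows the involution to exchange them.\<close>

lemma frechet_trep:
  assumes "Cinf P g" "open P" "x \<in> P"
  shows "frechet_derivative (trep g) (at (x, v)) (dx, dv) = (frechet_derivative g (at x) dx,
    frechet_derivative (\<lambda>y. frechet_derivative g (at y) v) (at x) dx + frechet_derivative g (at x) dv)"
proof -
  let ?H = "\<lambda>z. frechet_derivative g (at (fst z)) (snd z)"
  have o: "open (P \<times> (UNIV :: 'a set))" and xv: "(x, v) \<in> P \<times> UNIV"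
    using assms by (auto intro: open_Times)
  have "Cinf (P \<times> UNIV) ?H"
    using assms by (intro Cinf_frechet_joint[of P g] Cinf_fst Cinf_snd Cinf_id o) auto
  then obtain D where D: "(?H has_derivative D) (at (x, v))"
    using Cinf_has_derivative[OF _ xv] by blast
  have g: "(g has_derivative frechet_derivative g (at x)) (at x)"
    using Cinf_has_derivative[OF assms(1,3)] .
  have g1: "((\<lambda>z. g (fst z)) has_derivative (\<lambda>d. frechet_derivative g (at x) (fst d))) (at (x, v))"
    by (rule has_derivative_compose[where g = g]) (use g in \<open>auto intro!: derivative_eq_intros\<close>)
  have "(trep g has_derivative (\<lambda>d. (frechet_derivative g (at x) (fst d), D d))) (at (x, v))"
    unfolding trep_def by (rule has_derivative_Pair[OF g1 D])
  then have 1: "frechet_derivative (trep g) (at (x, v)) (dx, dv) = (frechet_derivative g (at x) dx, D (dx, dv))"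
    by (simp flip: frechet_derivative_at)
  have "((\<lambda>y. ?H (y, v)) has_derivative (\<lambda>d. D (d, 0))) (at x)"
    by (rule has_derivative_compose[where g = ?H and f = "\<lambda>y. (y, v)", OF _ D])
      (auto intro!: derivative_eq_intros)
  then have 2: "D (dx, 0) = frechet_derivative (\<lambda>y. frechet_derivative g (at y) v) (at x) dx"
    by (simp flip: frechet_derivative_at)
  have "((\<lambda>w. ?H (x, w)) has_derivative (\<lambda>d. D (0, d))) (at v)"
    by (rule has_derivative_compose[where g = ?H and f = "\<lambda>w. (x, w)", OF _ D])
      (auto intro!: derivative_eq_intros)
  moreover have "((\<lambda>w. ?H (x, w)) has_derivative frechet_derivative g (at x)) (at v)"
    using has_derivative_bounded_linear[OF g] by (auto intro: bounded_linear_imp_has_derivative)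
  ultimately have 3: "D (0, dv) = frechet_derivative g (at x) dv"
    using has_derivative_unique by metis
  have "D (dx, dv) = D (dx, 0) + D (0, dv)"
    using linear_add[OF has_derivative_linear[OF D], of "(dx, 0)" "(0, dv)"] by simp
  then show ?thesis using 1 2 3 by simp
qed

lemma loc_rep_tan_change:
  assumes "satlas A" "(U, \<phi>) \<in> A" "(V, \<psi>) \<in> A" "loc_rep (pts A) U \<phi> V \<psi> (\<lambda>p. p) P g"
  shows "loc_rep (pts (tan_atlas A)) {v \<in> TB A. pt v \<in> U} (tchart \<phi>) {v \<in> TB A. pt v \<in> V} (tchart \<psi>) (\<lambda>v. v)
    (P \<times> UNIV) (trep g)"
  using loc_rep_tmap[OF assms(1,1) assms(1)[unfolded satlas_def] assms(2-4)] tmap_id[OF assms(1)]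
  unfolding loc_rep_def pts_tan by auto

text \<open>The involution is well defined because second derivatives are symmetric.\<close>

lemma tan_flip:
  assumes "manifold n A" "V \<in> TB (tan_atlas A)"
  shows "tan_flip A V \<in> TB (tan_atlas A)" "tmap A pt (tan_flip A V) = pt V"
proof -
  have sA: "satlas A" using manifold_satlas assms(1) .
  have sT: "satlas (tan_atlas A)" using satlas_tan sA .
  define p where "p = pt (pt V)"
  have ptV: "pt V \<in> TB A" using TB_pt[OF assms(2)] by (simp add: pts_tan)
  obtain U \<phi> where U: "(U, \<phi>) \<in> A" "p \<in> U"
    using TB_pt[OF ptV] unfolding p_def by (rule pts_chart)
  obtain K where K: "inj_on \<phi> U" "subspace K" "openin (top_of_set K) (\<phi> ` U)"
      "\<And>p. p \<in> U \<Longrightarrow> dcoord \<phi> ` TS A p = K"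
    by (rule manifold_spaceE[OF assms(1) U(1)]) blast
  define v where "v = dcoord \<phi> (pt V)"
  obtain dx dv where d: "dcoord (tchart \<phi>) V = (dx, dv)" by fastforce
  obtain X where X: "curve (tan_atlas A) X" "V = velocity (tan_atlas A) X" "X 0 = pt V"
    using TB_velocity[OF assms(2)] .
  have X0: "pt (X 0) \<in> U" "X 0 \<in> {v \<in> TB A. pt v \<in> U}" using U X(3) ptV by (auto simp: p_def)
  obtain P c k where P: "open P" "0 \<in> P" "Cinf P c" "Cinf P k"
    "\<And>t. t \<in> P \<Longrightarrow> X t \<in> TB A \<and> pt (X t) \<in> U \<and> \<phi> (pt (X t)) = c t \<and> dcoord \<phi> (X t) = k t"
    by (rule tan_curveD[OF sA X(1) U(1) X0(1)]) blast
  have Xd: "((\<lambda>t. tchart \<phi> (X t)) has_vector_derivative (dx, dv)) (at 0)"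
    using dcoord_has_vd[OF sT X(1) tan_chartI[OF U(1)] X0(2)] d X(2) by simp
  have vK: "v \<in> K" unfolding v_def using K(4)[OF U(2)] ptV by (auto simp: p_def)
  have "\<phi> (pt (X t)) \<in> K \<and> dcoord \<phi> (X t) \<in> K" if "t \<in> P" for t
    using P(5)[OF that] K(4)[of "pt (X t)"] openin_imp_subset[OF K(3)]
    by (metis TS_iff image_eqI image_subset_iff)
  then have "\<forall>\<^sub>F t in nhds 0. \<phi> (pt (X t)) \<in> K \<and> dcoord \<phi> (X t) \<in> K"
    using P(1,2) unfolding eventually_nhds by blast
  then have dK: "dx \<in> K" "dv \<in> K"
    using has_vector_derivative_in_subspace[OF _ K(2), of "\<lambda>t. fst (tchart \<phi> (X t))" dx]
      has_vector_derivative_in_subspace[OF _ K(2), of "\<lambda>t. snd (tchart \<phi> (X t))" dv]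
      bounded_linear.has_vector_derivative[OF bounded_linear_fst Xd]
      bounded_linear.has_vector_derivative[OF bounded_linear_snd Xd]
    by (auto simp: eventually_conj_iff)
  \<comment> \<open>A representative of the flipped vector: the old fibre coordinate
    \<open>v\<close> becomes the velocity of the base point, and the old base velocity
    \<open>dx\<close> the initial fibre coordinate.\<close>
  let ?q = "\<lambda>t. inv_into U \<phi> (\<phi> p + t *\<^sub>R v)" and ?k = "\<lambda>t. dx + t *\<^sub>R dv"
  have xK: "\<phi> p \<in> K" using openin_imp_subset[OF K(3)] U(2) by blast
  have q: "curve A ?q" "?q 0 = p" "\<forall>\<^sub>F t in nhds 0. ?q t \<in> U \<and> \<phi> (?q t) = \<phi> p + t *\<^sub>R v"
    using model_curve[OF sA U(1) K(1,3) open_UNIV UNIV_I Cinf_line, of "\<phi> p" v p] xK vK K(2) U(2)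
    by (simp_all add: subspace_add subspace_scale)
  have q0: "?q 0 \<in> U" using q(2) U(2) by simp
  let ?Y = "\<lambda>t. vec_at A \<phi> (?q t) (?k t)"
  have kK: "?k t \<in> dcoord \<phi> ` TS A (?q 0)" for t
    using K(4)[OF q0] dK K(2) by (simp add: subspace_add subspace_scale)
  note Y = vec_at_curve[OF assms(1) U(1) q(1) q0 open_UNIV UNIV_I Cinf_line kK]
  define W where "W = velocity (tan_atlas A) ?Y"
  have W: "W \<in> TB (tan_atlas A)" "pt W = ?Y 0" using velocity_TB[OF Y(1)] Y(1) by (simp_all add: W_def)
  have Y0: "?Y 0 \<in> TB A" "pt (?Y 0) = p" "dcoord \<phi> (?Y 0) = dx"
    using eventually_nhds_x_imp_x[OF Y(2)] q(2) by auto
  have "((\<lambda>t. (\<phi> p + t *\<^sub>R v, ?k t)) has_vector_derivative (v, dv)) (at 0)"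
    by (intro has_vector_derivative_Pair has_vector_derivative_line)
  moreover have "\<forall>\<^sub>F t in nhds 0. (\<phi> p + t *\<^sub>R v, ?k t) = tchart \<phi> (?Y t)"
    using Y(2) q(3) by eventually_elim auto
  then obtain Q where "open Q" "0 \<in> Q" "\<And>t. t \<in> Q \<Longrightarrow> (\<phi> p + t *\<^sub>R v, ?k t) = tchart \<phi> (?Y t)"
    unfolding eventually_nhds by blast
  ultimately have "((\<lambda>t. tchart \<phi> (?Y t)) has_vector_derivative (v, dv)) (at 0)"
    by (rule has_vector_derivative_transform_within_open)
  then have dW: "dcoord (tchart \<phi>) W = (v, dv)"
    unfolding W_def using dcoord_velocityI[OF Y(1) tan_chartI[OF U(1)]] Y0 U(2) by simp
  have flip: "dcoord \<psi> (pt W) = fst (dcoord (tchart \<psi>) V)"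
      "dcoord (tchart \<psi>) W = (dcoord \<psi> (pt V), snd (dcoord (tchart \<psi>) V))"
    if V': "(V', \<psi>) \<in> A" "p \<in> V'" for V' \<psi>
  proof -
    obtain R g where R: "\<phi> p \<in> R" "loc_rep (pts A) U \<phi> V' \<psi> (\<lambda>p. p) R g"
      using smapD[OF sA[unfolded satlas_def] chart_pts[OF U] U V'] .
    have g: "Cinf R g" "open R" using R(2) by (auto simp: loc_rep_def)
    note ch = loc_rep_tan_change[OF sA U(1) V'(1) R(2)]
    \<comment> \<open>In another chart both vectors are images under derivatives of
      \<open>trep g\<close>, with \<open>v\<close> and \<open>dx\<close> exchanged.\<close>
    have "dcoord (tchart \<psi>) V = frechet_derivative (trep g) (at (\<phi> p, v)) (dx, dv)"
      using dcoord_change[OF sT assms(2) tan_chartI[OF U(1)] _ tan_chartI[OF V'(1)] ch] ptV U(2) R(1) d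
      by (simp add: p_def v_def)
    moreover have "dcoord (tchart \<psi>) W = frechet_derivative (trep g) (at (\<phi> p, dx)) (v, dv)"
      using dcoord_change[OF sT W(1) tan_chartI[OF U(1)] _ tan_chartI[OF V'(1)] ch] W(2) Y0 U(2) R(1) dW
      by simp
    moreover have "dcoord \<psi> (pt V) = frechet_derivative g (at (\<phi> p)) v"
      using dcoord_change[OF sA ptV U(1) _ V'(1) R(2)] U(2) R(1) by (simp add: p_def v_def)
    moreover have "dcoord \<psi> (pt W) = frechet_derivative g (at (\<phi> p)) dx"
      using dcoord_change[OF sA _ U(1) _ V'(1) R(2), of "pt W"] W(2) Y0 U(2) R(1) by simp
    ultimately show "dcoord \<psi> (pt W) = fst (dcoord (tchart \<psi>) V)"
      "dcoord (tchart \<psi>) W = (dcoord \<psi> (pt V), snd (dcoord (tchart \<psi>) V))"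
      using frechet_derivative_commute[OF g R(1), of v dx] by (simp_all add: frechet_trep[OF g R(1)])
  qed
  have "tan_flip A V = W"
    unfolding tan_flip_def
  proof (rule the_equality)
    show "W \<in> TB (tan_atlas A) \<and> pt (pt W) = pt (pt V) \<and>
        (\<forall>(U, \<phi>)\<in>A. pt (pt V) \<in> U \<longrightarrow> dcoord \<phi> (pt W) = fst (dcoord (tchart \<phi>) V) \<and>
          dcoord (tchart \<phi>) W = (dcoord \<phi> (pt V), snd (dcoord (tchart \<phi>) V)))"
      using W Y0 flip by (auto simp: p_def)
    fix W' assume W': "W' \<in> TB (tan_atlas A) \<and> pt (pt W') = pt (pt V) \<and>
        (\<forall>(U, \<phi>)\<in>A. pt (pt V) \<in> U \<longrightarrow> dcoord \<phi> (pt W') = fst (dcoord (tchart \<phi>) V) \<and>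
          dcoord (tchart \<phi>) W' = (dcoord \<phi> (pt V), snd (dcoord (tchart \<phi>) V)))"
    then have W'U: "dcoord \<phi> (pt W') = dx" "dcoord (tchart \<phi>) W' = (v, dv)"
      using U d by (auto simp: p_def v_def)
    have ptW': "pt W' \<in> TB A" using W' TB_pt[of W' "tan_atlas A"] by (simp add: pts_tan)
    \<comment> \<open>Uniqueness in two stages: the base points of \<open>W'\<close> and
      \<open>W\<close> are themselves tangent vectors and have to be identified first.\<close>
    have "pt W' = pt W"
      by (rule TB_eqI[OF sA ptW' _ _ U(1)]) (use W' W'U W Y0 U(2) in \<open>auto simp: p_def\<close>)
    then show "W' = W"
      using TB_eqI[OF sT conjunct1[OF W'] W(1) _ tan_chartI[OF U(1)]] W'U(2) dW ptW' W' U(2)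
      by (auto simp: p_def)
  qed
  moreover have "tmap A pt W = pt V"
  proof (rule TB_eqI[OF sA _ ptV _ U(1)])
    show "tmap A pt W \<in> TB A" "pt (tmap A pt W) = pt (pt V)" "pt (tmap A pt W) \<in> U"
      using tmap_TB[OF sT sA smap_pt'[OF sA] W(1)] W(2) Y0(2) U(2) by (auto simp: p_def)
    show "dcoord \<phi> (tmap A pt W) = dcoord \<phi> (pt V)"
      using dcoord_tmap_pt[OF sA W(1) U(1)] W(2) Y0(2) U(2) dW by (simp add: v_def)
  qed
  ultimately show "tan_flip A V \<in> TB (tan_atlas A)" "tmap A pt (tan_flip A V) = pt V"
    using W(1) by simp_all
qed


section \<open>The cotangent bundle\<close>

definition lin_on :: "'e::real_vector set \<Rightarrow> ('e \<Rightarrow> real) \<Rightarrow> bool" where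
  "lin_on K l \<longleftrightarrow> (\<forall>x\<in>K. \<forall>y\<in>K. \<forall>a b. l (a *\<^sub>R x + b *\<^sub>R y) = a * l x + b * l y)"

lemma lin_on_sum:
  assumes "lin_on K l" "subspace K" "finite B" "B \<subseteq> K"
  shows "l (\<Sum>b\<in>B. c b *\<^sub>R b) = (\<Sum>b\<in>B. c b * l b)"
  using assms(3,4)
proof (induction rule: finite_induct)
  case empty
  have "l (0 *\<^sub>R 0 + 0 *\<^sub>R 0) = 0"
    using assms(1) subspace_0[OF assms(2)] unfolding lin_on_def by (metis add_0 mult_zero_left)
  then show ?case by simp
next
  case (insert b B)
  have "(\<Sum>b\<in>B. c b *\<^sub>R b) \<in> K"
    using insert.prems assms(2) by (intro subspace_sum subspace_scale) auto
  then have "l (c b *\<^sub>R b + 1 *\<^sub>R (\<Sum>b\<in>B. c b *\<^sub>R b)) = c b * l b + 1 * l (\<Sum>b\<in>B. c b *\<^sub>R b)"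
    using assms(1) insert.prems unfolding lin_on_def by blast
  then show ?case using insert by simp
qed

text \<open>Only the expansion property of an orthonormal basis is recorded; it turns functionals on
  \<open>K\<close> into vectors of \<open>K\<close>.\<close>

lemma subspace_onbE:
  fixes K :: "'e::euclidean_space set"
  assumes "subspace K"
  obtains B where "finite B" "B \<subseteq> K" "\<And>k. k \<in> K \<Longrightarrow> (\<Sum>b\<in>B. (k \<bullet> b) *\<^sub>R b) = k"
proof -
  obtain B where B: "B \<subseteq> K" "pairwise orthogonal B" "\<And>x. x \<in> B \<Longrightarrow> norm x = 1" "independent B" "span B = K"
    using orthonormal_basis_subspace[OF assms] by metis
  show thesis
    using that[of B] B independent_imp_finite[OF B(4)] orthonormal_basis_expand[OF B(2,3)] by blast
qed

lemma lin_on_cot: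
  assumes "manifold n A" "(U, \<phi>) \<in> A" "\<alpha> \<in> CB A" "fst \<alpha> \<in> U"
  shows "lin_on (dcoord \<phi> ` TS A (fst \<alpha>)) (\<lambda>k. snd \<alpha> (vec_at A \<phi> (fst \<alpha>) k))"
  unfolding lin_on_def
proof (intro ballI allI)
  have sA: "satlas A" using manifold_satlas assms(1) .
  let ?v = "vec_at A \<phi> (fst \<alpha>)"
  fix x y a b assume xy: "x \<in> dcoord \<phi> ` TS A (fst \<alpha>)" "y \<in> dcoord \<phi> ` TS A (fst \<alpha>)"
  have v: "?v x \<in> TS A (fst \<alpha>)" "?v y \<in> TS A (fst \<alpha>)" "dcoord \<phi> (?v x) = x" "dcoord \<phi> (?v y) = y"
    using vec_at[OF sA assms(2,4)] xy by auto
  have t: "dcoord \<phi> (tlin A a (?v x) b (?v y)) = a *\<^sub>R x + b *\<^sub>R y"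
    using tlin(2)[OF assms(1) v(1,2) assms(2,4)] v(3,4) by simp
  have m: "tlin A a (?v x) b (?v y) \<in> TB A" "pt (tlin A a (?v x) b (?v y)) = fst \<alpha>"
    using tlin(1)[OF assms(1) v(1,2)] by auto
  have "?v (a *\<^sub>R x + b *\<^sub>R y) = tlin A a (?v x) b (?v y)"
    using vec_at_dcoord[OF sA assms(2) m(1)] m(2) assms(4) t by simp
  then show "snd \<alpha> (?v (a *\<^sub>R x + b *\<^sub>R y)) = a * snd \<alpha> (?v x) + b * snd \<alpha> (?v y)"
    using assms(3) v(1,2) unfolding CB_def by auto
qed

text \<open>The difference of two candidates lies in the model subspace, so it is the coordinate
  vector of some tangent vector; testing on that vector shows that the difference has norm
  0.\<close>

lemma ccoord_unique:
  assumes "manifold n A" "(U, \<phi>) \<in> A" "fst \<alpha> \<in> U" "y \<in> dcoord \<phi> ` TS A (fst \<alpha>)"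
    "\<And>v. v \<in> TS A (fst \<alpha>) \<Longrightarrow> snd \<alpha> v = y \<bullet> dcoord \<phi> v"
  shows "ccoord A \<phi> \<alpha> = y"
  unfolding ccoord_def
proof (rule the_equality)
  fix z assume z: "z \<in> dcoord \<phi> ` TS A (fst \<alpha>) \<and> (\<forall>v\<in>TS A (fst \<alpha>). snd \<alpha> v = z \<bullet> dcoord \<phi> v)"
  obtain K where K: "subspace K" "\<And>p. p \<in> U \<Longrightarrow> dcoord \<phi> ` TS A p = K"
    using manifold_spaceE[OF assms(1,2)] by metis
  have "z - y \<in> dcoord \<phi> ` TS A (fst \<alpha>)"
    using z assms(4) K(2)[OF assms(3)] subspace_diff[OF K(1)] by auto
  then obtain v where v: "v \<in> TS A (fst \<alpha>)" "dcoord \<phi> v = z - y" by (auto simp: image_iff)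
  have "z \<bullet> (z - y) = y \<bullet> (z - y)"
    using z assms(5)[OF v(1)] v by (metis)
  then have "(z - y) \<bullet> (z - y) = 0" by (simp add: inner_diff_left)
  then show "z = y" by simp
qed (use assms in blast)

text \<open>Riesz representation in the model subspace: the coefficients of \<open>y\<close> on the
  vectors of \<open>B\<close> are the values of the functional there.\<close>

lemma ccoord:
  assumes "manifold n A" "(U, \<phi>) \<in> A" "\<alpha> \<in> CB A" "fst \<alpha> \<in> U"
  shows "ccoord A \<phi> \<alpha> \<in> dcoord \<phi> ` TS A (fst \<alpha>)"
    "v \<in> TB A \<Longrightarrow> pt v = fst \<alpha> \<Longrightarrow> snd \<alpha> v = ccoord A \<phi> \<alpha> \<bullet> dcoord \<phi> v"
proof -
  have sA: "satlas A" using manifold_satlas assms(1) .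
  obtain K where K: "subspace K" "\<And>p. p \<in> U \<Longrightarrow> dcoord \<phi> ` TS A p = K"
    using manifold_spaceE[OF assms(1,2)] by metis
  note Kp = K(2)[OF assms(4)]
  obtain B where B: "finite B" "B \<subseteq> K" "\<And>k. k \<in> K \<Longrightarrow> (\<Sum>b\<in>B. (k \<bullet> b) *\<^sub>R b) = k"
    using subspace_onbE[OF K(1)] by metis
  let ?l = "\<lambda>k. snd \<alpha> (vec_at A \<phi> (fst \<alpha>) k)"
  have lin: "lin_on K ?l" using lin_on_cot[OF assms] Kp by simp
  define y where "y = (\<Sum>b\<in>B. ?l b *\<^sub>R b)"
  have yK: "y \<in> dcoord \<phi> ` TS A (fst \<alpha>)"
    unfolding Kp y_def using B(2) K(1) by (intro subspace_sum subspace_scale) auto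
  have y: "snd \<alpha> v = y \<bullet> dcoord \<phi> v" if v: "v \<in> TS A (fst \<alpha>)" for v
  proof -
    have "dcoord \<phi> v \<in> K" using v Kp by auto
    then have "snd \<alpha> v = ?l (\<Sum>b\<in>B. (dcoord \<phi> v \<bullet> b) *\<^sub>R b)"
      using B(3) vec_at_dcoord[OF sA assms(2)] v assms(4) by force
    also have "\<dots> = y \<bullet> dcoord \<phi> v"
      unfolding lin_on_sum[OF lin K(1) B(1,2)] y_def
      by (simp add: inner_sum_left mult.commute) (simp add: inner_commute)
    finally show ?thesis .
  qed
  have "ccoord A \<phi> \<alpha> = y"
    using ccoord_unique[OF assms(1,2,4) yK y] .
  then show "ccoord A \<phi> \<alpha> \<in> dcoord \<phi> ` TS A (fst \<alpha>)"
    "v \<in> TB A \<Longrightarrow> pt v = fst \<alpha> \<Longrightarrow> snd \<alpha> v = ccoord A \<phi> \<alpha> \<bullet> dcoord \<phi> v"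
    using yK y by simp_all
qed

lemma CB_pts: "\<alpha> \<in> CB A \<Longrightarrow> fst \<alpha> \<in> pts A"
  unfolding CB_def by auto

lemma CB_eqI:
  assumes "\<alpha> \<in> CB A" "\<beta> \<in> CB A" "fst \<alpha> = fst \<beta>" "\<And>v. v \<in> TS A (fst \<alpha>) \<Longrightarrow> snd \<alpha> v = snd \<beta> v"
  shows "\<alpha> = \<beta>"
proof (rule prod_eqI[OF assms(3)], rule ext)
  fix v show "snd \<alpha> v = snd \<beta> v"
    using assms unfolding CB_def by (cases "v \<in> TS A (fst \<alpha>)") auto
qed

text \<open>Covectors transform by the transposed derivative of the inverse transition map
  \<open>h\<close>. The sum over \<open>B\<close> projects the transposed image to the model
  subspace of the new chart, where \<open>ccoord\<close> has to lie.\<close>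

lemma ccoord_change:
  assumes "manifold n A" "(U, \<phi>) \<in> A" "(V, \<psi>) \<in> A" "p \<in> U" "p \<in> V"
  obtains P g S where "\<phi> p \<in> P" "loc_rep (pts A) U \<phi> V \<psi> (\<lambda>p. p) P g" "Cinf (P \<times> UNIV) S"
    "\<And>\<alpha>. \<alpha> \<in> CB A \<Longrightarrow> fst \<alpha> \<in> U \<Longrightarrow> \<phi> (fst \<alpha>) \<in> P \<Longrightarrow> ccoord A \<psi> \<alpha> = S (\<phi> (fst \<alpha>), ccoord A \<phi> \<alpha>)"
proof -
  have sA: "satlas A" using manifold_satlas assms(1) .
  have p: "p \<in> pts A" using chart_pts[OF assms(2,4)] .
  obtain P g where P: "\<phi> p \<in> P" "loc_rep (pts A) U \<phi> V \<psi> (\<lambda>p. p) P g"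
    using smapD[OF sA[unfolded satlas_def] p assms(2,4,3,5)] .
  obtain Q h where Q: "\<psi> p \<in> Q" "loc_rep (pts A) V \<psi> U \<phi> (\<lambda>p. p) Q h"
    using smapD[OF sA[unfolded satlas_def] p assms(3,5,2,4)] .
  obtain K where K: "subspace K" "\<And>p. p \<in> V \<Longrightarrow> dcoord \<psi> ` TS A p = K"
    using manifold_spaceE[OF assms(1,3)] by metis
  obtain B where B: "finite B" "B \<subseteq> K" "\<And>k. k \<in> K \<Longrightarrow> (\<Sum>b\<in>B. (k \<bullet> b) *\<^sub>R b) = k"
    using subspace_onbE[OF K(1)] by metis
  let ?R = "P \<inter> g -` Q"
  let ?S = "\<lambda>x. \<Sum>b\<in>B. (snd x \<bullet> frechet_derivative h (at (g (fst x))) b) *\<^sub>R b"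
  have g: "open P" "Cinf P g" and h: "open Q" "Cinf Q h" using P Q by (auto simp: loc_rep_def)
  have o: "open ?R" using Cinf_open_vimage[OF g(2,1) h(1)] .
  have oU: "open (?R \<times> (UNIV :: 'b set))" using o by (intro open_Times) auto
  show thesis
  proof (rule that)
    have "\<psi> p = g (\<phi> p)" using P p assms(4) unfolding loc_rep_def by blast
    then show "\<phi> p \<in> ?R" using P(1) Q(1) by simp
    show "loc_rep (pts A) U \<phi> V \<psi> (\<lambda>p. p) ?R g"
      using P(2) o Cinf_subset[OF g(2), of ?R] by (auto simp: loc_rep_def)
    show "Cinf (?R \<times> UNIV) ?S"
    proof (intro Cinf_sum Cinf_scaleR Cinf_inner Cinf_const oU Cinf_snd Cinf_id)
      fix b
      have "Cinf ?R (\<lambda>x. frechet_derivative h (at (g x)) b)"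
        using g h o by (intro Cinf_frechet_joint[of Q h] Cinf_const) (auto intro: Cinf_subset)
      then show "Cinf (?R \<times> UNIV) (\<lambda>x. frechet_derivative h (at (g (fst x))) b)"
        by (rule Cinf_fst_on[OF _ o open_UNIV])
    qed
    fix \<alpha> assume \<alpha>: "\<alpha> \<in> CB A" "fst \<alpha> \<in> U" "\<phi> (fst \<alpha>) \<in> ?R"
    then have q: "fst \<alpha> \<in> V" "\<psi> (fst \<alpha>) = g (\<phi> (fst \<alpha>))" "g (\<phi> (fst \<alpha>)) \<in> Q"
      using P(2) CB_pts[OF \<alpha>(1)] by (auto simp: loc_rep_def)
    let ?a = "ccoord A \<phi> \<alpha>" and ?D = "frechet_derivative h (at (g (\<phi> (fst \<alpha>))))"
    have lin: "linear ?D" using loc_rep_linear[OF Q(2) q(3)] .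
    show "ccoord A \<psi> \<alpha> = ?S (\<phi> (fst \<alpha>), ?a)"
    proof (rule ccoord_unique[OF assms(1,3) q(1)])
      show "?S (\<phi> (fst \<alpha>), ?a) \<in> dcoord \<psi> ` TS A (fst \<alpha>)"
        unfolding K(2)[OF q(1)] using B(2) K(1) by (intro subspace_sum subspace_scale) auto
      fix v assume v: "v \<in> TS A (fst \<alpha>)"
      have vK: "dcoord \<psi> v \<in> K" using v K(2)[OF q(1)] by auto
      have "snd \<alpha> v = ?a \<bullet> dcoord \<phi> v"
        using ccoord(2)[OF assms(1,2) \<alpha>(1,2)] v by auto
      also have "dcoord \<phi> v = ?D (dcoord \<psi> v)"
        using dcoord_change[OF sA _ assms(3) _ assms(2) Q(2), of v] v q by auto
      also have "\<dots> = ?D (\<Sum>b\<in>B. (dcoord \<psi> v \<bullet> b) *\<^sub>R b)"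
        using B(3)[OF vK] by simp
      also have "\<dots> = (\<Sum>b\<in>B. (dcoord \<psi> v \<bullet> b) *\<^sub>R ?D b)"
        using lin by (simp add: linear_sum linear_cmul)
      also have "?a \<bullet> \<dots> = ?S (\<phi> (fst \<alpha>), ?a) \<bullet> dcoord \<psi> v"
        by (simp add: inner_sum_left inner_sum_right inner_commute mult.commute)
      finally show "snd \<alpha> v = ?S (\<phi> (fst \<alpha>), ?a) \<bullet> dcoord \<psi> v" .
    qed
  qed
qed

lemma cot_chartE:
  assumes "(V, \<psi>) \<in> cot_atlas A"
  obtains U \<phi> where "(U, \<phi>) \<in> A" "V = {\<alpha> \<in> CB A. fst \<alpha> \<in> U}" "\<psi> = (\<lambda>\<alpha>. (\<phi> (fst \<alpha>), ccoord A \<phi> \<alpha>))"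
  using assms unfolding cot_atlas_def by blast

lemma cot_chartI:
  "(U, \<phi>) \<in> A \<Longrightarrow> ({\<alpha> \<in> CB A. fst \<alpha> \<in> U}, \<lambda>\<alpha>. (\<phi> (fst \<alpha>), ccoord A \<phi> \<alpha>)) \<in> cot_atlas A"
  unfolding cot_atlas_def by blast

lemma pts_cot: "pts (cot_atlas A) = CB A"
proof (intro equalityI subsetI)
  fix v assume "v \<in> pts (cot_atlas A)"
  then obtain V \<psi> where V: "(V, \<psi>) \<in> cot_atlas A" "v \<in> V" by (rule pts_chart)
  show "v \<in> CB A" by (rule cot_chartE[OF V(1)]) (use V(2) in simp)
next
  fix v assume v: "v \<in> CB A"
  obtain U \<phi> where U: "(U, \<phi>) \<in> A" "fst v \<in> U" using CB_pts[OF v] by (rule pts_chart)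
  show "v \<in> pts (cot_atlas A)"
    by (rule chart_pts[OF cot_chartI[OF U(1)]]) (use v U(2) in simp)
qed

lemma satlas_cot:
  assumes "manifold n A"
  shows "satlas (cot_atlas A)"
  unfolding satlas_def
proof (rule smap_allI)
  fix \<alpha> U' \<phi>' V' \<psi>'
  assume a: "\<alpha> \<in> pts (cot_atlas A)" "(U', \<phi>') \<in> cot_atlas A" "(V', \<psi>') \<in> cot_atlas A" "\<alpha> \<in> U'" "\<alpha> \<in> V'"
  obtain U \<phi> where U: "(U, \<phi>) \<in> A" "U' = {\<alpha> \<in> CB A. fst \<alpha> \<in> U}" "\<phi>' = (\<lambda>\<alpha>. (\<phi> (fst \<alpha>), ccoord A \<phi> \<alpha>))"
    using cot_chartE[OF a(2)] .
  obtain V \<psi> where V: "(V, \<psi>) \<in> A" "V' = {\<alpha> \<in> CB A. fst \<alpha> \<in> V}" "\<psi>' = (\<lambda>\<alpha>. (\<psi> (fst \<alpha>), ccoord A \<psi> \<alpha>))"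
    using cot_chartE[OF a(3)] .
  have "fst \<alpha> \<in> U" "fst \<alpha> \<in> V" using a U V by auto
  then obtain P g S where P: "\<phi> (fst \<alpha>) \<in> P" "loc_rep (pts A) U \<phi> V \<psi> (\<lambda>p. p) P g" "Cinf (P \<times> UNIV) S"
    "\<And>\<alpha>. \<alpha> \<in> CB A \<Longrightarrow> fst \<alpha> \<in> U \<Longrightarrow> \<phi> (fst \<alpha>) \<in> P \<Longrightarrow> ccoord A \<psi> \<alpha> = S (\<phi> (fst \<alpha>), ccoord A \<phi> \<alpha>)"
    by (rule ccoord_change[OF assms U(1) V(1)]) blast
  have g: "open P" "Cinf P g" using P(2) by (auto simp: loc_rep_def)
  have "loc_rep (pts (cot_atlas A)) U' \<phi>' V' \<psi>' (\<lambda>p. p) (P \<times> UNIV) (\<lambda>x. (g (fst x), S x))"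
    unfolding loc_rep_def
  proof (intro conjI ballI impI)
    show "open (P \<times> (UNIV :: 'b set))" using g by (intro open_Times) auto
    then show "Cinf (P \<times> UNIV) (\<lambda>x. (g (fst x), S x))"
      using g P(3) by (intro Cinf_Pair Cinf_fst_on) auto
    fix \<beta> assume "\<beta> \<in> pts (cot_atlas A) \<inter> U'" "\<phi>' \<beta> \<in> P \<times> UNIV"
    then have b: "\<beta> \<in> CB A" "fst \<beta> \<in> U" "\<phi> (fst \<beta>) \<in> P" using U by auto
    then have "fst \<beta> \<in> V" "\<psi> (fst \<beta>) = g (\<phi> (fst \<beta>))"
      using P(2) CB_pts[OF b(1)] by (auto simp: loc_rep_def)
    then show "\<beta> \<in> V'" "\<psi>' \<beta> = (g (fst (\<phi>' \<beta>)), S (\<phi>' \<beta>))"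
      using b P(4)[OF b] U V by auto
  qed
  then show "\<exists>O' g. \<phi>' \<alpha> \<in> O' \<and> loc_rep (pts (cot_atlas A)) U' \<phi>' V' \<psi>' (\<lambda>p. p) O' g"
    using P(1) U(3) by (intro exI conjI) auto
qed auto

lemma smap_fst_cot:
  assumes "manifold n A"
  shows "smap (cot_atlas A) (CB A) A fst"
proof (rule smapI[OF satlas_cot[OF assms] manifold_satlas[OF assms]])
  fix v assume v: "v \<in> CB A"
  obtain U \<phi> where U: "(U, \<phi>) \<in> A" "fst v \<in> U" using CB_pts[OF v] by (rule pts_chart)
  have "loc_rep (CB A) {v \<in> CB A. fst v \<in> U} (\<lambda>\<alpha>. (\<phi> (fst \<alpha>), ccoord A \<phi> \<alpha>)) U \<phi> fst UNIV fst"
    unfolding loc_rep_def using Cinf_linear[OF bounded_linear_fst open_UNIV Cinf_id[OF open_UNIV]] by auto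
  then show "\<exists>U \<phi> V \<psi> P g. (U, \<phi>) \<in> cot_atlas A \<and> (V, \<psi>) \<in> A \<and> v \<in> U \<and> \<phi> v \<in> P \<and>
      loc_rep (CB A) U \<phi> V \<psi> fst P g"
    using cot_chartI[OF U(1)] U v by (intro exI conjI) auto
qed (simp add: pts_cot)

section \<open>The Pontryagin bundle\<close>

lemma pont_chartE:
  assumes "(V, \<psi>) \<in> pont_atlas A"
  obtains U \<phi> where "(U, \<phi>) \<in> A" "V = {l \<in> PB A. pt (fst l) \<in> U}"
    "\<psi> = (\<lambda>l. (\<phi> (pt (fst l)), pcoord A \<phi> l))"
  using assms unfolding pont_atlas_def by blast

lemma pont_chartI:
  "(U, \<phi>) \<in> A \<Longrightarrow> ({l \<in> PB A. pt (fst l) \<in> U}, \<lambda>l. (\<phi> (pt (fst l)), pcoord A \<phi> l)) \<in> pont_atlas A"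
  unfolding pont_atlas_def by blast

lemma PB_D: "l \<in> PB A \<Longrightarrow> fst l \<in> TB A" "l \<in> PB A \<Longrightarrow> snd l \<in> CB A" "l \<in> PB A \<Longrightarrow> fst (snd l) = pt (fst l)"
  unfolding PB_def by auto

lemma PB_iff: "l \<in> PB A \<longleftrightarrow> fst l \<in> TB A \<and> snd l \<in> CB A \<and> fst (snd l) = pt (fst l)"
  unfolding PB_def by auto

lemma pts_pont: "pts (pont_atlas A) = PB A"
proof (intro equalityI subsetI)
  fix v assume "v \<in> pts (pont_atlas A)"
  then obtain V \<psi> where V: "(V, \<psi>) \<in> pont_atlas A" "v \<in> V" by (rule pts_chart)
  show "v \<in> PB A" by (rule pont_chartE[OF V(1)]) (use V(2) in simp)
next
  fix v assume v: "v \<in> PB A"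
  obtain U \<phi> where U: "(U, \<phi>) \<in> A" "pt (fst v) \<in> U" using TB_pt[OF PB_D(1)[OF v]] by (rule pts_chart)
  show "v \<in> pts (pont_atlas A)"
    by (rule chart_pts[OF pont_chartI[OF U(1)]]) (use v U(2) in simp)
qed

lemma satlas_pont:
  assumes "manifold n A"
  shows "satlas (pont_atlas A)"
  unfolding satlas_def
proof (rule smap_allI)
  have sA: "satlas A" using manifold_satlas assms .
  fix l U' \<phi>' V' \<psi>'
  assume a: "l \<in> pts (pont_atlas A)" "(U', \<phi>') \<in> pont_atlas A" "(V', \<psi>') \<in> pont_atlas A" "l \<in> U'" "l \<in> V'"
  obtain U \<phi> where U: "(U, \<phi>) \<in> A" "U' = {l \<in> PB A. pt (fst l) \<in> U}"
      "\<phi>' = (\<lambda>l. (\<phi> (pt (fst l)), pcoord A \<phi> l))"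
    using pont_chartE[OF a(2)] .
  obtain V \<psi> where V: "(V, \<psi>) \<in> A" "V' = {l \<in> PB A. pt (fst l) \<in> V}"
      "\<psi>' = (\<lambda>l. (\<psi> (pt (fst l)), pcoord A \<psi> l))"
    using pont_chartE[OF a(3)] .
  have lUV: "pt (fst l) \<in> U" "pt (fst l) \<in> V" using a U V by auto
  then obtain P g S where P: "\<phi> (pt (fst l)) \<in> P" "loc_rep (pts A) U \<phi> V \<psi> (\<lambda>p. p) P g" "Cinf (P \<times> UNIV) S"
    "\<And>\<alpha>. \<alpha> \<in> CB A \<Longrightarrow> fst \<alpha> \<in> U \<Longrightarrow> \<phi> (fst \<alpha>) \<in> P \<Longrightarrow> ccoord A \<psi> \<alpha> = S (\<phi> (fst \<alpha>), ccoord A \<phi> \<alpha>)"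
    by (rule ccoord_change[OF assms U(1) V(1)]) blast
  have g: "open P" "Cinf P g" using P(2) by (auto simp: loc_rep_def)
  let ?h = "\<lambda>x. (g (fst x), frechet_derivative g (at (fst x)) (fst (snd x)), S (fst x, snd (snd x)))"
  have oU: "open (P \<times> (UNIV :: ('b \<times> 'b) set))" using g by (intro open_Times) auto
  have "loc_rep (pts (pont_atlas A)) U' \<phi>' V' \<psi>' (\<lambda>p. p) (P \<times> UNIV) ?h"
    unfolding loc_rep_def
  proof (intro conjI ballI impI oU)
    have pr: "Cinf (P \<times> (UNIV :: ('b \<times> 'b) set)) (\<lambda>x. fst x)" "Cinf (P \<times> (UNIV :: ('b \<times> 'b) set)) (\<lambda>x. fst (snd x))"
      "Cinf (P \<times> (UNIV :: ('b \<times> 'b) set)) (\<lambda>x. (fst x, snd (snd x)))"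
      by (intro Cinf_Pair Cinf_fst Cinf_snd Cinf_id oU)+
    have "Cinf (P \<times> UNIV) (\<lambda>x::'b \<times> 'b \<times> 'b. frechet_derivative g (at (fst x)) (fst (snd x)))"
      by (rule Cinf_frechet_joint[OF g(2,1) pr(1,2) oU]) auto
    moreover have "Cinf (P \<times> UNIV) (\<lambda>x::'b \<times> 'b \<times> 'b. S (fst x, snd (snd x)))"
      by (rule Cinf_compose[OF P(3) pr(3) oU]) (use g in \<open>auto intro: open_Times\<close>)
    ultimately show "Cinf (P \<times> UNIV) ?h"
      using Cinf_fst_on[OF g(2,1) open_UNIV] by (intro Cinf_Pair oU)
    fix m assume "m \<in> pts (pont_atlas A) \<inter> U'" "\<phi>' m \<in> P \<times> UNIV"
    then have b: "m \<in> PB A" "pt (fst m) \<in> U" "\<phi> (pt (fst m)) \<in> P" using U by auto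
    note m = PB_D[OF b(1)]
    have q: "pt (fst m) \<in> V" "\<psi> (pt (fst m)) = g (\<phi> (pt (fst m)))"
      using P(2) b TB_pt[OF m(1)] by (auto simp: loc_rep_def)
    then show "m \<in> V'" using b V by auto
    show "\<psi>' m = ?h (\<phi>' m)"
      using q b m P(4)[OF m(2)] dcoord_change[OF sA m(1) U(1) b(2) V(1) P(2) b(3)] U V
      by (auto simp: split_beta)
  qed
  then show "\<exists>O' g. \<phi>' l \<in> O' \<and> loc_rep (pts (pont_atlas A)) U' \<phi>' V' \<psi>' (\<lambda>p. p) O' g"
    using P(1) U(3) by (intro exI conjI) auto
qed auto

lemma smap_pont_proj:
  assumes "manifold n A"
  shows "smap (pont_atlas A) (PB A) (tan_atlas A) fst" "smap (pont_atlas A) (PB A) (cot_atlas A) snd"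
proof -
  have *: "\<exists>U \<phi> V \<psi> P g. (U, \<phi>) \<in> pont_atlas A \<and> (V, \<psi>) \<in> tan_atlas A \<and> l \<in> U \<and> \<phi> l \<in> P \<and>
      loc_rep (PB A) U \<phi> V \<psi> fst P g"
    "\<exists>U \<phi> V \<psi> P g. (U, \<phi>) \<in> pont_atlas A \<and> (V, \<psi>) \<in> cot_atlas A \<and> l \<in> U \<and> \<phi> l \<in> P \<and>
      loc_rep (PB A) U \<phi> V \<psi> snd P g"
    if l: "l \<in> PB A" for l
  proof -
    obtain U \<phi> where U: "(U, \<phi>) \<in> A" "pt (fst l) \<in> U" using TB_pt[OF PB_D(1)[OF l]] by (rule pts_chart)
    let ?W = "{l \<in> PB A. pt (fst l) \<in> U}" and ?\<rho> = "\<lambda>l. (\<phi> (pt (fst l)), pcoord A \<phi> l)"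
    have c: "Cinf UNIV (\<lambda>x. (fst x, fst (snd x)) :: 'b \<times> 'b)" "Cinf UNIV (\<lambda>x. (fst x, snd (snd x)) :: 'b \<times> 'b)"
      by (intro Cinf_Pair Cinf_fst Cinf_snd Cinf_id open_UNIV)+
    have "loc_rep (PB A) ?W ?\<rho> {v \<in> TB A. pt v \<in> U} (tchart \<phi>) fst UNIV (\<lambda>x. (fst x, fst (snd x)))"
      "loc_rep (PB A) ?W ?\<rho> {\<alpha> \<in> CB A. fst \<alpha> \<in> U} (\<lambda>\<alpha>. (\<phi> (fst \<alpha>), ccoord A \<phi> \<alpha>)) snd UNIV
        (\<lambda>x. (fst x, snd (snd x)))"
      unfolding loc_rep_def using c PB_D[where A = A] by (auto simp: split_beta)
    then show "\<exists>U \<phi> V \<psi> P g. (U, \<phi>) \<in> pont_atlas A \<and> (V, \<psi>) \<in> tan_atlas A \<and> l \<in> U \<and> \<phi> l \<in> P \<and>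
        loc_rep (PB A) U \<phi> V \<psi> fst P g"
      "\<exists>U \<phi> V \<psi> P g. (U, \<phi>) \<in> pont_atlas A \<and> (V, \<psi>) \<in> cot_atlas A \<and> l \<in> U \<and> \<phi> l \<in> P \<and>
        loc_rep (PB A) U \<phi> V \<psi> snd P g"
      using pont_chartI[OF U(1)] tan_chartI[OF U(1)] cot_chartI[OF U(1)] U l
      by - (intro exI conjI; (assumption | simp))+
  qed
  show "smap (pont_atlas A) (PB A) (tan_atlas A) fst" "smap (pont_atlas A) (PB A) (cot_atlas A) snd"
    using * manifold_satlas[OF assms]
    by (auto intro!: smapI[OF satlas_pont[OF assms]] satlas_tan satlas_cot[OF assms] simp: pts_pont)
qed

lemma curve_pontI:
  assumes "manifold n A" "curve (tan_atlas A) X" "curve (cot_atlas A) \<xi>"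
    and "\<forall>\<^sub>F t in nhds 0. fst (\<xi> t) = pt (X t)"
  shows "curve (pont_atlas A) (\<lambda>t. (X t, \<xi> t))"
proof -
  have sA: "satlas A" using manifold_satlas assms(1) .
  have X0: "X 0 \<in> TB A" and \<xi>0: "\<xi> 0 \<in> CB A" using curve_pts[OF assms(2)] curve_pts[OF assms(3)]
    by (simp_all add: pts_tan pts_cot)
  obtain U \<phi> where U: "(U, \<phi>) \<in> A" "pt (X 0) \<in> U" using TB_pt[OF X0] by (rule pts_chart)
  obtain P c where P: "open P" "0 \<in> P" "Cinf P c"
      "\<And>t. t \<in> P \<Longrightarrow> X t \<in> {v \<in> TB A. pt v \<in> U} \<and> tchart \<phi> (X t) = c t"
    by (rule curveD[OF satlas_tan[OF sA] assms(2) tan_chartI[OF U(1)]]) (use X0 U(2) in auto)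
  have 0: "fst (\<xi> 0) = pt (X 0)" using assms(4) eventually_nhds_x_imp_x by blast
  obtain Q d where Q: "open Q" "0 \<in> Q" "Cinf Q d"
      "\<And>t. t \<in> Q \<Longrightarrow> \<xi> t \<in> {\<alpha> \<in> CB A. fst \<alpha> \<in> U} \<and> (\<phi> (fst (\<xi> t)), ccoord A \<phi> (\<xi> t)) = d t"
    by (rule curveD[OF satlas_cot[OF assms(1)] assms(3) cot_chartI[OF U(1)]]) (use \<xi>0 U(2) 0 in auto)
  have o: "open (P \<inter> Q)" "0 \<in> P \<inter> Q" using P Q by auto
  show ?thesis
  proof (rule curveI[OF satlas_pont[OF assms(1)] pont_chartI[OF U(1)] o])
    show "Cinf (P \<inter> Q) (\<lambda>t. (fst (c t), snd (c t), snd (d t)))"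
      using P Q o by (intro Cinf_Pair Cinf_fst Cinf_snd) (auto intro: Cinf_subset)
    show "\<forall>\<^sub>F t in nhds 0. (X t, \<xi> t) \<in> {l \<in> PB A. pt (fst l) \<in> U} \<and>
        (\<phi> (pt (fst (X t, \<xi> t))), pcoord A \<phi> (X t, \<xi> t)) = (fst (c t), snd (c t), snd (d t))"
      using assms(4) eventually_nhds_in_open[OF o]
    proof eventually_elim
      case (elim t)
      then show ?case using P(4)[of t] Q(4)[of t] by (auto simp: PB_def) (metis fst_conv snd_conv)+
    qed
  qed
qed

section \<open>Two-forms as bundle maps\<close>

lemma two_formD:
  assumes "two_form A \<omega>" "u \<in> TS A p" "v \<in> TS A p"
  shows "\<omega> u v = - \<omega> v u" "w \<in> TS A p \<Longrightarrow> \<omega> (tlin A a u b v) w = a * \<omega> u w + b * \<omega> v w"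
proof -
  have "p \<in> pts A" using assms(2) TB_pt by auto
  then show "\<omega> u v = - \<omega> v u" "w \<in> TS A p \<Longrightarrow> \<omega> (tlin A a u b v) w = a * \<omega> u w + b * \<omega> v w"
    using assms unfolding two_form_def by blast+
qed

lemma two_form_right:
  assumes "manifold n A" "two_form A \<omega>" "u \<in> TS A p" "v \<in> TS A p" "w \<in> TS A p"
  shows "\<omega> w (tlin A a u b v) = a * \<omega> w u + b * \<omega> w v"
  using two_formD(2)[OF assms(2-5), of a b] two_formD(1)[OF assms(2,5,3)] two_formD(1)[OF assms(2,5,4)]
    two_formD(1)[OF assms(2,5) tlin(1)[OF assms(1,3,4)], of a b]
  by simp

lemma fst_sharp [simp]: "fst (sharp A \<omega> X) = pt X"
  by (simp add: sharp_def)

lemma snd_sharp: "Y \<in> TB A \<Longrightarrow> pt Y = pt X \<Longrightarrow> snd (sharp A \<omega> X) Y = \<omega> X Y"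
  by (simp add: sharp_def)

lemma sharp_CB:
  assumes "manifold n A" "two_form A \<omega>" "X \<in> TB A"
  shows "sharp A \<omega> X \<in> CB A"
  unfolding CB_def sharp_def
  using TB_pt[OF assms(3)] tlin(1)[OF assms(1)] two_form_right[OF assms(1,2)] assms(3)
  by auto

lemma CB_add:
  assumes "manifold n A" "\<alpha> \<in> CB A" "\<beta> \<in> CB A" "fst \<alpha> = fst \<beta>"
  shows "(fst \<alpha>, \<lambda>Y. snd \<alpha> Y + snd \<beta> Y) \<in> CB A"
  using assms unfolding CB_def by (auto simp: algebra_simps)

lemma ccoord_add:
  assumes "manifold n A" "\<alpha> \<in> CB A" "\<beta> \<in> CB A" "fst \<alpha> = fst \<beta>" "(U, \<phi>) \<in> A" "fst \<alpha> \<in> U"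
  shows "ccoord A \<phi> (fst \<alpha>, \<lambda>Y. snd \<alpha> Y + snd \<beta> Y) = ccoord A \<phi> \<alpha> + ccoord A \<phi> \<beta>"
proof (rule ccoord_unique[OF assms(1,5)])
  obtain K where K: "subspace K" "\<And>p. p \<in> U \<Longrightarrow> dcoord \<phi> ` TS A p = K"
    using manifold_spaceE[OF assms(1,5)] by metis
  show "ccoord A \<phi> \<alpha> + ccoord A \<phi> \<beta> \<in> dcoord \<phi> ` TS A (fst (fst \<alpha>, \<lambda>Y. snd \<alpha> Y + snd \<beta> Y))"
    using ccoord(1)[OF assms(1,5,2,6)] ccoord(1)[OF assms(1,5,3)] assms(4,6) K
    by (simp add: subspace_add)
  fix v assume "v \<in> TS A (fst (fst \<alpha>, \<lambda>Y. snd \<alpha> Y + snd \<beta> Y))"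
  then show "snd (fst \<alpha>, \<lambda>Y. snd \<alpha> Y + snd \<beta> Y) v = (ccoord A \<phi> \<alpha> + ccoord A \<phi> \<beta>) \<bullet> dcoord \<phi> v"
    using ccoord(2)[OF assms(1,5,2,6)] ccoord(2)[OF assms(1,5,3)] assms(4,6)
    by (simp add: inner_add_left)
qed (use assms in simp)

text \<open>In coordinates the map is contraction with the matrix of \<omega> on fields with
  constant coordinates, whose entries are smooth by \<open>two_form\<close>. There are finitely many
  entries, so they have a common domain \<open>P\<close>.\<close>

lemma sharp_rep:
  assumes "manifold n A" "two_form A \<omega>" "(U, \<phi>) \<in> A" "p \<in> U"
  obtains P S where "open P" "\<phi> p \<in> P" "Cinf (P \<times> UNIV) S"
    "\<And>X. X \<in> TB A \<Longrightarrow> pt X \<in> U \<Longrightarrow> \<phi> (pt X) \<in> P \<Longrightarrow>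
      ccoord A \<phi> (sharp A \<omega> X) = S (\<phi> (pt X), dcoord \<phi> X)"
proof -
  have sA: "satlas A" using manifold_satlas assms(1) .
  obtain K where K: "subspace K" "\<And>p. p \<in> U \<Longrightarrow> dcoord \<phi> ` TS A p = K"
    using manifold_spaceE[OF assms(1,3)] by metis
  obtain B where B: "finite B" "B \<subseteq> K" "\<And>k. k \<in> K \<Longrightarrow> (\<Sum>b\<in>B. (k \<bullet> b) *\<^sub>R b) = k"
    using subspace_onbE[OF K(1)] by metis
  let ?v = "vec_at A \<phi>"
  have v: "?v q b \<in> TB A" "pt (?v q b) = q" "dcoord \<phi> (?v q b) = b" if "q \<in> U" "b \<in> K" for q b
    using vec_at[OF sA assms(3) that(1)] K(2)[OF that(1)] that(2) by auto
  have "\<exists>P g. open P \<and> \<phi> p \<in> P \<and> Cinf P g \<and> (\<forall>q\<in>U. \<phi> q \<in> P \<longrightarrow> \<omega> (?v q b) (?v q c) = g (\<phi> q))"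
    if "b \<in> B" "c \<in> B" for b c
  proof -
    have bc: "b \<in> K" "c \<in> K" using that B(2) by auto
    have "smooth_map A U euc (\<lambda>q. \<omega> (const_field A \<phi> (?v p b) q) (const_field A \<phi> (?v p c) q))"
    proof -
      have "\<forall>(U, \<phi>)\<in>A. \<forall>p\<in>U. \<forall>u\<in>TS A p. \<forall>v\<in>TS A p.
          smooth_map A U euc (\<lambda>q. \<omega> (const_field A \<phi> u q) (const_field A \<phi> v q))"
        using assms(2) unfolding two_form_def by (rule conjunct2)
      from bspec[OF this assms(3), unfolded prod.case] show ?thesis
        using assms(4) v[OF assms(4)] bc by simp
    qed
    then have "smooth_map A U euc (\<lambda>q. \<omega> (?v q b) (?v q c))"
      unfolding const_field_vec_at using v[OF assms(4)] bc by simp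
    then have s: "smap A U euc (\<lambda>q. \<omega> (?v q b) (?v q c))"
      by (rule smooth_map_imp_smap[OF sA satlas_euc manifold_inj_charts[OF assms(1)]])
    obtain P g where "\<phi> p \<in> P" "open P" "Cinf P g"
      "\<And>q. q \<in> U \<inter> U \<Longrightarrow> \<phi> q \<in> P \<Longrightarrow> \<omega> (?v q b) (?v q c) = g (\<phi> q)"
      by (rule smap_eucD[OF s assms(4,3,4)]) blast
    then show ?thesis by (intro exI[of _ P] exI[of _ g]) auto
  qed
  then obtain Q g where Q: "\<And>b c. b \<in> B \<Longrightarrow> c \<in> B \<Longrightarrow> open (Q b c) \<and> \<phi> p \<in> Q b c \<and> Cinf (Q b c) (g b c) \<and>
      (\<forall>q\<in>U. \<phi> q \<in> Q b c \<longrightarrow> \<omega> (?v q b) (?v q c) = g b c (\<phi> q))"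
    by metis
  define P where "P = (\<Inter>b\<in>B. \<Inter>c\<in>B. Q b c)"
  have P: "open P" "\<phi> p \<in> P" "\<And>b c. b \<in> B \<Longrightarrow> c \<in> B \<Longrightarrow> P \<subseteq> Q b c"
    unfolding P_def using Q B(1) by (auto intro!: open_INT)
  let ?S = "\<lambda>x. \<Sum>c\<in>B. (\<Sum>b\<in>B. (snd x \<bullet> b) *\<^sub>R g b c (fst x)) *\<^sub>R c"
  have oU: "open (P \<times> (UNIV :: 'b set))" using P(1) by (intro open_Times) auto
  show thesis
  proof (rule that[OF P(1,2)])
    show "Cinf (P \<times> UNIV) ?S"
    proof (intro Cinf_sum Cinf_scaleR Cinf_inner Cinf_const oU Cinf_snd Cinf_id)
      fix b c assume bc: "b \<in> B" "c \<in> B"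
      have "Cinf P (g b c)" using Q[OF bc] P(3)[OF bc] Cinf_subset by blast
      then show "Cinf (P \<times> UNIV) (\<lambda>x. g b c (fst x))"
        by (rule Cinf_fst_on[OF _ P(1) open_UNIV])
    qed
    fix X assume X: "X \<in> TB A" "pt X \<in> U" "\<phi> (pt X) \<in> P"
    have XK: "dcoord \<phi> X \<in> K" using K(2)[OF X(2)] X(1) by auto
    have lin: "\<omega> Z Y = (\<Sum>c\<in>B. (dcoord \<phi> Y \<bullet> c) * \<omega> Z (?v (pt X) c))"
      if Z: "Z \<in> TS A (pt X)" and Y: "Y \<in> TS A (pt X)" for Z Y
    proof -
      have YK: "dcoord \<phi> Y \<in> K" using K(2)[OF X(2)] Y by auto
      have "lin_on K (\<lambda>k. snd (sharp A \<omega> Z) (?v (pt X) k))"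
        using lin_on_cot[OF assms(1,3) sharp_CB[OF assms(1,2)], of Z] Z X(2) K(2)[OF X(2)] by simp
      from lin_on_sum[OF this K(1) B(1,2), of "\<lambda>c. dcoord \<phi> Y \<bullet> c"]
      have "snd (sharp A \<omega> Z) (?v (pt X) (dcoord \<phi> Y)) =
          (\<Sum>c\<in>B. (dcoord \<phi> Y \<bullet> c) * snd (sharp A \<omega> Z) (?v (pt X) c))"
        using B(3)[OF YK] by simp
      moreover have "?v (pt X) (dcoord \<phi> Y) = Y"
        using vec_at_dcoord[OF sA assms(3), of Y] Y X(2) by simp
      moreover have "snd (sharp A \<omega> Z) (?v (pt X) c) = \<omega> Z (?v (pt X) c)" if "c \<in> B" for c
        using v[OF X(2), of c] B(2) that Z by (intro snd_sharp) auto
      ultimately show ?thesis using Y Z by (simp add: snd_sharp)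
    qed
    show "ccoord A \<phi> (sharp A \<omega> X) = ?S (\<phi> (pt X), dcoord \<phi> X)"
    proof (rule ccoord_unique[OF assms(1,3)])
      show "fst (sharp A \<omega> X) \<in> U" using X by simp
      show "?S (\<phi> (pt X), dcoord \<phi> X) \<in> dcoord \<phi> ` TS A (fst (sharp A \<omega> X))"
        using K(2)[OF X(2)] B(2) K(1) by (auto intro!: subspace_sum subspace_scale)
      fix Y assume "Y \<in> TS A (fst (sharp A \<omega> X))"
      then have Y: "Y \<in> TS A (pt X)" by simp
      have "\<omega> X (?v (pt X) c) = (\<Sum>b\<in>B. (dcoord \<phi> X \<bullet> b) *\<^sub>R g b c (\<phi> (pt X)))" if c: "c \<in> B" for c
      proof -
        have vc: "?v (pt X) c \<in> TS A (pt X)" using v[OF X(2)] c B(2) by auto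
        have vb: "?v (pt X) b \<in> TS A (pt X)" if "b \<in> B" for b using v[OF X(2)] that B(2) by auto
        have XT: "X \<in> TS A (pt X)" using X by simp
        have g: "\<omega> (?v (pt X) b) (?v (pt X) c) = g b c (\<phi> (pt X))" if "b \<in> B" for b
          using Q[OF that c] P(3)[OF that c] X(2,3) by blast
        \<comment> \<open>\<open>lin\<close> expands the second argument only; skew-symmetry moves
          \<open>X\<close> there and back.\<close>
        have "\<omega> X (?v (pt X) c) = - (\<Sum>b\<in>B. (dcoord \<phi> X \<bullet> b) * \<omega> (?v (pt X) c) (?v (pt X) b))"
          using two_formD(1)[OF assms(2) XT vc] lin[OF vc XT] by simp
        also have "\<dots> = (\<Sum>b\<in>B. (dcoord \<phi> X \<bullet> b) * \<omega> (?v (pt X) b) (?v (pt X) c))"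
          using two_formD(1)[OF assms(2) vc vb] by (simp flip: sum_negf)
        also have "\<dots> = (\<Sum>b\<in>B. (dcoord \<phi> X \<bullet> b) *\<^sub>R g b c (\<phi> (pt X)))"
          using g by (intro sum.cong) auto
        finally show ?thesis .
      qed
      then have "\<omega> X Y = (\<Sum>c\<in>B. (dcoord \<phi> Y \<bullet> c) * (\<Sum>b\<in>B. (dcoord \<phi> X \<bullet> b) *\<^sub>R g b c (\<phi> (pt X))))"
        using lin[OF _ Y, of X] X(1) by simp
      also have "\<dots> = ?S (\<phi> (pt X), dcoord \<phi> X) \<bullet> dcoord \<phi> Y"
        by (simp add: inner_sum_left mult.commute) (simp add: inner_commute)
      finally show "snd (sharp A \<omega> X) Y = ?S (\<phi> (pt X), dcoord \<phi> X) \<bullet> dcoord \<phi> Y"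
        using Y by (simp add: snd_sharp)
    qed
  qed
qed

lemma smap_sharp:
  assumes "manifold n A" "two_form A \<omega>"
  shows "smap (tan_atlas A) (TB A) (cot_atlas A) (sharp A \<omega>)"
proof (rule smapI[OF satlas_tan[OF manifold_satlas[OF assms(1)]] satlas_cot[OF assms(1)]])
  fix X assume X: "X \<in> TB A"
  obtain U \<phi> where U: "(U, \<phi>) \<in> A" "pt X \<in> U" using TB_pt[OF X] by (rule pts_chart)
  obtain P S where P: "open P" "\<phi> (pt X) \<in> P" "Cinf (P \<times> UNIV) S"
    "\<And>X. X \<in> TB A \<Longrightarrow> pt X \<in> U \<Longrightarrow> \<phi> (pt X) \<in> P \<Longrightarrow>
      ccoord A \<phi> (sharp A \<omega> X) = S (\<phi> (pt X), dcoord \<phi> X)"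
    by (rule sharp_rep[OF assms U]) blast
  have o: "open (P \<times> (UNIV :: 'b set))" using P(1) by (intro open_Times) auto
  have "loc_rep (TB A) {v \<in> TB A. pt v \<in> U} (tchart \<phi>) {\<alpha> \<in> CB A. fst \<alpha> \<in> U}
      (\<lambda>\<alpha>. (\<phi> (fst \<alpha>), ccoord A \<phi> \<alpha>)) (sharp A \<omega>) (P \<times> UNIV) (\<lambda>x. (fst x, S x))"
    unfolding loc_rep_def using P(3,4) o sharp_CB[OF assms]
    by (auto intro!: Cinf_Pair Cinf_fst Cinf_id)
  then show "\<exists>U \<phi> V \<psi> P g. (U, \<phi>) \<in> tan_atlas A \<and> (V, \<psi>) \<in> cot_atlas A \<and> X \<in> U \<and> \<phi> X \<in> P \<and>
      loc_rep (TB A) U \<phi> V \<psi> (sharp A \<omega>) P g"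
    using tan_chartI[OF U(1)] cot_chartI[OF U(1)] U X P(2)
    by - (intro exI conjI; (assumption | simp))
qed (simp add: pts_tan)

lemma tau_simps [simp]:
  "fst (tau A \<omega> l) = fst l" "fst (snd (tau A \<omega> l)) = fst (snd l)"
  "snd (snd (tau A \<omega> l)) Y = snd (snd l) Y + snd (sharp A \<omega> (fst l)) Y"
  by (simp_all add: tau_def split_beta)

lemma snd_tau: "snd (tau A \<omega> l) = (fst (snd l), \<lambda>Y. snd (snd l) Y + snd (sharp A \<omega> (fst l)) Y)"
  by (simp add: tau_def split_beta)

lemma tau_PB:
  assumes "manifold n A" "two_form A \<omega>" "l \<in> PB A"
  shows "tau A \<omega> l \<in> PB A"
  unfolding PB_iff snd_tau
  using CB_add[OF assms(1) PB_D(2)[OF assms(3)] sharp_CB[OF assms(1,2) PB_D(1)[OF assms(3)]]] PB_D[OF assms(3)]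
  by simp

lemma ccoord_tau:
  assumes "manifold n A" "two_form A \<omega>" "l \<in> PB A" "(U, \<phi>) \<in> A" "pt (fst l) \<in> U"
  shows "ccoord A \<phi> (snd (tau A \<omega> l)) = ccoord A \<phi> (snd l) + ccoord A \<phi> (sharp A \<omega> (fst l))"
  unfolding snd_tau
  using ccoord_add[OF assms(1) PB_D(2)[OF assms(3)] sharp_CB[OF assms(1,2) PB_D(1)[OF assms(3)]] _ assms(4)]
    PB_D(3)[OF assms(3)] assms(5) by simp

lemma smap_tau:
  assumes "manifold n A" "two_form A \<omega>"
  shows "smap (pont_atlas A) (PB A) (pont_atlas A) (tau A \<omega>)"
proof (rule smapI[OF satlas_pont[OF assms(1)] satlas_pont[OF assms(1)]])
  fix l assume l: "l \<in> PB A"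
  obtain U \<phi> where U: "(U, \<phi>) \<in> A" "pt (fst l) \<in> U" using TB_pt[OF PB_D(1)[OF l]] by (rule pts_chart)
  obtain P S where P: "open P" "\<phi> (pt (fst l)) \<in> P" "Cinf (P \<times> UNIV) S"
    "\<And>X. X \<in> TB A \<Longrightarrow> pt X \<in> U \<Longrightarrow> \<phi> (pt X) \<in> P \<Longrightarrow>
      ccoord A \<phi> (sharp A \<omega> X) = S (\<phi> (pt X), dcoord \<phi> X)"
    by (rule sharp_rep[OF assms U]) blast
  let ?h = "\<lambda>x. (fst x, fst (snd x), snd (snd x) + S (fst x, fst (snd x)))"
  have o: "open (P \<times> (UNIV :: ('b \<times> 'b) set))" using P(1) by (intro open_Times) auto
  have "Cinf (P \<times> (UNIV :: ('b \<times> 'b) set)) (\<lambda>x. (fst x, fst (snd x)))"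
    by (intro Cinf_Pair Cinf_fst Cinf_snd Cinf_id o)
  then have "Cinf (P \<times> UNIV) (\<lambda>x::'b \<times> 'b \<times> 'b. S (fst x, fst (snd x)))"
    by (rule Cinf_compose[OF P(3) _ o]) (use P(1) in \<open>auto intro: open_Times\<close>)
  then have "Cinf (P \<times> UNIV) ?h"
    by (intro Cinf_Pair Cinf_add Cinf_fst Cinf_snd Cinf_id o)
  then have "loc_rep (PB A) {l \<in> PB A. pt (fst l) \<in> U} (\<lambda>l. (\<phi> (pt (fst l)), pcoord A \<phi> l))
      {l \<in> PB A. pt (fst l) \<in> U} (\<lambda>l. (\<phi> (pt (fst l)), pcoord A \<phi> l)) (tau A \<omega>) (P \<times> UNIV) ?h"
    unfolding loc_rep_def using o P(4) tau_PB[OF assms] ccoord_tau[OF assms _ U(1)] PB_D(1)[where A = A]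
    by (auto simp: split_beta)
  then show "\<exists>U \<phi> V \<psi> P g. (U, \<phi>) \<in> pont_atlas A \<and> (V, \<psi>) \<in> pont_atlas A \<and> l \<in> U \<and> \<phi> l \<in> P \<and>
      loc_rep (PB A) U \<phi> V \<psi> (tau A \<omega>) P g"
    using pont_chartI[OF U(1)] U l P(2)
    by - (intro exI conjI; (assumption | simp add: split_beta))
qed (simp add: pts_pont)

lemma tau_uminus:
  "l \<in> PB A \<Longrightarrow> tau A (\<lambda>u v. - \<omega> u v) (tau A \<omega> l) = l"
  "l \<in> PB A \<Longrightarrow> tau A \<omega> (tau A (\<lambda>u v. - \<omega> u v) l) = l"
  by (auto intro!: prod_eqI ext simp: sharp_def)

section \<open>The tangent pairing\<close>

text \<open>Product rule in a chart, where the pairing is the inner product of fibre coordinates.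
  The outcome does not depend on the pair of curves chosen by \<open>SOME\<close>; what has to be
  shown first is that representatives over a common base curve exist.\<close>

lemma tan_pairing_formula:
  assumes "manifold n A" "W \<in> TB (cot_atlas A)" "V \<in> TB (tan_atlas A)"
    and base: "tmap A fst W = tmap A pt V" and U: "(U, \<phi>) \<in> A" "pt (pt V) \<in> U"
  shows "tan_pairing W V = ccoord A \<phi> (pt W) \<bullet> snd (dcoord (tchart \<phi>) V) +
    snd (dcoord (\<lambda>\<alpha>. (\<phi> (fst \<alpha>), ccoord A \<phi> \<alpha>)) W) \<bullet> dcoord \<phi> (pt V)"
proof -
  have sA: "satlas A" using manifold_satlas assms(1) .
  note sT = satlas_tan[OF sA] and sC = satlas_cot[OF assms(1)]
  let ?c = "\<lambda>\<alpha>. (\<phi> (fst \<alpha>), ccoord A \<phi> \<alpha>)"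
  have fst_cot: "smap (cot_atlas A) (pts (cot_atlas A)) A fst"
    using smap_fst_cot[OF assms(1)] by (simp add: pts_cot)
  have pW: "fst (pt W) = pt (pt V)"
    using base tmap_TB(2)[OF sC sA fst_cot assms(2)] tmap_TB(2)[OF sT sA smap_pt'[OF sA] assms(3)] by simp
  have mem: "pt V \<in> TB A" "pt W \<in> CB A"
    using TB_pt[OF assms(2)] TB_pt[OF assms(3)] by (simp_all add: pts_tan pts_cot)
  define p where "p = (SOME (\<xi>, X). \<xi> \<in> W \<and> X \<in> V \<and> (\<forall>\<^sub>F t in nhds 0. fst (\<xi> t) = pt (X t)))"
  have ex: "\<exists>\<xi> X. \<xi> \<in> W \<and> X \<in> V \<and> (\<forall>\<^sub>F t in nhds 0. fst (\<xi> t) = pt (X t))"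
  proof -
    obtain \<xi> where \<xi>: "curve (cot_atlas A) \<xi>" "W = velocity (cot_atlas A) \<xi>" "\<xi> 0 = pt W"
      using TB_velocity[OF assms(2)] .
    obtain X where X: "curve (tan_atlas A) X" "V = velocity (tan_atlas A) X" "X 0 = pt V"
      using TB_velocity[OF assms(3)] .
    have q: "curve A (\<lambda>t. fst (\<xi> t))"
      using curve_compose[OF sC sA \<xi>(1) curve_ev_pts[OF sC \<xi>(1)] fst_cot] .
    have c: "curve A (\<lambda>t. pt (X t))"
      using curve_compose[OF sT sA X(1) curve_ev_pts[OF sT X(1)] smap_pt'[OF sA]] .
    have vel: "velocity A (\<lambda>t. fst (\<xi> t)) = velocity A (\<lambda>t. pt (X t))"
      using base tmap_velocity[OF sC sA fst_cot \<xi>(1)] tmap_velocity[OF sT sA smap_pt'[OF sA] X(1)]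
      by (simp add: \<xi>(2) X(2))
    have q0: "fst (\<xi> 0) = pt (X 0)" using pW \<xi>(3) X(3) by simp
    have X0: "pt (X 0) \<in> U" using U X(3) by simp
    obtain P h k where P: "open P" "0 \<in> P" "Cinf P h" "Cinf P k"
      "\<And>t. t \<in> P \<Longrightarrow> X t \<in> TB A \<and> pt (X t) \<in> U \<and> \<phi> (pt (X t)) = h t \<and> dcoord \<phi> (X t) = k t"
      by (rule tan_curveD[OF sA X(1) U(1) X0]) blast
    obtain K where K: "\<And>p. p \<in> U \<Longrightarrow> dcoord \<phi> ` TS A p = K"
      using manifold_spaceE[OF assms(1) U(1)] by metis
    have kK: "k t \<in> dcoord \<phi> ` TS A (fst (\<xi> 0))" if "t \<in> P" for t
      unfolding q0 K[OF X0] using K[of "pt (X t)"] P(5)[OF that] by (metis TS_iff image_eqI)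
    have q0U: "fst (\<xi> 0) \<in> U" using q0 X0 by simp
    \<comment> \<open>\<open>X\<close> is moved over the base curve of \<xi> with its fibre
      coordinates unchanged. It still represents \<open>V\<close>, since by \<open>base\<close> the
      two base curves agree to first order.\<close>
    let ?Y = "\<lambda>t. vec_at A \<phi> (fst (\<xi> t)) (k t)"
    have Y: "curve (tan_atlas A) ?Y" "\<forall>\<^sub>F t in nhds 0. ?Y t \<in> TB A \<and> pt (?Y t) = fst (\<xi> t) \<and>
        dcoord \<phi> (?Y t) = k t"
      by (rule vec_at_curve[OF assms(1) U(1) q q0U P(1,2,4)], erule kK)+
    have Y0: "?Y 0 = X 0"
      using vec_at_dcoord[OF sA U(1), of "X 0"] P(5)[OF P(2)] q0 by simp
    have X0': "X 0 \<in> {v \<in> TB A. pt v \<in> U}" using P(5)[OF P(2)] by simp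
    obtain d where d: "((\<lambda>t. tchart \<phi> (X t)) has_vector_derivative d) (at 0)"
      using dcoord_has_vd[OF sT X(1) tan_chartI[OF U(1)] X0'] by blast
    have "((\<lambda>t. \<phi> (pt (X t))) has_vector_derivative fst d) (at 0)"
      using bounded_linear.has_vector_derivative[OF bounded_linear_fst d] by simp
    from vector_derivative_unique_at[OF this dcoord_has_vd[OF sA c U(1) X0]]
    have "((\<lambda>t. \<phi> (fst (\<xi> t))) has_vector_derivative fst d) (at 0)"
      using dcoord_has_vd[OF sA q U(1) q0U] vel by simp
    moreover have "((\<lambda>t. dcoord \<phi> (X t)) has_vector_derivative snd d) (at 0)"
      using bounded_linear.has_vector_derivative[OF bounded_linear_snd d] by simp
    ultimately have "((\<lambda>t. (\<phi> (fst (\<xi> t)), dcoord \<phi> (X t))) has_vector_derivative (fst d, snd d)) (at 0)"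
      by (rule has_vector_derivative_Pair)
    moreover have "\<forall>\<^sub>F t in nhds 0. (\<phi> (fst (\<xi> t)), dcoord \<phi> (X t)) = tchart \<phi> (?Y t)"
      by (rule eventually_mono[OF eventually_conj[OF Y(2) eventually_nhds_in_open[OF P(1,2)]]])
        (use P(5) in auto)
    then obtain Q where "open Q" "0 \<in> Q" "\<And>t. t \<in> Q \<Longrightarrow> (\<phi> (fst (\<xi> t)), dcoord \<phi> (X t)) = tchart \<phi> (?Y t)"
      unfolding eventually_nhds by blast
    ultimately have "((\<lambda>t. tchart \<phi> (?Y t)) has_vector_derivative (fst d, snd d)) (at 0)"
      by (rule has_vector_derivative_transform_within_open)
    then have "velocity (tan_atlas A) ?Y = velocity (tan_atlas A) X"
      using d X0' by (intro velocity_eqI[OF sT Y(1) X(1) Y0 tan_chartI[OF U(1)]])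
        (auto simp: Y0 o_def vector_derivative_at)
    then have "?Y \<in> V" using velocity_self[OF Y(1)] X(2) by simp
    moreover have "\<forall>\<^sub>F t in nhds 0. fst (\<xi> t) = pt (?Y t)"
      using Y(2) by eventually_elim simp
    ultimately show ?thesis using velocity_self[OF \<xi>(1)] \<xi>(2) by blast
  qed
  then have "case p of (\<xi>, X) \<Rightarrow> \<xi> \<in> W \<and> X \<in> V \<and> (\<forall>\<^sub>F t in nhds 0. fst (\<xi> t) = pt (X t))"
    unfolding p_def by (intro someI_ex[of "\<lambda>p. case p of (\<xi>, X) \<Rightarrow> _ \<xi> X"]) auto
  then obtain \<xi> X where p: "p = (\<xi>, X)" "\<xi> \<in> W" "X \<in> V" "\<forall>\<^sub>F t in nhds 0. fst (\<xi> t) = pt (X t)"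
    by (cases p) auto
  have X: "curve (tan_atlas A) X" "V = velocity (tan_atlas A) X" "X 0 = pt V"
    using TB_memD[OF assms(3) p(3)] .
  have \<xi>: "curve (cot_atlas A) \<xi>" "W = velocity (cot_atlas A) \<xi>" "\<xi> 0 = pt W"
    using TB_memD[OF assms(2) p(2)] .
  have X0: "X 0 \<in> {v \<in> TB A. pt v \<in> U}" using X(3) mem U by simp
  have \<xi>0: "\<xi> 0 \<in> {\<alpha> \<in> CB A. fst \<alpha> \<in> U}" using \<xi>(3) mem U pW by simp
  have "((\<lambda>t. ccoord A \<phi> (\<xi> t)) has_vector_derivative snd (dcoord ?c W)) (at 0)"
    using bounded_linear.has_vector_derivative[OF bounded_linear_snd
        dcoord_has_vd[OF sC \<xi>(1) cot_chartI[OF U(1)] \<xi>0]] \<xi>(2) by simp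
  moreover have "((\<lambda>t. dcoord \<phi> (X t)) has_vector_derivative snd (dcoord (tchart \<phi>) V)) (at 0)"
    using bounded_linear.has_vector_derivative[OF bounded_linear_snd
        dcoord_has_vd[OF sT X(1) tan_chartI[OF U(1)] X0]] X(2) by simp
  ultimately have "((\<lambda>t. ccoord A \<phi> (\<xi> t) \<bullet> dcoord \<phi> (X t)) has_vector_derivative
      (ccoord A \<phi> (\<xi> 0) \<bullet> snd (dcoord (tchart \<phi>) V) + snd (dcoord ?c W) \<bullet> dcoord \<phi> (X 0))) (at 0)"
    by (rule bounded_bilinear.has_vector_derivative[OF bounded_bilinear_inner])
  moreover have "\<forall>\<^sub>F t in nhds 0. ccoord A \<phi> (\<xi> t) \<bullet> dcoord \<phi> (X t) = snd (\<xi> t) (X t)"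
    using p(4) curve_ev_chart[OF sC \<xi>(1) cot_chartI[OF U(1)] \<xi>0]
      curve_ev_chart[OF sT X(1) tan_chartI[OF U(1)] X0]
    by eventually_elim (use ccoord(2)[OF assms(1) U(1)] in auto)
  then obtain Q where "open Q" "0 \<in> Q" "\<And>t. t \<in> Q \<Longrightarrow> ccoord A \<phi> (\<xi> t) \<bullet> dcoord \<phi> (X t) = snd (\<xi> t) (X t)"
    unfolding eventually_nhds by blast
  ultimately have "((\<lambda>t. snd (\<xi> t) (X t)) has_vector_derivative
      (ccoord A \<phi> (\<xi> 0) \<bullet> snd (dcoord (tchart \<phi>) V) + snd (dcoord ?c W) \<bullet> dcoord \<phi> (X 0))) (at 0)"
    by (rule has_vector_derivative_transform_within_open)
  from vector_derivative_at[OF this] show ?thesis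
    unfolding tan_pairing_def p_def[symmetric] p(1) Let_def prod.case \<xi>(3) X(3) .
qed

text \<open>In the product rule the covector enters through its fibre coordinates and their
  velocity, and both are additive. Near 0 the three covector curves lie over the same base curve, so
  the same \<open>V\<close> can be paired with each.\<close>

lemma tan_pairing_tau:
  assumes "manifold n A" "two_form A \<omega>" "curve (pont_atlas A) \<gamma>" "V \<in> TB (tan_atlas A)"
    and base: "tmap A pt V = velocity A (\<lambda>t. pt (fst (\<gamma> t)))"
  shows "tan_pairing (velocity (cot_atlas A) (\<lambda>t. snd (tau A \<omega> (\<gamma> t)))) V =
    tan_pairing (velocity (cot_atlas A) (\<lambda>t. snd (\<gamma> t))) V +
    tan_pairing (velocity (cot_atlas A) (\<lambda>t. sharp A \<omega> (fst (\<gamma> t)))) V"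
proof -
  have sA: "satlas A" using manifold_satlas assms(1) .
  note sT = satlas_tan[OF sA] and sC = satlas_cot[OF assms(1)] and sP = satlas_pont[OF assms(1)]
  have ev: "\<forall>\<^sub>F t in nhds 0. \<gamma> t \<in> PB A" using curve_ev_pts[OF sP assms(3)] by (simp add: pts_pont)
  have \<gamma>0: "\<gamma> 0 \<in> PB A" using curve_pts[OF assms(3)] by (simp add: pts_pont)
  have fst_cot: "smap (cot_atlas A) (pts (cot_atlas A)) A fst"
    using smap_fst_cot[OF assms(1)] by (simp add: pts_cot)
  have cX: "curve (tan_atlas A) (\<lambda>t. fst (\<gamma> t))"
    using curve_compose[OF sP sT assms(3) ev smap_pont_proj(1)[OF assms(1)]] .
  then have evX: "\<forall>\<^sub>F t in nhds 0. fst (\<gamma> t) \<in> TB A"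
    using curve_ev_pts[OF sT] by (simp add: pts_tan)
  have c1: "curve (cot_atlas A) (\<lambda>t. snd (\<gamma> t))"
    using curve_compose[OF sP sC assms(3) ev smap_pont_proj(2)[OF assms(1)]] .
  have c2: "curve (cot_atlas A) (\<lambda>t. sharp A \<omega> (fst (\<gamma> t)))"
    using curve_compose[OF sT sC cX evX smap_sharp[OF assms(1,2)]] .
  have "curve (pont_atlas A) (\<lambda>t. tau A \<omega> (\<gamma> t))"
    using curve_compose[OF sP sP assms(3) ev smap_tau[OF assms(1,2)]] .
  moreover have "\<forall>\<^sub>F t in nhds 0. tau A \<omega> (\<gamma> t) \<in> PB A"
    using ev by eventually_elim (rule tau_PB[OF assms(1,2)])
  ultimately have c3: "curve (cot_atlas A) (\<lambda>t. snd (tau A \<omega> (\<gamma> t)))"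
    by (rule curve_compose[OF sP sC _ _ smap_pont_proj(2)[OF assms(1)]])
  have cb: "curve A (\<lambda>t. pt (fst (\<gamma> t)))"
    using curve_compose[OF sT sA cX evX smap_pt[OF sA]] .
  have b: "tmap A fst (velocity (cot_atlas A) \<xi>) = tmap A pt V"
    if c\<xi>: "curve (cot_atlas A) \<xi>" and ev\<xi>: "\<forall>\<^sub>F t in nhds 0. fst (\<xi> t) = pt (fst (\<gamma> t))" for \<xi>
  proof -
    obtain Q where Q: "open Q" "0 \<in> Q" "\<And>t. t \<in> Q \<Longrightarrow> pt (fst (\<gamma> t)) = fst (\<xi> t)"
      using ev\<xi> unfolding eventually_nhds by metis
    have c: "curve A (\<lambda>t. fst (\<xi> t))"
      using curve_compose[OF sC sA c\<xi> curve_ev_pts[OF sC c\<xi>] fst_cot] .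
    obtain U \<phi> where U: "(U, \<phi>) \<in> A" "fst (\<xi> 0) \<in> U" using curve_pts[OF c] by (rule pts_chart)
    have U': "pt (fst (\<gamma> 0)) \<in> U" using U Q by simp
    have "((\<lambda>t. \<phi> (fst (\<xi> t))) has_vector_derivative dcoord \<phi> (velocity A (\<lambda>t. pt (fst (\<gamma> t))))) (at 0)"
      by (rule has_vector_derivative_transform_within_open[OF dcoord_has_vd[OF sA cb U(1) U'] Q(1,2)])
        (use Q(3) in simp)
    then have "velocity A (\<lambda>t. fst (\<xi> t)) = velocity A (\<lambda>t. pt (fst (\<gamma> t)))"
      using dcoord_velocity[OF cb U(1) U'] Q(2,3) U
      by (intro velocity_eqI[OF sA c cb _ U]) (auto simp: o_def vector_derivative_at)
    then show ?thesis
      using tmap_velocity[OF sC sA fst_cot c\<xi>] base by simp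
  qed
  have e: "\<forall>\<^sub>F t in nhds 0. fst (snd (\<gamma> t)) = pt (fst (\<gamma> t))"
    using ev by eventually_elim (rule PB_D(3))
  have ptV: "pt (pt V) = pt (fst (\<gamma> 0))"
    using base tmap_TB(2)[OF sT sA smap_pt'[OF sA] assms(4)] cb by simp
  obtain U \<phi> where U: "(U, \<phi>) \<in> A" "pt (pt V) \<in> U"
    using TB_pt[OF PB_D(1)[OF \<gamma>0]] unfolding ptV by (rule pts_chart)
  let ?c = "\<lambda>\<alpha>. (\<phi> (fst \<alpha>), ccoord A \<phi> \<alpha>)"
  have U0: "pt (fst (\<gamma> 0)) \<in> U" using U ptV by simp
  have cc: "ccoord A \<phi> (snd (tau A \<omega> l)) = ccoord A \<phi> (snd l) + ccoord A \<phi> (sharp A \<omega> (fst l))"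
    if "l \<in> PB A" "pt (fst l) \<in> U" for l
    using ccoord_tau[OF assms(1,2) that(1) U(1) that(2)] .
  have m: "snd (\<gamma> 0) \<in> {\<alpha> \<in> CB A. fst \<alpha> \<in> U}" "sharp A \<omega> (fst (\<gamma> 0)) \<in> {\<alpha> \<in> CB A. fst \<alpha> \<in> U}"
    "snd (tau A \<omega> (\<gamma> 0)) \<in> {\<alpha> \<in> CB A. fst \<alpha> \<in> U}"
    using PB_D[OF \<gamma>0] PB_D[OF tau_PB[OF assms(1,2) \<gamma>0]] U0 sharp_CB[OF assms(1,2)] by auto
  have d: "((\<lambda>t. ccoord A \<phi> (\<xi> t)) has_vector_derivative snd (dcoord ?c (velocity (cot_atlas A) \<xi>))) (at 0)"
    if "curve (cot_atlas A) \<xi>" "\<xi> 0 \<in> {\<alpha> \<in> CB A. fst \<alpha> \<in> U}" for \<xi>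
    using bounded_linear.has_vector_derivative[OF bounded_linear_snd
        dcoord_has_vd[OF sC that(1) cot_chartI[OF U(1)] that(2)]] by simp
  have "\<forall>\<^sub>F t in nhds 0. pt (fst (\<gamma> t)) \<in> U" using curve_ev_chart[OF sA cb U(1) U0] .
  then have "\<forall>\<^sub>F t in nhds 0. ccoord A \<phi> (snd (\<gamma> t)) + ccoord A \<phi> (sharp A \<omega> (fst (\<gamma> t))) =
      ccoord A \<phi> (snd (tau A \<omega> (\<gamma> t)))"
    using ev by eventually_elim (use cc in simp)
  then obtain Q where "open Q" "0 \<in> Q" "\<And>t. t \<in> Q \<Longrightarrow>
      ccoord A \<phi> (snd (\<gamma> t)) + ccoord A \<phi> (sharp A \<omega> (fst (\<gamma> t))) = ccoord A \<phi> (snd (tau A \<omega> (\<gamma> t)))"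
    unfolding eventually_nhds by blast
  from has_vector_derivative_transform_within_open[OF has_vector_derivative_add[OF d[OF c1 m(1)] d[OF c2 m(2)]] this]
  have "snd (dcoord ?c (velocity (cot_atlas A) (\<lambda>t. snd (tau A \<omega> (\<gamma> t))))) =
      snd (dcoord ?c (velocity (cot_atlas A) (\<lambda>t. snd (\<gamma> t)))) +
      snd (dcoord ?c (velocity (cot_atlas A) (\<lambda>t. sharp A \<omega> (fst (\<gamma> t)))))"
    using d[OF c3 m(3)] vector_derivative_unique_at by blast
  then show ?thesis
    using tan_pairing_formula[OF assms(1) velocity_TB[OF c1] assms(4) b[OF c1 e] U]
      tan_pairing_formula[OF assms(1) velocity_TB[OF c2] assms(4) b[OF c2] U]
      tan_pairing_formula[OF assms(1) velocity_TB[OF c3] assms(4) b[OF c3] U]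
      e cc[OF \<gamma>0 U0] c1 c2 c3
    by (simp add: inner_add_left)
qed

section \<open>Curves in the fibres of a submersion\<close>

lemma curve_cong_ev:
  assumes "satlas A" "curve A \<gamma>" "\<forall>\<^sub>F t in nhds 0. \<gamma> t = \<delta> t"
  shows "curve A \<delta>" "velocity A \<gamma> = velocity A \<delta>"
proof -
  obtain U \<phi> where U: "(U, \<phi>) \<in> A" "\<gamma> 0 \<in> U" using curve_pts[OF assms(2)] by (rule pts_chart)
  obtain P c where P: "open P" "0 \<in> P" "Cinf P c" "\<And>t. t \<in> P \<Longrightarrow> \<gamma> t \<in> U \<and> \<phi> (\<gamma> t) = c t"
    by (rule curveD[OF assms(1,2) U]) blast
  have "\<forall>\<^sub>F t in nhds 0. \<delta> t \<in> U \<and> \<phi> (\<delta> t) = c t"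
  proof (rule eventually_mono[OF eventually_conj[OF assms(3) eventually_nhds_in_open[OF P(1,2)]]])
    fix t assume "\<gamma> t = \<delta> t \<and> t \<in> P"
    then show "\<delta> t \<in> U \<and> \<phi> (\<delta> t) = c t" using P(4)[of t] by simp
  qed
  then show c: "curve A \<delta>"
    by (rule curveI[OF assms(1) U(1) P(1-3)])
  have 0: "\<gamma> 0 = \<delta> 0" using assms(3) eventually_nhds_x_imp_x by blast
  obtain Q where Q: "open Q" "0 \<in> Q" "\<And>t. t \<in> Q \<Longrightarrow> \<phi> (\<gamma> t) = \<phi> (\<delta> t)"
    using assms(3) unfolding eventually_nhds by metis
  have "((\<lambda>t. \<phi> (\<delta> t)) has_vector_derivative dcoord \<phi> (velocity A \<gamma>)) (at 0)"
    by (rule has_vector_derivative_transform_within_open[OF dcoord_has_vd[OF assms(1,2) U] Q])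
  then show "velocity A \<gamma> = velocity A \<delta>"
    using dcoord_velocity[OF assms(2) U]
    by (intro velocity_eqI[OF assms(1,2) c 0 U]) (simp add: o_def vector_derivative_at)
qed

text \<open>In coordinates the curve is sought as \<open>x0 + t *\<^sub>R b' + R (z t)\<close>,
  where \<open>z\<close> corrects the straight line so that \<open>g\<close> stays constant.
  \<open>R\<close> is a right inverse of \<open>D\<close> on \<open>L\<close> with values in
  \<open>K\<close>, so that the curve can be lifted to the manifold.\<close>

lemma submersion_curve:
  assumes "manifold n A" "manifold m B" and f: "smap A (pts A) B f" and "p \<in> pts A"
    and sur: "tmap B f ` TS A p = TS B (f p)"
    and b: "b \<in> TS A p" "tmap B f b = tzero B (f p)"
  shows "\<exists>\<gamma>\<in>b. \<forall>\<^sub>F t in nhds 0. f (\<gamma> t) = f p"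
proof -
  have sA: "satlas A" and sB: "satlas B" using manifold_satlas assms(1,2) by blast+
  obtain U \<phi> where U: "(U, \<phi>) \<in> A" "p \<in> U" using assms(4) by (rule pts_chart)
  have fp: "f p \<in> pts B" using smap_pts(2)[OF f assms(4)] .
  then obtain V \<psi> where V: "(V, \<psi>) \<in> B" "f p \<in> V" by (rule pts_chart)
  obtain K where K: "inj_on \<phi> U" "subspace K" "openin (top_of_set K) (\<phi> ` U)"
      "\<And>p. p \<in> U \<Longrightarrow> dcoord \<phi> ` TS A p = K"
    by (rule manifold_spaceE[OF assms(1) U(1)]) blast
  obtain L where L: "inj_on \<psi> V" "subspace L" "openin (top_of_set L) (\<psi> ` V)"
      "\<And>p. p \<in> V \<Longrightarrow> dcoord \<psi> ` TS B p = L"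
    by (rule manifold_spaceE[OF assms(2) V(1)]) blast
  obtain P g where P: "\<phi> p \<in> P" "loc_rep (pts A) U \<phi> V \<psi> f P g"
    using smapD[OF f assms(4) U V] .
  have g: "open P" "Cinf P g" using P(2) by (auto simp: loc_rep_def)
  define x0 where "x0 = \<phi> p"
  define D where "D = frechet_derivative g (at x0)"
  have linD: "linear D" unfolding D_def x0_def using loc_rep_linear[OF P(2,1)] .
  have D: "dcoord \<psi> (tmap B f v) = D (dcoord \<phi> v)" if "v \<in> TS A p" for v
    using dcoord_tmap[OF sA sB f _ U(1) _ V(1) P(2)] that U(2) P(1) by (auto simp: D_def x0_def)
  define b' where "b' = dcoord \<phi> b"
  have b'K: "b' \<in> K" unfolding b'_def using K(4)[OF U(2)] b(1) by blast
  have Db': "D b' = 0" using D[OF b(1)] b(2) tzero(2)[OF sB fp V] by (simp add: b'_def)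
  have "D ` K = L"
  proof -
    have "D ` dcoord \<phi> ` TS A p = dcoord \<psi> ` tmap B f ` TS A p"
      unfolding image_image using D by (intro image_cong) auto
    then show ?thesis using K(4)[OF U(2)] L(4)[OF V(2)] sur by simp
  qed
  obtain \<B> where \<B>: "finite \<B>" "\<B> \<subseteq> L" "\<And>k. k \<in> L \<Longrightarrow> (\<Sum>b\<in>\<B>. (k \<bullet> b) *\<^sub>R b) = k"
    using subspace_onbE[OF L(2)] by metis
  have "\<forall>b\<in>\<B>. \<exists>r\<in>K. D r = b" using \<open>D ` K = L\<close> \<B>(2) by blast
  then obtain r where r: "\<And>b. b \<in> \<B> \<Longrightarrow> r b \<in> K \<and> D (r b) = b" by metis
  \<comment> \<open>Each vector of \<B> goes to a chosen preimage in \<open>K\<close>. Consequently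
    \<open>D\<close> after \<open>R\<close> is the orthogonal projection onto
    \<open>L\<close>.\<close>
  define R where "R z = (\<Sum>b\<in>\<B>. (z \<bullet> b) *\<^sub>R r b)" for z
  have RK: "R z \<in> K" for z
    unfolding R_def using r K(2) by (intro subspace_sum subspace_scale) auto
  have linR: "bounded_linear R"
    unfolding R_def by (intro bounded_linear_sum bounded_linear_scaleR_const bounded_linear_inner_left)
  have DR: "D (R z) = (\<Sum>b\<in>\<B>. (z \<bullet> b) *\<^sub>R b)" for z
    unfolding R_def using r linD by (simp add: linear_sum linear_cmul)
  have blDR: "bounded_linear (\<lambda>z. D (R z))"
    unfolding DR by (intro bounded_linear_sum bounded_linear_scaleR_const bounded_linear_inner_left)
  have DRL: "D (R z) \<in> L" for z
    unfolding DR using \<B>(2) L(2) by (intro subspace_sum subspace_scale) auto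
  have proj: "(z - D (R z)) \<bullet> k = 0" if "k \<in> L" for z k
  proof -
    have "D (R z) \<bullet> k = z \<bullet> (\<Sum>b\<in>\<B>. (k \<bullet> b) *\<^sub>R b)"
      unfolding DR by (simp add: inner_sum_left inner_sum_right mult.commute inner_commute)
    then show ?thesis using \<B>(3)[OF that] by (simp add: inner_diff_left)
  qed
  let ?a = "\<lambda>y. x0 + fst y *\<^sub>R b' + R (snd y)"
  \<comment> \<open>The last summand, the component orthogonal to \<open>L\<close>, fills the
    directions that are not tangent to the target, so that \<open>?F\<close> maps a Euclidean space
    to itself with derivative the identity at 0. As \<open>D b' = 0\<close>, the first variable does
    not disturb this.\<close>
  let ?F = "\<lambda>y::real \<times> 'd. (fst y, g (?a y) - g x0 + (snd y - D (R (snd y))))"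
  have Cid: "Cinf UNIV (\<lambda>y::real \<times> 'd. y)" by (rule Cinf_id) simp
  have Ca: "Cinf UNIV ?a"
    by (intro Cinf_add Cinf_const Cinf_scaleR Cinf_fst Cinf_linear[OF linR] Cinf_snd Cid open_UNIV)
  let ?Q = "UNIV \<inter> ?a -` P"
  have o: "open ?Q" using Cinf_open_vimage[OF Ca open_UNIV g(1)] .
  have CF: "Cinf ?Q ?F"
  proof -
    have i: "Cinf ?Q (\<lambda>y. y)" by (rule Cinf_id[OF o])
    have "Cinf ?Q (\<lambda>y. g (?a y))"
      by (rule Cinf_compose[OF g(2) Cinf_subset[OF Ca] o g(1)]) auto
    then show ?thesis
      by (intro Cinf_Pair Cinf_add Cinf_diff Cinf_const Cinf_fst Cinf_snd Cinf_linear[OF blDR] i o)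
  qed
  have x0Q: "(0, 0) \<in> ?Q" using P(1) bounded_linear.linear[OF linR] by (simp add: x0_def linear_0)
  have F0: "?F (0, 0) = (0, 0)"
    using linear_0[OF bounded_linear.linear[OF linR]] linear_0[OF linD] by simp
  have hF: "(?F has_derivative id) (at (0, 0))"
  proof -
    have a0: "?a (0, 0) = x0" using linear_0[OF bounded_linear.linear[OF linR]] by simp
    have da: "(?a has_derivative (\<lambda>d. fst d *\<^sub>R b' + R (snd d))) (at (0, 0))"
      by (auto intro!: derivative_eq_intros bounded_linear.has_derivative[OF linR])
    have dg: "(g has_derivative D) (at (?a (0, 0)))"
      unfolding a0 D_def using Cinf_has_derivative[OF g(2)] P(1) by (simp add: x0_def)
    have "((\<lambda>y. g (?a y)) has_derivative (\<lambda>d. D (fst d *\<^sub>R b' + R (snd d)))) (at (0, 0))"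
      by (rule has_derivative_compose[where g = g, OF da dg])
    then have "(?F has_derivative (\<lambda>d. (fst d, D (fst d *\<^sub>R b' + R (snd d)) - 0 + (snd d - D (R (snd d)))))) (at (0, 0))"
      by (intro has_derivative_Pair has_derivative_add has_derivative_diff has_derivative_const
          bounded_linear.has_derivative[OF blDR] has_derivative_fst has_derivative_snd has_derivative_ident)
    moreover have "(\<lambda>d. (fst d, D (fst d *\<^sub>R b' + R (snd d)) - 0 + (snd d - D (R (snd d))))) = id"
      using Db' linD by (auto simp: linear_add linear_cmul)
    ultimately show ?thesis by simp
  qed
  obtain W h where W: "open W" "?F (0, 0) \<in> W" "Cinf W h" "h ` W \<subseteq> ?Q" "h (?F (0, 0)) = (0, 0)"
      "\<And>y. y \<in> W \<Longrightarrow> ?F (h y) = y"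
    by (rule Cinf_inverse_function[OF CF o x0Q frechet_derivative_at[OF hF, symmetric]]) blast
  have W0: "(0, 0) \<in> W" "h (0, 0) = (0, 0)" using W(2,5) unfolding F0 .
  \<comment> \<open>The inverse has derivative the identity too, so the correction \<open>?z\<close>
    starts with velocity 0 and the curve keeps the velocity \<open>b'\<close>.\<close>
  have hh: "(h has_derivative id) (at (0, 0))"
  proof -
    obtain h' where h': "(h has_derivative h') (at (0, 0))"
      using Cinf_has_derivative[OF W(3) W0(1)] by blast
    have "((\<lambda>y. ?F (h y)) has_derivative (\<lambda>d. id (h' d))) (at (0, 0))"
      by (rule has_derivative_compose[where g = ?F, OF h']) (simp only: W0(2) hF)
    then have "((\<lambda>y. y) has_derivative (\<lambda>d. id (h' d))) (at (0, 0))"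
      by (rule has_derivative_transform_within_open[OF _ W(1) W0(1)]) (rule W(6))
    then have "(\<lambda>d. id (h' d)) = (\<lambda>d. d)"
      using has_derivative_unique has_derivative_ident by blast
    then show ?thesis using h' by (simp add: id_def)
  qed
  let ?z = "\<lambda>t. snd (h (t, 0))" and ?c = "\<lambda>t. x0 + t *\<^sub>R b' + R (snd (h (t, 0)))"
  let ?I = "UNIV \<inter> (\<lambda>t::real. (t, 0::'d)) -` W"
  have Ci: "Cinf UNIV (\<lambda>t::real. (t, 0::'d))"
    by (intro Cinf_Pair Cinf_id Cinf_const open_UNIV)
  have oI: "open ?I" using Cinf_open_vimage[OF Ci open_UNIV W(1)] .
  have I0: "0 \<in> ?I" using W0(1) by simp
  have Cc: "Cinf ?I ?c"
  proof -
    have "Cinf ?I (\<lambda>t. h (t, 0))"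
      by (rule Cinf_compose[OF W(3) Cinf_subset[OF Ci] oI W(1)]) auto
    then show ?thesis
      by (intro Cinf_add Cinf_const Cinf_scaleR Cinf_id Cinf_linear[OF linR] Cinf_snd oI)
  qed
  have c0: "?c 0 = x0" using W0(2) linear_0[OF bounded_linear.linear[OF linR]] by simp
  have xK: "x0 \<in> K" unfolding x0_def using openin_imp_subset[OF K(3)] U(2) by blast
  have cK: "?c t \<in> K" for t
    using xK b'K RK K(2) by (simp add: subspace_add subspace_scale)
  let ?\<gamma> = "\<lambda>t. inv_into U \<phi> (?c t)"
  have \<gamma>: "curve A ?\<gamma>" "?\<gamma> 0 = p" "\<forall>\<^sub>F t in nhds 0. ?\<gamma> t \<in> U \<and> \<phi> (?\<gamma> t) = ?c t"
    using model_curve[OF sA U(1) K(1,3) oI I0 Cc cK U(2)] c0 by (simp_all add: x0_def)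
  have "(?c has_vector_derivative b') (at 0)"
  proof -
    have "((\<lambda>t. h (t, 0)) has_derivative (\<lambda>d. id (d, 0))) (at 0)"
      by (rule has_derivative_compose[where g = h and f = "\<lambda>t. (t, 0)", OF _ hh])
        (auto intro!: derivative_eq_intros)
    then have "((\<lambda>t. R (snd (h (t, 0)))) has_derivative (\<lambda>d. R (snd (id (d, 0::'d))))) (at 0)"
      by (intro bounded_linear.has_derivative[OF linR] has_derivative_snd)
    then have "(?c has_derivative (\<lambda>d. (0 + d *\<^sub>R b') + R (snd (id (d, 0::'d))))) (at 0)"
      by (intro has_derivative_add has_derivative_const has_derivative_scaleR_left has_derivative_ident)
    then show ?thesis
      using linear_0[OF bounded_linear.linear[OF linR]] by (simp add: has_vector_derivative_def)
  qed
  moreover obtain Q where "open Q" "0 \<in> Q" "\<And>t. t \<in> Q \<Longrightarrow> ?c t = \<phi> (?\<gamma> t)"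
    using \<gamma>(3) unfolding eventually_nhds by metis
  ultimately have "((\<lambda>t. \<phi> (?\<gamma> t)) has_vector_derivative b') (at 0)"
    by (rule has_vector_derivative_transform_within_open)
  then have "dcoord \<phi> (velocity A ?\<gamma>) = b'"
    using dcoord_velocityI[OF \<gamma>(1) U(1)] \<gamma>(2) U(2) by simp
  then have "velocity A ?\<gamma> = b"
    using TB_eqI[OF sA velocity_TB[OF \<gamma>(1)] _ _ U(1), of b] b(1) \<gamma>(1,2) U(2)
    by (simp add: b'_def)
  then have "?\<gamma> \<in> b" using velocity_self[OF \<gamma>(1)] by simp
  moreover have "\<forall>\<^sub>F t in nhds 0. f (?\<gamma> t) = f p"
    using \<gamma>(3) eventually_nhds_in_open[OF oI I0]
  proof eventually_elim
    case (elim t)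
    have tW: "(t, 0) \<in> W" using elim by simp
    from W(6)[OF this] have fst_h: "fst (h (t, 0)) = t"
      and eq: "g (?c t) - g x0 + (?z t - D (R (?z t))) = 0"
      by (metis fst_conv, metis fst_conv snd_conv)
    have cP: "?c t \<in> P" using W(4) tW fst_h by (auto simp: image_subset_iff)
    have pts: "?\<gamma> t \<in> pts A" using chart_pts[OF U(1)] elim by blast
    have "f (?\<gamma> t) \<in> V \<and> \<psi> (f (?\<gamma> t)) = g (\<phi> (?\<gamma> t))"
      using P(2) pts elim cP unfolding loc_rep_def by auto
    then have q: "f (?\<gamma> t) \<in> V" "\<psi> (f (?\<gamma> t)) = g (?c t)"
      using elim by simp_all
    have p': "\<psi> (f p) = g x0"
      using P(2) assms(4) U(2) P(1) unfolding loc_rep_def by (auto simp: x0_def)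
    \<comment> \<open>The equation \<open>eq\<close> is a sum of a vector in \<open>L\<close> and a
      vector orthogonal to \<open>L\<close>; both vanish, and so \<open>g\<close> is constant along
      the curve.\<close>
    have "g (?c t) \<in> L" "g x0 \<in> L"
      using q p' V(2) openin_imp_subset[OF L(3)] by (metis image_eqI subsetD)+
    then have "g (?c t) - g x0 \<in> L" using L(2) by (simp add: subspace_diff)
    moreover have z: "?z t - D (R (?z t)) = - (g (?c t) - g x0)"
      using eq by (simp only: add_eq_0_iff)
    ultimately have "?z t - D (R (?z t)) \<in> L" using subspace_neg[OF L(2)] by metis
    from proj[OF this, of "?z t"] have "?z t - D (R (?z t)) = 0" by simp
    then have "g (?c t) = g x0" using z by simp
    then show "f (?\<gamma> t) = f p"
      using inj_onD[OF L(1) _ q(1) V(2)] q(2) p' by simp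
  qed
  ultimately show ?thesis by (intro bexI[of _ ?\<gamma>])
qed


section \<open>Lie groupoids\<close>

locale lie_gpd =
  fixes G :: "('g, 'e::euclidean_space, 'm, 'f::euclidean_space) gpd" and k n :: nat
  assumes mfd: "manifold k (arr G)" "manifold n (obj G)" and smooth: "smooth_groupoid G"
begin

lemmas sA = manifold_satlas[OF mfd(1)] and sM = manifold_satlas[OF mfd(2)]

lemma groupoid: "groupoid G"
  using smooth unfolding smooth_groupoid_def by blast

lemma src_tgt_obj: "g \<in> pts (arr G) \<Longrightarrow> src G g \<in> pts (obj G)" "g \<in> pts (arr G) \<Longrightarrow> tgt G g \<in> pts (obj G)"
  using groupoid unfolding groupoid_def by blast+

lemma one_simps: "x \<in> pts (obj G) \<Longrightarrow> one G x \<in> pts (arr G)" "x \<in> pts (obj G) \<Longrightarrow> src G (one G x) = x"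
  "x \<in> pts (obj G) \<Longrightarrow> tgt G (one G x) = x"
  using groupoid unfolding groupoid_def by blast+

lemma mul_one: "g \<in> pts (arr G) \<Longrightarrow> mul G g (one G (src G g)) = g"
  using groupoid unfolding groupoid_def by blast

lemma smap_structure:
  "smap (arr G) (pts (arr G)) (obj G) (src G)" "smap (arr G) (pts (arr G)) (obj G) (tgt G)"
  "smap (obj G) (pts (obj G)) (arr G) (one G)"
proof -
  have s: "smooth_map (arr G) (pts (arr G)) (obj G) (src G)" "smooth_map (arr G) (pts (arr G)) (obj G) (tgt G)"
    "smooth_map (obj G) (pts (obj G)) (arr G) (one G)"
    using smooth unfolding smooth_groupoid_def submersion_def by simp_all
  note iA = manifold_inj_charts[OF mfd(1)] and iM = manifold_inj_charts[OF mfd(2)]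
  show "smap (arr G) (pts (arr G)) (obj G) (src G)" by (rule smooth_map_imp_smap[OF sA sM iA s(1)])
  show "smap (arr G) (pts (arr G)) (obj G) (tgt G)" by (rule smooth_map_imp_smap[OF sA sM iA s(2)])
  show "smap (obj G) (pts (obj G)) (arr G) (one G)" by (rule smooth_map_imp_smap[OF sM sA iM s(3)])
qed

lemma satlas_comp: "satlas (comp_pairs G)"
  unfolding comp_pairs_def by (intro satlas_induced satlas_prod sA)

lemma pts_comp: "pts (comp_pairs G) = {(g, h). g \<in> pts (arr G) \<and> h \<in> pts (arr G) \<and> tgt G h = src G g}"
  unfolding comp_pairs_def by (auto simp: pts_induced pts_prod)

lemma smap_comp:
  "smap (comp_pairs G) (pts (comp_pairs G)) (arr G) (\<lambda>(g, h). mul G g h)"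
  "smap (comp_pairs G) (pts (comp_pairs G)) (arr G) fst"
  "smap (comp_pairs G) (pts (comp_pairs G)) (arr G) snd"
proof -
  have "inj_charts (comp_pairs G)"
    unfolding comp_pairs_def by (intro inj_charts_restr inj_charts_prod manifold_inj_charts[OF mfd(1)])
  then show "smap (comp_pairs G) (pts (comp_pairs G)) (arr G) (\<lambda>(g, h). mul G g h)"
    using smooth smooth_map_imp_smap[OF satlas_comp sA] unfolding smooth_groupoid_def by blast
  have sub: "pts (comp_pairs G) \<subseteq> pts (prod_atlas (arr G) (arr G))"
    by (auto simp: pts_comp pts_prod)
  show "smap (comp_pairs G) (pts (comp_pairs G)) (arr G) fst"
    "smap (comp_pairs G) (pts (comp_pairs G)) (arr G) snd"
    using smap_restr[OF smap_subset[OF smap_proj(1)[OF sA sA] sub]]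
      smap_restr[OF smap_subset[OF smap_proj(2)[OF sA sA] sub]]
    unfolding pts_comp unfolding comp_pairs_def by blast+
qed

section \<open>Multiplicative forms on velocities of composable curves\<close>

lemma curve_comp:
  assumes "curve (arr G) \<gamma>" "curve (arr G) \<delta>" "\<forall>\<^sub>F t in nhds 0. tgt G (\<delta> t) = src G (\<gamma> t)"
  shows "curve (comp_pairs G) (\<lambda>t. (\<gamma> t, \<delta> t))"
  unfolding comp_pairs_def curve_restr[OF satlas_prod[OF sA sA]]
proof
  show "curve (prod_atlas (arr G) (arr G)) (\<lambda>t. (\<gamma> t, \<delta> t))"
    by (rule curve_prodI[OF sA sA]) (use assms in simp_all)
  show "\<forall>\<^sub>F t in nhds 0. (\<gamma> t, \<delta> t) \<in> {(g, h). g \<in> pts (arr G) \<and> h \<in> pts (arr G) \<and> tgt G h = src G g}"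
    using assms(3) curve_ev_pts[OF sA assms(1)] curve_ev_pts[OF sA assms(2)] by eventually_elim simp
qed

lemma curve_mul:
  assumes "curve (arr G) \<gamma>" "curve (arr G) \<delta>" "\<forall>\<^sub>F t in nhds 0. tgt G (\<delta> t) = src G (\<gamma> t)"
  shows "curve (arr G) (\<lambda>t. mul G (\<gamma> t) (\<delta> t))"
  using curve_compose[OF satlas_comp sA curve_comp[OF assms] curve_ev_pts[OF satlas_comp curve_comp[OF assms]]
      smap_comp(1)] by simp

text \<open>Tangent vectors to the composable pairs are entered as velocities of pairs of curves, so
  their images under multiplication are velocities of pointwise products, which the later
  applications can recognise.\<close>

lemma mult_form_curves:
  assumes "mult_form G \<omega>"
    and c: "curve (arr G) \<gamma>" "curve (arr G) \<delta>" "\<forall>\<^sub>F t in nhds 0. tgt G (\<delta> t) = src G (\<gamma> t)"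
    and c': "curve (arr G) \<gamma>'" "curve (arr G) \<delta>'" "\<forall>\<^sub>F t in nhds 0. tgt G (\<delta>' t) = src G (\<gamma>' t)"
    and 0: "\<gamma> 0 = \<gamma>' 0" "\<delta> 0 = \<delta>' 0"
  shows "\<omega> (velocity (arr G) (\<lambda>t. mul G (\<gamma> t) (\<delta> t))) (velocity (arr G) (\<lambda>t. mul G (\<gamma>' t) (\<delta>' t))) =
    \<omega> (velocity (arr G) \<gamma>) (velocity (arr G) \<gamma>') + \<omega> (velocity (arr G) \<delta>) (velocity (arr G) \<delta>')"
proof -
  let ?V = "velocity (comp_pairs G) (\<lambda>t. (\<gamma> t, \<delta> t))" and ?W = "velocity (comp_pairs G) (\<lambda>t. (\<gamma>' t, \<delta>' t))"
  note V = curve_comp[OF c] and W = curve_comp[OF c']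
  have "pt ?V = pt ?W" using V W 0 by simp
  then have "\<omega> (tmap (arr G) (\<lambda>(g, h). mul G g h) ?V) (tmap (arr G) (\<lambda>(g, h). mul G g h) ?W) =
     \<omega> (tmap (arr G) fst ?V) (tmap (arr G) fst ?W) + \<omega> (tmap (arr G) snd ?V) (tmap (arr G) snd ?W)"
    using assms(1) velocity_TB[OF V] velocity_TB[OF W] unfolding mult_form_def by blast
  then show ?thesis
    by (simp add: tmap_velocity[OF satlas_comp sA smap_comp(1)] tmap_velocity[OF satlas_comp sA smap_comp(2)]
        tmap_velocity[OF satlas_comp sA smap_comp(3)] V W)
qed

text \<open>The unit of the tangent groupoid at the source of \<open>X\<close>.\<close>

definition base_unit :: "'g tan \<Rightarrow> 'g tan" where
  "base_unit X = tmap (arr G) (one G) (tmap (obj G) (src G) X)"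

lemma base_unit:
  assumes "X \<in> TB (arr G)"
  shows "base_unit X \<in> TB (arr G)" "pt (base_unit X) = one G (src G (pt X))"
  using tmap_TB[OF sA sM smap_structure(1) assms] tmap_TB[OF sM sA smap_structure(3)]
  by (simp_all add: base_unit_def)

lemma tmap_one_section:
  assumes "smap (arr G) (pts (arr G)) (obj G) f" "\<And>x. x \<in> pts (obj G) \<Longrightarrow> f (one G x) = x"
    and "u \<in> TB (obj G)"
  shows "tmap (obj G) f (tmap (arr G) (one G) u) = u"
proof -
  obtain c where c: "curve (obj G) c" "u = velocity (obj G) c" using TB_velocity[OF assms(3)] by metis
  have c1: "curve (arr G) (\<lambda>t. one G (c t))"
    using curve_compose[OF sM sA c(1) curve_ev_pts[OF sM c(1)] smap_structure(3)] .
  have "\<forall>\<^sub>F t in nhds 0. c t = f (one G (c t))"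
    using curve_ev_pts[OF sM c(1)] by eventually_elim (simp add: assms(2))
  then show ?thesis
    using tmap_velocity[OF sM sA smap_structure(3) c(1)] tmap_velocity[OF sA sM assms(1) c1]
      curve_cong_ev(2)[OF sM c(1)] c(2) by simp
qed

text \<open>\<open>w\<close> is the projection of \<open>v\<close> along the tangent space of the
  units onto the kernel of the tangent map of \<open>f\<close>. With the target it yields vectors
  that left translation accepts, with the source it lands in the Lie algebroid.\<close>

lemma unit_projection:
  assumes f: "smap (arr G) (pts (arr G)) (obj G) f" "\<And>x. x \<in> pts (obj G) \<Longrightarrow> f (one G x) = x"
    and x: "x \<in> pts (obj G)" and v: "v \<in> TS (arr G) (one G x)"
  defines "w \<equiv> tlin (arr G) 1 v (-1) (tmap (arr G) (one G) (tmap (obj G) f v))"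
  shows "tmap (arr G) (one G) (tmap (obj G) f v) \<in> TS (arr G) (one G x)" "w \<in> TS (arr G) (one G x)"
    "tmap (obj G) f w = tzero (obj G) x" "tmap (obj G) f v \<in> TS (obj G) x"
proof -
  show fv: "tmap (obj G) f v \<in> TS (obj G) x"
    using tmap_TB[OF sA sM f(1), of v] v f(2)[OF x] by auto
  show u: "tmap (arr G) (one G) (tmap (obj G) f v) \<in> TS (arr G) (one G x)"
    using tmap_TB[OF sM sA smap_structure(3), of "tmap (obj G) f v"] fv by auto
  show "w \<in> TS (arr G) (one G x)"
    unfolding w_def by (rule tlin(1)[OF mfd(1) v u])
  obtain U \<phi> where U: "(U, \<phi>) \<in> obj G" "x \<in> U" using x by (rule pts_chart)
  have "tmap (obj G) f w = tlin (obj G) 1 (tmap (obj G) f v) (-1) (tmap (obj G) f v)"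
    unfolding w_def tmap_tlin[OF mfd f(1) v u] using tmap_one_section[OF f] fv by simp
  also have "\<dots> = tzero (obj G) x"
    by (rule tlin_eqI[OF mfd(2) fv fv tzero(1)[OF sM x] U]) (use tzero(2)[OF sM x U] in simp)
  finally show "tmap (obj G) f w = tzero (obj G) x" .
qed

text \<open>Units are idempotent, so multiplicativity at a product of units shows that the value
  equals twice itself.\<close>

lemma mult_form_units:
  assumes "mult_form G \<omega>" "u \<in> TS (obj G) x" "w \<in> TS (obj G) x"
  shows "\<omega> (tmap (arr G) (one G) u) (tmap (arr G) (one G) w) = 0"
proof -
  obtain c where c: "curve (obj G) c" "u = velocity (obj G) c" "c 0 = pt u"
    using TB_velocity[of u] assms(2) by auto
  obtain d where d: "curve (obj G) d" "w = velocity (obj G) d" "d 0 = pt w"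
    using TB_velocity[of w] assms(3) by auto
  have one: "curve (arr G) (\<lambda>t. one G (q t))" "\<forall>\<^sub>F t in nhds 0. tgt G (one G (q t)) = src G (one G (q t))"
    "\<forall>\<^sub>F t in nhds 0. one G (q t) = mul G (one G (q t)) (one G (q t))"
    if "curve (obj G) q" for q
    using curve_compose[OF sM sA that curve_ev_pts[OF sM that] smap_structure(3)]
      eventually_mono[OF curve_ev_pts[OF sM that]] mul_one[OF one_simps(1)]
    by (auto simp: one_simps elim!: eventually_mono)
  note c1 = one[OF c(1)] and d1 = one[OF d(1)]
  have "\<omega> (velocity (arr G) (\<lambda>t. one G (c t))) (velocity (arr G) (\<lambda>t. one G (d t))) =
    \<omega> (velocity (arr G) (\<lambda>t. one G (c t))) (velocity (arr G) (\<lambda>t. one G (d t))) +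
    \<omega> (velocity (arr G) (\<lambda>t. one G (c t))) (velocity (arr G) (\<lambda>t. one G (d t)))"
    using mult_form_curves[OF assms(1) c1(1,1,2) d1(1,1,2)] c(3) d(3) assms(2,3)
      curve_cong_ev(2)[OF sA c1(1,3)] curve_cong_ev(2)[OF sA d1(1,3)] by simp
  then show ?thesis
    using tmap_velocity[OF sM sA smap_structure(3)] c d by simp
qed

lemma form_tzero:
  assumes "two_form (arr G) \<omega>" "X \<in> TB (arr G)"
  shows "\<omega> X (tzero (arr G) (pt X)) = 0"
proof -
  have X: "X \<in> TS (arr G) (pt X)" using assms(2) by simp
  obtain U \<phi> where U: "(U, \<phi>) \<in> arr G" "pt X \<in> U" using TB_pt[OF assms(2)] by (rule pts_chart)
  have "tlin (arr G) 0 X 0 X = tzero (arr G) (pt X)"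
    by (rule tlin_eqI[OF mfd(1) X X tzero(1)[OF sA TB_pt[OF assms(2)]] U])
      (use tzero(2)[OF sA TB_pt[OF assms(2)] U] in simp)
  then show ?thesis
    using two_form_right[OF mfd(1) assms(1) X X X, of 0 0] by simp
qed

text \<open>\<open>tleft\<close> follows a representative inside the target fibre, chosen by
  \<open>SOME\<close>. \<open>submersion_curve\<close> guarantees that there is one, and the chosen
  one is kept as \<delta>.\<close>

lemma tgt_fibre_curve:
  assumes x: "x \<in> pts (obj G)" and b: "b \<in> TS (arr G) (one G x)" "tmap (obj G) (tgt G) b = tzero (obj G) x"
    and g: "src G g = x"
  obtains \<delta> where "tleft G g b = velocity (arr G) (\<lambda>t. mul G g (\<delta> t))" "\<delta> \<in> b"
    "\<forall>\<^sub>F t in nhds 0. \<delta> t \<in> {h \<in> pts (arr G). tgt G h = x}"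
proof -
  have "tmap (obj G) (tgt G) ` TS (arr G) (one G x) = TS (obj G) (tgt G (one G x))"
    using smooth one_simps(1)[OF x] unfolding smooth_groupoid_def submersion_def by blast
  then obtain \<gamma> where \<gamma>: "\<gamma> \<in> b" "\<forall>\<^sub>F t in nhds 0. tgt G (\<gamma> t) = x"
    using submersion_curve[OF mfd smap_structure(2) one_simps(1)[OF x] _ b(1)] b(2) one_simps(3)[OF x] by auto
  have "curve (arr G) \<gamma>" using TB_memD(1)[OF _ \<gamma>(1)] b(1) by auto
  then have "\<forall>\<^sub>F t in nhds 0. \<gamma> t \<in> {h \<in> pts (arr G). tgt G h = x}"
    using \<gamma>(2) curve_ev_pts[OF sA] by (auto simp: eventually_conj_iff)
  then have some: "(SOME \<gamma>. \<gamma> \<in> b \<and> (\<forall>\<^sub>F t in nhds 0. \<gamma> t \<in> {h \<in> pts (arr G). tgt G h = x})) \<in> b \<and>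
      (\<forall>\<^sub>F t in nhds 0. (SOME \<gamma>. \<gamma> \<in> b \<and> (\<forall>\<^sub>F t in nhds 0. \<gamma> t \<in> {h \<in> pts (arr G). tgt G h = x})) t
        \<in> {h \<in> pts (arr G). tgt G h = x})"
    by (intro someI[of "\<lambda>\<gamma>. \<gamma> \<in> b \<and> (\<forall>\<^sub>F t in nhds 0. \<gamma> t \<in> {h \<in> pts (arr G). tgt G h = x})",
          OF conjI[OF \<gamma>(1)]])
  show thesis
    by (rule that[OF _ conjunct1[OF some] conjunct2[OF some]]) (simp add: tleft_def tmap_on_def o_def g)
qed

lemma form_tleft:
  assumes \<omega>: "two_form (arr G) \<omega>" "mult_form G \<omega>" and X: "X \<in> TB (arr G)"
    and b: "b \<in> TS (arr G) (one G (src G (pt X)))" "tmap (obj G) (tgt G) b = tzero (obj G) (src G (pt X))"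
  shows "tleft G (pt X) b \<in> TS (arr G) (pt X)" "\<omega> X (tleft G (pt X) b) = \<omega> (base_unit X) b"
proof -
  let ?x = "src G (pt X)"
  have gA: "pt X \<in> pts (arr G)" using TB_pt[OF X] .
  have x: "?x \<in> pts (obj G)" using src_tgt_obj(1)[OF gA] .
  obtain \<delta> where \<delta>: "tleft G (pt X) b = velocity (arr G) (\<lambda>t. mul G (pt X) (\<delta> t))" "\<delta> \<in> b"
    "\<forall>\<^sub>F t in nhds 0. \<delta> t \<in> {h \<in> pts (arr G). tgt G h = ?x}"
    by (rule tgt_fibre_curve[OF x b refl]) blast
  have d: "curve (arr G) \<delta>" "b = velocity (arr G) \<delta>" "\<delta> 0 = one G ?x"
    using TB_memD[OF _ \<delta>(2), of "arr G"] b(1) by auto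
  have td: "\<forall>\<^sub>F t in nhds 0. tgt G (\<delta> t) = src G (pt X)" using \<delta>(3) by eventually_elim simp
  obtain \<gamma> where \<gamma>: "curve (arr G) \<gamma>" "X = velocity (arr G) \<gamma>" "\<gamma> 0 = pt X" using TB_velocity[OF X] .
  note ev = curve_ev_pts[OF sA \<gamma>(1)]
  have cs: "curve (obj G) (\<lambda>t. src G (\<gamma> t))" using curve_compose[OF sA sM \<gamma>(1) ev smap_structure(1)] .
  have cu: "curve (arr G) (\<lambda>t. one G (src G (\<gamma> t)))"
    using curve_compose[OF sM sA cs curve_ev_pts[OF sM cs] smap_structure(3)] .
  have tu: "\<forall>\<^sub>F t in nhds 0. tgt G (one G (src G (\<gamma> t))) = src G (\<gamma> t)"
    using ev by eventually_elim (simp add: one_simps src_tgt_obj)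
  have mu: "\<forall>\<^sub>F t in nhds 0. \<gamma> t = mul G (\<gamma> t) (one G (src G (\<gamma> t)))"
    using ev by eventually_elim (simp add: mul_one)
  have cg: "curve (arr G) (\<lambda>_. pt X)" using curve_const[OF sA gA] .
  have E: "velocity (arr G) (\<lambda>t. one G (src G (\<gamma> t))) = base_unit X"
    unfolding base_unit_def \<gamma>(2) tmap_velocity[OF sA sM smap_structure(1) \<gamma>(1)]
      tmap_velocity[OF sM sA smap_structure(3) cs] ..
  show "tleft G (pt X) b \<in> TS (arr G) (pt X)"
    unfolding \<delta>(1) using velocity_TB[OF curve_mul[OF cg d(1) td]] curve_mul[OF cg d(1) td]
    by (simp add: d(3) mul_one[OF gA])
  \<comment> \<open>Multiplicativity for \<gamma> times its source units against the constant curve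
    times \<delta>. The first factors contribute the pairing with a zero vector, the second factors
    the term that survives.\<close>
  have "\<omega> X (tleft G (pt X) b) = \<omega> X (tzero (arr G) (pt X)) + \<omega> (base_unit X) b"
    using mult_form_curves[OF \<omega>(2) \<gamma>(1) cu tu cg d(1) td \<gamma>(3)] \<gamma>(3) d(3)
    unfolding curve_cong_ev(2)[OF sA \<gamma>(1) mu, symmetric] \<delta>(1) E tzero_def
    by (simp flip: \<gamma>(2) d(2))
  then show "\<omega> X (tleft G (pt X) b) = \<omega> (base_unit X) b"
    using form_tzero[OF \<omega>(1) X] by simp
qed

text \<open>The source of a covector tests it on the left translate of \<open>a\<close> minus its
  unit part. After \<open>form_tleft\<close> the unit part drops out, because \<omega> vanishes on
  two vectors tangent to the units.\<close>

lemma cot_src_sharp: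
  assumes \<omega>: "two_form (arr G) \<omega>" "mult_form G \<omega>" and X: "X \<in> TB (arr G)"
    and a: "a \<in> lie_alg_fib G (src G (pt X))"
  shows "snd (cot_src G (sharp (arr G) \<omega> X)) a = \<omega> (base_unit X) a"
proof -
  let ?x = "src G (pt X)"
  have x: "?x \<in> pts (obj G)" using src_tgt_obj(1)[OF TB_pt[OF X]] .
  have aT: "a \<in> TS (arr G) (one G ?x)" using a by (simp add: lie_alg_fib_def lie_alg_def)
  note p = unit_projection[OF smap_structure(2) one_simps(3) x aT]
  let ?u = "tmap (arr G) (one G) (tmap (obj G) (tgt G) a)"
  let ?b = "tlin (arr G) 1 a (-1) ?u"
  note t = form_tleft[OF \<omega> X p(2,3)]
  have E: "base_unit X \<in> TS (arr G) (one G ?x)" using base_unit[OF X] by simp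
  have "snd (cot_src G (sharp (arr G) \<omega> X)) a = \<omega> X (tleft G (pt X) ?b)"
    using a t(1) by (simp add: cot_src_def sharp_def)
  also have "\<dots> = \<omega> (base_unit X) ?b" by (rule t(2))
  also have "\<dots> = \<omega> (base_unit X) a - \<omega> (base_unit X) ?u"
    using two_form_right[OF mfd(1) \<omega>(1) aT p(1) E, of 1 "-1"] by simp
  also have "\<omega> (base_unit X) ?u = 0"
    unfolding base_unit_def
    by (rule mult_form_units[OF \<omega>(2) _ p(4)]) (use tmap_TB[OF sA sM smap_structure(1) X] in simp)
  finally show ?thesis by simp
qed

lemma unit_projection_fib:
  assumes x: "x \<in> pts (obj G)" and v: "v \<in> TS (arr G) (one G x)"
  shows "tlin (arr G) 1 v (-1) (tmap (arr G) (one G) (tmap (obj G) (src G) v)) \<in> lie_alg_fib G x"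
  using unit_projection[OF smap_structure(1) one_simps(2) assms] x
  by (auto simp: lie_alg_fib_def lie_alg_def)

text \<open>The unit covector sees only the algebroid part of \<open>v\<close>, where
  \<open>cot_src_sharp\<close> applies; on the remaining part, tangent to the units, \<omega> pairs
  \<open>base_unit X\<close> to 0.\<close>

lemma cot_one_src_sharp:
  assumes \<omega>: "two_form (arr G) \<omega>" "mult_form G \<omega>" and X: "X \<in> TB (arr G)"
  shows "cot_one G (cot_src G (sharp (arr G) \<omega> X)) = sharp (arr G) \<omega> (base_unit X)"
proof (rule prod_eqI)
  let ?x = "src G (pt X)"
  have x: "?x \<in> pts (obj G)" using src_tgt_obj(1)[OF TB_pt[OF X]] .
  have E: "base_unit X \<in> TS (arr G) (one G ?x)" using base_unit[OF X] by simp
  have fst_src: "cot_src G (sharp (arr G) \<omega> X) = (?x, snd (cot_src G (sharp (arr G) \<omega> X)))"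
    by (simp add: cot_src_def sharp_def)
  show "fst (cot_one G (cot_src G (sharp (arr G) \<omega> X))) = fst (sharp (arr G) \<omega> (base_unit X))"
    using E by (subst fst_src) (simp add: cot_one_def)
  have "snd (cot_one G (cot_src G (sharp (arr G) \<omega> X))) v = \<omega> (base_unit X) v"
    if v: "v \<in> TS (arr G) (one G ?x)" for v
  proof -
    let ?u = "tmap (arr G) (one G) (tmap (obj G) (src G) v)"
    note p = unit_projection[OF smap_structure(1) one_simps(2) x v]
    have "snd (cot_one G (cot_src G (sharp (arr G) \<omega> X))) v = \<omega> (base_unit X) (tlin (arr G) 1 v (-1) ?u)"
      using cot_src_sharp[OF \<omega> X unit_projection_fib[OF x v]] v
      by (subst fst_src) (simp add: cot_one_def)
    also have "\<dots> = \<omega> (base_unit X) v - \<omega> (base_unit X) ?u"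
      using two_form_right[OF mfd(1) \<omega>(1) v p(1) E, of 1 "-1"] by simp
    also have "\<omega> (base_unit X) ?u = 0"
      unfolding base_unit_def
      by (rule mult_form_units[OF \<omega>(2) _ p(4)]) (use tmap_TB[OF sA sM smap_structure(1) X] in simp)
    finally show ?thesis by simp
  qed
  moreover have "snd (cot_one G (cot_src G (sharp (arr G) \<omega> X))) v = 0"
    if v: "v \<notin> TS (arr G) (one G ?x)" for v
    using v by (subst fst_src) (auto simp: cot_one_def)
  ultimately show "snd (cot_one G (cot_src G (sharp (arr G) \<omega> X))) = snd (sharp (arr G) \<omega> (base_unit X))"
    using E by (auto simp: sharp_def)
qed

section \<open>The unit at the source in the Pontryagin groupoid\<close>

lemma cot_src_add:
  assumes "fst \<alpha> = fst \<beta>"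
  shows "cot_src G (fst \<alpha>, \<lambda>Y. snd \<alpha> Y + snd \<beta> Y) =
    (src G (fst \<alpha>), \<lambda>a. snd (cot_src G \<alpha>) a + snd (cot_src G \<beta>) a)"
  using assms by (auto simp: cot_src_def split_beta)

lemma cot_one_add: "cot_one G (x, \<lambda>a. \<alpha> a + \<beta> a) =
    (one G x, \<lambda>v. snd (cot_one G (x, \<alpha>)) v + snd (cot_one G (x, \<beta>)) v)"
  by (auto simp: cot_one_def)

lemma fst_cot_src: "fst (cot_src G \<alpha>) = src G (fst \<alpha>)"
  by (simp add: cot_src_def split_beta)

lemma fst_cot_one: "fst (cot_one G \<alpha>) = one G (fst \<alpha>)"
  by (simp add: cot_one_def split_beta)

abbreviation usrc :: "'g tan \<times> 'g cot \<Rightarrow> 'g tan \<times> 'g cot" where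
  "usrc l \<equiv> one (pont_gpd G) (src (pont_gpd G) l)"

lemma src_pont: "src (pont_gpd G) l = (tmap (obj G) (src G) (fst l), cot_src G (snd l))"
  by (simp add: pont_gpd_def tan_gpd_def cot_gpd_def map_prod_def split_beta)

lemma usrc: "usrc l = (base_unit (fst l), cot_one G (cot_src G (snd l)))"
  by (simp add: pont_gpd_def tan_gpd_def cot_gpd_def base_unit_def map_prod_def split_beta)

text \<open>Source and unit of covectors are additive in the fibre, so the covector of
  \<open>l\<close> and the one added by the form separate; the latter is handled by
  \<open>cot_one_src_sharp\<close>.\<close>

lemma usrc_tau:
  assumes \<omega>: "two_form (arr G) \<omega>" "mult_form G \<omega>" and l: "l \<in> PB (arr G)"
  shows "usrc (tau (arr G) \<omega> l) = tau (arr G) \<omega> (usrc l)"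
proof (rule prod_eqI)
  show "fst (usrc (tau (arr G) \<omega> l)) = fst (tau (arr G) \<omega> (usrc l))" by (simp add: usrc)
  have l': "fst l \<in> TB (arr G)" "fst (snd l) = pt (fst l)" using PB_D[OF l] by auto
  let ?\<beta> = "sharp (arr G) \<omega> (fst l)"
  have "cot_one G (cot_src G (snd (tau (arr G) \<omega> l))) =
      (one G (src G (fst (snd l))), \<lambda>v. snd (cot_one G (src G (fst (snd l)), snd (cot_src G (snd l)))) v +
        snd (cot_one G (src G (fst (snd l)), snd (cot_src G ?\<beta>))) v)"
    unfolding snd_tau using cot_src_add[of "snd l" ?\<beta>] l'(2) cot_one_add by simp
  also have "(src G (fst (snd l)), snd (cot_src G (snd l))) = cot_src G (snd l)"
    by (simp add: prod_eq_iff fst_cot_src)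
  also have "(src G (fst (snd l)), snd (cot_src G ?\<beta>)) = cot_src G ?\<beta>"
    using l'(2) by (simp add: prod_eq_iff fst_cot_src)
  also have "cot_one G (cot_src G ?\<beta>) = sharp (arr G) \<omega> (base_unit (fst l))"
    by (rule cot_one_src_sharp[OF \<omega> l'(1)])
  finally show "snd (usrc (tau (arr G) \<omega> l)) = snd (tau (arr G) \<omega> (usrc l))"
    by (simp add: usrc snd_tau fst_cot_one fst_cot_src)
qed

text \<open>Points of the base must lie in \<open>dual_alg\<close>, so the source of the added
  covector has to be linear on the algebroid fibre. It is, as a contraction of \<omega>, once the
  fibre is known to be closed under \<open>tlin\<close>.\<close>

lemma cot_src_tau_dual:
  assumes \<omega>: "two_form (arr G) \<omega>" "mult_form G \<omega>" and l: "l \<in> PB (arr G)"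
    and d: "cot_src G (snd l) \<in> dual_alg G"
  shows "cot_src G (snd (tau (arr G) \<omega> l)) \<in> dual_alg G"
proof -
  have l': "fst l \<in> TB (arr G)" "fst (snd l) = pt (fst l)" using PB_D[OF l] by auto
  let ?\<beta> = "sharp (arr G) \<omega> (fst l)" and ?x = "src G (pt (fst l))"
  have eq: "cot_src G (snd (tau (arr G) \<omega> l)) = (?x, \<lambda>a. snd (cot_src G (snd l)) a + snd (cot_src G ?\<beta>) a)"
    unfolding snd_tau using cot_src_add[of "snd l" ?\<beta>] l'(2) by simp
  have d': "(?x, snd (cot_src G (snd l))) \<in> dual_alg G"
    using d l'(2) by (metis fst_cot_src prod.collapse)
  have E: "base_unit (fst l) \<in> TS (arr G) (one G ?x)" using base_unit[OF l'(1)] by simp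
  have \<beta>: "snd (cot_src G ?\<beta>) (tlin (arr G) c a e b) = c * snd (cot_src G ?\<beta>) a + e * snd (cot_src G ?\<beta>) b"
    if ab: "a \<in> lie_alg_fib G ?x" "b \<in> lie_alg_fib G ?x" for a b c e
  proof -
    have x: "?x \<in> pts (obj G)" using src_tgt_obj(1)[OF TB_pt[OF l'(1)]] .
    have T: "a \<in> TS (arr G) (one G ?x)" "b \<in> TS (arr G) (one G ?x)"
      using ab by (auto simp: lie_alg_fib_def lie_alg_def)
    have s: "tmap (obj G) (src G) v = tzero (obj G) ?x" if sv: "v \<in> lie_alg_fib G ?x" for v
    proof -
      obtain y where "y \<in> pts (obj G)" "pt v = one G y" "tmap (obj G) (src G) v = tzero (obj G) y"
        using sv unfolding lie_alg_fib_def lie_alg_def by blast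
      moreover have "pt v = one G ?x" using sv by (simp add: lie_alg_fib_def)
      ultimately show ?thesis using one_simps(2) x by metis
    qed
    obtain U \<phi> where U: "(U, \<phi>) \<in> obj G" "?x \<in> U" using x by (rule pts_chart)
    have z: "tzero (obj G) ?x \<in> TS (obj G) ?x" using tzero(1)[OF sM x] .
    have "tmap (obj G) (src G) (tlin (arr G) c a e b) = tlin (obj G) c (tzero (obj G) ?x) e (tzero (obj G) ?x)"
      using tmap_tlin[OF mfd smap_structure(1) T] s ab by simp
    also have "\<dots> = tzero (obj G) ?x"
      by (rule tlin_eqI[OF mfd(2) z z z U]) (use tzero(2)[OF sM x U] in simp)
    finally have "tlin (arr G) c a e b \<in> lie_alg_fib G ?x"
      using tlin(1)[OF mfd(1) T] x by (auto simp: lie_alg_fib_def lie_alg_def)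
    then show ?thesis
      using cot_src_sharp[OF \<omega> l'(1)] ab two_form_right[OF mfd(1) \<omega>(1) T E] by simp
  qed
  have "snd (cot_src G ?\<beta>) a = 0" if "a \<notin> lie_alg_fib G ?x" for a
    using that by (simp add: cot_src_def sharp_def)
  then show ?thesis
    unfolding eq using d' \<beta> by (auto simp: dual_alg_def algebra_simps)
qed

end

section \<open>Curves with vanishing velocity\<close>

text \<open>Zero velocity written out in charts. Unlike equality with \<open>tzero\<close> it
  involves no classes of curves, so it passes unchanged between an atlas and its restricted or
  induced versions.\<close>

definition still :: "('a, 'e::euclidean_space) atlas \<Rightarrow> (real \<Rightarrow> 'a) \<Rightarrow> bool" where
  "still A \<gamma> \<longleftrightarrow> (\<forall>(U, \<phi>)\<in>A. \<gamma> 0 \<in> U \<longrightarrow> ((\<lambda>t. \<phi> (\<gamma> t)) has_vector_derivative 0) (at 0))"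

lemma stillD: "still A \<gamma> \<Longrightarrow> (U, \<phi>) \<in> A \<Longrightarrow> \<gamma> 0 \<in> U \<Longrightarrow> ((\<lambda>t. \<phi> (\<gamma> t)) has_vector_derivative 0) (at 0)"
  unfolding still_def by blast

lemma stillI:
  "(\<And>U \<phi>. (U, \<phi>) \<in> A \<Longrightarrow> \<gamma> 0 \<in> U \<Longrightarrow> ((\<lambda>t. \<phi> (\<gamma> t)) has_vector_derivative 0) (at 0)) \<Longrightarrow> still A \<gamma>"
  unfolding still_def by blast

lemma still_iff_velocity:
  assumes "satlas A" "curve A \<gamma>"
  shows "still A \<gamma> \<longleftrightarrow> velocity A \<gamma> = tzero A (\<gamma> 0)"
proof
  note z = tzero[OF assms(1) curve_pts[OF assms(2)]]
  assume s: "still A \<gamma>"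
  obtain U \<phi> where U: "(U, \<phi>) \<in> A" "\<gamma> 0 \<in> U" using curve_pts[OF assms(2)] by (rule pts_chart)
  show "velocity A \<gamma> = tzero A (\<gamma> 0)"
    by (rule TB_eqI[OF assms(1) velocity_TB[OF assms(2)] _ _ U(1)])
      (use z(1) z(2)[OF U] U assms(2) dcoord_velocityI[OF assms(2) U stillD[OF s U]] in simp_all)
next
  assume v: "velocity A \<gamma> = tzero A (\<gamma> 0)"
  show "still A \<gamma>"
  proof (rule stillI)
    fix U \<phi> assume U: "(U, \<phi>) \<in> A" "\<gamma> 0 \<in> U"
    show "((\<lambda>t. \<phi> (\<gamma> t)) has_vector_derivative 0) (at 0)"
      using dcoord_has_vd[OF assms U] unfolding v tzero(2)[OF assms(1) curve_pts[OF assms(2)] U] .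
  qed
qed

lemma still_cong_ev:
  assumes "satlas A" "curve A \<gamma>" "\<forall>\<^sub>F t in nhds 0. \<gamma> t = \<delta> t"
  shows "still A \<gamma> \<longleftrightarrow> still A \<delta>"
  using still_iff_velocity[OF assms(1,2)] still_iff_velocity[OF assms(1) curve_cong_ev(1)[OF assms]]
    curve_cong_ev(2)[OF assms] eventually_nhds_x_imp_x[OF assms(3)] by simp

lemma still_compose:
  assumes "satlas A" "satlas B" "curve A \<gamma>" "\<forall>\<^sub>F t in nhds 0. \<gamma> t \<in> S" "smap A S B f" "still A \<gamma>"
  shows "still B (\<lambda>t. f (\<gamma> t))"
proof (rule stillI)
  fix V \<psi> assume V: "(V, \<psi>) \<in> B" "f (\<gamma> 0) \<in> V"
  have S: "\<gamma> 0 \<in> S" using eventually_nhds_x_imp_x[OF assms(4)] .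
  obtain U \<phi> where U: "(U, \<phi>) \<in> A" "\<gamma> 0 \<in> U" using curve_pts[OF assms(3)] by (rule pts_chart)
  obtain P g where P: "\<phi> (\<gamma> 0) \<in> P" "loc_rep S U \<phi> V \<psi> f P g" using smapD[OF assms(5) S U V] .
  have "vector_derivative (\<phi> \<circ> \<gamma>) (at 0) = 0"
    using vector_derivative_at[OF stillD[OF assms(6) U]] by (simp add: o_def)
  then show "((\<lambda>t. \<psi> (f (\<gamma> t))) has_vector_derivative 0) (at 0)"
    using loc_rep_vd[OF assms(1,3) U assms(4) P(2,1)] linear_0[OF loc_rep_linear[OF P(2,1)]] by simp
qed

lemma still_induced:
  assumes "\<gamma> 0 \<in> S"
  shows "still (induced A S \<iota>) \<gamma> \<longleftrightarrow> still A (\<lambda>t. \<iota> (\<gamma> t))"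
proof
  assume s: "still (induced A S \<iota>) \<gamma>"
  show "still A (\<lambda>t. \<iota> (\<gamma> t))"
  proof (rule stillI)
    fix U \<phi> assume U: "(U, \<phi>) \<in> A" "\<iota> (\<gamma> 0) \<in> U"
    then have "({x \<in> S. \<iota> x \<in> U}, \<phi> \<circ> \<iota>) \<in> induced A S \<iota>" unfolding induced_def by blast
    from stillD[OF s this] show "((\<lambda>t. \<phi> (\<iota> (\<gamma> t))) has_vector_derivative 0) (at 0)"
      using assms U(2) by simp
  qed
next
  assume s: "still A (\<lambda>t. \<iota> (\<gamma> t))"
  show "still (induced A S \<iota>) \<gamma>"
  proof (rule stillI)
    fix V \<psi> assume V: "(V, \<psi>) \<in> induced A S \<iota>" "\<gamma> 0 \<in> V"
    obtain U \<phi> where U: "(U, \<phi>) \<in> A" "V = {x \<in> S. \<iota> x \<in> U}" "\<psi> = \<phi> \<circ> \<iota>"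
      using induced_chartE[OF V(1)] .
    show "((\<lambda>t. \<psi> (\<gamma> t)) has_vector_derivative 0) (at 0)"
      using stillD[OF s U(1)] V(2) U(2,3) by simp
  qed
qed

lemma still_prod:
  assumes "satlas A" "satlas B" "curve A (\<lambda>t. fst (\<gamma> t))" "curve B (\<lambda>t. snd (\<gamma> t))"
  shows "still (prod_atlas A B) \<gamma> \<longleftrightarrow> still A (\<lambda>t. fst (\<gamma> t)) \<and> still B (\<lambda>t. snd (\<gamma> t))"
proof
  note s = satlas_prod[OF assms(1,2)] and c = curve_prodI[OF assms]
  assume st: "still (prod_atlas A B) \<gamma>"
  show "still A (\<lambda>t. fst (\<gamma> t)) \<and> still B (\<lambda>t. snd (\<gamma> t))"
    using still_compose[OF s assms(1) c curve_ev_pts[OF s c] smap_proj(1)[OF assms(1,2)] st]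
      still_compose[OF s assms(2) c curve_ev_pts[OF s c] smap_proj(2)[OF assms(1,2)] st] by blast
next
  assume st: "still A (\<lambda>t. fst (\<gamma> t)) \<and> still B (\<lambda>t. snd (\<gamma> t))"
  show "still (prod_atlas A B) \<gamma>"
  proof (rule stillI)
    fix W \<rho> assume W: "(W, \<rho>) \<in> prod_atlas A B" "\<gamma> 0 \<in> W"
    obtain U \<phi> V \<psi> where c: "(U, \<phi>) \<in> A" "(V, \<psi>) \<in> B" "W = U \<times> V" "\<rho> = map_prod \<phi> \<psi>"
      using prod_chartE[OF W(1)] .
    have m: "fst (\<gamma> 0) \<in> U" "snd (\<gamma> 0) \<in> V" using W(2) c(3) by (auto simp: mem_Times_iff)
    have "((\<lambda>t. (\<phi> (fst (\<gamma> t)), \<psi> (snd (\<gamma> t)))) has_vector_derivative (0, 0)) (at 0)"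
      by (intro has_vector_derivative_Pair stillD[OF conjunct1[OF st] c(1) m(1)]
          stillD[OF conjunct2[OF st] c(2) m(2)])
    then show "((\<lambda>t. \<rho> (\<gamma> t)) has_vector_derivative 0) (at 0)"
      by (simp add: c(4) map_prod_def split_beta zero_prod_def)
  qed
qed

lemma still_pont:
  assumes "manifold n A" "curve (pont_atlas A) \<gamma>"
    and "still (tan_atlas A) (\<lambda>t. fst (\<gamma> t))" "still (cot_atlas A) (\<lambda>t. snd (\<gamma> t))"
  shows "still (pont_atlas A) \<gamma>"
proof (rule stillI)
  fix W \<rho> assume W: "(W, \<rho>) \<in> pont_atlas A" "\<gamma> 0 \<in> W"
  obtain U \<phi> where U: "(U, \<phi>) \<in> A" "W = {l \<in> PB A. pt (fst l) \<in> U}"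
      "\<rho> = (\<lambda>l. (\<phi> (pt (fst l)), pcoord A \<phi> l))"
    using pont_chartE[OF W(1)] .
  have m: "fst (\<gamma> 0) \<in> {v \<in> TB A. pt v \<in> U}" "snd (\<gamma> 0) \<in> {\<alpha> \<in> CB A. fst \<alpha> \<in> U}"
    using W(2) U(2) PB_D[of "\<gamma> 0" A] by auto
  have 1: "((\<lambda>t. tchart \<phi> (fst (\<gamma> t))) has_vector_derivative 0) (at 0)"
    using stillD[OF assms(3) tan_chartI[OF U(1)] m(1)] .
  have 2: "((\<lambda>t. (\<phi> (fst (snd (\<gamma> t))), ccoord A \<phi> (snd (\<gamma> t)))) has_vector_derivative 0) (at 0)"
    using stillD[OF assms(4) cot_chartI[OF U(1)] m(2)] .
  have "((\<lambda>t. (\<phi> (pt (fst (\<gamma> t))), dcoord \<phi> (fst (\<gamma> t)), ccoord A \<phi> (snd (\<gamma> t))))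
      has_vector_derivative (fst 0, snd 0, snd 0)) (at 0)"
    using bounded_linear.has_vector_derivative[OF bounded_linear_fst 1]
      bounded_linear.has_vector_derivative[OF bounded_linear_snd 1]
      bounded_linear.has_vector_derivative[OF bounded_linear_snd 2]
    by (intro has_vector_derivative_Pair) simp_all
  then show "((\<lambda>t. \<rho> (\<gamma> t)) has_vector_derivative 0) (at 0)"
    by (simp add: U(3) split_beta zero_prod_def)
qed

lemma velocity_compose:
  assumes "satlas A" "satlas B" "smap A S B f" "curve A \<gamma>" "\<forall>\<^sub>F t in nhds 0. \<gamma> t \<in> S"
    "curve A \<delta>" "\<forall>\<^sub>F t in nhds 0. \<delta> t \<in> S" "velocity A \<gamma> = velocity A \<delta>"
  shows "velocity B (\<lambda>t. f (\<gamma> t)) = velocity B (\<lambda>t. f (\<delta> t))"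
  using tmap_on_velocity[OF assms(1-3,4,5,5)] tmap_on_velocity[OF assms(1-3,6,7,7)] assms(8) by simp

text \<open>\<open>smooth_map_imp_smap\<close> asks for injective charts on \<open>L\<close>. Over a
  point, the fibre coordinates determine both the vector and the covector.\<close>

lemma inj_charts_pont:
  assumes "manifold n A"
  shows "inj_charts (pont_atlas A)"
  unfolding inj_charts_def
proof clarify
  have sA: "satlas A" using manifold_satlas assms .
  fix W \<rho> assume "(W, \<rho>) \<in> pont_atlas A"
  then obtain U \<phi> where U: "(U, \<phi>) \<in> A" "W = {l \<in> PB A. pt (fst l) \<in> U}"
      "\<rho> = (\<lambda>l. (\<phi> (pt (fst l)), pcoord A \<phi> l))"
    by (rule pont_chartE)
  have inj: "inj_on \<phi> U" using manifold_inj_charts[OF assms] U(1) unfolding inj_charts_def by fast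
  show "inj_on \<rho> W"
  proof (rule inj_onI)
    fix l m assume lm: "l \<in> W" "m \<in> W" "\<rho> l = \<rho> m"
    then have PB: "l \<in> PB A" "m \<in> PB A" "pt (fst l) \<in> U" "pt (fst m) \<in> U" using U(2) by auto
    have eq: "\<phi> (pt (fst l)) = \<phi> (pt (fst m))" "dcoord \<phi> (fst l) = dcoord \<phi> (fst m)"
      "ccoord A \<phi> (snd l) = ccoord A \<phi> (snd m)"
      using lm(3) by (auto simp: U(3) split_beta)
    have p: "pt (fst l) = pt (fst m)" using inj eq(1) PB(3,4) by (auto dest: inj_onD)
    note l = PB_D[OF PB(1)] and m = PB_D[OF PB(2)]
    have "fst l = fst m" by (rule TB_eqI[OF sA l(1) m(1) p U(1) PB(3) eq(2)])
    moreover have "snd l = snd m"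
      by (rule CB_eqI[OF l(2) m(2)])
        (use l m p eq(3) PB ccoord(2)[OF assms U(1) l(2)] ccoord(2)[OF assms U(1) m(2)] in simp_all)
    ultimately show "l = m" by (rule prod_eqI)
  qed
qed

lemma smooth_map_euc_uminus:
  assumes "smooth_map A S euc f"
  shows "smooth_map A S euc (\<lambda>q. - f q :: 'e::euclidean_space)"
proof -
  have neg: "smooth_on T (\<lambda>x. - h x)" if "smooth_on T h" for T :: "'b::euclidean_space set" and h :: "'b \<Rightarrow> 'e"
    unfolding smooth_on_def
  proof
    fix x assume "x \<in> T"
    then obtain V g where V: "open V" "x \<in> V" "\<forall>k. Ck_on k V g" "\<forall>y\<in>T \<inter> V. g y = h y"
      using \<open>smooth_on T h\<close> unfolding smooth_on_def by metis
    then have "\<forall>k. Ck_on k V (\<lambda>x. - g x)"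
      using Ck_on_linear[OF bounded_linear_minus[OF bounded_linear_ident]] by blast
    then show "\<exists>V g. open V \<and> x \<in> V \<and> (\<forall>k. Ck_on k V g) \<and> (\<forall>y\<in>T \<inter> V. g y = - h y)"
      using V by (intro exI[of _ V] exI[of _ "\<lambda>x. - g x"]) auto
  qed
  have "\<exists>(U, \<phi>)\<in>A. \<exists>W. mopen A W \<and> p \<in> W \<and> W \<subseteq> U \<and> smooth_on (\<phi> ` (S \<inter> W)) (\<lambda>x. f (inv_into U \<phi> x))"
    if "p \<in> S" for p
  proof -
    have "\<exists>(U, \<phi>)\<in>A. \<exists>(V, \<psi>)\<in>euc. \<exists>W. mopen A W \<and> p \<in> W \<and> W \<subseteq> U \<and> f ` (S \<inter> W) \<subseteq> V \<and>
        smooth_on (\<phi> ` (S \<inter> W)) (\<psi> \<circ> f \<circ> inv_into U \<phi>)"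
      using assms that unfolding smooth_map_def by (elim conjE) (rule bspec)
    then show ?thesis by (simp add: euc_def o_def)
  qed
  then have "\<exists>(U, \<phi>)\<in>A. \<exists>W. mopen A W \<and> p \<in> W \<and> W \<subseteq> U \<and> smooth_on (\<phi> ` (S \<inter> W)) (\<lambda>x. - f (inv_into U \<phi> x))"
    if "p \<in> S" for p
    using that neg by (fastforce simp: split_beta)
  moreover have "S \<subseteq> pts A" using assms unfolding smooth_map_def by blast
  ultimately show ?thesis
    unfolding smooth_map_def by (simp add: euc_def o_def pts_def)
qed

text \<open>Makes the inverse of a B-field transformation a transformation of the same kind, so that
  the smoothness results apply to it.\<close>

lemma two_form_uminus: "two_form A \<omega> \<Longrightarrow> two_form A (\<lambda>u v. - \<omega> u v)"
  unfolding two_form_def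
proof (elim conjE, intro conjI)
  assume s: "\<forall>(U, \<phi>)\<in>A. \<forall>p\<in>U. \<forall>u\<in>TS A p. \<forall>v\<in>TS A p.
      smooth_map A U euc (\<lambda>q. \<omega> (const_field A \<phi> u q) (const_field A \<phi> v q))"
  show "\<forall>(U, \<phi>)\<in>A. \<forall>p\<in>U. \<forall>u\<in>TS A p. \<forall>v\<in>TS A p.
      smooth_map A U euc (\<lambda>q. - \<omega> (const_field A \<phi> u q) (const_field A \<phi> v q))"
  proof (clarify, rule smooth_map_euc_uminus)
    fix U \<phi> p u v assume "(U, \<phi>) \<in> A" "p \<in> U" "u \<in> TS A p" "v \<in> TS A p"
    then show "smooth_map A U euc (\<lambda>q. \<omega> (const_field A \<phi> u q) (const_field A \<phi> v q))"
      using bspec[OF s \<open>(U, \<phi>) \<in> A\<close>] by auto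
  qed
next
  assume l: "\<forall>p\<in>pts A. \<forall>u\<in>TS A p. \<forall>v\<in>TS A p. \<omega> u v = - \<omega> v u \<and>
        (\<forall>w\<in>TS A p. \<forall>a b. \<omega> (tlin A a u b v) w = a * \<omega> u w + b * \<omega> v w)"
  show "\<forall>p\<in>pts A. \<forall>u\<in>TS A p. \<forall>v\<in>TS A p. - \<omega> u v = - (- \<omega> v u) \<and>
        (\<forall>w\<in>TS A p. \<forall>a b. - \<omega> (tlin A a u b v) w = a * - \<omega> u w + b * - \<omega> v w)"
  proof (intro ballI conjI allI)
    fix p u v assume "p \<in> pts A" "u \<in> TS A p" "v \<in> TS A p"
    note * = bspec[OF bspec[OF bspec[OF l this(1)] this(2)] this(3)]
    show "- \<omega> u v = - (- \<omega> v u)" using conjunct1[OF *] by simp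
    fix w a b assume "w \<in> TS A p"
    show "- \<omega> (tlin A a u b v) w = a * - \<omega> u w + b * - \<omega> v w"
      using bspec[OF conjunct2[OF *] \<open>w \<in> TS A p\<close>] by simp
  qed
qed

lemma tau_inverse:
  assumes "manifold n A" "two_form A \<omega>" "curve (pont_atlas A) \<gamma>"
  shows "curve (pont_atlas A) (\<lambda>t. tau A (\<lambda>u v. - \<omega> u v) (\<gamma> t))"
    "\<forall>\<^sub>F t in nhds 0. tau A \<omega> (tau A (\<lambda>u v. - \<omega> u v) (\<gamma> t)) = \<gamma> t"
proof -
  note sP = satlas_pont[OF assms(1)]
  have ev: "\<forall>\<^sub>F t in nhds 0. \<gamma> t \<in> PB A" using curve_ev_pts[OF sP assms(3)] by (simp add: pts_pont)
  then show "curve (pont_atlas A) (\<lambda>t. tau A (\<lambda>u v. - \<omega> u v) (\<gamma> t))"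
    by (rule curve_compose[OF sP sP assms(3) _ smap_tau[OF assms(1) two_form_uminus[OF assms(2)]]])
  show "\<forall>\<^sub>F t in nhds 0. tau A \<omega> (tau A (\<lambda>u v. - \<omega> u v) (\<gamma> t)) = \<gamma> t"
    using ev by eventually_elim (rule tau_uminus(2))
qed

section \<open>The Lie algebroid of a subgroupoid of the Pontryagin groupoid\<close>

context lie_gpd
begin

abbreviation "PA \<equiv> pont_atlas (arr G)"
abbreviation "TA \<equiv> tan_atlas (arr G)"
abbreviation "CA \<equiv> cot_atlas (arr G)"
abbreviation "OA \<equiv> obj (pont_gpd G)"
abbreviation "psrc \<equiv> src (pont_gpd G)"

lemmas sT = satlas_tan[OF sA] and sC = satlas_cot[OF mfd(1)] and sP = satlas_pont[OF mfd(1)]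

section \<open>Curves in the base of the Pontryagin groupoid\<close>

lemma OA: "OA = restr (prod_atlas (tan_atlas (obj G)) (induced CA (dual_alg G) (cot_one G)))
    {(x, \<alpha>). x \<in> TB (obj G) \<and> \<alpha> \<in> dual_alg G \<and> pt x = fst \<alpha>}"
  by (simp add: pont_gpd_def tan_gpd_def cot_gpd_def)

lemma sI: "satlas (induced CA (dual_alg G) (cot_one G))"
  by (rule satlas_induced[OF sC])

lemma sO: "satlas OA"
  unfolding OA by (intro satlas_induced satlas_prod satlas_tan sM sI)

text \<open>Since the dual of the Lie algebroid carries the structure induced by
  \<open>cot_one\<close>, the covector component of a base curve is judged by its unit in the
  cotangent bundle. This is how \<open>usrc\<close> enters.\<close>

lemma curve_OA: "curve OA q \<longleftrightarrow> curve (tan_atlas (obj G)) (\<lambda>t. fst (q t)) \<and> curve CA (\<lambda>t. cot_one G (snd (q t))) \<and>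
    (\<forall>\<^sub>F t in nhds 0. fst (q t) \<in> TB (obj G) \<and> snd (q t) \<in> dual_alg G \<and> pt (fst (q t)) = fst (snd (q t)))"
proof -
  note sp = satlas_prod[OF satlas_tan[OF sM] sI]
  have "curve (prod_atlas (tan_atlas (obj G)) (induced CA (dual_alg G) (cot_one G))) q \<longleftrightarrow>
      curve (tan_atlas (obj G)) (\<lambda>t. fst (q t)) \<and> curve (induced CA (dual_alg G) (cot_one G)) (\<lambda>t. snd (q t))"
    (is "?c \<longleftrightarrow> _")
    using curve_prodI[OF satlas_tan[OF sM] sI]
      curve_compose[OF sp satlas_tan[OF sM] _ curve_ev_pts[OF sp] smap_proj(1)[OF satlas_tan[OF sM] sI], of q]
      curve_compose[OF sp sI _ curve_ev_pts[OF sp] smap_proj(2)[OF satlas_tan[OF sM] sI], of q]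
    by blast
  then show ?thesis
    unfolding OA curve_restr[OF sp] curve_induced[OF sC]
    by (auto simp: split_beta eventually_conj_iff)
qed

lemma still_OA:
  assumes "curve OA q"
  shows "still OA q \<longleftrightarrow> still (tan_atlas (obj G)) (\<lambda>t. fst (q t)) \<and> still CA (\<lambda>t. cot_one G (snd (q t)))"
proof -
  note c = assms[unfolded curve_OA]
  have ev: "\<forall>\<^sub>F t in nhds 0. snd (q t) \<in> dual_alg G" using c by (auto simp: eventually_conj_iff)
  have 0: "fst (q 0) \<in> TB (obj G) \<and> snd (q 0) \<in> dual_alg G \<and> pt (fst (q 0)) = fst (snd (q 0))"
    using c eventually_nhds_x_imp_x by blast
  have ci: "curve (induced CA (dual_alg G) (cot_one G)) (\<lambda>t. snd (q t))"
    unfolding curve_induced[OF sC] using c ev by blast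
  have "still OA q \<longleftrightarrow> still (prod_atlas (tan_atlas (obj G)) (induced CA (dual_alg G) (cot_one G))) q"
    unfolding OA by (subst still_induced) (use 0 in \<open>auto simp: split_beta\<close>)
  also have "\<dots> \<longleftrightarrow> still (tan_atlas (obj G)) (\<lambda>t. fst (q t)) \<and>
      still (induced CA (dual_alg G) (cot_one G)) (\<lambda>t. snd (q t))"
    by (rule still_prod[OF satlas_tan[OF sM] sI _ ci]) (use c in blast)
  also have "still (induced CA (dual_alg G) (cot_one G)) (\<lambda>t. snd (q t)) \<longleftrightarrow> still CA (\<lambda>t. cot_one G (snd (q t)))"
    by (rule still_induced) (use 0 in blast)
  finally show ?thesis .
qed

text \<open>The vector component of the source is unaffected by the transformation. The covector
  component is judged by its unit, and by \<open>usrc_tau\<close> the new unit curve is the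
  transform of the old one; smoothness of the transformation and of its inverse carries both
  properties across.\<close>

lemma psrc_tau:
  assumes \<omega>: "two_form (arr G) \<omega>" "mult_form G \<omega>" and \<gamma>: "curve PA \<gamma>" "curve OA (\<lambda>t. psrc (\<gamma> t))"
  shows "curve OA (\<lambda>t. psrc (tau (arr G) \<omega> (\<gamma> t)))"
    "still OA (\<lambda>t. psrc (tau (arr G) \<omega> (\<gamma> t))) \<longleftrightarrow> still OA (\<lambda>t. psrc (\<gamma> t))"
    "usrc (\<gamma> 0) \<in> PB (arr G)"
proof -
  let ?\<tau> = "tau (arr G) \<omega>" and ?\<tau>' = "tau (arr G) (\<lambda>u v. - \<omega> u v)"
  have ev: "\<forall>\<^sub>F t in nhds 0. \<gamma> t \<in> PB (arr G)" using curve_ev_pts[OF sP \<gamma>(1)] by (simp add: pts_pont)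
  note c = \<gamma>(2)[unfolded curve_OA src_pont fst_conv snd_conv]
  let ?E = "\<lambda>t. usrc (\<gamma> t)"
  have cT: "curve (tan_atlas (obj G)) (\<lambda>t. tmap (obj G) (src G) (fst (\<gamma> t)))" using c by blast
  have evT: "\<forall>\<^sub>F t in nhds 0. tmap (obj G) (src G) (fst (\<gamma> t)) \<in> TB (obj G)"
    using curve_ev_pts[OF satlas_tan[OF sM] cT] by (simp add: pts_tan)
  have cE1: "curve TA (\<lambda>t. base_unit (fst (\<gamma> t)))"
    unfolding base_unit_def
    by (rule curve_compose[OF satlas_tan[OF sM] sT cT evT smap_tmap[OF sM sA smap_structure(3)]])
  have cE2: "curve CA (\<lambda>t. cot_one G (cot_src G (snd (\<gamma> t))))" using c by blast
  have "\<forall>\<^sub>F t in nhds 0. fst (cot_one G (cot_src G (snd (\<gamma> t)))) = pt (base_unit (fst (\<gamma> t)))"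
    using ev
  proof eventually_elim
    case (elim t)
    show ?case using PB_D[OF elim] base_unit(2) by (simp add: fst_cot_one fst_cot_src)
  qed
  then have cE: "curve PA ?E"
    unfolding usrc by (rule curve_pontI[OF mfd(1) cE1 cE2])
  have evE: "\<forall>\<^sub>F t in nhds 0. ?E t \<in> PB (arr G)" using curve_ev_pts[OF sP cE] by (simp add: pts_pont)
  then show "usrc (\<gamma> 0) \<in> PB (arr G)" by (rule eventually_nhds_x_imp_x)
  have cF: "curve PA (\<lambda>t. ?\<tau> (?E t))" by (rule curve_compose[OF sP sP cE evE smap_tau[OF mfd(1) \<omega>(1)]])
  have evF: "\<forall>\<^sub>F t in nhds 0. ?\<tau> (?E t) \<in> PB (arr G)"
    using curve_ev_pts[OF sP cF] by (simp add: pts_pont)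
  have cF2: "curve CA (\<lambda>t. snd (?\<tau> (?E t)))"
    by (rule curve_compose[OF sP sC cF evF smap_pont_proj(2)[OF mfd(1)]])
  have eq: "\<forall>\<^sub>F t in nhds 0. snd (?\<tau> (?E t)) = cot_one G (cot_src G (snd (?\<tau> (\<gamma> t))))"
    using ev
  proof eventually_elim
    case (elim t)
    show ?case using usrc_tau[OF \<omega> elim] by (metis usrc snd_conv)
  qed
  show c': "curve OA (\<lambda>t. psrc (?\<tau> (\<gamma> t)))"
    unfolding curve_OA src_pont fst_conv snd_conv tau_simps(1)
  proof (intro conjI cT curve_cong_ev(1)[OF sC cF2 eq])
    have "\<forall>\<^sub>F t in nhds 0. tmap (obj G) (src G) (fst (\<gamma> t)) \<in> TB (obj G) \<and>
        cot_src G (snd (\<gamma> t)) \<in> dual_alg G \<and> pt (tmap (obj G) (src G) (fst (\<gamma> t))) = fst (cot_src G (snd (\<gamma> t)))"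
      using c by blast
    then show "\<forall>\<^sub>F t in nhds 0. tmap (obj G) (src G) (fst (\<gamma> t)) \<in> TB (obj G) \<and>
        cot_src G (snd (?\<tau> (\<gamma> t))) \<in> dual_alg G \<and>
        pt (tmap (obj G) (src G) (fst (\<gamma> t))) = fst (cot_src G (snd (?\<tau> (\<gamma> t))))"
      using ev by eventually_elim (use cot_src_tau_dual[OF \<omega>] in \<open>simp add: fst_cot_src\<close>)
  qed
  have E1: "still TA (\<lambda>t. base_unit (fst (\<gamma> t)))"
    if "still (tan_atlas (obj G)) (\<lambda>t. tmap (obj G) (src G) (fst (\<gamma> t)))"
    unfolding base_unit_def
    by (rule still_compose[OF satlas_tan[OF sM] sT cT evT smap_tmap[OF sM sA smap_structure(3)] that])
  \<comment> \<open>The transformation adds a term that depends on the vector component, so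
    stillness of the covector components can be compared only when the vector component is still, as
    \<open>st\<close> ensures.\<close>
  have fibre: "still CA (\<lambda>t. snd (?E t)) \<longleftrightarrow> still CA (\<lambda>t. snd (?\<tau> (?E t)))"
    if st: "still (tan_atlas (obj G)) (\<lambda>t. tmap (obj G) (src G) (fst (\<gamma> t)))"
  proof
    assume "still CA (\<lambda>t. snd (?E t))"
    then have "still PA ?E" using E1[OF st] by (intro still_pont[OF mfd(1) cE]) (simp_all add: usrc)
    then have "still PA (\<lambda>t. ?\<tau> (?E t))"
      by (rule still_compose[OF sP sP cE evE smap_tau[OF mfd(1) \<omega>(1)]])
    then show "still CA (\<lambda>t. snd (?\<tau> (?E t)))"
      by (rule still_compose[OF sP sC cF evF smap_pont_proj(2)[OF mfd(1)]])
  next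
    assume "still CA (\<lambda>t. snd (?\<tau> (?E t)))"
    then have s: "still PA (\<lambda>t. ?\<tau> (?E t))"
      using E1[OF st] by (intro still_pont[OF mfd(1) cF]) (simp_all add: usrc)
    have s': "still PA (\<lambda>t. ?\<tau>' (?\<tau> (?E t)))"
      by (rule still_compose[OF sP sP cF evF smap_tau[OF mfd(1) two_form_uminus[OF \<omega>(1)]] s])
    have "\<forall>\<^sub>F t in nhds 0. ?E t = ?\<tau>' (?\<tau> (?E t))"
      using evE by eventually_elim (simp only: tau_uminus(1))
    from still_cong_ev[OF sP cE this] s' have "still PA ?E" by blast
    then show "still CA (\<lambda>t. snd (?E t))"
      by (rule still_compose[OF sP sC cE evE smap_pont_proj(2)[OF mfd(1)]])
  qed
  have a: "still CA (\<lambda>t. cot_one G (snd (psrc (?\<tau> (\<gamma> t))))) \<longleftrightarrow> still CA (\<lambda>t. snd (?\<tau> (?E t)))"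
    unfolding still_cong_ev[OF sC cF2 eq] unfolding src_pont snd_conv ..
  have b: "still CA (\<lambda>t. cot_one G (snd (psrc (\<gamma> t)))) \<longleftrightarrow> still CA (\<lambda>t. snd (?E t))"
    unfolding usrc unfolding src_pont snd_conv ..
  have base: "fst (psrc (?\<tau> (\<gamma> t))) = tmap (obj G) (src G) (fst (\<gamma> t))"
    "fst (psrc (\<gamma> t)) = tmap (obj G) (src G) (fst (\<gamma> t))" for t
    by (simp_all add: src_pont)
  show "still OA (\<lambda>t. psrc (?\<tau> (\<gamma> t))) \<longleftrightarrow> still OA (\<lambda>t. psrc (\<gamma> t))"
    unfolding still_OA[OF c'] still_OA[OF \<gamma>(2)] a b base using fibre by blast
qed

text \<open>The only consequences of being a Lie subgroupoid that are used. In contrast to that property,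
  they are easily seen to be inherited by the image under a B-field transformation.\<close>

definition smooth_src :: "('g tan \<times> 'g cot) set \<Rightarrow> bool" where
  "smooth_src L \<longleftrightarrow> L \<subseteq> PB (arr G) \<and>
     (\<forall>\<gamma>. curve (restr PA L) \<gamma> \<longrightarrow> curve OA (\<lambda>t. psrc (\<gamma> t))) \<and>
     (\<forall>\<gamma> \<delta>. curve (restr PA L) \<gamma> \<longrightarrow> curve (restr PA L) \<delta> \<longrightarrow>
        velocity (restr PA L) \<gamma> = velocity (restr PA L) \<delta> \<longrightarrow>
        still OA (\<lambda>t. psrc (\<gamma> t)) \<longrightarrow> still OA (\<lambda>t. psrc (\<delta> t)))"

text \<open>The source is smooth on \<open>L\<close>, so its velocity along a curve depends only on
  the velocity of that curve. Stillness means the same in \<open>OA\<close> and in the restricted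
  base \<open>?O\<close>.\<close>

lemma Dir_mult_smooth_src:
  assumes "L \<in> Dir_mult G"
  shows "smooth_src L"
proof -
  have L: "lie_subgroupoid (pont_gpd G) L" using assms by (simp add: Dir_mult_def)
  have arr: "arr (pont_gpd G) = PA" by (simp add: pont_gpd_def)
  have sub: "L \<subseteq> PB (arr G)"
    using L unfolding lie_subgroupoid_def submanifold_def arr pts_pont by blast
  let ?O = "restr OA (psrc ` L)"
  have pts: "pts (restr PA L) = L" using sub by (auto simp: pts_induced pts_pont)
  have "smooth_map (restr PA L) (pts (restr PA L)) ?O psrc"
    using L unfolding lie_subgroupoid_def smooth_groupoid_def submersion_def gpd_restr_def
    by (simp add: arr)
  then have s: "smap (restr PA L) L ?O psrc"
    unfolding pts
    by (rule smooth_map_imp_smap[OF satlas_induced[OF sP] satlas_induced[OF sO]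
          inj_charts_restr[OF inj_charts_pont[OF mfd(1)]]])
  have ev: "\<forall>\<^sub>F t in nhds 0. \<gamma> t \<in> L" if "curve (restr PA L) \<gamma>" for \<gamma>
    using that curve_restr[OF sP] by blast
  have c: "curve ?O (\<lambda>t. psrc (\<gamma> t))" if "curve (restr PA L) \<gamma>" for \<gamma>
    by (rule curve_compose[OF satlas_induced[OF sP] satlas_induced[OF sO] that ev[OF that] s])
  have st: "still OA (\<lambda>t. psrc (\<gamma> t)) \<longleftrightarrow> still ?O (\<lambda>t. psrc (\<gamma> t))" if "curve (restr PA L) \<gamma>" for \<gamma>
    using still_induced[of "\<lambda>t. psrc (\<gamma> t)" "psrc ` L" OA id] eventually_nhds_x_imp_x[OF ev[OF that]] by simp
  have "still OA (\<lambda>t. psrc (\<delta> t))"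
    if cs: "curve (restr PA L) \<gamma>" "curve (restr PA L) \<delta>" and v: "velocity (restr PA L) \<gamma> = velocity (restr PA L) \<delta>"
      and s\<gamma>: "still OA (\<lambda>t. psrc (\<gamma> t))" for \<gamma> \<delta>
  proof -
    have "velocity ?O (\<lambda>t. psrc (\<gamma> t)) = velocity ?O (\<lambda>t. psrc (\<delta> t))"
      by (rule velocity_compose[OF satlas_induced[OF sP] satlas_induced[OF sO] s cs(1) ev[OF cs(1)] cs(2) ev[OF cs(2)] v])
    moreover have "\<gamma> 0 = \<delta> 0" using v pt_velocity[OF cs(1)] pt_velocity[OF cs(2)] by simp
    ultimately show ?thesis
      using s\<gamma> unfolding st[OF cs(1)] st[OF cs(2)]
        still_iff_velocity[OF satlas_induced[OF sO] c[OF cs(1)]] still_iff_velocity[OF satlas_induced[OF sO] c[OF cs(2)]]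
      by simp
  qed
  then show ?thesis
    unfolding smooth_src_def using sub c curve_restr[OF sO] by blast
qed

text \<open>Representatives of elements of the Lie algebroid of \<open>L\<close>. That the curve
  starts at a unit is put as a fixed point equation, which names no base point and is compatible
  with the B-field transformation.\<close>

definition alg_curve :: "('g tan \<times> 'g cot) set \<Rightarrow> (real \<Rightarrow> 'g tan \<times> 'g cot) \<Rightarrow> bool" where
  "alg_curve L \<gamma> \<longleftrightarrow> curve (restr PA L) \<gamma> \<and> \<gamma> 0 = usrc (\<gamma> 0) \<and> still OA (\<lambda>t. psrc (\<gamma> t))"

text \<open>\<open>lie_alg\<close> tests the source along one representative chosen by
  \<open>SOME\<close>. The last clause of \<open>smooth_src\<close> makes the test independent of
  the representative, so every curve that passes it may be used.\<close>

lemma lie_alg_eq: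
  assumes "smooth_src L"
  shows "lie_alg (gpd_restr (pont_gpd G) L) = {velocity (restr PA L) \<gamma> |\<gamma>. alg_curve L \<gamma>}"
proof -
  let ?R = "restr PA L" and ?O = "restr OA (psrc ` L)"
  have sR: "satlas ?R" and sO': "satlas ?O" using satlas_induced sP sO by blast+
  have c: "curve ?O (\<lambda>t. psrc (\<gamma> t))" if "curve ?R \<gamma>" for \<gamma>
  proof -
    have "\<forall>\<^sub>F t in nhds 0. \<gamma> t \<in> L" using that curve_restr[OF sP] by blast
    then have "\<forall>\<^sub>F t in nhds 0. psrc (\<gamma> t) \<in> psrc ` L" by eventually_elim blast
    then show ?thesis using assms that curve_restr[OF sO] unfolding smooth_src_def by blast
  qed
  have st: "still OA (\<lambda>t. psrc (\<gamma> t)) \<longleftrightarrow> velocity ?O (\<lambda>t. psrc (\<gamma> t)) = tzero ?O (psrc (\<gamma> 0))"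
    if "curve ?R \<gamma>" for \<gamma>
  proof -
    have "\<gamma> 0 \<in> L" using that curve_restr[OF sP] eventually_nhds_x_imp_x by blast
    then show ?thesis
      using still_iff_velocity[OF sO' c[OF that]] still_induced[of "\<lambda>t. psrc (\<gamma> t)" "psrc ` L" OA id] by simp
  qed
  have mem: "U \<in> lie_alg (gpd_restr (pont_gpd G) L) \<longleftrightarrow> U \<in> TB ?R \<and>
      (\<exists>x\<in>pts ?O. pt U = one (pont_gpd G) x \<and> tmap ?O psrc U = tzero ?O x)" for U
    unfolding lie_alg_def gpd_restr_def by (simp add: pont_gpd_def)
  have tm: "tmap ?O psrc U = velocity ?O (\<lambda>t. psrc ((SOME \<gamma>. \<gamma> \<in> U) t))" for U
    by (simp add: tmap_on_def o_def)
  show ?thesis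
  proof (intro equalityI subsetI)
    fix U assume "U \<in> lie_alg (gpd_restr (pont_gpd G) L)"
    then obtain x where U: "U \<in> TB ?R" and x: "x \<in> pts ?O" "pt U = one (pont_gpd G) x"
        "tmap ?O psrc U = tzero ?O x"
      using mem by blast
    define \<gamma> where "\<gamma> = (SOME \<gamma>. \<gamma> \<in> U)"
    have \<gamma>: "curve ?R \<gamma>" "U = velocity ?R \<gamma>" "\<gamma> 0 = pt U"
      using TB_memD[OF U TB_some[OF U]] unfolding \<gamma>_def .
    have v: "velocity ?O (\<lambda>t. psrc (\<gamma> t)) = tzero ?O x"
      using x(3) tm[of U] by (simp add: \<gamma>_def)
    then have s0: "psrc (\<gamma> 0) = x"
      using pt_velocity[OF c[OF \<gamma>(1)]] tzero(1)[OF sO' x(1)] by simp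
    have "alg_curve L \<gamma>"
      unfolding alg_curve_def st[OF \<gamma>(1)] using \<gamma> x(2) v s0 by simp
    then show "U \<in> {velocity ?R \<gamma> |\<gamma>. alg_curve L \<gamma>}" using \<gamma>(2) by blast
  next
    fix U assume "U \<in> {velocity ?R \<gamma> |\<gamma>. alg_curve L \<gamma>}"
    then obtain \<gamma> where \<gamma>: "U = velocity ?R \<gamma>" "curve ?R \<gamma>" "\<gamma> 0 = usrc (\<gamma> 0)" "still OA (\<lambda>t. psrc (\<gamma> t))"
      unfolding alg_curve_def by blast
    have U: "U \<in> TB ?R" using velocity_TB[OF \<gamma>(2)] \<gamma>(1) by simp
    define \<delta> where "\<delta> = (SOME \<delta>. \<delta> \<in> U)"
    have \<delta>: "curve ?R \<delta>" "U = velocity ?R \<delta>" "\<delta> 0 = pt U"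
      using TB_memD[OF U TB_some[OF U]] unfolding \<delta>_def .
    have eq: "velocity ?R \<gamma> = velocity ?R \<delta>" "\<gamma> 0 = \<delta> 0" using \<gamma>(1,2) \<delta>(2,3) by simp_all
    have "still OA (\<lambda>t. psrc (\<delta> t))"
      using assms \<gamma>(2,4) \<delta>(1) eq(1) unfolding smooth_src_def by blast
    then have "tmap ?O psrc U = tzero ?O (psrc (\<gamma> 0))"
      using st[OF \<delta>(1)] tm[of U] eq(2) by (simp add: \<delta>_def)
    then show "U \<in> lie_alg (gpd_restr (pont_gpd G) L)"
      unfolding mem using U curve_pts[OF c[OF \<gamma>(2)]] \<gamma>(3) eq(2) \<delta>(3) by auto
  qed
qed

section \<open>Transport of curves and subsets along the B-field transformation\<close>

lemma curve_tau_image: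
  assumes "two_form (arr G) \<omega>" "L \<subseteq> PB (arr G)" "curve (restr PA L) \<gamma>"
  shows "curve (restr PA (tau (arr G) \<omega> ` L)) (\<lambda>t. tau (arr G) \<omega> (\<gamma> t))"
proof -
  have c: "curve PA \<gamma>" and ev: "\<forall>\<^sub>F t in nhds 0. \<gamma> t \<in> L" using assms(3) curve_restr[OF sP] by blast+
  have "\<forall>\<^sub>F t in nhds 0. \<gamma> t \<in> PB (arr G)" using ev by eventually_elim (use assms(2) in blast)
  then have "curve PA (\<lambda>t. tau (arr G) \<omega> (\<gamma> t))"
    by (rule curve_compose[OF sP sP c _ smap_tau[OF mfd(1) assms(1)]])
  moreover have "\<forall>\<^sub>F t in nhds 0. tau (arr G) \<omega> (\<gamma> t) \<in> tau (arr G) \<omega> ` L" using ev by eventually_elim blast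
  ultimately show ?thesis using curve_restr[OF sP] by blast
qed

lemma curve_tau_image_inverse:
  assumes "two_form (arr G) \<omega>" "L \<subseteq> PB (arr G)" "curve (restr PA (tau (arr G) \<omega> ` L)) \<gamma>"
  shows "curve (restr PA L) (\<lambda>t. tau (arr G) (\<lambda>u v. - \<omega> u v) (\<gamma> t))"
    "\<forall>\<^sub>F t in nhds 0. tau (arr G) \<omega> (tau (arr G) (\<lambda>u v. - \<omega> u v) (\<gamma> t)) = \<gamma> t"
proof -
  have c: "curve PA \<gamma>" and ev: "\<forall>\<^sub>F t in nhds 0. \<gamma> t \<in> tau (arr G) \<omega> ` L"
    using assms(3) curve_restr[OF sP] by blast+
  have "\<forall>\<^sub>F t in nhds 0. tau (arr G) (\<lambda>u v. - \<omega> u v) (\<gamma> t) \<in> L"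
    using ev
  proof eventually_elim
    case (elim t)
    then obtain l where "l \<in> L" "\<gamma> t = tau (arr G) \<omega> l" by blast
    then show ?case using tau_uminus(1)[of l "arr G" \<omega>] assms(2) by (metis subsetD)
  qed
  then show "curve (restr PA L) (\<lambda>t. tau (arr G) (\<lambda>u v. - \<omega> u v) (\<gamma> t))"
    using curve_restr[OF sP] tau_inverse(1)[OF mfd(1) assms(1) c] by blast
  show "\<forall>\<^sub>F t in nhds 0. tau (arr G) \<omega> (tau (arr G) (\<lambda>u v. - \<omega> u v) (\<gamma> t)) = \<gamma> t"
    by (rule tau_inverse(2)[OF mfd(1) assms(1) c])
qed

lemma curve_restr_PA: "curve (restr PA L) \<gamma> \<Longrightarrow> curve PA \<gamma>"
  using curve_restr[OF sP] by blast

text \<open>Velocities relative to the two atlases are different sets of curves, as only curves in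
  \<open>L\<close> count for the smaller one; but the charts are the same functions, so they detect
  the same equalities.\<close>

lemma velocity_restr_PA:
  assumes "curve (restr PA L) \<gamma>" "curve (restr PA L) \<delta>"
  shows "velocity (restr PA L) \<gamma> = velocity (restr PA L) \<delta> \<longleftrightarrow> velocity PA \<gamma> = velocity PA \<delta>"
proof
  have sR: "satlas (restr PA L)" by (rule satlas_induced[OF sP])
  note c = curve_restr_PA[OF assms(1)] curve_restr_PA[OF assms(2)]
  obtain U \<phi> where U: "(U, \<phi>) \<in> PA" "\<gamma> 0 \<in> U" using curve_pts[OF c(1)] by (rule pts_chart)
  have L: "\<gamma> 0 \<in> L" using assms(1) curve_restr[OF sP] eventually_nhds_x_imp_x by blast
  have U': "({x \<in> L. id x \<in> U}, \<phi> \<circ> id) \<in> restr PA L" "\<gamma> 0 \<in> {x \<in> L. id x \<in> U}"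
    using U L unfolding induced_def by auto
  show "velocity PA \<gamma> = velocity PA \<delta>" if v: "velocity (restr PA L) \<gamma> = velocity (restr PA L) \<delta>"
  proof (rule velocity_eqI[OF sP c _ U])
    show 0: "\<gamma> 0 = \<delta> 0" using v pt_velocity[OF assms(1)] pt_velocity[OF assms(2)] by simp
    show "vector_derivative (\<phi> \<circ> \<gamma>) (at 0) = vector_derivative (\<phi> \<circ> \<delta>) (at 0)"
      using dcoord_velocity[OF assms(1) U'] dcoord_velocity[OF assms(2) U'(1)] U'(2) 0 v by simp
  qed
  show "velocity (restr PA L) \<gamma> = velocity (restr PA L) \<delta>" if v: "velocity PA \<gamma> = velocity PA \<delta>"
  proof (rule velocity_eqI[OF sR assms _ U'])
    show 0: "\<gamma> 0 = \<delta> 0" using v pt_velocity[OF c(1)] pt_velocity[OF c(2)] by simp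
    show "vector_derivative (\<phi> \<circ> id \<circ> \<gamma>) (at 0) = vector_derivative (\<phi> \<circ> id \<circ> \<delta>) (at 0)"
      using dcoord_velocity[OF c(1) U] dcoord_velocity[OF c(2) U(1)] U(2) 0 v by simp
  qed
qed

text \<open>Curves in the image are pulled back to \<open>L\<close> by the inverse transformation,
  and \<open>psrc_tau\<close> returns what is known there. Velocities are compared in
  \<open>PA\<close>, on which the inverse transformation is smooth.\<close>

lemma smooth_src_tau:
  assumes \<omega>: "two_form (arr G) \<omega>" "mult_form G \<omega>" and L: "smooth_src L"
  shows "smooth_src (tau (arr G) \<omega> ` L)"
proof -
  let ?\<tau> = "tau (arr G) \<omega>" and ?\<tau>' = "tau (arr G) (\<lambda>u v. - \<omega> u v)"
  have sub: "L \<subseteq> PB (arr G)" using L unfolding smooth_src_def by blast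
  have sub': "?\<tau> ` L \<subseteq> PB (arr G)" using sub tau_PB[OF mfd(1) \<omega>(1)] by blast
  have key: "curve OA (\<lambda>t. psrc (\<gamma> t))"
      "still OA (\<lambda>t. psrc (\<gamma> t)) \<longleftrightarrow> still OA (\<lambda>t. psrc (?\<tau>' (\<gamma> t)))"
    if "curve (restr PA (?\<tau> ` L)) \<gamma>" for \<gamma>
  proof -
    note c = curve_tau_image_inverse[OF \<omega>(1) sub that]
    have cO: "curve OA (\<lambda>t. psrc (?\<tau>' (\<gamma> t)))" using L c(1) unfolding smooth_src_def by blast
    note p = psrc_tau[OF \<omega> curve_restr_PA[OF c(1)] cO]
    have ev: "\<forall>\<^sub>F t in nhds 0. psrc (?\<tau> (?\<tau>' (\<gamma> t))) = psrc (\<gamma> t)"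
      using c(2) by eventually_elim (simp only:)
    show "curve OA (\<lambda>t. psrc (\<gamma> t))" by (rule curve_cong_ev(1)[OF sO p(1) ev])
    show "still OA (\<lambda>t. psrc (\<gamma> t)) \<longleftrightarrow> still OA (\<lambda>t. psrc (?\<tau>' (\<gamma> t)))"
      using still_cong_ev[OF sO p(1) ev] p(2) by blast
  qed
  have "still OA (\<lambda>t. psrc (\<delta> t))"
    if cs: "curve (restr PA (?\<tau> ` L)) \<gamma>" "curve (restr PA (?\<tau> ` L)) \<delta>"
      and v: "velocity (restr PA (?\<tau> ` L)) \<gamma> = velocity (restr PA (?\<tau> ` L)) \<delta>"
      and s: "still OA (\<lambda>t. psrc (\<gamma> t))" for \<gamma> \<delta>
  proof -
    note c\<gamma> = curve_tau_image_inverse(1)[OF \<omega>(1) sub cs(1)] and c\<delta> = curve_tau_image_inverse(1)[OF \<omega>(1) sub cs(2)]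
    have ev: "\<forall>\<^sub>F t in nhds 0. q t \<in> PB (arr G)" if "curve PA q" for q
      using curve_ev_pts[OF sP that] by (simp add: pts_pont)
    note p = curve_restr_PA[OF cs(1)] curve_restr_PA[OF cs(2)]
    have "velocity PA \<gamma> = velocity PA \<delta>" using v velocity_restr_PA[OF cs] by blast
    then have "velocity PA (\<lambda>t. ?\<tau>' (\<gamma> t)) = velocity PA (\<lambda>t. ?\<tau>' (\<delta> t))"
      by (rule velocity_compose[OF sP sP smap_tau[OF mfd(1) two_form_uminus[OF \<omega>(1)]] p(1) ev[OF p(1)] p(2) ev[OF p(2)]])
    then have "velocity (restr PA L) (\<lambda>t. ?\<tau>' (\<gamma> t)) = velocity (restr PA L) (\<lambda>t. ?\<tau>' (\<delta> t))"
      using velocity_restr_PA[OF c\<gamma> c\<delta>] by blast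
    then have "still OA (\<lambda>t. psrc (?\<tau>' (\<delta> t)))"
      using L c\<gamma> c\<delta> s key(2)[OF cs(1)] unfolding smooth_src_def by blast
    then show ?thesis using key(2)[OF cs(2)] by blast
  qed
  then show ?thesis
    unfolding smooth_src_def using sub' key(1) by blast
qed

text \<open>For the starting point, the transformation commutes with \<open>usrc\<close> and is
  injective on \<open>PB (arr G)\<close>; for the source, \<open>psrc_tau\<close> applies.\<close>

lemma alg_curve_tau:
  assumes \<omega>: "two_form (arr G) \<omega>" "mult_form G \<omega>" and L: "smooth_src L" and c: "curve (restr PA L) \<gamma>"
  shows "alg_curve (tau (arr G) \<omega> ` L) (\<lambda>t. tau (arr G) \<omega> (\<gamma> t)) \<longleftrightarrow> alg_curve L \<gamma>"
proof -
  let ?\<tau> = "tau (arr G) \<omega>"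
  have sub: "L \<subseteq> PB (arr G)" and cO: "curve OA (\<lambda>t. psrc (\<gamma> t))"
    using L c unfolding smooth_src_def by blast+
  note p = psrc_tau[OF \<omega> curve_restr_PA[OF c] cO]
  have \<gamma>0: "\<gamma> 0 \<in> PB (arr G)" using curve_pts[OF curve_restr_PA[OF c]] by (simp add: pts_pont)
  have "?\<tau> (\<gamma> 0) = usrc (?\<tau> (\<gamma> 0)) \<longleftrightarrow> ?\<tau> (\<gamma> 0) = ?\<tau> (usrc (\<gamma> 0))"
    using usrc_tau[OF \<omega> \<gamma>0] by simp
  also have "\<dots> \<longleftrightarrow> \<gamma> 0 = usrc (\<gamma> 0)"
    using tau_uminus(1)[OF \<gamma>0, of \<omega>] tau_uminus(1)[OF p(3), of \<omega>] by metis
  finally show ?thesis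
    unfolding alg_curve_def p(2) using c curve_tau_image[OF \<omega>(1) sub c] by simp
qed

text \<open>\<delta> is the transform of \<gamma> by the inverse B-field. It is mapped back to
  \<gamma> only near 0, because the values of \<gamma> elsewhere are arbitrary.\<close>

lemma alg_curve_tauE:
  assumes \<omega>: "two_form (arr G) \<omega>" "mult_form G \<omega>" and L: "smooth_src L"
    and a: "alg_curve (tau (arr G) \<omega> ` L) \<gamma>"
  obtains \<delta> where "alg_curve L \<delta>" "\<forall>\<^sub>F t in nhds 0. tau (arr G) \<omega> (\<delta> t) = \<gamma> t"
proof -
  let ?\<tau> = "tau (arr G) \<omega>" and ?\<delta> = "\<lambda>t. tau (arr G) (\<lambda>u v. - \<omega> u v) (\<gamma> t)"
  have sub: "L \<subseteq> PB (arr G)" using L unfolding smooth_src_def by blast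
  have c: "curve (restr PA (?\<tau> ` L)) \<gamma>" using a unfolding alg_curve_def by blast
  note d = curve_tau_image_inverse[OF \<omega>(1) sub c]
  have cO: "curve OA (\<lambda>t. psrc (?\<delta> t))" using L d(1) unfolding smooth_src_def by blast
  note p = psrc_tau[OF \<omega> curve_restr_PA[OF d(1)] cO]
  have ev: "\<forall>\<^sub>F t in nhds 0. psrc (?\<tau> (?\<delta> t)) = psrc (\<gamma> t)" using d(2) by eventually_elim (simp only:)
  have "alg_curve (?\<tau> ` L) (\<lambda>t. ?\<tau> (?\<delta> t))"
    unfolding alg_curve_def still_cong_ev[OF sO p(1) ev]
    using a curve_tau_image[OF \<omega>(1) sub d(1)] eventually_nhds_x_imp_x[OF d(2)]
    unfolding alg_curve_def by metis
  then show thesis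
    using that[of ?\<delta>] alg_curve_tau[OF \<omega> L d(1)] d(2) by blast
qed

section \<open>The Lie functor and B-field transformations\<close>

lemma tmap_pont_proj:
  assumes "L \<subseteq> PB (arr G)" "curve (restr PA L) \<gamma>"
  shows "tmap TA fst (velocity (restr PA L) \<gamma>) = velocity TA (\<lambda>t. fst (\<gamma> t))"
    "tmap CA snd (velocity (restr PA L) \<gamma>) = velocity CA (\<lambda>t. snd (\<gamma> t))"
proof -
  have sR: "satlas (restr PA L)" by (rule satlas_induced[OF sP])
  have pts: "pts (restr PA L) = L" using assms(1) by (auto simp: pts_induced pts_pont)
  show "tmap TA fst (velocity (restr PA L) \<gamma>) = velocity TA (\<lambda>t. fst (\<gamma> t))"
    by (rule tmap_velocity[OF sR sT _ assms(2)], unfold pts, rule smap_restr)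
      (use smap_subset[OF smap_pont_proj(1)[OF mfd(1)] assms(1)] in auto)
  show "tmap CA snd (velocity (restr PA L) \<gamma>) = velocity CA (\<lambda>t. snd (\<gamma> t))"
    by (rule tmap_velocity[OF sR sC _ assms(2)], unfold pts, rule smap_restr)
      (use smap_subset[OF smap_pont_proj(2)[OF mfd(1)] assms(1)] in auto)
qed

text \<open>With the algebroid of \<open>L\<close> described by curves, the tangent maps of the two
  projections become velocities of the component curves.\<close>

lemma Lie_eq:
  assumes "smooth_src L"
  shows "Lie G L = {(Y, thetaG G (velocity CA (\<lambda>t. snd (\<gamma> t)))) |Y \<gamma>.
    alg_curve L \<gamma> \<and> Y \<in> TB (alg_mfd G) \<and> jG G Y = velocity TA (\<lambda>t. fst (\<gamma> t))}"
proof -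
  have sub: "L \<subseteq> PB (arr G)" using assms unfolding smooth_src_def by blast
  have c: "curve (restr PA L) \<gamma>" if "alg_curve L \<gamma>" for \<gamma> using that unfolding alg_curve_def by blast
  have "(Y, \<alpha>) \<in> Lie G L \<longleftrightarrow> (\<exists>\<gamma>. alg_curve L \<gamma> \<and> \<alpha> = thetaG G (velocity CA (\<lambda>t. snd (\<gamma> t))) \<and>
      Y \<in> TB (alg_mfd G) \<and> jG G Y = velocity TA (\<lambda>t. fst (\<gamma> t)))" for Y \<alpha>
  proof -
    have "(Y, \<alpha>) \<in> Lie G L \<longleftrightarrow> (\<exists>\<gamma>. alg_curve L \<gamma> \<and> \<alpha> = thetaG G (tmap CA snd (velocity (restr PA L) \<gamma>)) \<and>
        Y \<in> TB (alg_mfd G) \<and> jG G Y = tmap TA fst (velocity (restr PA L) \<gamma>))"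
      unfolding Lie_def lie_alg_eq[OF assms] by blast
    also have "\<dots> \<longleftrightarrow> (\<exists>\<gamma>. alg_curve L \<gamma> \<and> \<alpha> = thetaG G (velocity CA (\<lambda>t. snd (\<gamma> t))) \<and>
        Y \<in> TB (alg_mfd G) \<and> jG G Y = velocity TA (\<lambda>t. fst (\<gamma> t)))"
      using tmap_pont_proj[OF sub c] by (intro ex_cong1 conj_cong refl) simp_all
    finally show ?thesis .
  qed
  then show ?thesis by auto
qed

text \<open>The involution exchanges the two projections of the double tangent bundle, so the base
  vector of \<open>Y\<close> reappears as the tangent projection of its image. This puts the vectors
  to be paired over the base velocity of the covectors.\<close>

lemma jG:
  assumes "Y \<in> TB (alg_mfd G)"
  shows "jG G Y \<in> TB TA" "tmap (arr G) pt (jG G Y) = pt Y"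
proof -
  have s: "satlas (alg_mfd G)" unfolding alg_mfd_def by (rule satlas_induced[OF sT])
  obtain c where c: "curve (alg_mfd G) c" "Y = velocity (alg_mfd G) c" "c 0 = pt Y"
    using TB_velocity[OF assms] .
  have cT: "curve TA c" using c(1) curve_restr[OF sT] unfolding alg_mfd_def by blast
  have "smap (alg_mfd G) (pts (alg_mfd G)) TA (\<lambda>v. v)"
  proof -
    have "pts (alg_mfd G) = lie_alg G" unfolding alg_mfd_def by (auto simp: pts_induced pts_tan lie_alg_def)
    then show ?thesis
      unfolding alg_mfd_def
      by (simp, intro smap_restr smap_id[OF sT]) (auto simp: pts_tan lie_alg_def)
  qed
  then have t: "tmap TA id Y = velocity TA c"
    using tmap_velocity[OF s sT _ c(1)] by (simp add: id_def c(2))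
  have V: "velocity TA c \<in> TB TA" "pt (velocity TA c) = pt Y"
    using velocity_TB[OF cT] pt_velocity[OF cT] c(3) by simp_all
  show "jG G Y \<in> TB TA" "tmap (arr G) pt (jG G Y) = pt Y"
    unfolding jG_def t using tan_flip[OF mfd(1) V(1)] V(2) by simp_all
qed

text \<open>All three covector velocities lie over the same vector \<open>a\<close>, the base point
  of \<open>Y\<close>, so \<open>thetaG\<close> and \<open>sharp\<close> are cut off outside the
  same tangent space. Inside it the pairing is additive, and the added summand is the induced form
  because \<open>jG G Y\<close> is the velocity of the vector component.\<close>

lemma thetaG_tau:
  assumes \<omega>: "two_form (arr G) \<omega>" and \<gamma>: "curve PA \<gamma>"
    and Y: "Y \<in> TB (alg_mfd G)" "jG G Y = velocity TA (\<lambda>t. fst (\<gamma> t))"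
  shows "(Y, thetaG G (velocity CA (\<lambda>t. snd (tau (arr G) \<omega> (\<gamma> t))))) =
    tau (alg_mfd G) (induced_form G \<omega>) (Y, thetaG G (velocity CA (\<lambda>t. snd (\<gamma> t))))"
proof -
  let ?\<tau> = "tau (arr G) \<omega>"
  have ev: "\<forall>\<^sub>F t in nhds 0. \<gamma> t \<in> PB (arr G)" using curve_ev_pts[OF sP \<gamma>] by (simp add: pts_pont)
  have c\<tau>: "curve PA (\<lambda>t. ?\<tau> (\<gamma> t))" by (rule curve_compose[OF sP sP \<gamma> ev smap_tau[OF mfd(1) \<omega>]])
  have ev\<tau>: "\<forall>\<^sub>F t in nhds 0. ?\<tau> (\<gamma> t) \<in> PB (arr G)" using curve_ev_pts[OF sP c\<tau>] by (simp add: pts_pont)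
  have c0: "curve TA (\<lambda>t. fst (\<gamma> t))" by (rule curve_compose[OF sP sT \<gamma> ev smap_pont_proj(1)[OF mfd(1)]])
  have ev0: "\<forall>\<^sub>F t in nhds 0. fst (\<gamma> t) \<in> TB (arr G)" using curve_ev_pts[OF sT c0] by (simp add: pts_tan)
  have c1: "curve CA (\<lambda>t. snd (\<gamma> t))" by (rule curve_compose[OF sP sC \<gamma> ev smap_pont_proj(2)[OF mfd(1)]])
  have c2: "curve CA (\<lambda>t. sharp (arr G) \<omega> (fst (\<gamma> t)))"
    by (rule curve_compose[OF sT sC c0 ev0 smap_sharp[OF mfd(1) \<omega>]])
  have c3: "curve CA (\<lambda>t. snd (?\<tau> (\<gamma> t)))"
    by (rule curve_compose[OF sP sC c\<tau> ev\<tau> smap_pont_proj(2)[OF mfd(1)]])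
  have sf: "smap CA (pts CA) (arr G) fst" using smap_fst_cot[OF mfd(1)] by (simp add: pts_cot)
  have ss: "smap TA (pts TA) CA (sharp (arr G) \<omega>)" using smap_sharp[OF mfd(1) \<omega>] by (simp add: pts_tan)
  have cb: "curve (arr G) (\<lambda>t. pt (fst (\<gamma> t)))" by (rule curve_compose[OF sT sA c0 ev0 smap_pt[OF sA]])
  define a where "a = velocity (arr G) (\<lambda>t. pt (fst (\<gamma> t)))"
  have "\<forall>\<^sub>F t in nhds 0. pt (fst (\<gamma> t)) = fst (snd (\<gamma> t))"
    using ev by eventually_elim (simp add: PB_D)
  then have a1: "velocity (arr G) (\<lambda>t. fst (snd (\<gamma> t))) = a"
    unfolding a_def by (rule curve_cong_ev(2)[OF sA cb, symmetric])
  have W: "tmap (arr G) fst (velocity CA (\<lambda>t. snd (\<gamma> t))) = a"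
      "tmap (arr G) fst (velocity CA (\<lambda>t. sharp (arr G) \<omega> (fst (\<gamma> t)))) = a"
      "tmap (arr G) fst (velocity CA (\<lambda>t. snd (?\<tau> (\<gamma> t)))) = a"
    unfolding tmap_velocity[OF sC sA sf c1] tmap_velocity[OF sC sA sf c2] tmap_velocity[OF sC sA sf c3]
    using a1 by (simp_all add: a_def)
  have ptY: "pt Y = a"
    using jG(2)[OF Y(1)] tmap_velocity[OF sT sA smap_pt'[OF sA] c0] Y(2) by (simp add: a_def)
  have ind: "induced_form G \<omega> Y Z = snd (thetaG G (velocity CA (\<lambda>t. sharp (arr G) \<omega> (fst (\<gamma> t))))) Z" for Z
    unfolding induced_form_def Y(2) tmap_velocity[OF sT sC ss c0] ..
  have pair: "tan_pairing (velocity CA (\<lambda>t. snd (?\<tau> (\<gamma> t)))) (jG G Z) =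
      tan_pairing (velocity CA (\<lambda>t. snd (\<gamma> t))) (jG G Z) +
      tan_pairing (velocity CA (\<lambda>t. sharp (arr G) \<omega> (fst (\<gamma> t)))) (jG G Z)"
    if "Z \<in> TS (alg_mfd G) a" for Z
    by (rule tan_pairing_tau[OF mfd(1) \<omega> \<gamma> jG(1)]) (use that jG(2)[of Z] in \<open>simp_all add: a_def\<close>)
  have sharp_alg: "snd (sharp (alg_mfd G) (induced_form G \<omega>) Y) Z =
      (if Z \<in> TS (alg_mfd G) (pt Y) then induced_form G \<omega> Y Z else 0)" for Z
    by (simp add: sharp_def)
  show ?thesis
  proof (intro prod_eqI ext)
    show "fst (snd (Y, thetaG G (velocity CA (\<lambda>t. snd (?\<tau> (\<gamma> t)))))) =
        fst (snd (tau (alg_mfd G) (induced_form G \<omega>) (Y, thetaG G (velocity CA (\<lambda>t. snd (\<gamma> t))))))"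
      by (simp add: thetaG_def Let_def W)
    fix Z
    show "snd (snd (Y, thetaG G (velocity CA (\<lambda>t. snd (?\<tau> (\<gamma> t)))))) Z =
        snd (snd (tau (alg_mfd G) (induced_form G \<omega>) (Y, thetaG G (velocity CA (\<lambda>t. snd (\<gamma> t)))))) Z"
      using pair[of Z] by (simp add: sharp_alg ind ptY thetaG_def Let_def W del: TS_iff)
  qed simp
qed

lemma Lie_tau:
  assumes \<omega>: "two_form (arr G) \<omega>" "mult_form G \<omega>" and L: "smooth_src L"
  shows "Lie G (tau (arr G) \<omega> ` L) = tau (alg_mfd G) (induced_form G \<omega>) ` Lie G L"
proof (intro equalityI subsetI)
  let ?\<tau> = "tau (arr G) \<omega>" and ?\<tau>A = "tau (alg_mfd G) (induced_form G \<omega>)"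
  note L' = smooth_src_tau[OF \<omega> L]
  fix z assume "z \<in> Lie G (?\<tau> ` L)"
  then obtain Y \<gamma> where z: "z = (Y, thetaG G (velocity CA (\<lambda>t. snd (\<gamma> t))))" "alg_curve (?\<tau> ` L) \<gamma>"
      "Y \<in> TB (alg_mfd G)" "jG G Y = velocity TA (\<lambda>t. fst (\<gamma> t))"
    unfolding Lie_eq[OF L'] by blast
  obtain \<delta> where \<delta>: "alg_curve L \<delta>" "\<forall>\<^sub>F t in nhds 0. ?\<tau> (\<delta> t) = \<gamma> t"
    using alg_curve_tauE[OF \<omega> L z(2)] .
  have c\<delta>: "curve PA \<delta>" and c\<gamma>: "curve PA \<gamma>"
    using \<delta>(1) z(2) curve_restr_PA unfolding alg_curve_def by blast+
  have ev: "\<forall>\<^sub>F t in nhds 0. \<gamma> t \<in> PB (arr G)" using curve_ev_pts[OF sP c\<gamma>] by (simp add: pts_pont)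
  \<comment> \<open>\<gamma> and the transform of \<delta> agree only near 0; their components
    therefore have equal velocities without being equal as functions.\<close>
  have e1: "\<forall>\<^sub>F t in nhds 0. fst (\<gamma> t) = fst (\<delta> t)"
    using \<delta>(2) by eventually_elim (metis tau_simps(1))
  have e2: "\<forall>\<^sub>F t in nhds 0. snd (\<gamma> t) = snd (?\<tau> (\<delta> t))"
    using \<delta>(2) by eventually_elim (simp only:)
  have v1: "velocity TA (\<lambda>t. fst (\<gamma> t)) = velocity TA (\<lambda>t. fst (\<delta> t))"
    by (rule curve_cong_ev(2)[OF sT curve_compose[OF sP sT c\<gamma> ev smap_pont_proj(1)[OF mfd(1)]] e1])
  have v2: "velocity CA (\<lambda>t. snd (\<gamma> t)) = velocity CA (\<lambda>t. snd (?\<tau> (\<delta> t)))"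
    by (rule curve_cong_ev(2)[OF sC curve_compose[OF sP sC c\<gamma> ev smap_pont_proj(2)[OF mfd(1)]] e2])
  have "z = ?\<tau>A (Y, thetaG G (velocity CA (\<lambda>t. snd (\<delta> t))))"
    unfolding z(1) v2 by (rule thetaG_tau[OF \<omega>(1) c\<delta> z(3) z(4)[unfolded v1]])
  moreover have "(Y, thetaG G (velocity CA (\<lambda>t. snd (\<delta> t)))) \<in> Lie G L"
    unfolding Lie_eq[OF L] using \<delta>(1) z(3,4) v1 by blast
  ultimately show "z \<in> ?\<tau>A ` Lie G L" by blast
next
  let ?\<tau> = "tau (arr G) \<omega>" and ?\<tau>A = "tau (alg_mfd G) (induced_form G \<omega>)"
  note L' = smooth_src_tau[OF \<omega> L]
  fix z assume "z \<in> ?\<tau>A ` Lie G L"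
  then obtain Y \<gamma> where z: "z = ?\<tau>A (Y, thetaG G (velocity CA (\<lambda>t. snd (\<gamma> t))))" "alg_curve L \<gamma>"
      "Y \<in> TB (alg_mfd G)" "jG G Y = velocity TA (\<lambda>t. fst (\<gamma> t))"
    unfolding Lie_eq[OF L] by blast
  have c: "curve (restr PA L) \<gamma>" using z(2) unfolding alg_curve_def by blast
  have z': "z = (Y, thetaG G (velocity CA (\<lambda>t. snd (?\<tau> (\<gamma> t)))))"
    unfolding z(1) by (rule thetaG_tau[OF \<omega>(1) curve_restr_PA[OF c] z(3,4), symmetric])
  have a: "alg_curve (?\<tau> ` L) (\<lambda>t. ?\<tau> (\<gamma> t))" using alg_curve_tau[OF \<omega> L c] z(2) by blast
  have j: "jG G Y = velocity TA (\<lambda>t. fst (?\<tau> (\<gamma> t)))" by (simp add: z(4))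
  show "z \<in> Lie G (?\<tau> ` L)"
    unfolding Lie_eq[OF L']
    by (rule CollectI, rule exI[of _ Y], rule exI[of _ "\<lambda>t. ?\<tau> (\<gamma> t)"], intro conjI)
      (rule z', rule a, rule z(3), rule j)
qed

end

theorem theorem5p12:
  fixes G :: "('g, 'e::euclidean_space, 'm, 'f::euclidean_space) gpd"
    and B\<^sub>G :: "'g tan \<Rightarrow> 'g tan \<Rightarrow> real"
    and L\<^sub>G :: "('g tan \<times> 'g cot) set"
  assumes "lie_groupoid G"
    and "two_form (arr G) B\<^sub>G" and "closed_form (arr G) B\<^sub>G" and "mult_form G B\<^sub>G"
    and "L\<^sub>G \<in> Dir_mult G"
  shows "Lie G (tau (arr G) B\<^sub>G ` L\<^sub>G) = tau (alg_mfd G) (induced_form G B\<^sub>G) ` Lie G L\<^sub>G"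
proof -
  obtain k n where "manifold k (arr G)" "manifold n (obj G)" "smooth_groupoid G"
    using assms(1) unfolding lie_groupoid_def by blast
  then interpret lie_gpd G k n
    by unfold_locales
  show ?thesis
    by (rule Lie_tau[OF assms(2,4) Dir_mult_smooth_src[OF assms(5)]])
qed

end
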